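(* Let $G\subset O_N^+*\hat{\mathbb Z}_2$ be a compact matrix quantum group with degree of reflection two, and let $\tilde G\subset U_N^+$ be its glued version. Then $G$ is coamenable if and only if $\tilde G$ is coamenable.
   Context: A compact matrix quantum group (CMQG) $G=(C(G),u)$ is a unital C*-algebra $C(G)$ with $u\in M_n(C(G))$ such that the entries $u_{ij}$ generate $C(G)$, $u$ and $u^t$ are invertible, and $u_{ij}\mapsto\sum_k u_{ik}\otimes u_{kj}$ extends to a $*$-homomorphism $\Delta\colon C(G)\to C(G)\otimes_{\min}C(G)$. $O(G)$ is the $*$-subalgebra generated by the $u_{ij}$; every CMQG is taken in its maximal version, i.e. $C(G)$ is the universal enveloping C*-algebra of $O(G)$. $H=(C(H),v)$ is a quantum subgroup of $G$ ($H\subset G$) if $u,v$ have the same size and $u_{ij}\mapsto v_{ij}$ extends to a surjective $*$-homomorphism $O(G)\to O(H)$. $U_N^+$: universal C*-algebra generated by $u_{ij}$, $1\le i,j\le N$, with $u$ and $\bar u=(u_{ij}^* )$ unitary. $O_N^+$: universal C*-algebra generated by $u_{ij}$ with $u=\bar u$ unitary. $\hat{\mathbb Z}_2=(C^*(\mathbb Z_2),r)$ with $r$ the generator. $O_N^+*\hat{\mathbb Z}_2=(C(O_N^+)*_{\mathbb C}C^*(\mathbb Z_2),v\oplus r)$; a quantum subgroup $G$ of it has fundamental representation of the form $v\oplus r$. The glued version $\tilde G$ of $G$ is the CMQG with fundamental representation $(v_{ij}r)_{ij}$ and C*-algebra the C*-subalgebra of $C(G)$ generated by the elements $v_{ij}r$.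 Degree of reflection of a CMQG $G=(C(G),u)$: imposing on $C(G)$ the relations $u_{ij}=0$ $(i\ne j)$ and $u_{ii}=u_{jj}$ gives a quantum subgroup $\hat\Gamma\subset G$, the dual of a cyclic group $\Gamma$; the degree of reflection is the order of $\Gamma$, set to be $0$ if $\Gamma$ is infinite (here applied to $u=v\oplus r$). A compact quantum group $G$ is coamenable if its Haar state is faithful on the universal C*-algebra $C(G)$. *)

theory Defs
  imports Complex_Main "HOL-Algebra.Module" "HOL-Algebra.QuotRing" "HOL-Algebra.Elementary_Groups"
begin

section \<open>Complex *-algebras and C*-algebras\<close>

text \<open>All algebras are unital and carrier based, extending the ring records of HOL-Algebra.\<close>

record 'a star_alg = "(complex, 'a) module" +
  star :: "'a \<Rightarrow> 'a"

record 'a cstar_alg = "'a star_alg" +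
  nrm :: "'a \<Rightarrow> real"

definition complex_ring :: "complex ring" where
  "complex_ring = \<lparr>carrier = UNIV, mult = (*), one = 1, zero = 0, add = (+)\<rparr>"

locale star_algebra = module complex_ring A + ring A for A :: "('a, 'b) star_alg_scheme" (structure) +
  assumes smult_mult_left:
      "\<lbrakk>x \<in> carrier A; y \<in> carrier A\<rbrakk> \<Longrightarrow> (c \<odot> x) \<otimes> y = c \<odot> (x \<otimes> y)"
    and smult_mult_right:
      "\<lbrakk>x \<in> carrier A; y \<in> carrier A\<rbrakk> \<Longrightarrow> x \<otimes> (c \<odot> y) = c \<odot> (x \<otimes> y)"
    and star_closed: "x \<in> carrier A \<Longrightarrow> star A x \<in> carrier A"
    and star_star: "x \<in> carrier A \<Longrightarrow> star A (star A x) = x"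
    and star_add:
      "\<lbrakk>x \<in> carrier A; y \<in> carrier A\<rbrakk> \<Longrightarrow> star A (x \<oplus> y) = star A x \<oplus> star A y"
    and star_smult: "x \<in> carrier A \<Longrightarrow> star A (c \<odot> x) = cnj c \<odot> star A x"
    and star_mult:
      "\<lbrakk>x \<in> carrier A; y \<in> carrier A\<rbrakk> \<Longrightarrow> star A (x \<otimes> y) = star A y \<otimes> star A x"

text \<open>Seminorms with the C*-identity, i.e. the pull-backs of the norms of C*-algebras along
  *-homomorphisms.\<close>

definition cstar_seminorm :: "('a, 'b) star_alg_scheme \<Rightarrow> ('a \<Rightarrow> real) \<Rightarrow> bool" where
  "cstar_seminorm A p \<longleftrightarrow>
     (\<forall>x\<in>carrier A. 0 \<le> p x) \<and>
     (\<forall>c. \<forall>x\<in>carrier A. p (c \<odot>\<^bsub>A\<^esub> x) = cmod c * p x) \<and>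
     (\<forall>x\<in>carrier A. \<forall>y\<in>carrier A. p (x \<oplus>\<^bsub>A\<^esub> y) \<le> p x + p y) \<and>
     (\<forall>x\<in>carrier A. \<forall>y\<in>carrier A. p (x \<otimes>\<^bsub>A\<^esub> y) \<le> p x * p y) \<and>
     (\<forall>x\<in>carrier A. p (star A x \<otimes>\<^bsub>A\<^esub> x) = (p x)\<^sup>2)"

text \<open>Distances are written with \<open>(-1) \<odot> y\<close> instead of \<open>\<ominus> y\<close> because they are also used on the formal
  tensors below, which do not form a group.\<close>

definition seqconv :: "('a, 'b) star_alg_scheme \<Rightarrow> ('a \<Rightarrow> real) \<Rightarrow> (nat \<Rightarrow> 'a) \<Rightarrow> 'a \<Rightarrow> bool" where
  "seqconv A p s x \<longleftrightarrow> (\<lambda>n. p (s n \<oplus>\<^bsub>A\<^esub> (-1) \<odot>\<^bsub>A\<^esub> x)) \<longlonglongrightarrow> 0"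

definition seqcauchy :: "('a, 'b) star_alg_scheme \<Rightarrow> ('a \<Rightarrow> real) \<Rightarrow> (nat \<Rightarrow> 'a) \<Rightarrow> bool" where
  "seqcauchy A p s \<longleftrightarrow> (\<forall>n. s n \<in> carrier A) \<and>
     (\<forall>e>0. \<exists>M. \<forall>m\<ge>M. \<forall>n\<ge>M. p (s m \<oplus>\<^bsub>A\<^esub> (-1) \<odot>\<^bsub>A\<^esub> s n) < e)"

locale cstar_algebra = star_algebra A for A :: "'a cstar_alg" (structure) +
  assumes nontrivial: "\<one> \<noteq> \<zero>"
    and nrm_seminorm: "cstar_seminorm A (nrm A)"
    and nrm_eq_zero: "\<lbrakk>x \<in> carrier A; nrm A x = 0\<rbrakk> \<Longrightarrow> x = \<zero>"
    and complete: "seqcauchy A (nrm A) s \<Longrightarrow> \<exists>x\<in>carrier A. seqconv A (nrm A) s x"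

definition star_hom :: "('a, 'c) star_alg_scheme \<Rightarrow> ('b, 'd) star_alg_scheme \<Rightarrow> ('a \<Rightarrow> 'b) \<Rightarrow> bool" where
  "star_hom A B f \<longleftrightarrow> f \<in> ring_hom A B \<and>
     (\<forall>c. \<forall>x\<in>carrier A. f (c \<odot>\<^bsub>A\<^esub> x) = c \<odot>\<^bsub>B\<^esub> f x) \<and>
     (\<forall>x\<in>carrier A. f (star A x) = star B (f x))"

definition star_subalgebra :: "('a, 'b) star_alg_scheme \<Rightarrow> 'a set \<Rightarrow> bool" where
  "star_subalgebra A B \<longleftrightarrow> B \<subseteq> carrier A \<and> \<one>\<^bsub>A\<^esub> \<in> B \<and>
     (\<forall>c. \<forall>x\<in>B. c \<odot>\<^bsub>A\<^esub> x \<in> B) \<and> (\<forall>x\<in>B. star A x \<in> B) \<and>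
     (\<forall>x\<in>B. \<forall>y\<in>B. x \<oplus>\<^bsub>A\<^esub> y \<in> B \<and> x \<otimes>\<^bsub>A\<^esub> y \<in> B)"

definition norm_closed :: "'a cstar_alg \<Rightarrow> 'a set \<Rightarrow> bool" where
  "norm_closed A B \<longleftrightarrow>
     (\<forall>s x. (\<forall>n. s n \<in> B) \<longrightarrow> x \<in> carrier A \<longrightarrow> seqconv A (nrm A) s x \<longrightarrow> x \<in> B)"

definition gen_star_subalgebra :: "('a, 'b) star_alg_scheme \<Rightarrow> 'a set \<Rightarrow> 'a set" where
  "gen_star_subalgebra A S = \<Inter>{B. star_subalgebra A B \<and> S \<subseteq> B}"

definition gen_cstar_subalgebra :: "'a cstar_alg \<Rightarrow> 'a set \<Rightarrow> 'a set" where
  "gen_cstar_subalgebra A S = \<Inter>{B. star_subalgebra A B \<and> norm_closed A B \<and> S \<subseteq> B}"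

text \<open>Closed two-sided ideals of a C*-algebra are automatically *-invariant, so requiring invariance
  does not change the generated closed ideal.\<close>

definition gen_closed_ideal :: "'a cstar_alg \<Rightarrow> 'a set \<Rightarrow> 'a set" where
  "gen_closed_ideal A S =
     \<Inter>{I. ideal I A \<and> norm_closed A I \<and> (\<forall>x\<in>I. star A x \<in> I) \<and> S \<subseteq> I}"

definition state :: "('a, 'b) star_alg_scheme \<Rightarrow> ('a \<Rightarrow> complex) \<Rightarrow> bool" where
  "state A h \<longleftrightarrow>
     (\<forall>x\<in>carrier A. \<forall>y\<in>carrier A. h (x \<oplus>\<^bsub>A\<^esub> y) = h x + h y) \<and>
     (\<forall>c. \<forall>x\<in>carrier A. h (c \<odot>\<^bsub>A\<^esub> x) = c * h x) \<and>
     (\<forall>x\<in>carrier A. Im (h (star A x \<otimes>\<^bsub>A\<^esub> x)) = 0 \<and> 0 \<le> Re (h (star A x \<otimes>\<^bsub>A\<^esub> x))) \<and>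
     h \<one>\<^bsub>A\<^esub> = 1"

definition faithful :: "('a, 'b) star_alg_scheme \<Rightarrow> ('a \<Rightarrow> complex) \<Rightarrow> bool" where
  "faithful A h \<longleftrightarrow> (\<forall>x\<in>carrier A. h (star A x \<otimes>\<^bsub>A\<^esub> x) = 0 \<longrightarrow> x = \<zero>\<^bsub>A\<^esub>)"


section \<open>Separated completions and universal C*-algebras\<close>

text \<open>The elements of the completion of \<open>A\<close> with respect to a seminorm \<open>p\<close> are the classes of Cauchy
  sequences modulo null sequences.\<close>

definition cauchy_class ::
    "('a, 'b) star_alg_scheme \<Rightarrow> ('a \<Rightarrow> real) \<Rightarrow> (nat \<Rightarrow> 'a) \<Rightarrow> (nat \<Rightarrow> 'a) set" where
  "cauchy_class A p s =
     {t. seqcauchy A p t \<and> (\<lambda>n. p (s n \<oplus>\<^bsub>A\<^esub> (-1) \<odot>\<^bsub>A\<^esub> t n)) \<longlonglongrightarrow> 0}"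

definition rep :: "(nat \<Rightarrow> 'a) set \<Rightarrow> nat \<Rightarrow> 'a" where
  "rep X = (SOME s. s \<in> X)"

definition completion ::
    "('a, 'b) star_alg_scheme \<Rightarrow> ('a \<Rightarrow> real) \<Rightarrow> (nat \<Rightarrow> 'a) set cstar_alg" where
  "completion A p =
     \<lparr>carrier = {cauchy_class A p s | s. seqcauchy A p s},
      mult = (\<lambda>X Y. cauchy_class A p (\<lambda>n. rep X n \<otimes>\<^bsub>A\<^esub> rep Y n)),
      one = cauchy_class A p (\<lambda>_. \<one>\<^bsub>A\<^esub>),
      zero = cauchy_class A p (\<lambda>_. \<zero>\<^bsub>A\<^esub>),
      add = (\<lambda>X Y. cauchy_class A p (\<lambda>n. rep X n \<oplus>\<^bsub>A\<^esub> rep Y n)),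
      smult = (\<lambda>c X. cauchy_class A p (\<lambda>n. c \<odot>\<^bsub>A\<^esub> rep X n)),
      star = (\<lambda>X. cauchy_class A p (\<lambda>n. star A (rep X n))),
      nrm = (\<lambda>X. lim (\<lambda>n. p (rep X n)))\<rparr>"

definition to_completion :: "('a, 'b) star_alg_scheme \<Rightarrow> ('a \<Rightarrow> real) \<Rightarrow> 'a \<Rightarrow> (nat \<Rightarrow> 'a) set" where
  "to_completion A p x = cauchy_class A p (\<lambda>_. x)"

text \<open>The largest C*-seminorm compatible with a set \<open>R\<close> of relations \<open>a = b\<close>, given as pairs \<open>(a, b)\<close>.\<close>

definition universal_seminorm :: "('a, 'b) star_alg_scheme \<Rightarrow> ('a \<times> 'a) set \<Rightarrow> 'a \<Rightarrow> real" where
  "universal_seminorm A R x =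
     (SUP p \<in> {p. cstar_seminorm A p \<and> (\<forall>(a, b)\<in>R. p (a \<oplus>\<^bsub>A\<^esub> (-1) \<odot>\<^bsub>A\<^esub> b) = 0)}. p x)"

definition universal_cstar :: "('a, 'b) star_alg_scheme \<Rightarrow> ('a \<times> 'a) set \<Rightarrow> (nat \<Rightarrow> 'a) set cstar_alg" where
  "universal_cstar A R = completion A (universal_seminorm A R)"

definition to_universal :: "('a, 'b) star_alg_scheme \<Rightarrow> ('a \<times> 'a) set \<Rightarrow> 'a \<Rightarrow> (nat \<Rightarrow> 'a) set" where
  "to_universal A R = to_completion A (universal_seminorm A R)"

text \<open>The universal enveloping C*-algebra is the case without relations.\<close>

abbreviation enveloping_cstar :: "('a, 'b) star_alg_scheme \<Rightarrow> (nat \<Rightarrow> 'a) set cstar_alg" where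
  "enveloping_cstar A \<equiv> universal_cstar A {}"

abbreviation to_enveloping :: "('a, 'b) star_alg_scheme \<Rightarrow> 'a \<Rightarrow> (nat \<Rightarrow> 'a) set" where
  "to_enveloping A \<equiv> to_universal A {}"

text \<open>The free unital *-algebra on \<open>X\<close>: finitely supported functions on words in the letters
  \<open>(x, False)\<close>, standing for \<open>x\<close>, and \<open>(x, True)\<close>, standing for its adjoint.\<close>

definition free_star_alg :: "'g set \<Rightarrow> (('g \<times> bool) list \<Rightarrow> complex) star_alg" where
  "free_star_alg X =
     \<lparr>carrier = {f. finite {w. f w \<noteq> 0} \<and> {w. f w \<noteq> 0} \<subseteq> lists (X \<times> UNIV)},
      mult = (\<lambda>f g w. \<Sum>k\<le>length w. f (take k w) * g (drop k w)),
      one = (\<lambda>w. if w = [] then 1 else 0),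
      zero = (\<lambda>_. 0),
      add = (\<lambda>f g w. f w + g w),
      smult = (\<lambda>c f w. c * f w),
      star = (\<lambda>f w. cnj (f (rev (map (\<lambda>(x, b). (x, \<not> b)) w))))\<rparr>"

definition gen :: "'g \<Rightarrow> ('g \<times> bool) list \<Rightarrow> complex" where
  "gen x = (\<lambda>w. if w = [(x, False)] then 1 else 0)"

text \<open>The free product \<open>A *\<^sub>\<complex> B\<close> is the universal C*-algebra generated by copies of \<open>A\<close> and \<open>B\<close>
  with common unit.\<close>

definition hom_relations ::
    "('a, 'b) star_alg_scheme \<Rightarrow> ('c, 'd) star_alg_scheme \<Rightarrow> ('a \<Rightarrow> 'c) \<Rightarrow> ('c \<times> 'c) set" where
  "hom_relations A F i =
     {(i (x \<oplus>\<^bsub>A\<^esub> y), i x \<oplus>\<^bsub>F\<^esub> i y) | x y. x \<in> carrier A \<and> y \<in> carrier A} \<union>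
     {(i (x \<otimes>\<^bsub>A\<^esub> y), i x \<otimes>\<^bsub>F\<^esub> i y) | x y. x \<in> carrier A \<and> y \<in> carrier A} \<union>
     {(i (c \<odot>\<^bsub>A\<^esub> x), c \<odot>\<^bsub>F\<^esub> i x) | c x. x \<in> carrier A} \<union>
     {(i (star A x), star F (i x)) | x. x \<in> carrier A} \<union>
     {(i \<one>\<^bsub>A\<^esub>, \<one>\<^bsub>F\<^esub>)}"

definition free_prod_alg ::
    "'a cstar_alg \<Rightarrow> 'b cstar_alg \<Rightarrow> ((('a + 'b) \<times> bool) list \<Rightarrow> complex) star_alg" where
  "free_prod_alg A B = free_star_alg (carrier A <+> carrier B)"

definition free_prod_relations ::
    "'a cstar_alg \<Rightarrow> 'b cstar_alg \<Rightarrow>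
      (((('a + 'b) \<times> bool) list \<Rightarrow> complex) \<times> ((('a + 'b) \<times> bool) list \<Rightarrow> complex)) set" where
  "free_prod_relations A B =
     hom_relations A (free_prod_alg A B) (\<lambda>a. gen (Inl a)) \<union>
     hom_relations B (free_prod_alg A B) (\<lambda>b. gen (Inr b))"

definition cstar_free_product ::
    "'a cstar_alg \<Rightarrow> 'b cstar_alg \<Rightarrow> (nat \<Rightarrow> (('a + 'b) \<times> bool) list \<Rightarrow> complex) set cstar_alg" where
  "cstar_free_product A B = universal_cstar (free_prod_alg A B) (free_prod_relations A B)"

definition free_prod_inl ::
    "'a cstar_alg \<Rightarrow> 'b cstar_alg \<Rightarrow> 'a \<Rightarrow> (nat \<Rightarrow> (('a + 'b) \<times> bool) list \<Rightarrow> complex) set" where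
  "free_prod_inl A B a = to_universal (free_prod_alg A B) (free_prod_relations A B) (gen (Inl a))"

definition free_prod_inr ::
    "'a cstar_alg \<Rightarrow> 'b cstar_alg \<Rightarrow> 'b \<Rightarrow> (nat \<Rightarrow> (('a + 'b) \<times> bool) list \<Rightarrow> complex) set" where
  "free_prod_inr A B b = to_universal (free_prod_alg A B) (free_prod_relations A B) (gen (Inr b))"

text \<open>The group *-algebra of a discrete group; its enveloping C*-algebra is the full group
  C*-algebra.\<close>

definition group_star_alg :: "('g, 'b) monoid_scheme \<Rightarrow> ('g \<Rightarrow> complex) star_alg" where
  "group_star_alg \<Gamma> =
     \<lparr>carrier = {f. finite {x. f x \<noteq> 0} \<and> {x. f x \<noteq> 0} \<subseteq> carrier \<Gamma>},
      mult = (\<lambda>f g x. if x \<in> carrier \<Gamma>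
                then \<Sum>y | y \<in> carrier \<Gamma> \<and> f y \<noteq> 0. f y * g (inv\<^bsub>\<Gamma>\<^esub> y \<otimes>\<^bsub>\<Gamma>\<^esub> x) else 0),
      one = (\<lambda>x. if x = \<one>\<^bsub>\<Gamma>\<^esub> then 1 else 0),
      zero = (\<lambda>_. 0),
      add = (\<lambda>f g x. f x + g x),
      smult = (\<lambda>c f x. c * f x),
      star = (\<lambda>f x. if x \<in> carrier \<Gamma> then cnj (f (inv\<^bsub>\<Gamma>\<^esub> x)) else 0)\<rparr>"


section \<open>The minimal tensor product\<close>

text \<open>Elements of the algebraic tensor product are represented by lists \<open>[(a\<^sub>1, b\<^sub>1), \<dots>, (a\<^sub>k, b\<^sub>k)]\<close>
  standing for \<open>a\<^sub>1 \<otimes> b\<^sub>1 + \<dots> + a\<^sub>k \<otimes> b\<^sub>k\<close>. Two lists represent the same tensor iff they have distance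
  zero in the minimal norm, so the passage to the quotient is part of the separated completion.\<close>

definition formal_tensor ::
    "('a, 'c) star_alg_scheme \<Rightarrow> ('b, 'd) star_alg_scheme \<Rightarrow> ('a \<times> 'b) list star_alg" where
  "formal_tensor A B =
     \<lparr>carrier = lists (carrier A \<times> carrier B),
      mult = (\<lambda>s t. [(a \<otimes>\<^bsub>A\<^esub> a', b \<otimes>\<^bsub>B\<^esub> b'). (a, b) \<leftarrow> s, (a', b') \<leftarrow> t]),
      one = [(\<one>\<^bsub>A\<^esub>, \<one>\<^bsub>B\<^esub>)],
      zero = [],
      add = (@),
      smult = (\<lambda>c. map (\<lambda>(a, b). (c \<odot>\<^bsub>A\<^esub> a, b))),
      star = map (\<lambda>(a, b). (star A a, star B b))\<rparr>"

definition tensor_functional ::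
    "('a \<Rightarrow> complex) \<Rightarrow> ('b \<Rightarrow> complex) \<Rightarrow> ('a \<times> 'b) list \<Rightarrow> complex" where
  "tensor_functional \<phi> \<psi> t = (\<Sum>(a, b)\<leftarrow>t. \<phi> a * \<psi> b)"

text \<open>The spatial norm of \<open>t\<close> is the supremum of the operator norms of \<open>(\<pi>\<^sub>\<phi> \<otimes> \<pi>\<^sub>\<psi>)(t)\<close> over the GNS
  representations of states \<open>\<phi>\<close> of \<open>A\<close> and \<open>\<psi>\<close> of \<open>B\<close>. The vectors \<open>y (\<xi>\<^sub>\<phi> \<otimes> \<xi>\<^sub>\<psi>)\<close>, for algebraic tensors
  \<open>y\<close>, are dense in the tensor product of the GNS spaces, and the squared lengths of such a vector and
  of its image under \<open>t\<close> are \<open>(\<phi> \<otimes> \<psi>)(y* y)\<close> and \<open>(\<phi> \<otimes> \<psi>)((t y)* (t y))\<close>.\<close>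

definition min_norm ::
    "('a, 'c) star_alg_scheme \<Rightarrow> ('b, 'd) star_alg_scheme \<Rightarrow> ('a \<times> 'b) list \<Rightarrow> real" where
  "min_norm A B t =
     (let T = formal_tensor A B in
      Sup {sqrt (Re (tensor_functional \<phi> \<psi> (star T (t \<otimes>\<^bsub>T\<^esub> y) \<otimes>\<^bsub>T\<^esub> (t \<otimes>\<^bsub>T\<^esub> y)))) | \<phi> \<psi> y.
             state A \<phi> \<and> state B \<psi> \<and> y \<in> carrier T \<and>
             tensor_functional \<phi> \<psi> (star T y \<otimes>\<^bsub>T\<^esub> y) = 1})"

definition min_tensor ::
    "'a cstar_alg \<Rightarrow> 'b cstar_alg \<Rightarrow> (nat \<Rightarrow> ('a \<times> 'b) list) set cstar_alg" where
  "min_tensor A B = completion (formal_tensor A B) (min_norm A B)"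

definition to_min_tensor ::
    "'a cstar_alg \<Rightarrow> 'b cstar_alg \<Rightarrow> ('a \<times> 'b) list \<Rightarrow> (nat \<Rightarrow> ('a \<times> 'b) list) set" where
  "to_min_tensor A B = to_completion (formal_tensor A B) (min_norm A B)"

text \<open>The slice maps \<open>h \<otimes> id\<close> and \<open>id \<otimes> h\<close> from the minimal tensor product of \<open>A\<close> with itself to \<open>A\<close>,
  as the continuous extensions of their restrictions to algebraic tensors.\<close>

definition seqlim :: "'a cstar_alg \<Rightarrow> (nat \<Rightarrow> 'a) \<Rightarrow> 'a" where
  "seqlim A s = (THE x. x \<in> carrier A \<and> seqconv A (nrm A) s x)"

definition slice_left :: "'a cstar_alg \<Rightarrow> ('a \<Rightarrow> complex) \<Rightarrow> (nat \<Rightarrow> ('a \<times> 'a) list) set \<Rightarrow> 'a" where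
  "slice_left A h X =
     seqlim A (\<lambda>n. foldr (\<lambda>(a, b) s. (h a \<odot>\<^bsub>A\<^esub> b) \<oplus>\<^bsub>A\<^esub> s) (rep X n) \<zero>\<^bsub>A\<^esub>)"

definition slice_right :: "'a cstar_alg \<Rightarrow> ('a \<Rightarrow> complex) \<Rightarrow> (nat \<Rightarrow> ('a \<times> 'a) list) set \<Rightarrow> 'a" where
  "slice_right A h X =
     seqlim A (\<lambda>n. foldr (\<lambda>(a, b) s. (h b \<odot>\<^bsub>A\<^esub> a) \<oplus>\<^bsub>A\<^esub> s) (rep X n) \<zero>\<^bsub>A\<^esub>)"


section \<open>Compact matrix quantum groups\<close>

text \<open>An \<open>n \<times> n\<close> matrix is a function on indices of which only the values at \<open>i, j < n\<close> matter.\<close>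

type_synonym 'a mat = "nat \<Rightarrow> nat \<Rightarrow> 'a"

definition mat_mul :: "('a, 'b) ring_scheme \<Rightarrow> nat \<Rightarrow> 'a mat \<Rightarrow> 'a mat \<Rightarrow> 'a mat" where
  "mat_mul A n x y = (\<lambda>i j. \<Oplus>\<^bsub>A\<^esub>k\<in>{..<n}. x i k \<otimes>\<^bsub>A\<^esub> y k j)"

definition mat_one :: "('a, 'b) ring_scheme \<Rightarrow> 'a mat" where
  "mat_one A = (\<lambda>i j. if i = j then \<one>\<^bsub>A\<^esub> else \<zero>\<^bsub>A\<^esub>)"

definition mat_invertible :: "('a, 'b) ring_scheme \<Rightarrow> nat \<Rightarrow> 'a mat \<Rightarrow> bool" where
  "mat_invertible A n x \<longleftrightarrow>
     (\<exists>y. \<forall>i<n. \<forall>j<n. y i j \<in> carrier A \<and>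
        mat_mul A n x y i j = mat_one A i j \<and> mat_mul A n y x i j = mat_one A i j)"

record 'a cmqg =
  alg :: "'a cstar_alg"
  msize :: nat
  fund :: "'a mat"

definition entries :: "'a cmqg \<Rightarrow> 'a set" where
  "entries G = {fund G i j | i j. i < msize G \<and> j < msize G}"

definition comultiplication :: "'a cmqg \<Rightarrow> ('a \<Rightarrow> (nat \<Rightarrow> ('a \<times> 'a) list) set) \<Rightarrow> bool" where
  "comultiplication G \<Delta> \<longleftrightarrow>
     star_hom (alg G) (min_tensor (alg G) (alg G)) \<Delta> \<and>
     (\<forall>i<msize G. \<forall>j<msize G. \<Delta> (fund G i j) =
        to_min_tensor (alg G) (alg G) [(fund G i k, fund G k j). k \<leftarrow> [0..<msize G]])"

definition cmqg :: "'a cmqg \<Rightarrow> bool" where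
  "cmqg G \<longleftrightarrow>
     cstar_algebra (alg G) \<and>
     entries G \<subseteq> carrier (alg G) \<and>
     gen_cstar_subalgebra (alg G) (entries G) = carrier (alg G) \<and>
     mat_invertible (alg G) (msize G) (fund G) \<and>
     mat_invertible (alg G) (msize G) (\<lambda>i j. fund G j i) \<and>
     (\<exists>\<Delta>. comultiplication G \<Delta>)"

text \<open>The *-algebra \<open>O(G)\<close>, with the norm inherited from \<open>C(G)\<close>.\<close>

definition pol :: "'a cmqg \<Rightarrow> 'a cstar_alg" where
  "pol G = alg G\<lparr>carrier := gen_star_subalgebra (alg G) (entries G)\<rparr>"

definition max_version :: "'a cmqg \<Rightarrow> (nat \<Rightarrow> 'a) set cmqg" where
  "max_version G =
     \<lparr>alg = enveloping_cstar (pol G), msize = msize G,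
      fund = (\<lambda>i j. to_enveloping (pol G) (fund G i j))\<rparr>"

text \<open>Since \<open>O(G)\<close> is dense in \<open>C(G)\<close>, the algebra \<open>C(G)\<close> is the enveloping C*-algebra of \<open>O(G)\<close> iff its
  norm restricts to the enveloping norm.\<close>

definition in_max_version :: "'a cmqg \<Rightarrow> bool" where
  "in_max_version G \<longleftrightarrow>
     (\<forall>x\<in>carrier (pol G). nrm (alg G) x = universal_seminorm (pol G) {} x)"

text \<open>\<open>quantum_subgroup H G\<close> means \<open>H \<subset> G\<close>.\<close>

definition quantum_subgroup :: "'b cmqg \<Rightarrow> 'a cmqg \<Rightarrow> bool" where
  "quantum_subgroup H G \<longleftrightarrow> msize H = msize G \<and>
     (\<exists>f. star_hom (pol G) (pol H) f \<and> f ` carrier (pol G) = carrier (pol H) \<and>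
        (\<forall>i<msize G. \<forall>j<msize G. f (fund G i j) = fund H i j))"

definition haar_state :: "'a cmqg \<Rightarrow> ('a \<Rightarrow> complex) \<Rightarrow> bool" where
  "haar_state G h \<longleftrightarrow> state (alg G) h \<and>
     (\<exists>\<Delta>. comultiplication G \<Delta> \<and>
        (\<forall>x\<in>carrier (alg G).
           slice_left (alg G) h (\<Delta> x) = h x \<odot>\<^bsub>alg G\<^esub> \<one>\<^bsub>alg G\<^esub> \<and>
           slice_right (alg G) h (\<Delta> x) = h x \<odot>\<^bsub>alg G\<^esub> \<one>\<^bsub>alg G\<^esub>))"

text \<open>Every compact matrix quantum group has exactly one Haar state.\<close>

definition coamenable :: "'a cmqg \<Rightarrow> bool" where
  "coamenable G \<longleftrightarrow>
     (\<exists>h. haar_state (max_version G) h \<and> faithful (alg (max_version G)) h)"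

text \<open>In the quotient of \<open>C(G)\<close> by the relations \<open>u\<^sub>i\<^sub>j = 0\<close> for \<open>i \<noteq> j\<close> and \<open>u\<^sub>i\<^sub>i = u\<^sub>j\<^sub>j\<close> the fundamental
  representation becomes \<open>z\<close> times the identity matrix, and \<open>\<Gamma>\<close> is the group generated by the
  invertible element \<open>z\<close>. The order of an infinite group is \<open>0\<close> in HOL-Algebra.\<close>

definition reflection_ideal :: "'a cmqg \<Rightarrow> 'a set" where
  "reflection_ideal G = gen_closed_ideal (alg G)
     ({fund G i j | i j. i < msize G \<and> j < msize G \<and> i \<noteq> j} \<union>
      {fund G i i \<ominus>\<^bsub>alg G\<^esub> fund G j j | i j. i < msize G \<and> j < msize G})"

definition reflection_group :: "'a cmqg \<Rightarrow> 'a set monoid" where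
  "reflection_group G =
     subgroup_generated (units_of (alg G Quot reflection_ideal G))
       {reflection_ideal G +>\<^bsub>alg G\<^esub> fund G 0 0}"

definition degree_of_reflection :: "'a cmqg \<Rightarrow> nat" where
  "degree_of_reflection G = order (reflection_group G)"


section \<open>The free orthogonal quantum group, the dual of \<open>\<int>\<^sub>2\<close>, free products and gluing\<close>

abbreviation O_plus_free :: "nat \<Rightarrow> (((nat \<times> nat) \<times> bool) list \<Rightarrow> complex) star_alg" where
  "O_plus_free N \<equiv> free_star_alg ({..<N} \<times> {..<N})"

definition O_plus_relations ::
    "nat \<Rightarrow> ((((nat \<times> nat) \<times> bool) list \<Rightarrow> complex) \<times> (((nat \<times> nat) \<times> bool) list \<Rightarrow> complex)) set" where
  "O_plus_relations N =
     (let F = O_plus_free N; u = (\<lambda>i j. gen (i, j)); u_adj = (\<lambda>i j. star F (u j i)) in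
        {(star F (u i j), u i j) | i j. i < N \<and> j < N} \<union>
        {(mat_mul F N u u_adj i j, mat_one F i j) | i j. i < N \<and> j < N} \<union>
        {(mat_mul F N u_adj u i j, mat_one F i j) | i j. i < N \<and> j < N})"

definition O_plus :: "nat \<Rightarrow> (nat \<Rightarrow> ((nat \<times> nat) \<times> bool) list \<Rightarrow> complex) set cmqg" where
  "O_plus N =
     \<lparr>alg = universal_cstar (O_plus_free N) (O_plus_relations N), msize = N,
      fund = (\<lambda>i j. to_universal (O_plus_free N) (O_plus_relations N) (gen (i, j)))\<rparr>"

definition Z2_dual :: "(nat \<Rightarrow> int \<Rightarrow> complex) set cmqg" where
  "Z2_dual =
     (let C = group_star_alg (integer_mod_group 2) in
        \<lparr>alg = enveloping_cstar C, msize = 1,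
         fund = (\<lambda>_ _. to_enveloping C (\<lambda>x. if x = 1 then 1 else 0))\<rparr>)"

definition cmqg_free_product ::
    "'a cmqg \<Rightarrow> 'b cmqg \<Rightarrow> (nat \<Rightarrow> (('a + 'b) \<times> bool) list \<Rightarrow> complex) set cmqg" where
  "cmqg_free_product G H =
     (let A = alg G; B = alg H; n = msize G in
        \<lparr>alg = cstar_free_product A B, msize = n + msize H,
         fund = (\<lambda>i j. if i < n \<and> j < n then free_prod_inl A B (fund G i j)
                       else if n \<le> i \<and> n \<le> j then free_prod_inr A B (fund H (i - n) (j - n))
                       else \<zero>\<^bsub>cstar_free_product A B\<^esub>)\<rparr>)"

text \<open>Here the fundamental representation of \<open>G\<close> is \<open>v \<oplus> r\<close> with \<open>v\<close> of size \<open>N\<close>, so that \<open>r\<close> is the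
  entry with both indices \<open>N\<close>. When \<open>v\<close> and its conjugate are unitary and \<open>r\<close> is a self-adjoint
  unitary, the matrix \<open>(v\<^sub>i\<^sub>j r)\<close> and its conjugate are unitary, so the result is always a quantum
  subgroup of the free unitary quantum group.\<close>

definition glued_version :: "nat \<Rightarrow> 'a cmqg \<Rightarrow> 'a cmqg" where
  "glued_version N G =
     (let A = alg G; w = (\<lambda>i j. fund G i j \<otimes>\<^bsub>A\<^esub> fund G N N) in
        \<lparr>alg = A\<lparr>carrier := gen_cstar_subalgebra A {w i j | i j. i < N \<and> j < N}\<rparr>,
         msize = N, fund = w\<rparr>)"

end

theory Submission
  imports Defs
begin

text \<open>Since \<open>\<Gamma>\<close> has order two, \<open>v\<^sub>i\<^sub>j \<mapsto> -\<delta>\<^sub>i\<^sub>j\<close>, \<open>r \<mapsto> -1\<close> defines a character \<open>\<chi>\<close> of \<open>O(G)\<close>. The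
  translation \<open>\<gamma> = (\<chi> \<otimes> id) \<Delta>\<close> is an automorphism of \<open>O(G)\<close> that changes the sign of all \<open>v\<^sub>i\<^sub>j\<close> and of \<open>r\<close>.
  Its fixed points form the *-algebra \<open>O\<close> of the glued version, generated by the \<open>v\<^sub>i\<^sub>j r\<close>, and
  \<open>O(G) = O \<oplus> r O\<close>. The projection \<open>ev = (id + \<gamma>) / 2\<close> onto \<open>O\<close> satisfies
  \<open>ev (x* x) = a* a + b* b\<close> for \<open>x = a + r b\<close>. Hence states of \<open>O\<close> extend to \<open>O(G)\<close> by zero on \<open>r O\<close>, so that
  the universal norm of \<open>O(G)\<close> restricts to the universal norm of \<open>O\<close>. The Haar state of \<open>O(G)\<close>
  restricts to that of \<open>O\<close>, and \<open>h \<circ> ev\<close> is the Haar state of \<open>O(G)\<close> if \<open>h\<close> is the one of \<open>O\<close>. By the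
  formula for \<open>ev (x* x)\<close>, faithfulness passes in both directions. Faithfulness of \<open>h\<close> on the completion
  means that a Cauchy sequence \<open>(s\<^sub>n)\<close> in the polynomial algebra with \<open>h (s\<^sub>n* s\<^sub>n) \<longlonglongrightarrow> 0\<close> is a null sequence.
  The C*-algebra theory behind this, in particular the existence of enough states, rests on the
  positivity of \<open>y* y\<close>, shown here with square roots instead of spectral theory.\<close>

section \<open>The Hahn-Banach theorem\<close>

text \<open>Modulo the reflection ideal all diagonal entries equal \<open>r\<close>, and
  \<open>r\<close> squares to 1. If \<open>1 - r\<close> were in the ideal, \<Gamma> would be
  trivial, so degree two makes \<open>e = 1 - r\<close> a common eigenvector of all entries that is
  nonzero modulo the ideal, with eigenvalue -1 on the diagonal and 0 off it. The character \<chi>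
  reads off the eigenvalues, and the quotient is never analysed. The obstacle is that the glued
  version is completed in the largest norm of its own polynomial algebra, which could a priori
  exceed the norm inherited from O(G). So everything is phrased on polynomial algebras, where
  \<Delta> is only a relation between elements and formal tensors; that it is single-valued is
  inherited from C(G), because the minimal norm separates algebraic tensors. An extended state
  yields a C*-seminorm only through a bounded GNS representation; boundedness comes from the columns
  of \<open>v\<close>, whose squares sum to 1. Enough states are needed in many completions with
  different carriers. Therefore they are constructed once, on a type with a complete C*-seminorm,
  and transported to carriers.\<close>

definition sublinear :: "('b::real_vector \<Rightarrow> real) \<Rightarrow> bool" where
  "sublinear q \<longleftrightarrow> (\<forall>x y. q (x + y) \<le> q x + q y) \<and> (\<forall>r x. 0 \<le> r \<longrightarrow> q (r *\<^sub>R x) = r * q x)"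

lemma sublinear_zero: "sublinear q \<Longrightarrow> q 0 = 0"
  unfolding sublinear_def by (metis mult_zero_left order_refl scaleR_zero_left)

lemma sublinear_minus: "sublinear q \<Longrightarrow> - q (- x) \<le> q x"
  using sublinear_zero[of q] unfolding sublinear_def
  by (smt (verit) add.right_inverse)

text \<open>Two parameters matter: t = 0 keeps the infimum below \<open>q\<close>, and t = 1 gives
  at most \<open>- q y\<close> at the point \<open>- y\<close>. So every linear functional below the
  tilt attains \<open>q y\<close> at \<open>y\<close>.\<close>

definition sublinear_tilt :: "('b::real_vector \<Rightarrow> real) \<Rightarrow> 'b \<Rightarrow> 'b \<Rightarrow> real" where
  "sublinear_tilt q y x = (INF t\<in>{0..}. q (x + t *\<^sub>R y) - t * q y)"

lemma sublinear_tilt_le: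
  assumes q: "sublinear q" and "0 \<le> t"
  shows "sublinear_tilt q y x \<le> q (x + t *\<^sub>R y) - t * q y"
proof -
  have "- q (- x) \<le> q (x + s *\<^sub>R y) - s * q y" if "0 \<le> s" for s
  proof -
    have "s * q y = q ((x + s *\<^sub>R y) + (- x))" using q that by (simp add: sublinear_def)
    also have "\<dots> \<le> q (x + s *\<^sub>R y) + q (- x)" using q unfolding sublinear_def by blast
    finally show ?thesis by simp
  qed
  then have "bdd_below ((\<lambda>t. q (x + t *\<^sub>R y) - t * q y) ` {0..})"
    by (intro bdd_belowI2[where m = "- q (- x)"]) auto
  then show ?thesis unfolding sublinear_tilt_def using assms(2) by (intro cINF_lower) auto
qed

lemma sublinear_tilt_greatest:
  assumes "\<And>t. 0 \<le> t \<Longrightarrow> m \<le> q (x + t *\<^sub>R y) - t * q y"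
  shows "m \<le> sublinear_tilt q y x"
  unfolding sublinear_tilt_def using assms by (intro cINF_greatest) auto

text \<open>Parameters t and t' of two summands combine to t + t' for the sum, and scaling the point
  by r > 0 is absorbed by scaling the parameter.\<close>

lemma sublinear_tilt:
  assumes q: "sublinear q"
  shows "sublinear (sublinear_tilt q y)"
proof -
  have hom: "q (r *\<^sub>R x) = r * q x" if "0 \<le> r" for r x
    using q that by (simp add: sublinear_def)
  have add: "q (x + y) \<le> q x + q y" for x y
    using q by (simp add: sublinear_def)
  have sub: "sublinear_tilt q y (a + b) \<le> sublinear_tilt q y a + sublinear_tilt q y b" for a b
  proof -
    have 1: "sublinear_tilt q y (a + b) - (q (b + t' *\<^sub>R y) - t' * q y) \<le> q (a + t *\<^sub>R y) - t * q y"
      if "0 \<le> t" "0 \<le> t'" for t t'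
    proof -
      have "sublinear_tilt q y (a + b) \<le> q ((a + b) + (t + t') *\<^sub>R y) - (t + t') * q y"
        using that by (intro sublinear_tilt_le[OF q]) auto
      also have "(a + b) + (t + t') *\<^sub>R y = (a + t *\<^sub>R y) + (b + t' *\<^sub>R y)"
        by (simp add: algebra_simps)
      finally show ?thesis using add[of "a + t *\<^sub>R y" "b + t' *\<^sub>R y"]
        by (simp add: algebra_simps)
    qed
    have "sublinear_tilt q y (a + b) - (q (b + t' *\<^sub>R y) - t' * q y) \<le> sublinear_tilt q y a"
      if "0 \<le> t'" for t'
      using 1 that by (intro sublinear_tilt_greatest) auto
    then have "sublinear_tilt q y (a + b) - sublinear_tilt q y a \<le> sublinear_tilt q y b"
      by (intro sublinear_tilt_greatest) (simp add: algebra_simps)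
    then show ?thesis by simp
  qed
  have scale_le: "sublinear_tilt q y (r *\<^sub>R x) \<le> r * sublinear_tilt q y x" if "0 < r" for r x
  proof -
    have "sublinear_tilt q y (r *\<^sub>R x) / r \<le> sublinear_tilt q y x"
    proof (rule sublinear_tilt_greatest)
      fix t :: real assume t: "0 \<le> t"
      have "sublinear_tilt q y (r *\<^sub>R x) \<le> q (r *\<^sub>R x + (r * t) *\<^sub>R y) - (r * t) * q y"
        using that t by (intro sublinear_tilt_le[OF q]) auto
      also have "r *\<^sub>R x + (r * t) *\<^sub>R y = r *\<^sub>R (x + t *\<^sub>R y)" by (simp add: algebra_simps)
      also have "q (r *\<^sub>R (x + t *\<^sub>R y)) = r * q (x + t *\<^sub>R y)" using that by (intro hom) simp
      finally have "sublinear_tilt q y (r *\<^sub>R x) \<le> r * (q (x + t *\<^sub>R y) - t * q y)"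
        by (simp add: right_diff_distrib mult.assoc)
      then show "sublinear_tilt q y (r *\<^sub>R x) / r \<le> q (x + t *\<^sub>R y) - t * q y"
        using that by (simp add: field_simps)
    qed
    then show ?thesis using that by (simp add: field_simps)
  qed
  have scale: "sublinear_tilt q y (r *\<^sub>R x) = r * sublinear_tilt q y x" if "0 \<le> r" for r x
  proof (cases "r = 0")
    case True
    have "0 \<le> sublinear_tilt q y 0"
      by (rule sublinear_tilt_greatest) (simp add: hom)
    moreover have "sublinear_tilt q y 0 \<le> 0"
      using sublinear_tilt_le[OF q, of 0 y 0] sublinear_zero[OF q] by simp
    ultimately show ?thesis using True by simp
  next
    case False
    then have r: "0 < r" using that by simp
    have "sublinear_tilt q y (inverse r *\<^sub>R (r *\<^sub>R x)) \<le> inverse r * sublinear_tilt q y (r *\<^sub>R x)"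
      by (rule scale_le) (use r in simp)
    then have "r * sublinear_tilt q y x \<le> sublinear_tilt q y (r *\<^sub>R x)"
      using r by (simp add: field_simps)
    then show ?thesis using scale_le[OF r, of x] by simp
  qed
  show ?thesis unfolding sublinear_def using sub scale by blast
qed

text \<open>Linear functionals are the minimal sublinear ones.\<close>

lemma ex_minimal_sublinear:
  assumes s: "sublinear s"
  obtains q where "sublinear q" "\<And>x. q x \<le> s x"
    "\<And>q'. sublinear q' \<Longrightarrow> (\<And>x. q' x \<le> q x) \<Longrightarrow> q' = q"
proof -
  define A where "A = {q. sublinear q \<and> q \<le> s}"
  define P :: "('a \<Rightarrow> real) \<Rightarrow> ('a \<Rightarrow> real) \<Rightarrow> bool" where "P = (\<lambda>q q'. q' \<le> q)"
  have "\<exists>m\<in>A. \<forall>a\<in>A. P m a \<longrightarrow> a = m"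
  proof (rule predicate_Zorn)
    show "partial_order_on A (relation_of P A)"
      by (auto simp: partial_order_on_def preorder_on_def refl_on_def trans_def antisym_def
          relation_of_def P_def)
  next
    fix C assume C: "C \<in> Chains (relation_of P A)"
    show "\<exists>u\<in>A. \<forall>a\<in>C. P a u"
    proof (cases "C = {}")
      case True
      then show ?thesis using s by (auto simp: A_def)
    next
      case False
      have CA: "C \<subseteq> A" using C by (auto simp: Chains_def relation_of_def)
      have chain: "a \<le> b \<or> b \<le> a" if "a \<in> C" "b \<in> C" for a b
        using C that by (auto simp: Chains_def relation_of_def P_def)
      \<comment> \<open>All members of the chain lie below \<open>s\<close> and hence share the
        lower bound \<open>- s (- x)\<close>, so the pointwise infimum is finite.\<close>
      define u where "u = (\<lambda>x. INF q\<in>C. q x)"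
      have low: "- s (- x) \<le> q x" if "q \<in> C" for q x
      proof -
        have "sublinear q" "q (- x) \<le> s (- x)" using that CA by (auto simp: A_def le_fun_def)
        then show ?thesis using sublinear_minus[of q x] by linarith
      qed
      have u_le: "u x \<le> q x" if "q \<in> C" for q x
        unfolding u_def using low that by (intro cINF_lower bdd_belowI2[where m = "- s (- x)"]) auto
      have u_gr: "m \<le> u x" if "\<And>q. q \<in> C \<Longrightarrow> m \<le> q x" for m x
        unfolding u_def using that False by (intro cINF_greatest) auto
      have hom: "q (r *\<^sub>R x) = r * q x" if "0 \<le> r" "q \<in> C" for r x q
        using that CA by (auto simp: sublinear_def A_def)
      have scale_le: "r * u x \<le> u (r *\<^sub>R x)" if "0 \<le> r" for r x
      proof (rule u_gr)
        fix q assume q: "q \<in> C"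
        show "r * u x \<le> q (r *\<^sub>R x)" using hom[OF that q] mult_left_mono[OF u_le[OF q] that] by simp
      qed
      have "sublinear u"
        unfolding sublinear_def
      proof (intro conjI allI impI)
        fix x y
        have "u (x + y) \<le> q x + q' y" if "q \<in> C" "q' \<in> C" for q q'
        proof -
          \<comment> \<open>Two members of a chain are comparable, so the smaller one can be used at
            both points.\<close>
          define m where "m = (if q \<le> q' then q else q')"
          have m: "m \<in> C" "m \<le> q" "m \<le> q'" using chain that by (auto simp: m_def)
          have "u (x + y) \<le> m (x + y)" by (rule u_le) (rule m)
          also have "\<dots> \<le> m x + m y" using m CA by (auto simp: A_def sublinear_def)
          also have "\<dots> \<le> q x + q' y" using m by (simp add: le_fun_def add_mono)
          finally show ?thesis .
        qed
        then have "u (x + y) - q' y \<le> u x" if "q' \<in> C" for q'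
          using that by (intro u_gr) (simp add: algebra_simps)
        then have "u (x + y) - u x \<le> u y" by (intro u_gr) (simp add: algebra_simps)
        then show "u (x + y) \<le> u x + u y" by simp
      next
        fix r :: real and x assume r: "0 \<le> r"
        show "u (r *\<^sub>R x) = r * u x"
        proof (cases "r = 0")
          case True
          obtain q where q: "q \<in> C" using False by blast
          have "u 0 \<le> 0" using u_le[OF q, of 0] hom[OF _ q, of 0 0] by simp
          then show ?thesis using scale_le[of 0 x] True by simp
        next
          case False
          then have "inverse r * u (r *\<^sub>R x) \<le> u x"
            using scale_le[of "inverse r" "r *\<^sub>R x"] r by simp
          then show ?thesis using scale_le[OF r, of x] r False by (simp add: field_simps)
        qed
      qed
      moreover have "u \<le> s"
      proof -
        obtain q where "q \<in> C" using False by blast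
        then show ?thesis using u_le[of q] CA by (force simp: le_fun_def A_def intro: order_trans)
      qed
      ultimately show ?thesis using u_le by (auto simp: A_def P_def le_fun_def)
    qed
  qed
  then obtain m where "m \<in> A" and min: "\<forall>a\<in>A. P m a \<longrightarrow> a = m" by blast
  show thesis
  proof (rule that)
    show "sublinear m" "m x \<le> s x" for x using \<open>m \<in> A\<close> by (auto simp: A_def le_fun_def)
    show "q' = m" if "sublinear q'" "\<And>x. q' x \<le> m x" for q'
      using min that \<open>m \<in> A\<close> unfolding A_def P_def le_fun_def
      by (smt (verit) mem_Collect_eq)
  qed
qed

text \<open>A minimal sublinear functional equals its own tilt in every direction \<open>y\<close>;
  the parameter t = 1 then gives superadditivity and so linearity. Starting below the tilt of
  \<open>s\<close> at \<open>z\<close> forces equality at \<open>z\<close>.\<close>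

theorem hahn_banach_sublinear:
  fixes s :: "'b::real_vector \<Rightarrow> real"
  assumes s: "sublinear s"
  obtains f where "linear f" "\<And>x. f x \<le> s x" "f z = s z"
proof -
  obtain f where f: "sublinear f" "\<And>x. f x \<le> sublinear_tilt s z x"
    "\<And>q'. sublinear q' \<Longrightarrow> (\<And>x. q' x \<le> f x) \<Longrightarrow> q' = f"
    by (rule ex_minimal_sublinear[OF sublinear_tilt[OF s, of z]]) blast
  have ge: "f x + f y \<le> f (x + y)" for x y
  proof -
    have "sublinear_tilt f y = f"
    proof (rule f(3))
      show "sublinear (sublinear_tilt f y)" by (rule sublinear_tilt) (rule f)
      show "sublinear_tilt f y x \<le> f x" for x using sublinear_tilt_le[OF f(1), of 0 y x] by simp
    qed
    then show ?thesis using sublinear_tilt_le[OF f(1), of 1 y x] by simp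
  qed
  have add: "f (x + y) = f x + f y" for x y
    using ge[of x y] f(1) unfolding sublinear_def by (meson order_antisym)
  have neg: "f (- x) = - f x" for x
    using add[of x "- x"] sublinear_zero[OF f(1)] by simp
  have "linear f"
  proof (rule linearI)
    show "f (r *\<^sub>R x) = r *\<^sub>R f x" for r x
    proof (cases "0 \<le> r")
      case True then show ?thesis using f(1) by (simp add: sublinear_def)
    next
      case False
      then have "f ((- r) *\<^sub>R x) = (- r) * f x"
        using f(1) unfolding sublinear_def by (metis linorder_linear neg_0_le_iff_le)
      then show ?thesis using neg[of "r *\<^sub>R x"] by simp
    qed
  qed (rule add)
  moreover have le: "f x \<le> s x" for x
    using f(2)[of x] sublinear_tilt_le[OF s, of 0 z x] by simp
  moreover have "f z = s z"
  proof -
    have "f (- z) \<le> - s z"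
      using f(2)[of "- z"] sublinear_tilt_le[OF s, of 1 z "- z"] sublinear_zero[OF s] by simp
    then show ?thesis using neg[of z] le[of z] by simp
  qed
  ultimately show thesis by (rule that)
qed

section \<open>Positivity in C*-algebras\<close>

text \<open>A type equipped with a complete C*-seminorm; equality of elements of the C*-algebra is
  \<open>N (x - y) = 0\<close>, and \<open>J\<close> is the imaginary unit.\<close>

locale cstar_space =
  fixes adj :: "'b::real_algebra_1 \<Rightarrow> 'b" and J :: 'b and N :: "'b \<Rightarrow> real"
  assumes adj_add: "adj (x + y) = adj x + adj y"
    and adj_scale: "adj (r *\<^sub>R x) = r *\<^sub>R adj x"
    and adj_mult: "adj (x * y) = adj y * adj x"
    and adj_adj: "adj (adj x) = x"
    and adj_J: "adj J = - J"
    and J_J: "J * J = - 1"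
    and J_comm: "x * J = J * x"
    and N_scale: "N (r *\<^sub>R x) = \<bar>r\<bar> * N x"
    and N_add: "N (x + y) \<le> N x + N y"
    and N_mult: "N (x * y) \<le> N x * N y"
    and N_cstar: "N (adj x * x) = (N x)\<^sup>2"
    and N_one: "N 1 = 1"
    and N_complete: "(\<And>e. 0 < e \<Longrightarrow> \<exists>M. \<forall>m\<ge>M. \<forall>n\<ge>M. N (X m - X n) < e) \<Longrightarrow>
      \<exists>L. (\<lambda>n. N (X n - L)) \<longlonglongrightarrow> 0"
begin

section \<open>Calculus of the adjoint and of the seminorm\<close>

lemma adj_zero: "adj 0 = 0"
  using adj_scale[of 0 0] by simp

lemma adj_minus: "adj (- x) = - adj x"
  using adj_scale[of "-1" x] by simp

lemma adj_diff: "adj (x - y) = adj x - adj y"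
  using adj_add[of x "- y"] adj_minus by simp

lemma adj_one: "adj 1 = 1"
  by (metis adj_adj adj_mult mult_1_left mult_1_right)

lemmas adj_simps = adj_add adj_scale adj_mult adj_adj adj_zero adj_minus adj_diff adj_one

lemma adj_Jx: "adj (J * x) = - (J * adj x)"
  by (simp add: adj_mult adj_J J_comm)

lemma JJx: "J * (J * x) = - x"
  by (simp add: mult.assoc[symmetric] J_J)

lemma xJy: "x * (J * y) = J * (x * y)"
  by (metis J_comm mult.assoc)

lemma N_zero: "N 0 = 0"
  using N_scale[of 0 0] by simp

lemma N_minus: "N (- x) = N x"
  using N_scale[of "-1" x] by simp

lemma N_nonneg: "0 \<le> N x"
  using N_add[of x "- x"] by (simp add: N_zero N_minus)

lemma N_diff: "N (x - y) \<le> N x + N y"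
  using N_add[of x "- y"] by (simp add: N_minus)

lemma N_diff_commute: "N (x - y) = N (y - x)"
  using N_minus[of "x - y"] by simp

lemma N_triangle: "N (x - z) \<le> N (x - y) + N (y - z)"
  using N_add[of "x - y" "y - z"] by simp

lemma N_le_add_diff: "N x \<le> N y + N (x - y)"
  using N_add[of y "x - y"] by simp

lemma N_adj: "N (adj x) = N x"
proof -
  have le: "N x \<le> N (adj x)" for x
  proof (cases "N x = 0")
    case True then show ?thesis by (simp add: N_nonneg)
  next
    case False
    then have "0 < N x" using N_nonneg[of x] by simp
    moreover have "N x * N x \<le> N (adj x) * N x"
      using N_mult[of "adj x" x] by (simp add: N_cstar power2_eq_square)
    ultimately show ?thesis by simp
  qed
  show ?thesis using le[of x] le[of "adj x"] by (simp add: adj_adj)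
qed

lemma N_J: "N (J * x) = N x"
proof -
  have "(N (J * x))\<^sup>2 = N (adj (J * x) * (J * x))" by (simp add: N_cstar)
  also have "adj (J * x) * (J * x) = adj x * x"
    by (simp add: adj_Jx JJx mult.assoc xJy[of "adj x"])
  finally show ?thesis by (simp add: N_cstar N_nonneg)
qed

lemma N_selfadj_square: "adj x = x \<Longrightarrow> N (x * x) = (N x)\<^sup>2"
  using N_cstar[of x] by simp

lemma N_scalar: "N (t *\<^sub>R 1) = \<bar>t\<bar>"
  by (simp add: N_scale N_one)

lemma N_limit_le:
  assumes "e \<longlonglongrightarrow> 0" "\<And>n. N a \<le> c + e n"
  shows "N a \<le> c"
proof -
  have "(\<lambda>n. c + e n) \<longlonglongrightarrow> c + 0" by (intro tendsto_intros assms)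
  then show ?thesis using assms(2) by (intro LIMSEQ_le_const[where X = "\<lambda>n. c + e n"]) auto
qed

definition eqv :: "'b \<Rightarrow> 'b \<Rightarrow> bool" (infix \<open>\<approx>\<close> 50) where
  "x \<approx> y \<longleftrightarrow> N (x - y) = 0"

lemma eqv_refl [simp, intro]: "x \<approx> x"
  by (simp add: eqv_def N_zero)

lemma eqv_sym: "x \<approx> y \<Longrightarrow> y \<approx> x"
  by (simp add: eqv_def N_diff_commute)

lemma eqv_trans [trans]: "x \<approx> y \<Longrightarrow> y \<approx> z \<Longrightarrow> x \<approx> z"
  using N_triangle[of x z y] N_nonneg[of "x - z"] by (simp add: eqv_def)

lemma eqv_iff_le: "x \<approx> y \<longleftrightarrow> N (x - y) \<le> 0"
  using N_nonneg[of "x - y"] by (auto simp: eqv_def)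

lemma eqv_add: "x \<approx> y \<Longrightarrow> x' \<approx> y' \<Longrightarrow> x + x' \<approx> y + y'"
  using N_add[of "x - y" "x' - y'"] by (simp add: eqv_iff_le algebra_simps)

lemma eqv_scale: "x \<approx> y \<Longrightarrow> r *\<^sub>R x \<approx> r *\<^sub>R y"
  by (simp add: eqv_def N_scale flip: scaleR_diff_right)

lemma eqv_minus: "x \<approx> y \<Longrightarrow> - x \<approx> - y"
  using eqv_scale[of x y "-1"] by simp

lemma eqv_diff: "x \<approx> y \<Longrightarrow> x' \<approx> y' \<Longrightarrow> x - x' \<approx> y - y'"
  using eqv_add[OF _ eqv_minus, of x y x' y'] by simp

lemma eqv_mult: 
  assumes "x \<approx> y" "x' \<approx> y'" shows "x * x' \<approx> y * y'"
proof -
  have "x * x' - y * y' = (x - y) * x' + y * (x' - y')" by (simp add: algebra_simps)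
  then have "N (x * x' - y * y') \<le> N (x - y) * N x' + N y * N (x' - y')"
    using N_add[of "(x - y) * x'" "y * (x' - y')"] N_mult[of "x - y" x'] N_mult[of y "x' - y'"]
    by simp
  then show ?thesis using assms by (simp add: eqv_iff_le eqv_def[THEN iffD1])
qed

lemma eqv_N: "x \<approx> y \<Longrightarrow> N x = N y"
  using N_le_add_diff[of x y] N_le_add_diff[of y x] by (simp add: eqv_def N_diff_commute)

section \<open>Square roots by iteration\<close>

lemma geometric_cauchy:
  assumes \<sigma>: "0 \<le> \<sigma>" "\<sigma> < 1" and step: "\<And>n. N (X (Suc n) - X n) \<le> C * \<sigma> ^ n"
  shows "\<exists>L. (\<lambda>n. N (X n - L)) \<longlonglongrightarrow> 0"
proof (rule N_complete)
  fix e :: real assume e: "0 < e"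
  have C: "0 \<le> C" using order_trans[OF N_nonneg step[of 0]] by simp
  have bound: "N (X (n + k) - X n) \<le> C * \<sigma> ^ n * (\<Sum>i<k. \<sigma> ^ i)" for n k
  proof (induction k)
    case 0 then show ?case by (simp add: N_zero)
  next
    case (Suc k)
    have "N (X (n + Suc k) - X n) \<le> C * \<sigma> ^ (n + k) + N (X (n + k) - X n)"
      using N_triangle[of "X (n + Suc k)" "X n" "X (n + k)"] step[of "n + k"] by simp
    then show ?case using Suc.IH by (simp add: algebra_simps power_add)
  qed
  have sum_le: "(\<Sum>i<k. \<sigma> ^ i) \<le> 1 / (1 - \<sigma>)" for k
    using \<sigma> by (simp add: sum_gp_strict divide_right_mono)
  have bound': "N (X (n + k) - X n) \<le> C * \<sigma> ^ n * (1 / (1 - \<sigma>))" for n k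
    using order_trans[OF bound mult_left_mono[OF sum_le]] C \<sigma> by simp
  have "(\<lambda>n. C * \<sigma> ^ n * (1 / (1 - \<sigma>))) \<longlonglongrightarrow> C * 0 * (1 / (1 - \<sigma>))"
    using \<sigma> by (intro tendsto_intros LIMSEQ_power_zero) auto
  then have "(\<lambda>n. C * \<sigma> ^ n * (1 / (1 - \<sigma>))) \<longlonglongrightarrow> 0" by simp
  then have "eventually (\<lambda>n. C * \<sigma> ^ n * (1 / (1 - \<sigma>)) < e / 2) sequentially"
    by (rule order_tendstoD(2)) (use e in simp)
  then obtain M where M: "\<And>n. n \<ge> M \<Longrightarrow> C * \<sigma> ^ n * (1 / (1 - \<sigma>)) < e / 2"
    unfolding eventually_sequentially by blast
  show "\<exists>M. \<forall>m\<ge>M. \<forall>n\<ge>M. N (X m - X n) < e"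
  proof (intro exI allI impI)
    fix m n assume "M \<le> m" "M \<le> n"
    then have "N (X m - X M) < e / 2" "N (X n - X M) < e / 2"
      using le_less_trans[OF bound'[of M "m - M"] M] le_less_trans[OF bound'[of M "n - M"] M]
      by simp_all
    then show "N (X m - X n) < e"
      using N_triangle[of "X m" "X n" "X M"] by (simp add: N_diff_commute)
  qed
qed

text \<open>The square root of \<open>1 - h\<close> is \<open>1 - y\<close>, where \<open>y\<close> is the fixed point of the contraction
  \<open>y \<mapsto> (h + y\<^sup>2) / 2\<close>.\<close>

lemma ex_sqrt_one_minus:
  assumes h: "adj h = h" "N h < 1"
  obtains k where "adj k = k" "k * k \<approx> 1 - h" "N (1 - k) \<le> 1"
    "\<And>z. z * h \<approx> h * z \<Longrightarrow> z * k \<approx> k * z"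
proof -
  \<comment> \<open>The smaller root of \<open>(N h + t * t) / 2 = t\<close>. Being a fixed point,
    it bounds all iterates, and it is at the same time their contraction constant.\<close>
  define \<sigma> where "\<sigma> = 1 - sqrt (1 - N h)"
  have \<sigma>: "0 \<le> \<sigma>" "\<sigma> < 1" using h N_nonneg[of h] by (auto simp: \<sigma>_def)
  have fix_pt: "(N h + \<sigma> * \<sigma>) / 2 = \<sigma>"
  proof -
    have "\<sigma> * \<sigma> = 1 - 2 * sqrt (1 - N h) + sqrt (1 - N h) * sqrt (1 - N h)"
      by (simp add: \<sigma>_def algebra_simps)
    also have "sqrt (1 - N h) * sqrt (1 - N h) = 1 - N h" using h by simp
    finally show ?thesis by (simp add: \<sigma>_def)
  qed
  define y where "y = rec_nat (0::'b) (\<lambda>_ y. (1/2) *\<^sub>R (h + y * y))"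
  have y0: "y 0 = 0" and yS: "y (Suc n) = (1/2) *\<^sub>R (h + y n * y n)" for n
    by (simp_all add: y_def)
  have adj_y: "adj (y n) = y n" for n
    by (induction n) (simp_all add: y0 yS adj_simps h)
  have Ny: "N (y n) \<le> \<sigma>" for n
  proof (induction n)
    case 0 then show ?case using \<sigma> by (simp add: y0 N_zero)
  next
    case (Suc n)
    have "N (h + y n * y n) \<le> N h + N (y n) * N (y n)"
      using N_add[of h "y n * y n"] N_mult[of "y n" "y n"] by simp
    also have "\<dots> \<le> N h + \<sigma> * \<sigma>" using Suc \<sigma> N_nonneg by (intro add_mono mult_mono) auto
    finally show ?case using fix_pt by (simp add: yS N_scale)
  qed
  have step: "N (y (Suc n) - y n) \<le> N h * \<sigma> ^ n" for n
  proof (induction n)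
    case 0 then show ?case using N_nonneg[of h] by (simp add: y0 yS N_scale)
  next
    case (Suc n)
    let ?d = "y (Suc n) - y n"
    have "y (Suc (Suc n)) - y (Suc n) =
        (1/2) *\<^sub>R (h + y (Suc n) * y (Suc n)) - (1/2) *\<^sub>R (h + y n * y n)"
      by (simp only: yS)
    also have "\<dots> = (1/2) *\<^sub>R (y (Suc n) * ?d + ?d * y n)"
      by (simp add: algebra_simps)
    finally have "N (y (Suc (Suc n)) - y (Suc n)) = (1/2) * N (y (Suc n) * ?d + ?d * y n)"
      by (simp add: N_scale)
    also have "\<dots> \<le> (1/2) * (\<sigma> * N ?d + \<sigma> * N ?d)"
    proof -
      have "N (y (Suc n) * ?d) \<le> \<sigma> * N ?d"
        using order_trans[OF N_mult mult_right_mono[OF Ny N_nonneg]] .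
      moreover have "N (?d * y n) \<le> \<sigma> * N ?d"
        using order_trans[OF N_mult mult_left_mono[OF Ny N_nonneg]] by (simp add: mult.commute)
      ultimately show ?thesis using N_add[of "y (Suc n) * ?d" "?d * y n"] by simp
    qed
    also have "\<dots> = \<sigma> * N ?d" by simp
    also have "\<dots> \<le> \<sigma> * (N h * \<sigma> ^ n)" using Suc \<sigma> by (intro mult_left_mono) auto
    finally show ?case by (simp add: mult.left_commute)
  qed
  obtain L0 where L0: "(\<lambda>n. N (y n - L0)) \<longlonglongrightarrow> 0" using geometric_cauchy[OF \<sigma> step] by blast
  \<comment> \<open>A limit in the seminorm is determined only up to null elements, so it need not
    be self-adjoint; its symmetrisation is, and is no farther from the iterates.\<close>
  define L where "L = (1/2) *\<^sub>R (L0 + adj L0)"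
  have L_adj: "adj L = L" by (simp add: L_def adj_simps add.commute)
  have L_le: "N (y n - L) \<le> N (y n - L0)" for n
  proof -
    have "y n - L = (1/2) *\<^sub>R ((y n - L0) + adj (y n - L0))"
      by (simp add: L_def adj_simps adj_y algebra_simps flip: scaleR_2) 
    then have "N (y n - L) = (1/2) * N ((y n - L0) + adj (y n - L0))" by (simp add: N_scale)
    also have "\<dots> \<le> (1/2) * (N (y n - L0) + N (y n - L0))"
      using N_add[of "y n - L0" "adj (y n - L0)"] by (simp add: N_adj)
    finally show ?thesis by simp
  qed
  have L: "(\<lambda>n. N (y n - L)) \<longlonglongrightarrow> 0"
    by (rule tendsto_sandwich[OF _ _ tendsto_const L0]) (use L_le N_nonneg in auto)
  have NL: "N L \<le> 1"
  proof (rule N_limit_le[OF L])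
    show "N L \<le> 1 + N (y n - L)" for n
      using N_le_add_diff[of L "y n"] Ny[of n] \<sigma> by (simp add: N_diff_commute)
  qed
  have eq: "2 *\<^sub>R L \<approx> h + L * L"
  proof -
    have "N (2 *\<^sub>R L - (h + L * L)) \<le> 0"
    proof (rule N_limit_le)
      have "(\<lambda>n. N (y (Suc n) - L)) \<longlonglongrightarrow> 0" using L by (rule LIMSEQ_Suc)
      then have "(\<lambda>n. 2 * N (y (Suc n) - L) + 2 * N (y n - L)) \<longlonglongrightarrow> 2 * 0 + 2 * 0"
        using L by (intro tendsto_intros)
      then show "(\<lambda>n. 2 * N (y (Suc n) - L) + 2 * N (y n - L)) \<longlonglongrightarrow> 0" by simp
      fix n
      have id: "2 *\<^sub>R L - (h + L * L) =
          (- 2) *\<^sub>R (y (Suc n) - L) + ((y n - L) * y n + L * (y n - L))"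
        by (simp add: yS algebra_simps)
      have "N ((y n - L) * y n) \<le> N (y n - L) * 1"
        using order_trans[OF N_mult mult_left_mono[OF order_trans[OF Ny less_imp_le[OF \<sigma>(2)]] N_nonneg]] .
      moreover have "N (L * (y n - L)) \<le> 1 * N (y n - L)"
        using order_trans[OF N_mult mult_right_mono[OF NL N_nonneg]] .
      moreover have "N ((- 2) *\<^sub>R (y (Suc n) - L)) = 2 * N (y (Suc n) - L)" by (simp add: N_scale del: scaleR_minus_left)
      ultimately show "N (2 *\<^sub>R L - (h + L * L)) \<le> 0 + (2 * N (y (Suc n) - L) + 2 * N (y n - L))"
        unfolding id
        using N_add[of "(- 2) *\<^sub>R (y (Suc n) - L)" "(y n - L) * y n + L * (y n - L)"]
          N_add[of "(y n - L) * y n" "L * (y n - L)"] by simp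
    qed
    then show ?thesis by (simp add: eqv_iff_le)
  qed
  show thesis
  proof (rule that[of "1 - L"])
    show "adj (1 - L) = 1 - L" by (simp add: adj_simps L_adj)
    have "(1 - L) * (1 - L) = 1 + L * L - 2 *\<^sub>R L" by (simp add: algebra_simps scaleR_2)
    also have "\<dots> \<approx> 1 + L * L - (h + L * L)" by (intro eqv_diff eq) simp
    also have "\<dots> = 1 - h" by simp
    finally show "(1 - L) * (1 - L) \<approx> 1 - h" .
    show "N (1 - (1 - L)) \<le> 1" using NL by simp
    \<comment> \<open>This clause replaces functional calculus: later arguments need square roots
      that commute with everything that commutes with \<open>h\<close>.\<close>
    fix z assume z: "z * h \<approx> h * z"
    have zy: "z * y n \<approx> y n * z" for n
    proof (induction n)
      case 0 then show ?case by (simp add: y0)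
    next
      case (Suc n)
      have "z * (y n * y n) = (z * y n) * y n" by (simp add: mult.assoc)
      also have "\<dots> \<approx> (y n * z) * y n" by (intro eqv_mult Suc) simp
      also have "\<dots> = y n * (z * y n)" by (simp add: mult.assoc)
      also have "\<dots> \<approx> y n * (y n * z)" by (intro eqv_mult Suc) simp
      finally have "z * (y n * y n) \<approx> y n * y n * z" by (simp add: mult.assoc)
      then have "(1/2) *\<^sub>R (z * h + z * (y n * y n)) \<approx> (1/2) *\<^sub>R (h * z + y n * y n * z)"
        by (intro eqv_scale eqv_add z)
      then show ?case by (simp add: yS algebra_simps)
    qed
    have "N (z * L - L * z) \<le> 0"
    proof (rule N_limit_le)
      have "(\<lambda>n. 2 * N z * N (y n - L)) \<longlonglongrightarrow> 2 * N z * 0" by (intro tendsto_intros L)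
      then show "(\<lambda>n. 2 * N z * N (y n - L)) \<longlonglongrightarrow> 0" by simp
      fix n
      have id: "z * L - L * z = (z * y n - y n * z) + ((y n - L) * z - z * (y n - L))"
        by (simp add: algebra_simps)
      have "N (z * y n - y n * z) = 0" using zy[of n] by (simp add: eqv_def)
      then show "N (z * L - L * z) \<le> 0 + 2 * N z * N (y n - L)"
        unfolding id using N_add[of "z * y n - y n * z" "(y n - L) * z - z * (y n - L)"]
          N_diff[of "(y n - L) * z" "z * (y n - L)"] N_mult[of "y n - L" z] N_mult[of z "y n - L"]
        by (simp add: algebra_simps)
    qed
    then have "z * L \<approx> L * z" by (simp add: eqv_iff_le)
    then have "z - z * L \<approx> z - L * z" by (intro eqv_diff) simp_all
    then show "z * (1 - L) \<approx> (1 - L) * z" by (simp add: algebra_simps)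
  qed
qed

text \<open>In spectral terms the norm condition places the spectrum of the self-adjoint
  \<open>h\<close> in the interval from 0 to 2t. In this form sums of positive elements are positive
  by the triangle inequality alone.\<close>

definition Pos :: "'b \<Rightarrow> bool" where
  "Pos h \<longleftrightarrow> adj h = h \<and> (\<exists>t. N (t *\<^sub>R 1 - h) \<le> t)"

lemma Pos_selfadj: "Pos h \<Longrightarrow> adj h = h"
  by (simp add: Pos_def)

lemma PosI: "adj h = h \<Longrightarrow> N (t *\<^sub>R 1 - h) \<le> t \<Longrightarrow> Pos h"
  by (auto simp: Pos_def)

lemma Pos_add:
  assumes "Pos h" "Pos k" shows "Pos (h + k)"
proof -
  obtain s t where *: "N (s *\<^sub>R 1 - h) \<le> s" "N (t *\<^sub>R 1 - k) \<le> t" using assms by (auto simp: Pos_def)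
  show ?thesis
  proof (rule PosI)
    show "adj (h + k) = h + k" using assms by (simp add: adj_simps Pos_selfadj)
    have "(s + t) *\<^sub>R 1 - (h + k) = (s *\<^sub>R 1 - h) + (t *\<^sub>R 1 - k)" by (simp add: algebra_simps)
    then have "N ((s + t) *\<^sub>R 1 - (h + k)) \<le> N (s *\<^sub>R 1 - h) + N (t *\<^sub>R 1 - k)"
      using N_add[of "s *\<^sub>R 1 - h" "t *\<^sub>R 1 - k"] by (simp only:)
    then show "N ((s + t) *\<^sub>R 1 - (h + k)) \<le> s + t" using * by linarith
  qed
qed

lemma Pos_scale:
  assumes "Pos h" "0 \<le> r" shows "Pos (r *\<^sub>R h)"
proof -
  obtain t where *: "N (t *\<^sub>R 1 - h) \<le> t" using assms by (auto simp: Pos_def)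
  show ?thesis
  proof (rule PosI)
    show "adj (r *\<^sub>R h) = r *\<^sub>R h" using assms by (simp add: adj_simps Pos_selfadj)
    have "(r * t) *\<^sub>R 1 - r *\<^sub>R h = r *\<^sub>R (t *\<^sub>R 1 - h)" by (simp add: algebra_simps)
    then show "N ((r * t) *\<^sub>R 1 - r *\<^sub>R h) \<le> r * t"
      using mult_left_mono[OF * assms(2)] assms(2) by (simp add: N_scale)
  qed
qed

lemma Pos_eqv:
  assumes "Pos h" "adj k = k" "h \<approx> k" shows "Pos k"
proof -
  obtain t where *: "N (t *\<^sub>R 1 - h) \<le> t" using assms by (auto simp: Pos_def)
  have "t *\<^sub>R 1 - h \<approx> t *\<^sub>R 1 - k" by (intro eqv_diff assms) simp
  then show ?thesis using * eqv_N assms(2) by (metis PosI)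
qed

lemma Pos_scalar: "0 \<le> r \<Longrightarrow> Pos (r *\<^sub>R 1)"
  by (rule PosI[of _ r]) (simp_all add: adj_simps N_zero)

lemma Pos_scalarD:
  assumes "Pos (r *\<^sub>R 1)" shows "0 \<le> r"
proof -
  obtain t where "N (t *\<^sub>R 1 - r *\<^sub>R 1) \<le> t" using assms by (auto simp: Pos_def)
  then have "\<bar>t - r\<bar> \<le> t" by (simp add: N_scalar flip: scaleR_diff_left)
  then show ?thesis by simp
qed

lemma Pos_diff_of_le: "adj w = w \<Longrightarrow> N w \<le> r \<Longrightarrow> Pos (r *\<^sub>R 1 - w)"
  by (rule PosI[of _ r]) (simp_all add: adj_simps)

lemma Pos_add_of_le: "adj w = w \<Longrightarrow> N w \<le> r \<Longrightarrow> Pos (r *\<^sub>R 1 + w)"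
  using Pos_diff_of_le[of "- w" r] by (simp add: adj_simps N_minus)

text \<open>The iteration needs norm strictly below 1. The margin \<epsilon> provides it: for
  \<open>g = (t - h) / (t + \<epsilon>)\<close> the norm is at most
  \<open>t / (t + \<epsilon>)\<close>, and \<open>h + \<epsilon>\<close> is a multiple of
  \<open>1 - g\<close>.\<close>

lemma Pos_sqrt:
  assumes h: "Pos h" and \<epsilon>: "0 < \<epsilon>"
  obtains k where "Pos k" "k * k \<approx> h + \<epsilon> *\<^sub>R 1"
    "\<And>z. z * h \<approx> h * z \<Longrightarrow> z * k \<approx> k * z"
proof -
  obtain t where t: "N (t *\<^sub>R 1 - h) \<le> t" using h by (auto simp: Pos_def)
  have t0: "0 \<le> t" using t N_nonneg order_trans by blast
  define s where "s = t + \<epsilon>"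
  have s: "0 < s" using t0 \<epsilon> by (simp add: s_def)
  define g where "g = inverse s *\<^sub>R (t *\<^sub>R 1 - h)"
  have "adj g = g" using h by (simp add: g_def adj_simps Pos_selfadj)
  moreover have "N g < 1"
  proof -
    have "N g = inverse s * N (t *\<^sub>R 1 - h)" using s by (simp only: g_def N_scale) simp
    also have "\<dots> \<le> inverse s * t" using s t by (intro mult_left_mono) auto
    also have "\<dots> < 1" using s \<epsilon> by (simp add: s_def field_simps)
    finally show ?thesis .
  qed
  ultimately obtain k where k: "adj k = k" "k * k \<approx> 1 - g" "N (1 - k) \<le> 1"
    "\<And>z. z * g \<approx> g * z \<Longrightarrow> z * k \<approx> k * z" using ex_sqrt_one_minus by blast
  have Pk: "Pos k" by (rule PosI[of _ 1]) (use k in simp_all)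
  show thesis
  proof (rule that[of "sqrt s *\<^sub>R k"])
    show "Pos (sqrt s *\<^sub>R k)" using Pk s by (intro Pos_scale) auto
    have "(sqrt s *\<^sub>R k) * (sqrt s *\<^sub>R k) = s *\<^sub>R (k * k)" using s by simp
    also have "\<dots> \<approx> s *\<^sub>R (1 - g)" by (intro eqv_scale k)
    also have "s *\<^sub>R (1 - g) = h + \<epsilon> *\<^sub>R 1"
    proof -
      have "s *\<^sub>R g = t *\<^sub>R 1 - h" using s by (simp only: g_def scaleR_scaleR) simp
      then show ?thesis by (simp add: scaleR_diff_right s_def scaleR_add_left)
    qed
    finally show "(sqrt s *\<^sub>R k) * (sqrt s *\<^sub>R k) \<approx> h + \<epsilon> *\<^sub>R 1" .
    fix z assume z: "z * h \<approx> h * z"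
    have "inverse s *\<^sub>R (t *\<^sub>R z - z * h) \<approx> inverse s *\<^sub>R (t *\<^sub>R z - h * z)"
      by (intro eqv_scale eqv_diff z) simp
    then have "z * g \<approx> g * z" by (simp add: g_def algebra_simps)
    then have "sqrt s *\<^sub>R (z * k) \<approx> sqrt s *\<^sub>R (k * z)" by (intro eqv_scale k)
    then show "z * (sqrt s *\<^sub>R k) \<approx> (sqrt s *\<^sub>R k) * z" by simp
  qed
qed

text \<open>If \<open>k\<^sup>2 + l\<^sup>2 = 1\<close> with commuting self-adjoint \<open>k\<close> and \<open>l\<close>, then \<open>k + i l\<close> is unitary.\<close>

lemma N_one_minus_square:
  assumes k: "adj k = k" "N k < 1"
  shows "N (1 - k * k) \<le> 1"
proof -
  have "N (k * k) < 1" using k N_nonneg[of k] by (simp add: N_selfadj_square power_less_one_iff)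
  moreover have "adj (k * k) = k * k" by (simp add: adj_simps k)
  ultimately obtain l where l: "adj l = l" "l * l \<approx> 1 - k * k"
    "\<And>z. z * (k * k) \<approx> k * k * z \<Longrightarrow> z * l \<approx> l * z" using ex_sqrt_one_minus by blast
  have kl: "k * l \<approx> l * k" by (rule l(3)) (simp add: mult.assoc)
  define u where "u = k + J * l"
  have adj_u: "adj u = k - J * l" by (simp add: u_def adj_add adj_Jx k l)
  have "adj u * u = (k * k + l * l) + J * (k * l - l * k)"
    unfolding adj_u by (simp add: u_def algebra_simps xJy[of k] xJy[of l] JJx)
  also have "\<dots> \<approx> (k * k + (1 - k * k)) + J * (k * l - k * l)"
    by (intro eqv_add eqv_mult eqv_diff l eqv_sym[OF kl]) simp_all
  finally have "adj u * u \<approx> 1" by simp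
  then have "(N u)\<^sup>2 = 1" using eqv_N[of "adj u * u" 1] by (simp add: N_cstar N_one)
  then have u: "N u = 1" using N_nonneg[of u] by (simp add: power2_eq_1_iff)
  \<comment> \<open>As the imaginary part of a unitary, \<open>l\<close> has norm at most 1, and
    \<open>l * l\<close> is \<open>1 - k * k\<close> up to null elements.\<close>
  have "J * l = (1/2) *\<^sub>R (u - adj u)"
    unfolding adj_u by (simp add: u_def flip: scaleR_2)
  then have "N l = (1/2) * N (u - adj u)" using N_J[of l] by (simp add: N_scale)
  then have "N l \<le> 1" using N_diff[of u "adj u"] u by (simp add: N_adj)
  then have "N (l * l) \<le> 1" using N_nonneg[of l] by (simp add: N_selfadj_square l power_le_one)
  then show ?thesis using eqv_N[OF l(2)] by simp
qed

lemma N_scalar_minus_square: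
  assumes k: "adj k = k" "N k < \<tau>"
  shows "N ((\<tau> * \<tau>) *\<^sub>R 1 - k * k) \<le> \<tau> * \<tau>"
proof -
  have \<tau>: "0 < \<tau>" using k N_nonneg[of k] by simp
  have "N (1 - (inverse \<tau> *\<^sub>R k) * (inverse \<tau> *\<^sub>R k)) \<le> 1"
    using k \<tau> by (intro N_one_minus_square) (auto simp: adj_simps N_scale field_simps)
  moreover have "(\<tau> * \<tau>) *\<^sub>R 1 - k * k = (\<tau> * \<tau>) *\<^sub>R (1 - (inverse \<tau> *\<^sub>R k) * (inverse \<tau> *\<^sub>R k))"
  proof -
    have "\<tau> * \<tau> * (inverse \<tau> * inverse \<tau>) = 1" using \<tau> by (simp add: field_simps)
    then show ?thesis by (simp add: scaleR_diff_right)
  qed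
  ultimately show ?thesis using \<tau> by (simp only: N_scale) simp
qed

lemma Pos_square: "adj k = k \<Longrightarrow> Pos (k * k)"
  using N_scalar_minus_square[of k "N k + 1"] by (intro PosI[of _ "(N k + 1) * (N k + 1)"]) (simp_all add: adj_simps)

text \<open>The witness t in \<open>Pos (h + \<epsilon> *\<^sub>R 1)\<close> may vary with
  \<epsilon>. Writing \<open>h\<close> plus a small scalar as a square and applying
  \<open>N_scalar_minus_square\<close> replaces it by the uniform witness \<open>N h + 2\<close>,
  and then \<epsilon> can tend to 0.\<close>

lemma Pos_of_Pos_add:
  assumes h: "adj h = h" and pos: "\<And>\<epsilon>. 0 < \<epsilon> \<Longrightarrow> Pos (h + \<epsilon> *\<^sub>R 1)"
  shows "Pos h"
proof (rule PosI[OF h])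
  define \<tau> where "\<tau> = sqrt (N h + 2)"
  have \<tau>: "\<tau> * \<tau> = N h + 2" using N_nonneg[of h] by (simp add: \<tau>_def)
  show "N ((\<tau> * \<tau>) *\<^sub>R 1 - h) \<le> \<tau> * \<tau>"
  proof (rule field_le_epsilon)
    fix e :: real assume "0 < e"
    define \<epsilon> where "\<epsilon> = min 1 e / 2"
    have \<epsilon>: "0 < \<epsilon>" "2 * \<epsilon> \<le> 1" "2 * \<epsilon> \<le> e" using \<open>0 < e\<close> by (auto simp: \<epsilon>_def)
    obtain k where k: "Pos k" "k * k \<approx> h + \<epsilon> *\<^sub>R 1 + \<epsilon> *\<^sub>R 1"
      using Pos_sqrt[OF pos[OF \<epsilon>(1)] \<epsilon>(1)] by metis
    have kk: "k * k \<approx> h + (2 * \<epsilon>) *\<^sub>R 1"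
      using k(2) by (simp add: add.assoc flip: scaleR_add_left)
    have "(N k)\<^sup>2 = N (h + (2 * \<epsilon>) *\<^sub>R 1)"
      using eqv_N[OF kk] N_selfadj_square[OF Pos_selfadj[OF k(1)]] by simp
    also have "\<dots> \<le> N h + 2 * \<epsilon>"
      using N_add[of h "(2 * \<epsilon>) *\<^sub>R 1"] \<epsilon> by (simp add: N_scalar)
    also have "\<dots> < \<tau>\<^sup>2" using \<epsilon> \<tau> by (simp add: power2_eq_square)
    finally have "(N k)\<^sup>2 < \<tau>\<^sup>2" .
    then have "N k < \<tau>"
      by (rule power_less_imp_less_base) (use N_nonneg[of h] in \<open>simp add: \<tau>_def\<close>)
    then have "N ((\<tau> * \<tau>) *\<^sub>R 1 - k * k) \<le> \<tau> * \<tau>"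
      by (intro N_scalar_minus_square Pos_selfadj k)
    moreover have "(\<tau> * \<tau>) *\<^sub>R 1 - k * k \<approx> (\<tau> * \<tau>) *\<^sub>R 1 - (h + (2 * \<epsilon>) *\<^sub>R 1)"
      by (intro eqv_diff kk) simp
    ultimately have "N ((\<tau> * \<tau>) *\<^sub>R 1 - (h + (2 * \<epsilon>) *\<^sub>R 1)) \<le> \<tau> * \<tau>"
      using eqv_N by simp
    then show "N ((\<tau> * \<tau>) *\<^sub>R 1 - h) \<le> \<tau> * \<tau> + e"
      using N_add[of "(\<tau> * \<tau>) *\<^sub>R 1 - (h + (2 * \<epsilon>) *\<^sub>R 1)" "(2 * \<epsilon>) *\<^sub>R 1"] \<epsilon>
      by (simp add: N_scalar)
  qed
qed

text \<open>Take commuting square roots p of T - x and q of T + x with T slightly above \<tau>. Then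
  u = x + i p q satisfies u* u = x x + (T T - x x) = T T, so \<open>x\<close> is the real part of an
  element of norm T.\<close>

lemma N_le_of_Pos:
  assumes x: "adj x = x" and pos: "Pos (\<tau> *\<^sub>R 1 - x)" "Pos (\<tau> *\<^sub>R 1 + x)"
  shows "N x \<le> \<tau>"
proof (rule field_le_epsilon)
  fix \<eta> :: real assume \<eta>: "0 < \<eta>"
  define T where "T = \<tau> + \<eta>"
  have "Pos ((2 * \<tau>) *\<^sub>R 1)" using Pos_add[OF pos] by (simp add: scaleR_2 flip: scaleR_scaleR)
  then have \<tau>: "0 \<le> \<tau>" using Pos_scalarD by fastforce
  obtain p where p: "Pos p" "p * p \<approx> \<tau> *\<^sub>R 1 - x + \<eta> *\<^sub>R 1"
    "\<And>z. z * (\<tau> *\<^sub>R 1 - x) \<approx> (\<tau> *\<^sub>R 1 - x) * z \<Longrightarrow> z * p \<approx> p * z" using Pos_sqrt[OF pos(1) \<eta>] by metis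
  obtain q where q: "Pos q" "q * q \<approx> \<tau> *\<^sub>R 1 + x + \<eta> *\<^sub>R 1"
    "\<And>z. z * (\<tau> *\<^sub>R 1 + x) \<approx> (\<tau> *\<^sub>R 1 + x) * z \<Longrightarrow> z * q \<approx> q * z" using Pos_sqrt[OF pos(2) \<eta>] by metis
  have xp: "x * p \<approx> p * x" by (rule p(3)) (simp add: algebra_simps)
  have xq: "x * q \<approx> q * x" by (rule q(3)) (simp add: algebra_simps)
  have pq: "p * q \<approx> q * p"
  proof (rule q(3))
    have "\<tau> *\<^sub>R p + p * x \<approx> \<tau> *\<^sub>R p + x * p" by (intro eqv_add eqv_sym[OF xp]) simp
    then show "p * (\<tau> *\<^sub>R 1 + x) \<approx> (\<tau> *\<^sub>R 1 + x) * p" by (simp add: algebra_simps)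
  qed
  have pp: "p * p \<approx> T *\<^sub>R 1 - x" using p(2) by (simp add: T_def algebra_simps)
  have qq: "q * q \<approx> T *\<^sub>R 1 + x" using q(2) by (simp add: T_def algebra_simps)
  have adj_pq: "adj p = p" "adj q = q" using p q by (auto intro: Pos_selfadj)
  define u where "u = x + J * (p * q)"
  have "x * (p * q) = (x * p) * q" by (simp add: mult.assoc)
  also have "\<dots> \<approx> (p * x) * q" by (intro eqv_mult xp) simp
  also have "\<dots> = p * (x * q)" by (simp add: mult.assoc)
  also have "\<dots> \<approx> p * (q * x)" by (intro eqv_mult xq) simp
  also have "\<dots> = (p * q) * x" by (simp add: mult.assoc)
  also have "\<dots> \<approx> (q * p) * x" by (intro eqv_mult pq) simp
  finally have comm: "x * (p * q) \<approx> (q * p) * x" .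
  have "(q * p) * (p * q) = q * ((p * p) * q)" by (simp add: mult.assoc)
  also have "\<dots> \<approx> q * ((T *\<^sub>R 1 - x) * q)" by (intro eqv_mult pp) simp_all
  also have "\<dots> = T *\<^sub>R (q * q) - q * (x * q)" by (simp add: algebra_simps)
  also have "\<dots> \<approx> T *\<^sub>R (q * q) - q * (q * x)" by (intro eqv_diff eqv_mult xq) simp_all
  also have "\<dots> = (q * q) * (T *\<^sub>R 1 - x)" by (simp add: algebra_simps)
  also have "\<dots> \<approx> (T *\<^sub>R 1 + x) * (T *\<^sub>R 1 - x)" by (intro eqv_mult qq) simp
  also have "\<dots> = (T * T) *\<^sub>R 1 - x * x" by (simp add: algebra_simps)
  finally have qppq: "(q * p) * (p * q) \<approx> (T * T) *\<^sub>R 1 - x * x" .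
  have adj_u: "adj u = x - J * (q * p)" by (simp add: u_def adj_add adj_Jx adj_mult[of p q] adj_pq x)
  have "adj u * u = (x * x + (q * p) * (p * q)) + J * (x * (p * q) - (q * p) * x)"
    unfolding adj_u by (simp add: u_def algebra_simps xJy[of x] xJy[of p] xJy[of q] JJx)
  also have "\<dots> \<approx> (x * x + ((T * T) *\<^sub>R 1 - x * x)) + J * ((q * p) * x - (q * p) * x)"
    by (intro eqv_add eqv_mult eqv_diff comm qppq) simp_all
  finally have "adj u * u \<approx> (T * T) *\<^sub>R 1" by simp
  then have "(N u)\<^sup>2 = T * T" using eqv_N[of "adj u * u"] by (simp add: N_cstar N_scalar)
  then have "(N u)\<^sup>2 = T\<^sup>2" by (simp add: power2_eq_square)
  then have u: "N u = T" by (rule power2_eq_imp_eq) (use N_nonneg[of u] \<tau> \<eta> in \<open>simp_all add: T_def\<close>)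
  have "2 *\<^sub>R x = (u + adj u) - J * (p * q - q * p)"
    unfolding adj_u by (simp add: u_def algebra_simps scaleR_2)
  also have "\<dots> \<approx> (u + adj u) - J * (p * q - p * q)"
    by (intro eqv_add eqv_mult eqv_diff eqv_sym[OF pq]) simp_all
  finally have "2 * N x = N (u + adj u)" using eqv_N by (fastforce simp: N_scale)
  then show "N x \<le> \<tau> + \<eta>" using N_add[of u "adj u"] u by (simp add: N_adj T_def)
qed

text \<open>Centring: \<open>h - t/2\<close> lies between -t/2 and t/2, so its norm is at most
  t/2.\<close>

lemma N_le_of_Pos_diff:
  assumes "Pos h" "Pos (t *\<^sub>R 1 - h)"
  shows "N h \<le> t"
proof -
  have h: "adj h = h" using assms by (simp add: Pos_selfadj)
  have "Pos (t *\<^sub>R 1)" using Pos_add[OF assms] by simp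
  then have t: "0 \<le> t" by (rule Pos_scalarD)
  have "N (h - (t/2) *\<^sub>R 1) \<le> t/2"
  proof (rule N_le_of_Pos)
    show "adj (h - (t/2) *\<^sub>R 1) = h - (t/2) *\<^sub>R 1" by (simp add: adj_simps h)
    have "(t/2) *\<^sub>R 1 - (h - (t/2) *\<^sub>R 1) = t *\<^sub>R 1 - h"
    proof -
      have "t *\<^sub>R 1 = (t/2) *\<^sub>R 1 + (t/2) *\<^sub>R (1::'b)" by (simp flip: scaleR_add_left)
      then show ?thesis by (simp add: diff_diff_eq2)
    qed
    then show "Pos ((t/2) *\<^sub>R 1 - (h - (t/2) *\<^sub>R 1))" using assms(2) by (simp only:)
    show "Pos ((t/2) *\<^sub>R 1 + (h - (t/2) *\<^sub>R 1))" using assms by simp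
  qed
  then show ?thesis using N_add[of "h - (t/2) *\<^sub>R 1" "(t/2) *\<^sub>R 1"] t by (simp add: N_scalar)
qed

lemma N_selfadj_power2: "adj g = g \<Longrightarrow> N (g ^ (2 ^ k)) = N g ^ (2 ^ k)"
proof (induction k)
  case 0 then show ?case by simp
next
  case (Suc k)
  have adj_pow: "adj (g ^ n) = g ^ n" for n
    by (induction n) (simp_all add: adj_simps Suc.prems power_commutes)
  have "g ^ (2 ^ Suc k) = g ^ (2 ^ k) * g ^ (2 ^ k)" by (simp add: power_add[symmetric] mult_2)
  then have "N (g ^ (2 ^ Suc k)) = (N (g ^ (2 ^ k)))\<^sup>2"
    using N_selfadj_square[OF adj_pow[of "2 ^ k"]] by (simp only:)
  also have "\<dots> = (N g ^ (2 ^ k))\<^sup>2" using Suc by simp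
  also have "\<dots> = N g ^ (2 ^ Suc k)" by (metis power_Suc power_mult mult.commute)
  finally show ?case .
qed

lemma N_power_le: "N (g ^ n) \<le> N g ^ n"
proof (induction n)
  case 0 then show ?case by (simp add: N_one)
next
  case (Suc n)
  then show ?case using order_trans[OF N_mult mult_left_mono[OF Suc N_nonneg]] by simp
qed

text \<open>The spectra of \<open>z z*\<close> and \<open>z* z\<close> agree up to \<open>0\<close>; here this appears as
  \<open>z* (t - z z*)\<^sup>n z = (t - z* z)\<^sup>n z* z\<close>.\<close>

lemma Pos_adj_mult_swap:
  assumes pos: "Pos (z * adj z + \<delta> *\<^sub>R 1)" and \<delta>: "0 \<le> \<delta>"
  shows "Pos (adj z * z + \<delta> *\<^sub>R 1)"
proof -
  obtain t0 where t0: "N (t0 *\<^sub>R 1 - (z * adj z + \<delta> *\<^sub>R 1)) \<le> t0" using pos by (auto simp: Pos_def)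
  define t where "t = t0 + 1"
  have t: "0 < t" using t0 order_trans[OF N_nonneg t0] by (simp add: t_def)
  have "N (t *\<^sub>R 1 - (z * adj z + \<delta> *\<^sub>R 1)) \<le> t"
  proof -
    have eq: "t *\<^sub>R 1 - (z * adj z + \<delta> *\<^sub>R 1) = (t0 *\<^sub>R 1 - (z * adj z + \<delta> *\<^sub>R 1)) + 1 *\<^sub>R 1"
      by (simp add: t_def scaleR_add_left)
    show ?thesis unfolding eq
      using N_add[of "t0 *\<^sub>R 1 - (z * adj z + \<delta> *\<^sub>R 1)" "1 *\<^sub>R 1"] t0 N_scalar[of 1] by (simp add: t_def)
  qed
  then have f: "N (t *\<^sub>R 1 - z * adj z) \<le> t + \<delta>"
    using N_add[of "t *\<^sub>R 1 - (z * adj z + \<delta> *\<^sub>R 1)" "\<delta> *\<^sub>R 1"] \<delta> by (simp add: N_scalar)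
  define f where "f = t *\<^sub>R 1 - z * adj z"
  define g where "g = t *\<^sub>R 1 - adj z * z"
  have adj_g: "adj g = g" by (simp add: g_def adj_simps)
  have fg: "f ^ n * z = z * g ^ n" for n
  proof (induction n)
    case 0 then show ?case by simp
  next
    case (Suc n)
    have "f ^ Suc n * z = f * (f ^ n * z)" by (simp add: mult.assoc)
    also have "\<dots> = (f * z) * g ^ n" using Suc by (simp add: mult.assoc)
    also have "f * z = z * g" by (simp add: f_def g_def algebra_simps)
    finally show ?case by (simp add: mult.assoc)
  qed
  define s where "s = t + \<delta>"
  have s: "0 < s" "t \<le> s" using t \<delta> by (auto simp: s_def)
  have rec: "N (g ^ Suc n) \<le> t * N g ^ n + (N z)\<^sup>2 * s ^ n" for n
  proof -
    have "g ^ Suc n = t *\<^sub>R g ^ n - adj z * (f ^ n * z)"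
      by (simp add: fg) (simp add: g_def algebra_simps)
    then have "N (g ^ Suc n) \<le> N (t *\<^sub>R g ^ n) + N (adj z * (f ^ n * z))"
      using N_diff by metis
    also have "N (t *\<^sub>R g ^ n) \<le> t * N g ^ n" using t N_power_le[of g n] by (simp add: N_scale)
    also have "N (adj z * (f ^ n * z)) \<le> N z * (N f ^ n * N z)"
    proof -
      have "N (f ^ n * z) \<le> N f ^ n * N z"
        using order_trans[OF N_mult mult_right_mono[OF N_power_le N_nonneg]] .
      then have "N (adj z) * N (f ^ n * z) \<le> N z * (N f ^ n * N z)"
        using N_nonneg by (simp add: N_adj mult_left_mono)
      then show ?thesis using N_mult order_trans by blast
    qed
    also have "N z * (N f ^ n * N z) \<le> (N z)\<^sup>2 * s ^ n"
    proof -
      have "N f ^ n \<le> s ^ n" using f N_nonneg by (intro power_mono) (auto simp: f_def s_def)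
      then show ?thesis
        using mult_left_mono[of "N f ^ n" "s ^ n" "(N z)\<^sup>2"] by (simp add: power2_eq_square ac_simps)
    qed
    finally show ?thesis by simp
  qed
  \<comment> \<open>Suppose N g > s. The norm of a power of \<open>g\<close> is known exactly for
    exponents 2^k, hence n = 2^k - 1 in \<open>rec\<close>. This bounds \<open>(N g / s) ^ n\<close>
    independently of k, which is absurd for a base above 1.\<close>
  have "N g \<le> s"
  proof (rule ccontr)
    assume "\<not> N g \<le> s"
    then have M: "s < N g" by simp
    have "(N g / s) ^ (2 ^ k - 1) * (N g - t) \<le> (N z)\<^sup>2" for k
    proof -
      define n :: nat where "n = 2 ^ k - 1"
      have n: "Suc n = 2 ^ k" by (simp add: n_def)
      have "N g ^ Suc n \<le> t * N g ^ n + (N z)\<^sup>2 * s ^ n"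
        using rec[of n] N_selfadj_power2[OF adj_g, of k] by (simp only: n)
      then have "N g ^ n * (N g - t) \<le> (N z)\<^sup>2 * s ^ n" by (simp add: algebra_simps)
      then show ?thesis using s unfolding n_def[symmetric] by (simp add: power_divide field_simps)
    qed
    then have bound: "(N g / s) ^ (2 ^ k - 1) \<le> (N z)\<^sup>2 / (N g - t)" for k
      using M s by (simp add: field_simps)
    have "1 < N g / s" using M s by simp
    then obtain m where m: "(N z)\<^sup>2 / (N g - t) < (N g / s) ^ m" using real_arch_pow by blast
    have "m \<le> 2 ^ m - 1" using less_exp[of m] by linarith
    then have "(N g / s) ^ m \<le> (N g / s) ^ (2 ^ m - 1)"
      using \<open>1 < N g / s\<close> by (intro power_increasing) auto
    then show False using m bound[of m] by simp
  qed
  show ?thesis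
  proof (rule PosI)
    show "adj (adj z * z + \<delta> *\<^sub>R 1) = adj z * z + \<delta> *\<^sub>R 1" by (simp add: adj_simps)
    show "N (s *\<^sub>R 1 - (adj z * z + \<delta> *\<^sub>R 1)) \<le> s"
      using \<open>N g \<le> s\<close> by (simp add: g_def s_def algebra_simps)
  qed
qed

text \<open>If l l = k + \<delta> and \<open>l\<close> commutes with \<open>d\<close>, then d k d +
  \<delta> d d is the square of d l. The product d l is self-adjoint only up to null elements and is
  therefore symmetrised; \<delta> is chosen so that \<delta> d d has norm at most
  \<epsilon>.\<close>

lemma Pos_conj_commuting:
  assumes k: "Pos k" and d: "adj d = d" and dk: "d * k \<approx> k * d"
  shows "Pos (d * k * d)"
proof (rule Pos_of_Pos_add)
  show "adj (d * k * d) = d * k * d" using assms by (simp add: adj_simps Pos_selfadj mult.assoc)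
  fix \<epsilon> :: real assume \<epsilon>: "0 < \<epsilon>"
  define \<delta> where "\<delta> = \<epsilon> / ((N d)\<^sup>2 + 1)"
  have \<delta>: "0 < \<delta>" "\<delta> * (N d)\<^sup>2 \<le> \<epsilon>"
    using \<epsilon> by (auto simp: \<delta>_def field_simps add_pos_nonneg intro: add_pos_nonneg)
  obtain l where l: "Pos l" "l * l \<approx> k + \<delta> *\<^sub>R 1" "\<And>z. z * k \<approx> k * z \<Longrightarrow> z * l \<approx> l * z"
    using Pos_sqrt[OF k \<delta>(1)] by metis
  have dl: "d * l \<approx> l * d" by (rule l(3)[OF dk])
  define m where "m = (1/2) *\<^sub>R (d * l + l * d)"
  have m: "adj m = m" using l(1) d by (simp add: m_def adj_simps Pos_selfadj add.commute)
  have dl_m: "d * l \<approx> m"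
  proof -
    have "d * l = (1/2) *\<^sub>R (d * l + d * l)" by (simp flip: scaleR_2)
    also have "\<dots> \<approx> m" unfolding m_def by (intro eqv_scale eqv_add dl) simp
    finally show ?thesis .
  qed
  have "d * k * d + \<delta> *\<^sub>R (d * d) = d * (k + \<delta> *\<^sub>R 1) * d" by (simp add: algebra_simps)
  also have "\<dots> \<approx> d * (l * l) * d" by (intro eqv_mult eqv_sym[OF l(2)]) simp_all
  also have "\<dots> = (d * l) * (l * d)" by (simp add: mult.assoc)
  also have "\<dots> \<approx> (d * l) * (d * l)" by (rule eqv_mult[OF eqv_refl eqv_sym[OF dl]])
  also have "\<dots> \<approx> m * m" by (intro eqv_mult dl_m)
  finally have "Pos (d * k * d + \<delta> *\<^sub>R (d * d))"
    using k d by (intro Pos_eqv[OF Pos_square[OF m] _ eqv_sym]) (simp_all add: adj_simps Pos_selfadj mult.assoc)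
  moreover have "Pos (\<epsilon> *\<^sub>R 1 - \<delta> *\<^sub>R (d * d))"
    using \<delta> d by (intro Pos_diff_of_le) (simp_all add: adj_simps N_scale N_selfadj_square)
  ultimately have "Pos ((d * k * d + \<delta> *\<^sub>R (d * d)) + (\<epsilon> *\<^sub>R 1 - \<delta> *\<^sub>R (d * d)))" by (rule Pos_add)
  then show "Pos (d * k * d + \<epsilon> *\<^sub>R 1)" by simp
qed

lemma power3_le_power3: "(a::real) ^ 3 \<le> b ^ 3 \<Longrightarrow> 0 \<le> b \<Longrightarrow> a \<le> b"
  by (rule power_le_imp_le_base[of _ 2]) (simp_all add: eval_nat_numeral)

text \<open>For \<open>h = y* y\<close>, the element \<open>b = (\<surd>(h\<^sup>2 + \<epsilon>) - h) / 2\<close> approximates the negative part of \<open>h\<close>. With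
  \<open>z = y b\<close> the element \<open>z* z = b h b\<close> is nearly negative, but \<open>z* z + z z*\<close> is positive, so \<open>z z*\<close> and
  hence \<open>z* z\<close> is nearly positive. Hence \<open>b\<close> is small.\<close>

theorem Pos_adj_mult: "Pos (adj y * y)"
proof -
  define h where "h = adj y * y"
  have h: "adj h = h" by (simp add: h_def adj_simps)
  define D where "D = 2 * N h + 1"
  have D: "1 \<le> D" using N_nonneg[of h] by (simp add: D_def)
  have "Pos h"
  proof (rule Pos_of_Pos_add[OF h])
    fix \<eta> :: real assume \<eta>: "0 < \<eta>"
    \<comment> \<open>\<open>D\<close> will bound \<open>N d\<close>. The final estimate is
      \<open>N d ^ 3 \<le> 3 * (\<epsilon> * D)\<close>, and this choice makes the right side at
      most \<eta>^3. The cap 1 serves the bound \<open>N k \<le> N h + 1\<close>.\<close>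
    define \<epsilon> where "\<epsilon> = min 1 ((\<eta>/2) ^ 3 / D)"
    have \<epsilon>: "0 < \<epsilon>" "\<epsilon> \<le> 1" using \<eta> D by (auto simp: \<epsilon>_def)
    have "\<epsilon> \<le> (\<eta>/2) ^ 3 / D" by (simp add: \<epsilon>_def)
    then have \<epsilon>D: "\<epsilon> * D \<le> (\<eta>/2) ^ 3" using D by (simp add: field_simps)
    obtain k where k: "Pos k" "k * k \<approx> h * h + \<epsilon> *\<^sub>R 1"
      "\<And>z. z * (h * h) \<approx> (h * h) * z \<Longrightarrow> z * k \<approx> k * z"
      using Pos_sqrt[OF Pos_square[OF h] \<epsilon>(1)] by metis
    have hk: "h * k \<approx> k * h" by (rule k(3)) (simp add: mult.assoc)
    have adj_k: "adj k = k" using k by (simp add: Pos_selfadj)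
    have Nk: "N k \<le> N h + 1"
    proof -
      have "(N k)\<^sup>2 = N (h * h + \<epsilon> *\<^sub>R 1)" using eqv_N[OF k(2)] N_selfadj_square[OF adj_k] by simp
      also have "\<dots> \<le> (N h)\<^sup>2 + \<epsilon>"
        using N_add[of "h * h" "\<epsilon> *\<^sub>R 1"] \<epsilon> by (simp add: N_scalar N_selfadj_square[OF h])
      also have "\<dots> \<le> (N h + 1)\<^sup>2" using \<epsilon> N_nonneg[of h] by (simp add: power2_eq_square algebra_simps)
      finally show ?thesis by (rule power2_le_imp_le) (use N_nonneg[of h] in simp)
    qed
    \<comment> \<open>Twice the approximate negative part of \<open>h\<close>, since
      \<open>k\<close> approximates its absolute value. The relation \<open>dh\<close> below says
      that \<open>h\<close> acts on \<open>d\<close> like \<open>- k\<close> up to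
      \<epsilon>.\<close>
    define d where "d = k - h"
    have d: "adj d = d" by (simp add: d_def adj_simps adj_k h)
    have Nd: "N d \<le> D" using N_diff[of k h] Nk by (simp add: d_def D_def)
    have "d * k = k * k - h * k" by (simp add: d_def algebra_simps)
    also have "\<dots> \<approx> k * k - k * h" by (intro eqv_diff hk) simp
    finally have dk: "d * k \<approx> k * d" by (simp add: d_def algebra_simps)
    have "d * h = k * h - h * h" by (simp add: d_def algebra_simps)
    also have "\<dots> \<approx> k * h - (k * k - \<epsilon> *\<^sub>R 1)"
    proof (intro eqv_diff)
      have "h * h = (h * h + \<epsilon> *\<^sub>R 1) - \<epsilon> *\<^sub>R 1" by simp
      also have "\<dots> \<approx> k * k - \<epsilon> *\<^sub>R 1" by (intro eqv_diff eqv_sym[OF k(2)]) simp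
      finally show "h * h \<approx> k * k - \<epsilon> *\<^sub>R 1" .
    qed simp
    also have "\<dots> = \<epsilon> *\<^sub>R 1 - k * d" by (simp add: d_def algebra_simps)
    finally have dh: "d * h \<approx> \<epsilon> *\<^sub>R 1 - k * d" .
    define z where "z = y * d"
    define c where "c = - (adj z * z)"
    have zz: "adj z * z = d * h * d" by (simp add: z_def h_def adj_simps d mult.assoc)
    have "adj z * z \<approx> (\<epsilon> *\<^sub>R 1 - k * d) * d" unfolding zz by (intro eqv_mult dh) simp
    also have "\<dots> = \<epsilon> *\<^sub>R d - (k * d) * d" by (simp add: algebra_simps)
    also have "\<dots> \<approx> \<epsilon> *\<^sub>R d - (d * k) * d" by (intro eqv_diff eqv_mult eqv_sym[OF dk]) simp_all
    finally have "- (adj z * z) \<approx> - (\<epsilon> *\<^sub>R d - d * k * d)" by (rule eqv_minus)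
    then have c: "d * k * d - \<epsilon> *\<^sub>R d \<approx> c" by (simp add: c_def eqv_sym)
    have adj_c: "adj c = c" by (simp add: c_def adj_simps)
    define \<delta> where "\<delta> = \<epsilon> * D"
    have \<delta>: "0 \<le> \<delta>" using \<epsilon> D by (simp add: \<delta>_def)
    have "Pos (d * k * d + (\<delta> *\<^sub>R 1 - \<epsilon> *\<^sub>R d))"
      using Nd \<epsilon> by (intro Pos_add Pos_conj_commuting k d dk Pos_diff_of_le)
        (simp_all add: adj_simps d N_scale \<delta>_def)
    then have "Pos ((d * k * d - \<epsilon> *\<^sub>R d) + \<delta> *\<^sub>R 1)" by (simp add: algebra_simps)
    then have c_pos: "Pos (c + \<delta> *\<^sub>R 1)"
      by (rule Pos_eqv) (simp add: adj_simps adj_c, intro eqv_add c, simp)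
    \<comment> \<open>Twice the sum of the squares of the real and imaginary parts of
      \<open>z\<close>, hence positive.\<close>
    have "z * adj z + adj z * z = (1/2) *\<^sub>R ((z + adj z) * (z + adj z) + (J * (z - adj z)) * (J * (z - adj z)))"
    proof -
      have *: "(J * (z - adj z)) * (J * (z - adj z)) = - ((z - adj z) * (z - adj z))"
        by (simp add: mult.assoc xJy[of "z - adj z"] JJx)
      show ?thesis unfolding * by (simp add: algebra_simps flip: scaleR_2)
    qed
    moreover have "Pos ((1/2) *\<^sub>R ((z + adj z) * (z + adj z) + (J * (z - adj z)) * (J * (z - adj z))))"
      by (intro Pos_scale Pos_add Pos_square)
         (simp_all add: adj_add adj_adj adj_diff adj_Jx add.commute right_diff_distrib)
    ultimately have "Pos ((z * adj z + adj z * z) + (c + \<delta> *\<^sub>R 1))" using c_pos by (simp add: Pos_add)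
    then have "Pos (z * adj z + \<delta> *\<^sub>R 1)" by (simp add: c_def)
    then have "Pos (adj z * z + \<delta> *\<^sub>R 1)" using \<delta> by (rule Pos_adj_mult_swap)
    then have "N c \<le> \<delta>" by (intro N_le_of_Pos adj_c) (use c_pos in \<open>simp_all add: c_def algebra_simps\<close>)
    \<comment> \<open>Here \<open>- (d * h * d)\<close> is \<open>c\<close>, and
      \<open>d * k * d\<close> is \<open>c + \<epsilon> *\<^sub>R d\<close> up to null elements. So
      the cube of \<open>d\<close> is as small as \<open>c\<close>, and the cube controls
      \<open>N d\<close>.\<close>
    have "d * (d * d) = d * k * d - d * h * d" by (simp add: d_def algebra_simps)
    also have "\<dots> = ((d * k * d - \<epsilon> *\<^sub>R d) + c) + \<epsilon> *\<^sub>R d" by (simp add: c_def zz)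
    also have "\<dots> \<approx> (c + c) + \<epsilon> *\<^sub>R d" by (intro eqv_add c) simp_all
    finally have "N (d * (d * d)) \<le> 2 * N c + \<epsilon> * N d"
      using eqv_N N_add[of "c + c" "\<epsilon> *\<^sub>R d"] N_add[of c c] \<epsilon> by (fastforce simp: N_scale)
    also have "\<dots> \<le> 3 * (\<epsilon> * D)" using \<open>N c \<le> \<delta>\<close> mult_left_mono[OF Nd less_imp_le[OF \<epsilon>(1)]] by (simp add: \<delta>_def)
    finally have Nddd: "N (d * (d * d)) \<le> 3 * (\<epsilon> * D)" .
    have "N d ^ 3 \<le> N (d * (d * d))"
    proof (cases "N d = 0")
      case True then show ?thesis by (simp add: N_nonneg)
    next
      case False
      have "N d ^ 4 = N ((d * d) * (d * d))"
        using d by (simp add: N_selfadj_square adj_simps power_mult[symmetric])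
      also have "\<dots> = N ((d * (d * d)) * d)" by (simp add: mult.assoc)
      also have "\<dots> \<le> N (d * (d * d)) * N d" by (rule N_mult)
      finally have "N d * N d ^ 3 \<le> N d * N (d * (d * d))"
        by (simp add: eval_nat_numeral mult.commute)
      then show ?thesis using False N_nonneg[of d] by simp
    qed
    also have "\<dots> \<le> (2 * (\<eta>/2)) ^ 3"
    proof -
      have "(\<eta>/2) ^ 3 = \<eta> ^ 3 / 8" "(2 * (\<eta>/2)) ^ 3 = \<eta> ^ 3" "0 \<le> \<eta> ^ 3"
        using \<eta> by (simp_all add: power_divide)
      then show ?thesis using Nddd \<epsilon>D by linarith
    qed
    finally have "N d \<le> \<eta>" using power3_le_power3[of "N d" \<eta>] \<eta> by simp
    then have "Pos (k + (\<eta> *\<^sub>R 1 - d))" by (intro Pos_add k Pos_diff_of_le d)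
    then show "Pos (h + \<eta> *\<^sub>R 1)" by (simp add: d_def algebra_simps)
  qed
  then show ?thesis by (simp add: h_def)
qed

section \<open>States\<close>

definition sym :: "'b \<Rightarrow> 'b" where
  "sym x = (1/2) *\<^sub>R (x + adj x)"

lemma adj_sym: "adj (sym x) = sym x"
  by (simp add: sym_def adj_simps add.commute)

lemma sym_add: "sym (x + y) = sym x + sym y"
  by (simp add: sym_def adj_simps algebra_simps)

lemma sym_scale: "sym (r *\<^sub>R x) = r *\<^sub>R sym x"
  by (simp add: sym_def adj_simps algebra_simps)

lemma sym_selfadj: "adj x = x \<Longrightarrow> sym x = x"
  by (simp add: sym_def flip: scaleR_2)

lemma N_sym: "N (sym x) \<le> N x"
  using N_add[of x "adj x"] by (simp add: sym_def N_scale N_adj)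

text \<open>The maximum of the spectrum of the real part. The linear functionals below it are
  exactly the real parts of states, so the Hahn-Banach theorem for this functional produces
  states.\<close>

definition upper :: "'b \<Rightarrow> real" where
  "upper x = Inf {t. Pos (t *\<^sub>R 1 - sym x)}"

lemma upper_bound_ge:
  assumes "Pos (t *\<^sub>R 1 - sym x)" shows "- N (sym x) \<le> t"
proof -
  have "Pos ((t *\<^sub>R 1 - sym x) + (N (sym x) *\<^sub>R 1 + sym x))"
    by (intro Pos_add assms Pos_add_of_le adj_sym) simp
  then have "Pos ((t + N (sym x)) *\<^sub>R 1)" by (simp add: scaleR_add_left)
  then show ?thesis using Pos_scalarD by fastforce
qed

lemma upper_le: "Pos (t *\<^sub>R 1 - sym x) \<Longrightarrow> upper x \<le> t"
  unfolding upper_def using upper_bound_ge by (intro cInf_lower) (auto intro!: bdd_belowI[where m = "- N (sym x)"])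

lemma upper_ge: "(\<And>t. Pos (t *\<^sub>R 1 - sym x) \<Longrightarrow> m \<le> t) \<Longrightarrow> m \<le> upper x"
  unfolding upper_def using Pos_diff_of_le[OF adj_sym order_refl, of x] by (intro cInf_greatest) auto

lemma upper_le_N: "upper x \<le> N x"
  by (intro upper_le Pos_diff_of_le adj_sym N_sym)

lemma sublinear_upper: "sublinear upper"
proof -
  have add: "upper (x + y) \<le> upper x + upper y" for x y
  proof -
    have 1: "upper (x + y) \<le> s + t" if "Pos (s *\<^sub>R 1 - sym x)" "Pos (t *\<^sub>R 1 - sym y)" for s t
    proof (rule upper_le)
      have "(s + t) *\<^sub>R 1 - sym (x + y) = (s *\<^sub>R 1 - sym x) + (t *\<^sub>R 1 - sym y)"
        by (simp add: sym_add scaleR_add_left)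
      then show "Pos ((s + t) *\<^sub>R 1 - sym (x + y))" using Pos_add[OF that] by simp
    qed
    have "upper (x + y) - t \<le> upper x" if "Pos (t *\<^sub>R 1 - sym y)" for t
      using 1[OF _ that] by (intro upper_ge) (simp add: algebra_simps)
    then have "upper (x + y) - upper x \<le> upper y" by (intro upper_ge) (simp add: algebra_simps)
    then show ?thesis by simp
  qed
  have scale_le: "upper (r *\<^sub>R x) \<le> r * upper x" if "0 < r" for r x
  proof -
    have "upper (r *\<^sub>R x) / r \<le> upper x"
    proof (rule upper_ge)
      fix t assume "Pos (t *\<^sub>R 1 - sym x)"
      then have "Pos (r *\<^sub>R (t *\<^sub>R 1 - sym x))" using that by (intro Pos_scale) auto
      then have "Pos ((r * t) *\<^sub>R 1 - sym (r *\<^sub>R x))" by (simp add: sym_scale scaleR_diff_right)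
      then show "upper (r *\<^sub>R x) / r \<le> t" using that upper_le by (fastforce simp: field_simps)
    qed
    then show ?thesis using that by (simp add: field_simps)
  qed
  have zero: "upper 0 = 0"
  proof (rule antisym)
    have s0: "sym 0 = 0" by (simp add: sym_def adj_simps)
    show "upper 0 \<le> 0" using Pos_scalar[of 0] by (intro upper_le) (simp add: s0)
    show "0 \<le> upper 0" by (rule upper_ge) (use Pos_scalarD in \<open>simp add: s0\<close>)
  qed
  have scale: "upper (r *\<^sub>R x) = r * upper x" if "0 \<le> r" for r x
  proof (cases "r = 0")
    case False
    then have r: "0 < r" using that by simp
    have "upper (inverse r *\<^sub>R (r *\<^sub>R x)) \<le> inverse r * upper (r *\<^sub>R x)"
      by (rule scale_le) (use r in simp)
    then have "r * upper x \<le> upper (r *\<^sub>R x)" using r by (simp add: field_simps)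
    then show ?thesis using scale_le[OF r, of x] by simp
  qed (simp add: zero)
  show ?thesis using add scale by (simp add: sublinear_def)
qed

text \<open>Hahn-Banach at the point a* a, where \<open>upper\<close> equals the norm because a* a
  is positive. Positivity, normalisation and invariance under the adjoint follow by evaluating
  \<open>upper\<close> at - y* y, at 1 and -1, and at x - x*, whose real part is 0.\<close>

theorem ex_real_state:
  obtains f where "linear f" "\<And>x. f x \<le> N x" "\<And>y. 0 \<le> f (adj y * y)" "f 1 = 1"
    "\<And>x. f (adj x) = f x" "f (adj a * a) = (N a)\<^sup>2"
proof -
  obtain f where f: "linear f" "\<And>x. f x \<le> upper x" "f (adj a * a) = upper (adj a * a)"
    using hahn_banach_sublinear[OF sublinear_upper] by blast
  have le_N: "f x \<le> N x" for x using f(2) upper_le_N order_trans by blast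
  have neg: "f (- x) = - f x" for x using f(1) by (simp add: linear_neg)
  have pos: "0 \<le> f (adj y * y)" for y
  proof -
    have "upper (- (adj y * y)) \<le> 0"
      using Pos_adj_mult[of y] by (intro upper_le) (simp add: sym_selfadj adj_simps)
    then show ?thesis using f(2)[of "- (adj y * y)"] by (simp add: neg)
  qed
  have one: "f 1 = 1"
  proof -
    have 0: "Pos (0 *\<^sub>R 1)" by (rule Pos_scalar) simp
    have "upper 1 \<le> 1" by (intro upper_le) (use 0 in \<open>simp add: sym_selfadj adj_simps\<close>)
    moreover have "upper (- 1) \<le> - 1" by (intro upper_le) (use 0 in \<open>simp add: sym_selfadj adj_simps\<close>)
    ultimately show ?thesis using f(2)[of 1] f(2)[of "- 1"] by (simp add: neg)
  qed
  have "f (x - adj x) = 0" for x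
  proof -
    have 0: "sym (x - adj x) = 0" "sym (adj x - x) = 0" by (simp_all add: sym_def adj_simps)
    have "upper (x - adj x) \<le> 0" "upper (adj x - x) \<le> 0"
      using Pos_scalar[of 0] by (auto intro!: upper_le simp: 0)
    then show ?thesis using f(2)[of "x - adj x"] f(2)[of "adj x - x"] neg[of "x - adj x"] by simp
  qed
  then have adj: "f (adj x) = f x" for x using f(1) by (simp add: linear_diff)
  have "upper (adj a * a) = (N a)\<^sup>2"
  proof (rule antisym)
    show "upper (adj a * a) \<le> (N a)\<^sup>2" using upper_le_N[of "adj a * a"] by (simp add: N_cstar)
    show "(N a)\<^sup>2 \<le> upper (adj a * a)"
      by (rule upper_ge) (use N_le_of_Pos_diff[OF Pos_adj_mult] N_cstar in \<open>force simp: sym_selfadj adj_simps\<close>)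
  qed
  then show thesis using that f(1) le_N pos one adj f(3) by metis
qed

end

section \<open>Star algebras on a carrier\<close>

lemma cring_complex_ring: "cring complex_ring"
proof -
  have "\<exists>y. y + x = 0" for x :: complex by (rule exI[of _ "- x"]) simp
  then show ?thesis
    by (intro cringI abelian_groupI comm_monoidI) (auto simp: complex_ring_def algebra_simps)
qed

lemma complex_ring_simps [simp]:
  "carrier complex_ring = UNIV" "mult complex_ring = (*)" "one complex_ring = 1"
  "zero complex_ring = 0" "add complex_ring = (+)"
  by (simp_all add: complex_ring_def)

lemma star_algebraI:
  fixes A (structure)
  assumes "\<one> \<in> carrier A" "\<zero> \<in> carrier A"
    and ac: "\<And>x y. x \<in> carrier A \<Longrightarrow> y \<in> carrier A \<Longrightarrow> x \<oplus> y \<in> carrier A"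
    and mc: "\<And>x y. x \<in> carrier A \<Longrightarrow> y \<in> carrier A \<Longrightarrow> x \<otimes> y \<in> carrier A"
    and sc: "\<And>c x. x \<in> carrier A \<Longrightarrow> c \<odot> x \<in> carrier A"
    and "\<And>x. x \<in> carrier A \<Longrightarrow> star A x \<in> carrier A"
    and "\<And>x y z. x \<in> carrier A \<Longrightarrow> y \<in> carrier A \<Longrightarrow> z \<in> carrier A \<Longrightarrow> (x \<oplus> y) \<oplus> z = x \<oplus> (y \<oplus> z)"
    and comm: "\<And>x y. x \<in> carrier A \<Longrightarrow> y \<in> carrier A \<Longrightarrow> x \<oplus> y = y \<oplus> x"
    and "\<And>x. x \<in> carrier A \<Longrightarrow> \<zero> \<oplus> x = x"
    and neg: "\<And>x. x \<in> carrier A \<Longrightarrow> x \<oplus> (-1) \<odot> x = \<zero>"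
    and "\<And>x y z. x \<in> carrier A \<Longrightarrow> y \<in> carrier A \<Longrightarrow> z \<in> carrier A \<Longrightarrow> (x \<otimes> y) \<otimes> z = x \<otimes> (y \<otimes> z)"
    and "\<And>x. x \<in> carrier A \<Longrightarrow> \<one> \<otimes> x = x" "\<And>x. x \<in> carrier A \<Longrightarrow> x \<otimes> \<one> = x"
    and "\<And>x y z. x \<in> carrier A \<Longrightarrow> y \<in> carrier A \<Longrightarrow> z \<in> carrier A \<Longrightarrow> (x \<oplus> y) \<otimes> z = x \<otimes> z \<oplus> y \<otimes> z"
    and "\<And>x y z. x \<in> carrier A \<Longrightarrow> y \<in> carrier A \<Longrightarrow> z \<in> carrier A \<Longrightarrow> z \<otimes> (x \<oplus> y) = z \<otimes> x \<oplus> z \<otimes> y"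
    and "\<And>a b x. x \<in> carrier A \<Longrightarrow> (a + b) \<odot> x = a \<odot> x \<oplus> b \<odot> x"
    and "\<And>a x y. x \<in> carrier A \<Longrightarrow> y \<in> carrier A \<Longrightarrow> a \<odot> (x \<oplus> y) = a \<odot> x \<oplus> a \<odot> y"
    and "\<And>a b x. x \<in> carrier A \<Longrightarrow> (a * b) \<odot> x = a \<odot> (b \<odot> x)"
    and "\<And>x. x \<in> carrier A \<Longrightarrow> 1 \<odot> x = x"
    and "\<And>c x y. x \<in> carrier A \<Longrightarrow> y \<in> carrier A \<Longrightarrow> (c \<odot> x) \<otimes> y = c \<odot> (x \<otimes> y)"
    and "\<And>c x y. x \<in> carrier A \<Longrightarrow> y \<in> carrier A \<Longrightarrow> x \<otimes> (c \<odot> y) = c \<odot> (x \<otimes> y)"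
    and "\<And>x. x \<in> carrier A \<Longrightarrow> star A (star A x) = x"
    and "\<And>x y. x \<in> carrier A \<Longrightarrow> y \<in> carrier A \<Longrightarrow> star A (x \<oplus> y) = star A x \<oplus> star A y"
    and "\<And>c x. x \<in> carrier A \<Longrightarrow> star A (c \<odot> x) = cnj c \<odot> star A x"
    and "\<And>x y. x \<in> carrier A \<Longrightarrow> y \<in> carrier A \<Longrightarrow> star A (x \<otimes> y) = star A y \<otimes> star A x"
  shows "star_algebra A"
proof -
  have ag: "abelian_group A"
    using assms(1-9) neg by (intro abelian_groupI) (auto, metis)
  have "ring A"
    by (rule ringI[OF ag monoidI]) (use assms in auto)
  moreover have "module complex_ring A"
    by (rule moduleI[OF cring_complex_ring ag]) (use assms in auto)
  moreover have "star_algebra_axioms A"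
    by (unfold_locales) (use assms in auto)
  ultimately show ?thesis by (intro star_algebra.intro)
qed

context star_algebra
begin

lemma smult_c: "x \<in> carrier A \<Longrightarrow> c \<odot> x \<in> carrier A"
  using smult_closed by simp

lemma smult_add_left: "x \<in> carrier A \<Longrightarrow> (a + b) \<odot> x = a \<odot> x \<oplus> b \<odot> x"
  using smult_l_distr[of a b x] by simp

lemma smult_add_right: "x \<in> carrier A \<Longrightarrow> y \<in> carrier A \<Longrightarrow> a \<odot> (x \<oplus> y) = a \<odot> x \<oplus> a \<odot> y"
  using smult_r_distr[of a x y] by simp

lemma smult_smult: "x \<in> carrier A \<Longrightarrow> a \<odot> (b \<odot> x) = (a * b) \<odot> x"
  using smult_assoc1[of a b x] by simp

lemma smult_1: "x \<in> carrier A \<Longrightarrow> 1 \<odot> x = x"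
  using smult_one[of x] by simp

lemma smult_0: "x \<in> carrier A \<Longrightarrow> 0 \<odot> x = \<zero>"
  using smult_l_null[of x] by simp

lemma smult_zero: "c \<odot> \<zero> = \<zero>"
  using smult_r_null[of c] by simp

lemma add_smult_minus: "x \<in> carrier A \<Longrightarrow> x \<oplus> (-1) \<odot> x = \<zero>"
  using smult_add_left[of x 1 "-1"] by (simp add: smult_1 smult_0)

lemma minus_eq_smult: "x \<in> carrier A \<Longrightarrow> \<ominus> x = (-1) \<odot> x"
  using add_smult_minus[of x] smult_c[of x "-1"] minus_equality[of "(-1) \<odot> x" x] 
  by (metis a_comm minus_minus)

lemma eq_of_diff_zero: 
  assumes "x \<in> carrier A" "y \<in> carrier A" "x \<oplus> (-1) \<odot> y = \<zero>" shows "x = y"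
  using assms by (metis minus_eq_smult minus_minus minus_equality a_inv_closed)

lemma star_zero: "star A \<zero> = \<zero>"
  using star_smult[of \<zero> 0] by (simp add: smult_0 star_closed)

lemma star_one: "star A \<one> = \<one>"
  by (metis one_closed star_closed star_mult star_star r_one l_one)

end

text \<open>The index of the product type below ranges over plain \<open>star_alg\<close> records;
  truncation brings algebras with further fields, such as a norm, to this form.\<close>

lemma star_algebra_truncate:
  assumes "star_algebra A" shows "star_algebra (star_alg.truncate A)"
proof -
  interpret star_algebra A by fact
  show ?thesis
    by (rule star_algebraI)
      (simp_all add: star_alg.truncate_def smult_c star_closed a_assoc a_comm a_lcomm add_smult_minus m_assoc
        l_distr r_distr smult_add_left smult_add_right smult_smult smult_1 smult_mult_left
        smult_mult_right star_star star_add star_smult star_mult)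
qed

text \<open>All star algebras on subsets of a type \<open>'a\<close> are quotients of one algebra on a type, the
  product of all of them. The factor \<open>complex\<close> ensures that \<open>0\<close> and \<open>1\<close> are different.\<close>

typedef 'a elt =
  "{F :: 'a star_alg \<Rightarrow> 'a. \<forall>A. if star_algebra A then F A \<in> carrier A else F A = undefined} \<times>
    (UNIV :: complex set)"
proof -
  have "star_algebra A \<Longrightarrow> \<zero>\<^bsub>A\<^esub> \<in> carrier A" for A :: "'a star_alg"
    by (meson abelian_group.axioms abelian_monoid.zero_closed ring_def star_algebra.axioms(2))
  then have "(\<lambda>A. if star_algebra A then \<zero>\<^bsub>A\<^esub> else undefined, 0) \<in> {F :: 'a star_alg \<Rightarrow> 'a. \<forall>A.
    if star_algebra A then F A \<in> carrier A else F A = undefined} \<times> (UNIV :: complex set)" by simp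
  then show ?thesis by (rule exI)
qed

setup_lifting type_definition_elt

lemma star_algebra_closed:
  assumes "star_algebra A"
  shows "\<zero>\<^bsub>A\<^esub> \<in> carrier A" "\<one>\<^bsub>A\<^esub> \<in> carrier A"
    "x \<in> carrier A \<Longrightarrow> y \<in> carrier A \<Longrightarrow> x \<oplus>\<^bsub>A\<^esub> y \<in> carrier A"
    "x \<in> carrier A \<Longrightarrow> y \<in> carrier A \<Longrightarrow> x \<otimes>\<^bsub>A\<^esub> y \<in> carrier A"
    "x \<in> carrier A \<Longrightarrow> c \<odot>\<^bsub>A\<^esub> x \<in> carrier A"
    "x \<in> carrier A \<Longrightarrow> star A x \<in> carrier A"
proof -
  interpret star_algebra A by fact
  show "\<zero>\<^bsub>A\<^esub> \<in> carrier A" "\<one>\<^bsub>A\<^esub> \<in> carrier A"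
    "x \<in> carrier A \<Longrightarrow> y \<in> carrier A \<Longrightarrow> x \<oplus>\<^bsub>A\<^esub> y \<in> carrier A"
    "x \<in> carrier A \<Longrightarrow> y \<in> carrier A \<Longrightarrow> x \<otimes>\<^bsub>A\<^esub> y \<in> carrier A"
    "x \<in> carrier A \<Longrightarrow> c \<odot>\<^bsub>A\<^esub> x \<in> carrier A"
    "x \<in> carrier A \<Longrightarrow> star A x \<in> carrier A"
    by (simp_all add: smult_c star_closed)
qed

text \<open>Transfer to the product type produces identities in varying algebras, so the algebra
  laws are needed as unconditional rewriting rules with \<open>A\<close> as a parameter.\<close>

lemma star_algebra_rules:
  fixes A (structure)
  assumes "star_algebra A"
  shows
    "x \<in> carrier A \<Longrightarrow> y \<in> carrier A \<Longrightarrow> z \<in> carrier A \<Longrightarrow> x \<oplus> y \<oplus> z = x \<oplus> (y \<oplus> z)"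
    "x \<in> carrier A \<Longrightarrow> y \<in> carrier A \<Longrightarrow> x \<oplus> y = y \<oplus> x"
    "x \<in> carrier A \<Longrightarrow> \<zero> \<oplus> x = x"
    "x \<in> carrier A \<Longrightarrow> x \<oplus> \<zero> = x"
    "x \<in> carrier A \<Longrightarrow> x \<oplus> (-1) \<odot> x = \<zero>"
    "x \<in> carrier A \<Longrightarrow> (-1) \<odot> x \<oplus> x = \<zero>"
    "x \<in> carrier A \<Longrightarrow> y \<in> carrier A \<Longrightarrow> z \<in> carrier A \<Longrightarrow> x \<otimes> y \<otimes> z = x \<otimes> (y \<otimes> z)"
    "x \<in> carrier A \<Longrightarrow> \<one> \<otimes> x = x"
    "x \<in> carrier A \<Longrightarrow> x \<otimes> \<one> = x"
    "x \<in> carrier A \<Longrightarrow> y \<in> carrier A \<Longrightarrow> z \<in> carrier A \<Longrightarrow> (x \<oplus> y) \<otimes> z = x \<otimes> z \<oplus> y \<otimes> z"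
    "x \<in> carrier A \<Longrightarrow> y \<in> carrier A \<Longrightarrow> z \<in> carrier A \<Longrightarrow> z \<otimes> (x \<oplus> y) = z \<otimes> x \<oplus> z \<otimes> y"
    "x \<in> carrier A \<Longrightarrow> (a + b) \<odot> x = a \<odot> x \<oplus> b \<odot> x"
    "x \<in> carrier A \<Longrightarrow> y \<in> carrier A \<Longrightarrow> a \<odot> (x \<oplus> y) = a \<odot> x \<oplus> a \<odot> y"
    "x \<in> carrier A \<Longrightarrow> a \<odot> (b \<odot> x) = (a * b) \<odot> x"
    "x \<in> carrier A \<Longrightarrow> 1 \<odot> x = x"
    "x \<in> carrier A \<Longrightarrow> 0 \<odot> x = \<zero>"
    "x \<in> carrier A \<Longrightarrow> y \<in> carrier A \<Longrightarrow> (a \<odot> x) \<otimes> y = a \<odot> (x \<otimes> y)"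
    "x \<in> carrier A \<Longrightarrow> y \<in> carrier A \<Longrightarrow> x \<otimes> (a \<odot> y) = a \<odot> (x \<otimes> y)"
    "x \<in> carrier A \<Longrightarrow> star A (star A x) = x"
    "x \<in> carrier A \<Longrightarrow> y \<in> carrier A \<Longrightarrow> star A (x \<oplus> y) = star A x \<oplus> star A y"
    "x \<in> carrier A \<Longrightarrow> star A (a \<odot> x) = cnj a \<odot> star A x"
    "x \<in> carrier A \<Longrightarrow> y \<in> carrier A \<Longrightarrow> star A (x \<otimes> y) = star A y \<otimes> star A x"
    "star A \<one> = \<one>"
    "star A \<zero> = \<zero>"
    "a \<odot> \<zero> = \<zero>"
    "x \<in> carrier A \<Longrightarrow> x \<otimes> \<zero> = \<zero>"
    "x \<in> carrier A \<Longrightarrow> \<zero> \<otimes> x = \<zero>"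
proof -
  interpret star_algebra A by fact
  show
    "x \<in> carrier A \<Longrightarrow> y \<in> carrier A \<Longrightarrow> z \<in> carrier A \<Longrightarrow> x \<oplus> y \<oplus> z = x \<oplus> (y \<oplus> z)"
    "x \<in> carrier A \<Longrightarrow> y \<in> carrier A \<Longrightarrow> x \<oplus> y = y \<oplus> x"
    "x \<in> carrier A \<Longrightarrow> \<zero> \<oplus> x = x"
    "x \<in> carrier A \<Longrightarrow> x \<oplus> \<zero> = x"
    "x \<in> carrier A \<Longrightarrow> x \<oplus> (-1) \<odot> x = \<zero>"
    "x \<in> carrier A \<Longrightarrow> (-1) \<odot> x \<oplus> x = \<zero>"
    "x \<in> carrier A \<Longrightarrow> y \<in> carrier A \<Longrightarrow> z \<in> carrier A \<Longrightarrow> x \<otimes> y \<otimes> z = x \<otimes> (y \<otimes> z)"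
    "x \<in> carrier A \<Longrightarrow> \<one> \<otimes> x = x"
    "x \<in> carrier A \<Longrightarrow> x \<otimes> \<one> = x"
    "x \<in> carrier A \<Longrightarrow> y \<in> carrier A \<Longrightarrow> z \<in> carrier A \<Longrightarrow> (x \<oplus> y) \<otimes> z = x \<otimes> z \<oplus> y \<otimes> z"
    "x \<in> carrier A \<Longrightarrow> y \<in> carrier A \<Longrightarrow> z \<in> carrier A \<Longrightarrow> z \<otimes> (x \<oplus> y) = z \<otimes> x \<oplus> z \<otimes> y"
    "x \<in> carrier A \<Longrightarrow> (a + b) \<odot> x = a \<odot> x \<oplus> b \<odot> x"
    "x \<in> carrier A \<Longrightarrow> y \<in> carrier A \<Longrightarrow> a \<odot> (x \<oplus> y) = a \<odot> x \<oplus> a \<odot> y"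
    "x \<in> carrier A \<Longrightarrow> a \<odot> (b \<odot> x) = (a * b) \<odot> x"
    "x \<in> carrier A \<Longrightarrow> 1 \<odot> x = x"
    "x \<in> carrier A \<Longrightarrow> 0 \<odot> x = \<zero>"
    "x \<in> carrier A \<Longrightarrow> y \<in> carrier A \<Longrightarrow> (a \<odot> x) \<otimes> y = a \<odot> (x \<otimes> y)"
    "x \<in> carrier A \<Longrightarrow> y \<in> carrier A \<Longrightarrow> x \<otimes> (a \<odot> y) = a \<odot> (x \<otimes> y)"
    "x \<in> carrier A \<Longrightarrow> star A (star A x) = x"
    "x \<in> carrier A \<Longrightarrow> y \<in> carrier A \<Longrightarrow> star A (x \<oplus> y) = star A x \<oplus> star A y"
    "x \<in> carrier A \<Longrightarrow> star A (a \<odot> x) = cnj a \<odot> star A x"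
    "x \<in> carrier A \<Longrightarrow> y \<in> carrier A \<Longrightarrow> star A (x \<otimes> y) = star A y \<otimes> star A x"
    "star A \<one> = \<one>"
    "star A \<zero> = \<zero>"
    "a \<odot> \<zero> = \<zero>"
    "x \<in> carrier A \<Longrightarrow> x \<otimes> \<zero> = \<zero>"
    "x \<in> carrier A \<Longrightarrow> \<zero> \<otimes> x = \<zero>"
    using a_comm[OF smult_c, of x x "-1"]
    by (simp_all add: a_assoc a_comm a_lcomm m_assoc l_distr r_distr smult_c smult_add_left smult_add_right
        smult_smult smult_1 smult_0 smult_zero smult_mult_left smult_mult_right star_star star_add
        star_smult star_mult add_smult_minus star_one star_zero)
qed

section \<open>The product of all star algebras as a real algebra with involution\<close>

instantiation elt :: (type) real_algebra_1
begin

lift_definition zero_elt :: "'a elt" is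
  "(\<lambda>A. if star_algebra A then \<zero>\<^bsub>A\<^esub> else undefined, 0)"
  by (simp add: star_algebra_closed)

lift_definition one_elt :: "'a elt" is
  "(\<lambda>A. if star_algebra A then \<one>\<^bsub>A\<^esub> else undefined, 1)"
  by (simp add: star_algebra_closed)

lift_definition plus_elt :: "'a elt \<Rightarrow> 'a elt \<Rightarrow> 'a elt" is
  "\<lambda>(F, c) (G, d). (\<lambda>A. if star_algebra A then F A \<oplus>\<^bsub>A\<^esub> G A else undefined, c + d)"
  by (auto simp: star_algebra_closed split: if_splits)

lift_definition times_elt :: "'a elt \<Rightarrow> 'a elt \<Rightarrow> 'a elt" is
  "\<lambda>(F, c) (G, d). (\<lambda>A. if star_algebra A then F A \<otimes>\<^bsub>A\<^esub> G A else undefined, c * d)"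
  by (auto simp: star_algebra_closed split: if_splits)

lift_definition uminus_elt :: "'a elt \<Rightarrow> 'a elt" is
  "\<lambda>(F, c). (\<lambda>A. if star_algebra A then (-1) \<odot>\<^bsub>A\<^esub> F A else undefined, - c)"
  by (auto simp: star_algebra_closed split: if_splits)

lift_definition minus_elt :: "'a elt \<Rightarrow> 'a elt \<Rightarrow> 'a elt" is
  "\<lambda>(F, c) (G, d). (\<lambda>A. if star_algebra A then F A \<oplus>\<^bsub>A\<^esub> (-1) \<odot>\<^bsub>A\<^esub> G A else undefined, c - d)"
  by (auto simp: star_algebra_closed split: if_splits)

lift_definition scaleR_elt :: "real \<Rightarrow> 'a elt \<Rightarrow> 'a elt" is
  "\<lambda>r (F, c). (\<lambda>A. if star_algebra A then complex_of_real r \<odot>\<^bsub>A\<^esub> F A else undefined, complex_of_real r * c)"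
  by (auto simp: star_algebra_closed split: if_splits)

instance
proof
  fix a b c :: "'a elt" and r s :: real
  show "a + b + c = a + (b + c)" by transfer (auto simp: fun_eq_iff add.assoc star_algebra_rules(1))
  show "a + b = b + a" by transfer (force simp: fun_eq_iff add.commute intro: star_algebra_rules(2))
  show "0 + a = a" by transfer (auto simp: fun_eq_iff algebra_simps star_algebra_rules star_algebra_closed)
  show "- a + a = 0" by transfer (auto simp: fun_eq_iff algebra_simps star_algebra_rules star_algebra_closed)
  show "a - b = a + - b" by transfer (auto simp: fun_eq_iff algebra_simps star_algebra_rules star_algebra_closed)
  show "a * b * c = a * (b * c)" by transfer (auto simp: fun_eq_iff algebra_simps star_algebra_rules star_algebra_closed)
  show "(a + b) * c = a * c + b * c" by transfer (auto simp: fun_eq_iff algebra_simps star_algebra_rules star_algebra_closed)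
  show "a * (b + c) = a * b + a * c" by transfer (auto simp: fun_eq_iff algebra_simps star_algebra_rules star_algebra_closed)
  show "1 * a = a" by transfer (auto simp: fun_eq_iff algebra_simps star_algebra_rules star_algebra_closed)
  show "a * 1 = a" by transfer (auto simp: fun_eq_iff algebra_simps star_algebra_rules star_algebra_closed)
  show "r *\<^sub>R (a + b) = r *\<^sub>R a + r *\<^sub>R b" by transfer (auto simp: fun_eq_iff algebra_simps star_algebra_rules star_algebra_closed)
  show "(r + s) *\<^sub>R a = r *\<^sub>R a + s *\<^sub>R a" by transfer (auto simp: fun_eq_iff algebra_simps star_algebra_rules star_algebra_closed)
  show "r *\<^sub>R s *\<^sub>R a = (r * s) *\<^sub>R a" by transfer (auto simp: fun_eq_iff algebra_simps star_algebra_rules star_algebra_closed)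
  show "1 *\<^sub>R a = a" by transfer (auto simp: fun_eq_iff algebra_simps star_algebra_rules star_algebra_closed)
  show "r *\<^sub>R a * b = r *\<^sub>R (a * b)" by transfer (auto simp: fun_eq_iff algebra_simps star_algebra_rules star_algebra_closed)
  show "a * r *\<^sub>R b = r *\<^sub>R (a * b)" by transfer (auto simp: fun_eq_iff algebra_simps star_algebra_rules star_algebra_closed)
  show "(0::'a elt) \<noteq> 1" by transfer simp
qed

end

lift_definition adj_elt :: "'a elt \<Rightarrow> 'a elt" is
  "\<lambda>(F, c). (\<lambda>A. if star_algebra A then star A (F A) else undefined, cnj c)"
  by (auto simp: star_algebra_closed split: if_splits)

lift_definition imag_elt :: "'a elt" is
  "(\<lambda>A. if star_algebra A then \<i> \<odot>\<^bsub>A\<^esub> \<one>\<^bsub>A\<^esub> else undefined, \<i>)"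
  by (simp add: star_algebra_closed)

lift_definition pr_elt :: "'a star_alg \<Rightarrow> 'a elt \<Rightarrow> 'a" is "\<lambda>A (F, c). F A" .

definition pr :: "('a, 'b) star_alg_scheme \<Rightarrow> 'a elt \<Rightarrow> 'a" where
  "pr A = pr_elt (star_alg.truncate A)"


context
  fixes A :: "'a star_alg" (structure)
  assumes A: "star_algebra A"
begin

lemma pr_elt_closed: "pr_elt A X \<in> carrier A"
  using A by transfer (auto split: if_splits)

lemma pr_elt_simps:
  "pr_elt A X \<oplus> pr_elt A Y = pr_elt A (X + Y)"
  "pr_elt A X \<otimes> pr_elt A Y = pr_elt A (X * Y)"
  "complex_of_real r \<odot> pr_elt A X = pr_elt A (r *\<^sub>R X)"
  "star A (pr_elt A X) = pr_elt A (adj_elt X)"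
  "\<one> = pr_elt A 1" "\<zero> = pr_elt A 0" "(-1) \<odot> pr_elt A X = pr_elt A (- X)"
  using A by (transfer, auto)+

lemma pr_elt_imag: "\<i> \<odot> pr_elt A X = pr_elt A (imag_elt * X)"
  using A by transfer (auto simp: star_algebra_rules star_algebra_closed split: if_splits)

lemma pr_elt_surj:
  assumes "x \<in> carrier A" shows "\<exists>X. pr_elt A X = x"
  using A assms
proof (transfer, goal_cases)
  case (1 A x)
  \<comment> \<open>The family that is \<open>x\<close> at the index \<open>A\<close> and zero at
    all other indices.\<close>
  have "(\<lambda>B. if B = A then x else if star_algebra B then \<zero>\<^bsub>B\<^esub> else undefined, 0)
    \<in> {F :: 'a star_alg \<Rightarrow> 'a. \<forall>A. if star_algebra A then F A \<in> carrier A else F A = undefined} \<times> (UNIV :: complex set)"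
    using 1 by (auto simp: star_algebra_closed)
  then show ?case by (rule bexI[rotated, OF CollectI]) simp
qed

end

lemma truncate_simps:
  "carrier (star_alg.truncate A) = carrier A" "add (star_alg.truncate A) = add A"
  "mult (star_alg.truncate A) = mult A" "one (star_alg.truncate A) = one A"
  "zero (star_alg.truncate A) = zero A" "smult (star_alg.truncate A) = smult A"
  "star (star_alg.truncate A) = star A"
  by (simp_all add: star_alg.truncate_def)

context
  fixes A :: "('a, 'b) star_alg_scheme" (structure)
  assumes A: "star_algebra A"
begin

lemma pr_closed: "pr A X \<in> carrier A"
  using pr_elt_closed[OF star_algebra_truncate[OF A]] by (simp add: truncate_simps pr_def)

lemma pr_simps:
  "pr A X \<oplus> pr A Y = pr A (X + Y)" "pr A X \<otimes> pr A Y = pr A (X * Y)"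
  "complex_of_real r \<odot> pr A X = pr A (r *\<^sub>R X)" "star A (pr A X) = pr A (adj_elt X)"
  "\<one> = pr A 1" "\<zero> = pr A 0" "(-1) \<odot> pr A X = pr A (- X)"
  using pr_elt_simps[OF star_algebra_truncate[OF A]] by (simp_all add: truncate_simps pr_def)

lemma pr_surj: "x \<in> carrier A \<Longrightarrow> \<exists>X. pr A X = x"
  using pr_elt_surj[OF star_algebra_truncate[OF A], of x] by (simp add: truncate_simps pr_def)

text \<open>The product type is only a real algebra, so complex scalars are recovered through
  multiplication by the central element \<open>imag_elt\<close>.\<close>

lemma pr_imag: "c \<odot> pr A X = pr A (Re c *\<^sub>R X + Im c *\<^sub>R (imag_elt * X))"
proof -
  have 1: "\<i> \<odot> pr A X = pr A (imag_elt * X)"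
    using pr_elt_imag[OF star_algebra_truncate[OF A], of X] by (simp add: truncate_simps pr_def)
  have "c \<odot> pr A X = complex_of_real (Re c) \<odot> pr A X \<oplus> complex_of_real (Im c) \<odot> (\<i> \<odot> pr A X)"
    using pr_closed[of X] star_algebra_closed[OF A]
    by (simp add: star_algebra_rules[OF A] flip: star_algebra_rules(12)[OF A])
       (simp add: mult.commute flip: complex_eq)
  then show ?thesis by (simp only: 1 pr_simps)
qed

end

lemma elt_star_rules:
  "adj_elt (X + Y) = adj_elt X + adj_elt Y" "adj_elt (r *\<^sub>R X) = r *\<^sub>R adj_elt X"
  "adj_elt (X * Y) = adj_elt Y * adj_elt X" "adj_elt (adj_elt X) = X"
  "adj_elt imag_elt = - (imag_elt :: 'a elt)" "imag_elt * imag_elt = (- 1 :: 'a elt)"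
  "X * imag_elt = imag_elt * X"
  for X Y :: "'a elt"
proof -
  show "adj_elt (X + Y) = adj_elt X + adj_elt Y"
    by transfer (force simp: fun_eq_iff star_algebra_rules)
  show "adj_elt (r *\<^sub>R X) = r *\<^sub>R adj_elt X"
    by transfer (force simp: fun_eq_iff star_algebra_rules)
  show "adj_elt (X * Y) = adj_elt Y * adj_elt X"
    by transfer (force simp: fun_eq_iff star_algebra_rules)
  show "adj_elt (adj_elt X) = X"
    by transfer (force simp: fun_eq_iff star_algebra_rules)
  show "adj_elt imag_elt = - (imag_elt :: 'a elt)"
    by transfer (auto simp: fun_eq_iff star_algebra_rules star_algebra_closed)
  show "imag_elt * imag_elt = (- 1 :: 'a elt)"
    by transfer (auto simp: fun_eq_iff star_algebra_rules star_algebra_closed)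
  show "X * imag_elt = imag_elt * X"
    by transfer (force simp: fun_eq_iff star_algebra_rules star_algebra_closed)
qed


section \<open>C*-algebras\<close>

text \<open>In contrast to \<open>cstar_algebra\<close>, the algebra may be trivial and its norm is a parameter.\<close>

locale cstar_normed = star_algebra A for A :: "('a, 'b) star_alg_scheme" (structure) +
  fixes p :: "'a \<Rightarrow> real"
  assumes p_seminorm: "cstar_seminorm A p"
    and p_definite: "\<lbrakk>x \<in> carrier A; p x = 0\<rbrakk> \<Longrightarrow> x = \<zero>"
    and p_complete: "seqcauchy A p s \<Longrightarrow> \<exists>x\<in>carrier A. seqconv A p s x"

lemma (in cstar_algebra) cstar_normed: "cstar_normed A (nrm A)"
  by unfold_locales (use nrm_seminorm nrm_eq_zero complete in auto)

lemma cstar_seminormD: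
  fixes A (structure)
  assumes "cstar_seminorm A p"
  shows "x \<in> carrier A \<Longrightarrow> 0 \<le> p x"
    "x \<in> carrier A \<Longrightarrow> p (c \<odot> x) = cmod c * p x"
    "x \<in> carrier A \<Longrightarrow> y \<in> carrier A \<Longrightarrow> p (x \<oplus> y) \<le> p x + p y"
    "x \<in> carrier A \<Longrightarrow> y \<in> carrier A \<Longrightarrow> p (x \<otimes> y) \<le> p x * p y"
    "x \<in> carrier A \<Longrightarrow> p (star A x \<otimes> x) = (p x)\<^sup>2"
  using assms unfolding cstar_seminorm_def by auto

context star_algebra
begin

lemma seminorm_zero: "cstar_seminorm A p \<Longrightarrow> p \<zero> = 0"
  using cstar_seminormD(2)[of A p \<zero> 0] by (simp add: smult_zero)

lemma seminorm_star:
  assumes p: "cstar_seminorm A p" and x: "x \<in> carrier A"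
  shows "p (star A x) = p x"
proof -
  have le: "p x \<le> p (star A x)" if x: "x \<in> carrier A" for x
  proof (cases "p x = 0")
    case True then show ?thesis using cstar_seminormD(1)[OF p] x star_closed by simp
  next
    case False
    then have "0 < p x" using cstar_seminormD(1)[OF p x] by simp
    moreover have "p x * p x \<le> p (star A x) * p x"
      using cstar_seminormD(4)[OF p star_closed[OF x] x] cstar_seminormD(5)[OF p x]
      by (simp add: power2_eq_square)
    ultimately show ?thesis by simp
  qed
  show ?thesis using le[OF x] le[OF star_closed[OF x]] x by (simp add: star_star)
qed

text \<open>The unit is a self-adjoint idempotent, so its seminorm equals its own square. The value
  0 must be allowed, because the zero seminorm counts as a C*-seminorm; by
  \<open>seminorm_trivial\<close> it is the only exception.\<close>

lemma seminorm_one_cases: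
  assumes "cstar_seminorm A p" shows "p \<one> = 0 \<or> p \<one> = 1"
  using cstar_seminormD(5)[OF assms one_closed] by (simp add: star_one power2_eq_square)

lemma seminorm_trivial:
  assumes p: "cstar_seminorm A p" and "p \<one> = 0" and x: "x \<in> carrier A" shows "p x = 0"
  using cstar_seminormD(4)[OF p one_closed x] cstar_seminormD(1)[OF p x] assms(2) x by simp

end

context cstar_normed
begin

text \<open>Elements of the type with the same projection have distance zero, so the seminorm on the
  type carries the C*-algebra on the carrier. Nontriviality is what makes the unit have norm
  1.\<close>

lemma cstar_space:
  assumes "\<one> \<noteq> \<zero>"
  shows "cstar_space adj_elt imag_elt (\<lambda>X. p (pr A X))"
proof -
  have A: "star_algebra A" by unfold_locales
  note cl = pr_closed[OF A] and pr = pr_simps[OF A]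
  show ?thesis
  proof
    fix X Y :: "'a elt" and r :: real
    show "adj_elt (X + Y) = adj_elt X + adj_elt Y" "adj_elt (r *\<^sub>R X) = r *\<^sub>R adj_elt X"
      "adj_elt (X * Y) = adj_elt Y * adj_elt X" "adj_elt (adj_elt X) = X"
      "adj_elt imag_elt = - (imag_elt :: 'a elt)" "imag_elt * imag_elt = (- 1 :: 'a elt)"
      "X * imag_elt = imag_elt * X" by (rule elt_star_rules)+
    show "p (pr A (r *\<^sub>R X)) = \<bar>r\<bar> * p (pr A X)"
      using cstar_seminormD(2)[OF p_seminorm cl, of "of_real r" X] by (simp add: pr)
    show "p (pr A (X + Y)) \<le> p (pr A X) + p (pr A Y)" "p (pr A (X * Y)) \<le> p (pr A X) * p (pr A Y)"
      "p (pr A (adj_elt X * X)) = (p (pr A X))\<^sup>2"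
      using cstar_seminormD(3,4)[OF p_seminorm cl cl, of X Y] cstar_seminormD(5)[OF p_seminorm cl, of X]
      by (simp_all add: pr)
    show "p (pr A 1) = 1"
      using seminorm_one_cases[OF p_seminorm] p_definite[OF one_closed] assms by (auto simp: pr)
  next
    fix X :: "nat \<Rightarrow> 'a elt"
    assume *: "\<And>e. 0 < e \<Longrightarrow> \<exists>M. \<forall>m\<ge>M. \<forall>n\<ge>M. p (pr A (X m - X n)) < e"
    have "seqcauchy A p (\<lambda>n. pr A (X n))"
      using * by (simp add: seqcauchy_def cl pr)
    then obtain x where x: "x \<in> carrier A" "seqconv A p (\<lambda>n. pr A (X n)) x" using p_complete by blast
    obtain L where "pr A L = x" using pr_surj[OF A x(1)] by blast
    then show "\<exists>L. (\<lambda>n. p (pr A (X n - L))) \<longlonglongrightarrow> 0"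
      using x(2) by (intro exI[of _ L]) (auto simp: seqconv_def pr)
  qed
qed

text \<open>The real functional f is complexified to g X = f X - i f (i X). Since f is dominated by
  the norm of the projection, f and g depend on the projection only and descend to the
  carrier.\<close>

theorem ex_state:
  assumes nontriv: "\<one> \<noteq> \<zero>" and a: "a \<in> carrier A"
  obtains \<phi> where "state A \<phi>" "\<phi> (star A a \<otimes> a) = of_real ((p a)\<^sup>2)"
proof -
  have A: "star_algebra A" by unfold_locales
  note cl = pr_closed[OF A] and pr = pr_simps[OF A]
  interpret N: cstar_space adj_elt imag_elt "\<lambda>X. p (pr A X)" by (rule cstar_space[OF nontriv])
  obtain a' where a': "pr A a' = a" using pr_surj[OF A a] by blast
  obtain f where f: "linear f" "\<And>X. f X \<le> p (pr A X)" "\<And>Y. 0 \<le> f (adj_elt Y * Y)" "f 1 = 1"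
    "\<And>X. f (adj_elt X) = f X" "f (adj_elt a' * a') = (p (pr A a'))\<^sup>2"
    using N.ex_real_state[of a'] by blast
  define g where "g X = complex_of_real (f X) - \<i> * complex_of_real (f (imag_elt * X))" for X
  have f_eq: "f X = f Y" if "pr A X = pr A Y" for X Y
  proof -
    have "pr A (X - Y) = pr A X \<oplus> (-1) \<odot> pr A Y" "pr A (Y - X) = pr A Y \<oplus> (-1) \<odot> pr A X"
      by (simp_all add: pr)
    then have "p (pr A (X - Y)) = 0" "p (pr A (Y - X)) = 0"
      using that cl by (simp_all add: add_smult_minus seminorm_zero[OF p_seminorm])
    then show ?thesis using f(2)[of "X - Y"] f(2)[of "Y - X"] f(1) by (simp add: linear_diff)
  qed
  have g_eq: "g X = g Y" if "pr A X = pr A Y" for X Y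
  proof -
    have "pr A (imag_elt * X) = pr A (imag_elt * Y)" using that by (simp flip: pr)
    then show ?thesis using f_eq that by (metis g_def)
  qed
  define \<phi> where "\<phi> x = g (SOME X. pr A X = x)" for x
  have \<phi>: "\<phi> (pr A X) = g X" for X
    unfolding \<phi>_def by (rule g_eq) (rule someI[where P = "\<lambda>Y. pr A Y = pr A X"], rule refl)
  have g_add: "g (X + Y) = g X + g Y" for X Y
    using f(1) by (simp add: g_def linear_add distrib_left)
  have JJ: "imag_elt * (imag_elt * X) = - X" for X :: "'a elt" by (rule N.JJx)
  have g_smult: "g (Re c *\<^sub>R X + Im c *\<^sub>R (imag_elt * X)) = c * g X" for c X
    using f(1) by (simp add: g_def linear_add linear_scale linear_neg linear_diff distrib_left JJ complex_eq_iff)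
  \<comment> \<open>The element i X* X is mapped to its negative by the adjoint, while f is
    invariant under the adjoint; so the imaginary part of g at X* X vanishes.\<close>
  have g_square: "g (adj_elt X * X) = of_real (f (adj_elt X * X))" for X
  proof -
    have "f (imag_elt * (adj_elt X * X)) = f (adj_elt (imag_elt * (adj_elt X * X)))" by (simp add: f)
    also have "adj_elt (imag_elt * (adj_elt X * X)) = - (imag_elt * (adj_elt X * X))"
      by (simp only: N.adj_Jx N.adj_mult[of "adj_elt X" X] N.adj_adj)
    finally have "f (imag_elt * (adj_elt X * X)) = 0" using f(1) by (simp add: linear_neg)
    then show ?thesis by (simp add: g_def)
  qed
  show thesis
  proof (rule that)
    have "f imag_elt = - f imag_elt" using f(5)[of imag_elt] f(1) by (simp add: N.adj_J linear_neg)
    then have one: "g 1 = 1" by (simp add: g_def f)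
    show "state A \<phi>"
      unfolding state_def
    proof (intro conjI ballI allI)
      fix x y c assume x: "x \<in> carrier A"
      obtain X where X: "pr A X = x" using pr_surj[OF A x] by blast
      show "\<phi> (c \<odot> x) = c * \<phi> x" by (simp add: X[symmetric] pr_imag[OF A] \<phi> g_smult)
      show "Im (\<phi> (star A x \<otimes> x)) = 0" "0 \<le> Re (\<phi> (star A x \<otimes> x))"
        by (simp_all add: X[symmetric] pr \<phi> g_square f)
      assume y: "y \<in> carrier A"
      obtain Y where Y: "pr A Y = y" using pr_surj[OF A y] by blast
      show "\<phi> (x \<oplus> y) = \<phi> x + \<phi> y" by (simp add: X[symmetric] Y[symmetric] pr \<phi> g_add)
    next
      show "\<phi> \<one> = 1" by (simp add: pr \<phi> one)
    qed
    show "\<phi> (star A a \<otimes> a) = of_real ((p a)\<^sup>2)"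
      using f(6) by (simp add: a'[symmetric] pr \<phi> g_square)
  qed
qed

text \<open>The inequality a* a \<le> t in algebraic form: t - a* a has a square root, as a* a / t
  has norm below 1. Unlike an inequality, the identity survives tensoring with 1 and can be
  evaluated in any state.\<close>

lemma ex_complement_square:
  assumes nontriv: "\<one> \<noteq> \<zero>" and a: "a \<in> carrier A" and t: "(p a)\<^sup>2 < t"
  obtains c where "c \<in> carrier A" "star A c \<otimes> c \<oplus> star A a \<otimes> a = of_real t \<odot> \<one>"
proof -
  have A: "star_algebra A" by unfold_locales
  note cl = pr_closed[OF A] and pr = pr_simps[OF A]
  interpret N: cstar_space adj_elt imag_elt "\<lambda>X. p (pr A X)" by (rule cstar_space[OF nontriv])
  obtain a' where a': "pr A a' = a" using pr_surj[OF A a] by blast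
  have t0: "0 < t" using t by (rule le_less_trans[OF zero_le_power2])
  define h where "h = inverse t *\<^sub>R (adj_elt a' * a')"
  have "adj_elt h = h" by (simp add: h_def N.adj_simps)
  moreover have "p (pr A h) < 1"
    using t t0 by (simp only: h_def N.N_scale N.N_cstar a') (simp add: field_simps)
  ultimately obtain k where k: "adj_elt k = k" "N.eqv (k * k) (1 - h)" using N.ex_sqrt_one_minus by blast
  define c where "c = sqrt t *\<^sub>R k"
  have "N.eqv (t *\<^sub>R (k * k)) (t *\<^sub>R (1 - h))" by (intro N.eqv_scale k)
  moreover have "t *\<^sub>R (k * k) = adj_elt c * c" using t0 by (simp add: c_def N.adj_simps k)
  moreover have "t *\<^sub>R (1 - h) = t *\<^sub>R 1 - adj_elt a' * a'" using t0 by (simp add: h_def scaleR_diff_right)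
  ultimately have "N.eqv (adj_elt c * c) (t *\<^sub>R 1 - adj_elt a' * a')" by simp
  then have "pr A (adj_elt c * c - (t *\<^sub>R 1 - adj_elt a' * a')) = \<zero>"
    using p_definite[OF cl] unfolding N.eqv_def by blast
  then have 0: "pr A ((adj_elt c * c + adj_elt a' * a') + - (t *\<^sub>R 1)) = \<zero>" by (simp add: algebra_simps)
  have "pr A (adj_elt c * c + adj_elt a' * a') = pr A (t *\<^sub>R 1)"
    by (rule eq_of_diff_zero[OF cl cl]) (use 0 in \<open>simp only: pr\<close>)
  then show thesis
    by (intro that[of "pr A c"] cl) (simp add: a'[symmetric] pr)
qed

end

section \<open>Completions\<close>

text \<open>Only the facts needed for the operations of the completion to be well defined are assumed, so
  that formal tensors with the minimal norm are covered.\<close>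

locale prenormed =
  fixes A :: "('a, 'b) star_alg_scheme" (structure) and p :: "'a \<Rightarrow> real"
    and dst :: "'a \<Rightarrow> 'a \<Rightarrow> real"
  assumes dst: "dst x y = p (x \<oplus> (-1) \<odot> y)"
    and one_in: "\<one> \<in> carrier A" and zero_in: "\<zero> \<in> carrier A"
    and add_in: "x \<in> carrier A \<Longrightarrow> y \<in> carrier A \<Longrightarrow> x \<oplus> y \<in> carrier A"
    and mult_in: "x \<in> carrier A \<Longrightarrow> y \<in> carrier A \<Longrightarrow> x \<otimes> y \<in> carrier A"
    and smult_in: "x \<in> carrier A \<Longrightarrow> c \<odot> x \<in> carrier A"
    and star_in: "x \<in> carrier A \<Longrightarrow> star A x \<in> carrier A"
    and p_nonneg: "x \<in> carrier A \<Longrightarrow> 0 \<le> p x"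
    and dst_refl: "x \<in> carrier A \<Longrightarrow> dst x x = 0"
    and dst_commute: "x \<in> carrier A \<Longrightarrow> y \<in> carrier A \<Longrightarrow> dst x y = dst y x"
    and dst_triangle: "x \<in> carrier A \<Longrightarrow> y \<in> carrier A \<Longrightarrow> z \<in> carrier A \<Longrightarrow> dst x z \<le> dst x y + dst y z"
    and dst_add: "x \<in> carrier A \<Longrightarrow> y \<in> carrier A \<Longrightarrow> x' \<in> carrier A \<Longrightarrow> y' \<in> carrier A \<Longrightarrow>
      dst (x \<oplus> y) (x' \<oplus> y') \<le> dst x x' + dst y y'"
    and dst_smult: "x \<in> carrier A \<Longrightarrow> y \<in> carrier A \<Longrightarrow> dst (c \<odot> x) (c \<odot> y) \<le> cmod c * dst x y"
    and dst_star: "x \<in> carrier A \<Longrightarrow> y \<in> carrier A \<Longrightarrow> dst (star A x) (star A y) \<le> dst x y"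
    and dst_mult: "x \<in> carrier A \<Longrightarrow> y \<in> carrier A \<Longrightarrow> x' \<in> carrier A \<Longrightarrow> y' \<in> carrier A \<Longrightarrow>
      dst (x \<otimes> y) (x' \<otimes> y') \<le> p x * dst y y' + dst x x' * p y'"
    and p_lipschitz: "x \<in> carrier A \<Longrightarrow> y \<in> carrier A \<Longrightarrow> p x \<le> p y + dst x y"
begin

abbreviation "cauchy \<equiv> seqcauchy A p"
abbreviation "cls \<equiv> cauchy_class A p"
abbreviation "C \<equiv> completion A p"

section \<open>Cauchy sequences modulo null sequences\<close>

lemma dst_nonneg: "x \<in> carrier A \<Longrightarrow> y \<in> carrier A \<Longrightarrow> 0 \<le> dst x y"
  unfolding dst by (intro p_nonneg add_in smult_in)

lemma cauchy_iff: "cauchy s \<longleftrightarrow> (\<forall>n. s n \<in> carrier A) \<and> (\<forall>e>0. \<exists>M. \<forall>m\<ge>M. \<forall>n\<ge>M. dst (s m) (s n) < e)"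
  by (simp add: seqcauchy_def dst)

lemma cauchy_in: "cauchy s \<Longrightarrow> s n \<in> carrier A"
  by (simp add: cauchy_iff)

lemma cls_iff: "t \<in> cls s \<longleftrightarrow> cauchy t \<and> (\<lambda>n. dst (s n) (t n)) \<longlonglongrightarrow> 0"
  by (simp add: cauchy_class_def dst)

lemma tendsto_0_le:
  assumes "f \<longlonglongrightarrow> 0" "\<And>n. 0 \<le> g n" "\<And>n. g n \<le> f n" shows "g \<longlonglongrightarrow> (0::real)"
  by (rule tendsto_sandwich[OF _ _ tendsto_const assms(1)]) (use assms in auto)

lemma dst_null_trans:
  assumes "(\<lambda>n. dst (s n) (t n)) \<longlonglongrightarrow> 0" "(\<lambda>n. dst (t n) (u n)) \<longlonglongrightarrow> 0"
    and "\<And>n. s n \<in> carrier A" "\<And>n. t n \<in> carrier A" "\<And>n. u n \<in> carrier A"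
  shows "(\<lambda>n. dst (s n) (u n)) \<longlonglongrightarrow> 0"
proof (rule tendsto_0_le)
  show "(\<lambda>n. dst (s n) (t n) + dst (t n) (u n)) \<longlonglongrightarrow> 0" using tendsto_add[OF assms(1,2)] by simp
  show "0 \<le> dst (s n) (u n)" for n by (rule dst_nonneg) (rule assms)+
  show "dst (s n) (u n) \<le> dst (s n) (t n) + dst (t n) (u n)" for n by (rule dst_triangle) (rule assms)+
qed

lemma dst_null_commute:
  assumes "(\<lambda>n. dst (s n) (t n)) \<longlonglongrightarrow> 0"
    and "\<And>n. s n \<in> carrier A" "\<And>n. t n \<in> carrier A"
  shows "(\<lambda>n. dst (t n) (s n)) \<longlonglongrightarrow> 0"
  using assms(1) by (simp add: dst_commute assms)

lemma cls_self: "cauchy s \<Longrightarrow> s \<in> cls s"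
  by (simp add: cls_iff dst_refl cauchy_in)

lemma rep_cls: "cauchy s \<Longrightarrow> cauchy (rep (cls s)) \<and> (\<lambda>n. dst (s n) (rep (cls s) n)) \<longlonglongrightarrow> 0"
  using someI[of "\<lambda>t. t \<in> cls s", OF cls_self] unfolding rep_def by (simp add: cls_iff)

lemma cls_eq_iff:
  assumes "cauchy s" "cauchy t" shows "cls s = cls t \<longleftrightarrow> (\<lambda>n. dst (s n) (t n)) \<longlonglongrightarrow> 0"
proof
  assume "cls s = cls t"
  then show "(\<lambda>n. dst (s n) (t n)) \<longlonglongrightarrow> 0" using cls_self[OF assms(2)] cls_iff by blast
next
  assume *: "(\<lambda>n. dst (s n) (t n)) \<longlonglongrightarrow> 0"
  note ** = dst_null_commute[OF *] cauchy_in assms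
  show "cls s = cls t"
    using dst_null_trans[OF *] dst_null_trans[OF dst_null_commute[OF *]] assms
    by (auto simp: cls_iff cauchy_in)
qed

lemma cauchy_p_tendsto:
  assumes s: "cauchy s" shows "convergent (\<lambda>n. p (s n))"
proof -
  have "Cauchy (\<lambda>n. p (s n))"
  proof (rule metric_CauchyI)
    fix e :: real assume "0 < e"
    then obtain M where M: "\<forall>m\<ge>M. \<forall>n\<ge>M. dst (s m) (s n) < e" using s unfolding cauchy_iff by meson
    show "\<exists>M. \<forall>m\<ge>M. \<forall>n\<ge>M. dist (p (s m)) (p (s n)) < e"
    proof (intro exI allI impI)
      fix m n assume "M \<le> m" "M \<le> n"
      then have "dst (s m) (s n) < e" "dst (s n) (s m) < e" using M by auto
      then show "dist (p (s m)) (p (s n)) < e"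
        using p_lipschitz[OF cauchy_in[OF s] cauchy_in[OF s], of m n]
          p_lipschitz[OF cauchy_in[OF s] cauchy_in[OF s], of n m] by (auto simp: dist_real_def)
    qed
  qed
  then show ?thesis by (simp add: Cauchy_convergent)
qed

lemma p_tendsto_of_null:
  assumes "(\<lambda>n. p (s n)) \<longlonglongrightarrow> l" and null: "(\<lambda>n. dst (s n) (t n)) \<longlonglongrightarrow> 0"
    and st: "\<And>n. s n \<in> carrier A" "\<And>n. t n \<in> carrier A"
  shows "(\<lambda>n. p (t n)) \<longlonglongrightarrow> l"
proof -
  have "(\<lambda>n. p (t n) - p (s n)) \<longlonglongrightarrow> 0"
  proof (rule tendsto_rabs_zero_cancel, rule tendsto_0_le[OF null])
    fix n
    show "\<bar>p (t n) - p (s n)\<bar> \<le> dst (s n) (t n)"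
      using p_lipschitz[OF st(1)[of n] st(2)[of n]] p_lipschitz[OF st(2)[of n] st(1)[of n]]
        dst_commute[OF st(2)[of n] st(1)[of n]] by simp
  qed simp
  from tendsto_add[OF this assms(1)] show ?thesis by simp
qed

lemma cauchy_bounded:
  assumes s: "cauchy s" obtains B where "0 \<le> B" "\<And>n. p (s n) \<le> B"
proof -
  have "Bseq (\<lambda>n. p (s n))" using cauchy_p_tendsto[OF s] by (rule convergent_imp_Bseq)
  then obtain B where "0 < B" "\<And>n. norm (p (s n)) \<le> B" unfolding Bseq_def by blast
  then show thesis using that[of B] by (metis abs_le_D1 less_imp_le real_norm_def)
qed

lemma cauchy_of_null:
  assumes s: "cauchy s" and null: "(\<lambda>n. dst (s n) (t n)) \<longlonglongrightarrow> 0" and t: "\<And>n. t n \<in> carrier A"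
  shows "cauchy t"
  unfolding cauchy_iff
proof (intro conjI allI impI t)
  fix e :: real assume "0 < e"
  then have e: "0 < e/3" by simp
  then obtain M where M: "\<forall>m\<ge>M. \<forall>n\<ge>M. dst (s m) (s n) < e/3" using s unfolding cauchy_iff by meson
  obtain N where N: "\<And>n. n \<ge> N \<Longrightarrow> dst (s n) (t n) < e/3"
    using order_tendstoD(2)[OF null e] unfolding eventually_sequentially by blast
  show "\<exists>M. \<forall>m\<ge>M. \<forall>n\<ge>M. dst (t m) (t n) < e"
  proof (intro exI allI impI)
    fix m n assume "max M N \<le> m" "max M N \<le> n"
    then have "dst (s m) (s n) < e/3" "dst (s m) (t m) < e/3" "dst (s n) (t n) < e/3" using M N by auto
    moreover have "dst (t m) (t n) \<le> dst (t m) (s m) + dst (s m) (t n)"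
      by (rule dst_triangle) (rule t cauchy_in[OF s])+
    moreover have "dst (s m) (t n) \<le> dst (s m) (s n) + dst (s n) (t n)"
      by (rule dst_triangle) (rule t cauchy_in[OF s])+
    moreover have "dst (t m) (s m) = dst (s m) (t m)" by (rule dst_commute) (rule t cauchy_in[OF s])+
    ultimately show "dst (t m) (t n) < e" by simp
  qed
qed

lemma cauchy_const: "x \<in> carrier A \<Longrightarrow> cauchy (\<lambda>_. x)"
  by (auto simp: cauchy_iff dst_refl)

lemma cauchy_add:
  assumes "cauchy s" "cauchy t" shows "cauchy (\<lambda>n. s n \<oplus> t n)"
  unfolding cauchy_iff
proof (intro conjI allI impI)
  show "s n \<oplus> t n \<in> carrier A" for n using assms by (intro add_in cauchy_in)
  fix e :: real assume "0 < e"
  then have "0 < e/2" by simp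
  then obtain M N where M: "\<forall>m\<ge>M. \<forall>n\<ge>M. dst (s m) (s n) < e/2" and N: "\<forall>m\<ge>N. \<forall>n\<ge>N. dst (t m) (t n) < e/2"
    using assms unfolding cauchy_iff by meson
  show "\<exists>M. \<forall>m\<ge>M. \<forall>n\<ge>M. dst (s m \<oplus> t m) (s n \<oplus> t n) < e"
  proof (intro exI allI impI)
    fix m n assume mn: "max M N \<le> m" "max M N \<le> n"
    then have "dst (s m) (s n) < e/2" "dst (t m) (t n) < e/2" using M N by auto
    then show "dst (s m \<oplus> t m) (s n \<oplus> t n) < e"
      using dst_add[of "s m" "t m" "s n" "t n"] assms cauchy_in by fastforce
  qed
qed

lemma cauchy_smult:
  assumes "cauchy s" shows "cauchy (\<lambda>n. c \<odot> s n)"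
  unfolding cauchy_iff
proof (intro conjI allI impI)
  show "c \<odot> s n \<in> carrier A" for n using assms by (intro smult_in cauchy_in)
  fix e :: real assume e: "0 < e"
  then have "0 < e / (cmod c + 1)" by (simp add: add_nonneg_pos)
  then obtain M where M: "\<forall>m\<ge>M. \<forall>n\<ge>M. dst (s m) (s n) < e / (cmod c + 1)"
    using assms unfolding cauchy_iff by meson
  show "\<exists>M. \<forall>m\<ge>M. \<forall>n\<ge>M. dst (c \<odot> s m) (c \<odot> s n) < e"
  proof (intro exI allI impI)
    fix m n assume mn: "M \<le> m" "M \<le> n"
    have "dst (c \<odot> s m) (c \<odot> s n) \<le> cmod c * dst (s m) (s n)"
      using assms by (intro dst_smult cauchy_in)
    also have "\<dots> \<le> cmod c * (e / (cmod c + 1))" using M mn by (intro mult_left_mono) (auto intro: less_imp_le)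
    also have "\<dots> < e"
    proof -
      have "0 < cmod c + 1" by (simp add: add_nonneg_pos)
      then show ?thesis using e by (simp add: field_simps)
    qed
    finally show "dst (c \<odot> s m) (c \<odot> s n) < e" .
  qed
qed

lemma cauchy_star:
  assumes "cauchy s" shows "cauchy (\<lambda>n. star A (s n))"
  unfolding cauchy_iff
proof (intro conjI allI impI)
  show "star A (s n) \<in> carrier A" for n using assms by (intro star_in cauchy_in)
  fix e :: real assume e: "0 < e"
  then obtain M where M: "\<forall>m\<ge>M. \<forall>n\<ge>M. dst (s m) (s n) < e"
    using assms unfolding cauchy_iff by meson
  then show "\<exists>M. \<forall>m\<ge>M. \<forall>n\<ge>M. dst (star A (s m)) (star A (s n)) < e"
    using dst_star[OF cauchy_in[OF assms] cauchy_in[OF assms]] by (meson le_less_trans)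
qed

lemma cauchy_mult:
  assumes "cauchy s" "cauchy t" shows "cauchy (\<lambda>n. s n \<otimes> t n)"
  unfolding cauchy_iff
proof (intro conjI allI impI)
  note st = cauchy_in[OF assms(1)] cauchy_in[OF assms(2)]
  show "s n \<otimes> t n \<in> carrier A" for n using st by (intro mult_in)
  obtain B B' where B: "0 \<le> B" "\<And>n. p (s n) \<le> B" "0 \<le> B'" "\<And>n. p (t n) \<le> B'"
    using cauchy_bounded[OF assms(1)] cauchy_bounded[OF assms(2)] by metis
  fix e :: real assume e: "0 < e"
  define \<delta> where "\<delta> = e / (B + B' + 1)"
  have \<delta>: "0 < \<delta>" using e B by (simp add: \<delta>_def)
  have "\<delta> * (B + B' + 1) = e" using B by (simp add: \<delta>_def)
  then have lt: "B * \<delta> + \<delta> * B' < e" using \<delta> by (simp add: algebra_simps)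
  obtain M N where M: "\<forall>m\<ge>M. \<forall>n\<ge>M. dst (s m) (s n) < \<delta>" and N: "\<forall>m\<ge>N. \<forall>n\<ge>N. dst (t m) (t n) < \<delta>"
    using assms \<delta> unfolding cauchy_iff by meson
  show "\<exists>M. \<forall>m\<ge>M. \<forall>n\<ge>M. dst (s m \<otimes> t m) (s n \<otimes> t n) < e"
  proof (intro exI allI impI)
    fix m n assume mn: "max M N \<le> m" "max M N \<le> n"
    then have *: "dst (s m) (s n) \<le> \<delta>" "dst (t m) (t n) \<le> \<delta>" using M N by (auto intro: less_imp_le)
    have "dst (s m \<otimes> t m) (s n \<otimes> t n) \<le> p (s m) * dst (t m) (t n) + dst (s m) (s n) * p (t n)"
      by (rule dst_mult) (rule st)+
    also have "\<dots> \<le> B * \<delta> + \<delta> * B'"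
      using * B \<delta> st by (intro add_mono mult_mono) (auto intro: dst_nonneg p_nonneg)
    finally show "dst (s m \<otimes> t m) (s n \<otimes> t n) < e" using lt by simp
  qed
qed

section \<open>Operations of the completion in terms of arbitrary representatives\<close>

lemma completion_simps:
  "carrier C = {cls s | s. cauchy s}" "\<one>\<^bsub>C\<^esub> = cls (\<lambda>_. \<one>)" "\<zero>\<^bsub>C\<^esub> = cls (\<lambda>_. \<zero>)"
  by (simp_all add: completion_def)

lemma cls_closed: "cauchy s \<Longrightarrow> cls s \<in> carrier C"
  by (auto simp: completion_simps)

lemma completion_cases:
  assumes "X \<in> carrier C" obtains s where "cauchy s" "X = cls s"
  using assms by (auto simp: completion_simps)

lemma cls_add:
  assumes "cauchy s" "cauchy t" shows "cls s \<oplus>\<^bsub>C\<^esub> cls t = cls (\<lambda>n. s n \<oplus> t n)"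
proof -
  note r = rep_cls[OF assms(1)] rep_cls[OF assms(2)]
  have "cls s \<oplus>\<^bsub>C\<^esub> cls t = cls (\<lambda>n. rep (cls s) n \<oplus> rep (cls t) n)" by (simp add: completion_def)
  also have "\<dots> = cls (\<lambda>n. s n \<oplus> t n)"
  proof (subst cls_eq_iff)
    show "(\<lambda>n. dst (rep (cls s) n \<oplus> rep (cls t) n) (s n \<oplus> t n)) \<longlonglongrightarrow> 0"
    proof (rule tendsto_0_le)
      show "(\<lambda>n. dst (rep (cls s) n) (s n) + dst (rep (cls t) n) (t n)) \<longlonglongrightarrow> 0"
        using tendsto_add[OF dst_null_commute dst_null_commute, of s "rep (cls s)" t "rep (cls t)"]
          r assms cauchy_in by auto
    qed (use r assms cauchy_in in \<open>auto intro: dst_nonneg add_in dst_add\<close>)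
  qed (use r assms in \<open>auto intro: cauchy_add\<close>)
  finally show ?thesis .
qed

lemma cls_smult:
  assumes "cauchy s" shows "c \<odot>\<^bsub>C\<^esub> cls s = cls (\<lambda>n. c \<odot> s n)"
proof -
  note r = rep_cls[OF assms(1)]
  have "c \<odot>\<^bsub>C\<^esub> cls s = cls (\<lambda>n. c \<odot> rep (cls s) n)" by (simp add: completion_def)
  also have "\<dots> = cls (\<lambda>n. c \<odot> s n)"
  proof (subst cls_eq_iff)
    show "(\<lambda>n. dst (c \<odot> rep (cls s) n) (c \<odot> s n)) \<longlonglongrightarrow> 0"
    proof (rule tendsto_0_le)
      have "(\<lambda>n. dst (rep (cls s) n) (s n)) \<longlonglongrightarrow> 0" by (rule dst_null_commute) (use r assms cauchy_in in auto)
      from tendsto_mult_left[OF this, of "cmod c"]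
      show "(\<lambda>n. cmod c * dst (rep (cls s) n) (s n)) \<longlonglongrightarrow> 0" by simp
    qed (use r assms cauchy_in in \<open>auto intro: dst_nonneg smult_in dst_smult\<close>)
  qed (use r assms in \<open>auto intro: cauchy_smult\<close>)
  finally show ?thesis .
qed

lemma cls_star:
  assumes "cauchy s" shows "star C (cls s) = cls (\<lambda>n. star A (s n))"
proof -
  note r = rep_cls[OF assms(1)]
  have "star C (cls s) = cls (\<lambda>n. star A (rep (cls s) n))" by (simp add: completion_def)
  also have "\<dots> = cls (\<lambda>n. star A (s n))"
  proof (subst cls_eq_iff)
    show "(\<lambda>n. dst (star A (rep (cls s) n)) (star A (s n))) \<longlonglongrightarrow> 0"
    proof (rule tendsto_0_le)
      show "(\<lambda>n. dst (rep (cls s) n) (s n)) \<longlonglongrightarrow> 0" by (rule dst_null_commute) (use r assms cauchy_in in auto)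
    qed (use r assms cauchy_in in \<open>auto intro: dst_nonneg star_in dst_star\<close>)
  qed (use r assms in \<open>auto intro: cauchy_star\<close>)
  finally show ?thesis .
qed

lemma cls_mult:
  assumes "cauchy s" "cauchy t" shows "cls s \<otimes>\<^bsub>C\<^esub> cls t = cls (\<lambda>n. s n \<otimes> t n)"
proof -
  note r = rep_cls[OF assms(1)] rep_cls[OF assms(2)]
  have "cls s \<otimes>\<^bsub>C\<^esub> cls t = cls (\<lambda>n. rep (cls s) n \<otimes> rep (cls t) n)" by (simp add: completion_def)
  also have "\<dots> = cls (\<lambda>n. s n \<otimes> t n)"
  proof (subst cls_eq_iff)
    obtain B B' where B: "0 \<le> B" "\<And>n. p (rep (cls s) n) \<le> B" "0 \<le> B'" "\<And>n. p (t n) \<le> B'"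
      using cauchy_bounded[of "rep (cls s)"] cauchy_bounded[OF assms(2)] r by metis
    show "(\<lambda>n. dst (rep (cls s) n \<otimes> rep (cls t) n) (s n \<otimes> t n)) \<longlonglongrightarrow> 0"
    proof (rule tendsto_0_le)
      have "(\<lambda>n. dst (rep (cls s) n) (s n)) \<longlonglongrightarrow> 0" by (rule dst_null_commute) (use r assms cauchy_in in auto)
      moreover have "(\<lambda>n. dst (rep (cls t) n) (t n)) \<longlonglongrightarrow> 0" by (rule dst_null_commute) (use r assms cauchy_in in auto)
      ultimately show "(\<lambda>n. B * dst (rep (cls t) n) (t n) + dst (rep (cls s) n) (s n) * B') \<longlonglongrightarrow> 0"
        by (auto intro!: tendsto_eq_intros)
      fix n
      have "dst (rep (cls s) n \<otimes> rep (cls t) n) (s n \<otimes> t n)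
        \<le> p (rep (cls s) n) * dst (rep (cls t) n) (t n) + dst (rep (cls s) n) (s n) * p (t n)"
        by (rule dst_mult) (use r assms cauchy_in in auto)
      also have "\<dots> \<le> B * dst (rep (cls t) n) (t n) + dst (rep (cls s) n) (s n) * B'"
        using B r assms cauchy_in by (intro add_mono mult_mono) (auto intro: dst_nonneg p_nonneg)
      finally show "dst (rep (cls s) n \<otimes> rep (cls t) n) (s n \<otimes> t n) \<le>
        B * dst (rep (cls t) n) (t n) + dst (rep (cls s) n) (s n) * B'" .
    qed (use r assms cauchy_in in \<open>auto intro: dst_nonneg mult_in\<close>)
  qed (use r assms in \<open>auto intro: cauchy_mult\<close>)
  finally show ?thesis .
qed

lemma nrm_cls:
  assumes "cauchy s" shows "(\<lambda>n. p (s n)) \<longlonglongrightarrow> nrm C (cls s)"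
proof -
  note r = rep_cls[OF assms(1)]
  obtain l where l: "(\<lambda>n. p (s n)) \<longlonglongrightarrow> l" using cauchy_p_tendsto[OF assms] by (auto simp: convergent_def)
  have "(\<lambda>n. p (rep (cls s) n)) \<longlonglongrightarrow> l"
    by (rule p_tendsto_of_null[OF l]) (use r assms cauchy_in in auto)
  then have "nrm C (cls s) = l" by (simp add: completion_def limI)
  then show ?thesis using l by simp
qed

lemma nrm_cls_const: "x \<in> carrier A \<Longrightarrow> nrm C (cls (\<lambda>_. x)) = p x"
  by (rule LIMSEQ_unique[OF nrm_cls[OF cauchy_const] tendsto_const])

lemma dst_cls:
  assumes "cauchy s" "cauchy t"
  shows "(\<lambda>n. dst (s n) (t n)) \<longlonglongrightarrow> nrm C (cls s \<oplus>\<^bsub>C\<^esub> (-1) \<odot>\<^bsub>C\<^esub> cls t)"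
  using nrm_cls[OF cauchy_add[OF assms(1) cauchy_smult[OF assms(2), of "-1"]]] assms
  by (simp add: cls_add cls_smult cauchy_smult dst)

text \<open>A diagonal argument: from the k-th representative take a term from which all later terms
  stay within 1/(k+1). The distance of two such terms is the norm of \<open>X k - X l\<close> up to
  the two errors.\<close>

lemma completion_complete:
  assumes X: "seqcauchy C (nrm C) X"
  shows "\<exists>x\<in>carrier C. seqconv C (nrm C) X x"
proof -
  have X_in: "X k \<in> carrier C" for k using X by (simp add: seqcauchy_def)
  have "\<forall>k. \<exists>s. cauchy s \<and> X k = cls s"
  proof
    fix k
    obtain s where "cauchy s" "X k = cls s" using X_in[of k] by (rule completion_cases)
    then show "\<exists>s. cauchy s \<and> X k = cls s" by blast
  qed
  then have "\<exists>s. \<forall>k. cauchy (s k) \<and> X k = cls (s k)" by (rule choice)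
  then obtain s where s: "\<And>k. cauchy (s k)" "\<And>k. X k = cls (s k)" by blast
  have "\<exists>N. \<forall>m\<ge>N. dst (s k m) (s k N) < 1 / (real k + 1)" for k
  proof -
    have "0 < 1 / (real k + 1)" by simp
    then obtain M where "\<forall>m\<ge>M. \<forall>n\<ge>M. dst (s k m) (s k n) < 1 / (real k + 1)"
      using s(1)[of k] unfolding cauchy_iff by meson
    then show ?thesis by (intro exI[of _ M]) auto
  qed
  then obtain N where N: "\<And>k m. m \<ge> N k \<Longrightarrow> dst (s k m) (s k (N k)) < 1 / (real k + 1)" by metis
  define t where "t k = s k (N k)" for k
  have t_in: "t k \<in> carrier A" and s_in: "s k m \<in> carrier A" for k m
    using s(1) by (auto simp: t_def intro: cauchy_in)
  have Xd: "(\<lambda>m. dst (s k m) (s l m)) \<longlonglongrightarrow> nrm C (X k \<oplus>\<^bsub>C\<^esub> (-1) \<odot>\<^bsub>C\<^esub> X l)" for k l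
    using dst_cls[OF s(1) s(1)] s(2) by simp
  have tb: "dst (t k) (t l) \<le> 1 / (real k + 1) + 1 / (real l + 1) + nrm C (X k \<oplus>\<^bsub>C\<^esub> (-1) \<odot>\<^bsub>C\<^esub> X l)" for k l
  proof (rule LIMSEQ_le_const)
    show "(\<lambda>m. 1 / (real k + 1) + 1 / (real l + 1) + dst (s k m) (s l m)) \<longlonglongrightarrow>
      1 / (real k + 1) + 1 / (real l + 1) + nrm C (X k \<oplus>\<^bsub>C\<^esub> (-1) \<odot>\<^bsub>C\<^esub> X l)"
      by (intro tendsto_intros Xd)
    have "dst (t k) (t l) \<le> 1 / (real k + 1) + 1 / (real l + 1) + dst (s k m) (s l m)"
      if m: "max (N k) (N l) \<le> m" for m
    proof -
      have "dst (s k m) (t k) < 1 / (real k + 1)" "dst (s l m) (t l) < 1 / (real l + 1)"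
        using N m by (auto simp: t_def)
      moreover have "dst (t k) (t l) \<le> dst (t k) (s k m) + dst (s k m) (t l)"
        by (rule dst_triangle) (rule t_in s_in)+
      moreover have "dst (s k m) (t l) \<le> dst (s k m) (s l m) + dst (s l m) (t l)"
        by (rule dst_triangle) (rule t_in s_in)+
      moreover have "dst (t k) (s k m) = dst (s k m) (t k)" by (rule dst_commute) (rule t_in s_in)+
      ultimately show ?thesis by simp
    qed
    then show "\<exists>M. \<forall>n\<ge>M. dst (t k) (t l) \<le> 1 / (real k + 1) + 1 / (real l + 1) + dst (s k n) (s l n)" by blast
  qed
  have small: "\<exists>M. \<forall>k\<ge>M. 1 / (real k + 1) < e" if "0 < e" for e :: real
  proof -
    have "(\<lambda>k. 1 / (real k + 1)) \<longlonglongrightarrow> 0" using LIMSEQ_inverse_real_of_nat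
      by (simp add: inverse_eq_divide add.commute)
    from order_tendstoD(2)[OF this that] show ?thesis by (simp add: eventually_sequentially)
  qed
  have t: "cauchy t"
    unfolding cauchy_iff
  proof (intro conjI allI impI t_in)
    fix e :: real assume "0 < e"
    then have e: "0 < e/3" by simp
    obtain M where M: "\<forall>k\<ge>M. 1 / (real k + 1) < e/3" using small[OF e] by blast
    obtain M' where M': "\<forall>k\<ge>M'. \<forall>l\<ge>M'. nrm C (X k \<oplus>\<^bsub>C\<^esub> (-1) \<odot>\<^bsub>C\<^esub> X l) < e/3"
      using X e unfolding seqcauchy_def by meson
    show "\<exists>M. \<forall>m\<ge>M. \<forall>n\<ge>M. dst (t m) (t n) < e"
    proof (intro exI allI impI)
      fix m n assume "max M M' \<le> m" "max M M' \<le> n"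
      then have "1 / (real m + 1) < e/3" "1 / (real n + 1) < e/3" "nrm C (X m \<oplus>\<^bsub>C\<^esub> (-1) \<odot>\<^bsub>C\<^esub> X n) < e/3"
        using M M' by auto
      then show "dst (t m) (t n) < e" using tb[of m n] by linarith
    qed
  qed
  have "seqconv C (nrm C) X (cls t)"
    unfolding seqconv_def
  proof (rule LIMSEQ_I)
    fix e :: real assume "0 < e"
    then have e: "0 < e/4" by simp
    obtain M where M: "\<forall>k\<ge>M. 1 / (real k + 1) < e/4" using small[OF e] by blast
    obtain M' where M': "\<forall>k\<ge>M'. \<forall>l\<ge>M'. dst (t k) (t l) < e/4"
      using t e unfolding cauchy_iff by meson
    show "\<exists>no. \<forall>n\<ge>no. norm (nrm C (X n \<oplus>\<^bsub>C\<^esub> (-1) \<odot>\<^bsub>C\<^esub> cls t) - 0) < e"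
    proof (intro exI allI impI)
      fix k assume k: "max M M' \<le> k"
      have lim: "(\<lambda>m. dst (s k m) (t m)) \<longlonglongrightarrow> nrm C (X k \<oplus>\<^bsub>C\<^esub> (-1) \<odot>\<^bsub>C\<^esub> cls t)"
        using dst_cls[OF s(1) t] s(2) by simp
      have "nrm C (X k \<oplus>\<^bsub>C\<^esub> (-1) \<odot>\<^bsub>C\<^esub> cls t) \<le> e/2"
      proof (rule LIMSEQ_le_const2[OF lim])
        have "dst (s k m) (t m) \<le> e/2" if "max (N k) M' \<le> m" for m
        proof -
          have "dst (s k m) (t k) < 1 / (real k + 1)" "dst (t k) (t m) < e/4" "1 / (real k + 1) < e/4"
            using N that M M' k by (auto simp: t_def)
          moreover have "dst (s k m) (t m) \<le> dst (s k m) (t k) + dst (t k) (t m)"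
            by (rule dst_triangle) (rule t_in s_in)+
          ultimately show ?thesis by linarith
        qed
        then show "\<exists>M. \<forall>n\<ge>M. dst (s k n) (t n) \<le> e/2" by blast
      qed
      moreover have "0 \<le> nrm C (X k \<oplus>\<^bsub>C\<^esub> (-1) \<odot>\<^bsub>C\<^esub> cls t)"
        by (rule LIMSEQ_le_const[OF lim]) (use s_in t_in dst_nonneg in blast)
      ultimately show "norm (nrm C (X k \<oplus>\<^bsub>C\<^esub> (-1) \<odot>\<^bsub>C\<^esub> cls t) - 0) < e" using \<open>0 < e\<close> by simp
    qed
  qed
  then show ?thesis using cls_closed[OF t] by blast
qed

section \<open>The canonical map into the completion\<close>

abbreviation "emb \<equiv> to_completion A p"

lemma emb_simps:
  "x \<in> carrier A \<Longrightarrow> emb x \<in> carrier C"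
  "x \<in> carrier A \<Longrightarrow> y \<in> carrier A \<Longrightarrow> emb (x \<oplus> y) = emb x \<oplus>\<^bsub>C\<^esub> emb y"
  "x \<in> carrier A \<Longrightarrow> y \<in> carrier A \<Longrightarrow> emb (x \<otimes> y) = emb x \<otimes>\<^bsub>C\<^esub> emb y"
  "x \<in> carrier A \<Longrightarrow> emb (c \<odot> x) = c \<odot>\<^bsub>C\<^esub> emb x"
  "x \<in> carrier A \<Longrightarrow> emb (star A x) = star C (emb x)"
  "emb \<one> = \<one>\<^bsub>C\<^esub>" "emb \<zero> = \<zero>\<^bsub>C\<^esub>"
  "x \<in> carrier A \<Longrightarrow> nrm C (emb x) = p x"
  by (simp_all add: to_completion_def cls_closed cauchy_const cls_add cls_mult cls_smult cls_star
      completion_simps(2,3) nrm_cls_const)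

lemma emb_eq_iff:
  "x \<in> carrier A \<Longrightarrow> y \<in> carrier A \<Longrightarrow> emb x = emb y \<longleftrightarrow> dst x y = 0"
  by (simp add: to_completion_def cls_eq_iff cauchy_const LIMSEQ_const_iff)

lemma emb_hom: "star_hom A C emb"
  by (simp add: star_hom_def ring_hom_def emb_simps Pi_def)

lemma cauchy_tendsto_emb:
  assumes s: "cauchy s"
  shows "(\<lambda>n. nrm C (emb (s n) \<oplus>\<^bsub>C\<^esub> (-1) \<odot>\<^bsub>C\<^esub> cls s)) \<longlonglongrightarrow> 0"
proof (rule LIMSEQ_I)
  fix e :: real assume "0 < e"
  then have e: "0 < e/2" by simp
  obtain M where M: "\<forall>m\<ge>M. \<forall>n\<ge>M. dst (s m) (s n) < e/2" using s e unfolding cauchy_iff by meson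
  show "\<exists>no. \<forall>n\<ge>no. norm (nrm C (emb (s n) \<oplus>\<^bsub>C\<^esub> (-1) \<odot>\<^bsub>C\<^esub> cls s) - 0) < e"
  proof (intro exI allI impI)
    fix n assume n: "M \<le> n"
    have lim: "(\<lambda>m. dst (s n) (s m)) \<longlonglongrightarrow> nrm C (emb (s n) \<oplus>\<^bsub>C\<^esub> (-1) \<odot>\<^bsub>C\<^esub> cls s)"
      unfolding to_completion_def using dst_cls[OF cauchy_const s] cauchy_in[OF s] by blast
    have "nrm C (emb (s n) \<oplus>\<^bsub>C\<^esub> (-1) \<odot>\<^bsub>C\<^esub> cls s) \<le> e/2"
      by (rule LIMSEQ_le_const2[OF lim]) (use M n in \<open>force intro: less_imp_le\<close>)
    moreover have "0 \<le> nrm C (emb (s n) \<oplus>\<^bsub>C\<^esub> (-1) \<odot>\<^bsub>C\<^esub> cls s)"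
      by (rule LIMSEQ_le_const[OF lim]) (use cauchy_in[OF s] dst_nonneg in blast)
    ultimately show "norm (nrm C (emb (s n) \<oplus>\<^bsub>C\<^esub> (-1) \<odot>\<^bsub>C\<^esub> cls s) - 0) < e" using \<open>0 < e\<close> by simp
  qed
qed

end

lemma (in star_algebra) prenormed_of_cstar_seminorm:
  assumes p: "cstar_seminorm A p"
  shows "prenormed A p (\<lambda>x y. p (x \<oplus> (-1) \<odot> y))"
proof -
  note D = cstar_seminormD[OF p]
  have A: "star_algebra A" by unfold_locales
  note rules = star_algebra_rules[OF A] and cl = star_algebra_closed[OF A]
  have commute: "p (x \<oplus> (-1) \<odot> y) = p (y \<oplus> (-1) \<odot> x)" if "x \<in> carrier A" "y \<in> carrier A" for x y
  proof -
    have "x \<oplus> (-1) \<odot> y = (-1) \<odot> (y \<oplus> (-1) \<odot> x)" using that by (simp add: rules cl a_comm)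
    then show ?thesis using that cl by (simp add: D)
  qed
  have cancel: "(x \<oplus> (-1) \<odot> y) \<oplus> (y \<oplus> z) = x \<oplus> z" if "x \<in> carrier A" "y \<in> carrier A" "z \<in> carrier A" for x y z
  proof -
    have "(x \<oplus> (-1) \<odot> y) \<oplus> (y \<oplus> z) = x \<oplus> (((-1) \<odot> y \<oplus> y) \<oplus> z)" using that by (simp add: a_assoc cl)
    then show ?thesis using that by (simp add: rules)
  qed
  show ?thesis
  proof
    fix x y z x' y' c assume x: "x \<in> carrier A"
    show "p (x \<oplus> (-1) \<odot> x) = 0" using x by (simp add: rules seminorm_zero[OF p])
    show "0 \<le> p x" using x by (rule D)
    assume y: "y \<in> carrier A"
    show "p (x \<oplus> (-1) \<odot> y) = p (y \<oplus> (-1) \<odot> x)" by (rule commute[OF x y])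
    show "p (c \<odot> x \<oplus> (-1) \<odot> (c \<odot> y)) \<le> cmod c * p (x \<oplus> (-1) \<odot> y)"
    proof -
      have "c \<odot> x \<oplus> (-1) \<odot> (c \<odot> y) = c \<odot> (x \<oplus> (-1) \<odot> y)" using x y by (simp add: rules cl)
      then show ?thesis using x y by (simp add: D cl)
    qed
    show "p (star A x \<oplus> (-1) \<odot> star A y) \<le> p (x \<oplus> (-1) \<odot> y)"
    proof -
      have "star A x \<oplus> (-1) \<odot> star A y = star A (x \<oplus> (-1) \<odot> y)" using x y by (simp add: rules cl)
      then show ?thesis using x y by (simp add: seminorm_star[OF p] cl)
    qed
    show "p x \<le> p y + p (x \<oplus> (-1) \<odot> y)"
      using cancel[OF x y zero_closed] D(3)[of "x \<oplus> (-1) \<odot> y" y] x y by (simp add: cl rules)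
    assume z: "z \<in> carrier A"
    show "p (x \<oplus> (-1) \<odot> z) \<le> p (x \<oplus> (-1) \<odot> y) + p (y \<oplus> (-1) \<odot> z)"
      using cancel[OF x y, of "(-1) \<odot> z"] D(3)[of "x \<oplus> (-1) \<odot> y" "y \<oplus> (-1) \<odot> z"] x y z by (simp add: cl)
  next
    fix x y x' y' assume xy: "x \<in> carrier A" "y \<in> carrier A" "x' \<in> carrier A" "y' \<in> carrier A"
    have "x \<oplus> y \<oplus> (-1) \<odot> (x' \<oplus> y') = (x \<oplus> (-1) \<odot> x') \<oplus> (y \<oplus> (-1) \<odot> y')"
      using xy by (simp add: rules cl a_assoc a_lcomm)
    then show "p (x \<oplus> y \<oplus> (-1) \<odot> (x' \<oplus> y')) \<le> p (x \<oplus> (-1) \<odot> x') + p (y \<oplus> (-1) \<odot> y')"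
      using xy by (simp add: D cl)
    have "x \<otimes> y \<oplus> (-1) \<odot> (x' \<otimes> y') = x \<otimes> (y \<oplus> (-1) \<odot> y') \<oplus> (x \<oplus> (-1) \<odot> x') \<otimes> y'"
    proof -
      have "x \<otimes> (y \<oplus> (-1) \<odot> y') \<oplus> (x \<oplus> (-1) \<odot> x') \<otimes> y' =
          (x \<otimes> y \<oplus> (-1) \<odot> (x \<otimes> y')) \<oplus> (x \<otimes> y' \<oplus> (-1) \<odot> (x' \<otimes> y'))"
        using xy by (simp add: r_distr l_distr smult_mult_left smult_mult_right cl)
      then show ?thesis using xy by (simp add: cancel cl)
    qed
    then have "p (x \<otimes> y \<oplus> (-1) \<odot> (x' \<otimes> y')) \<le>
      p (x \<otimes> (y \<oplus> (-1) \<odot> y')) + p ((x \<oplus> (-1) \<odot> x') \<otimes> y')"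
      using xy by (simp add: D cl)
    also have "\<dots> \<le> p x * p (y \<oplus> (-1) \<odot> y') + p (x \<oplus> (-1) \<odot> x') * p y'"
      using xy by (intro add_mono D cl)
    finally show "p (x \<otimes> y \<oplus> (-1) \<odot> (x' \<otimes> y')) \<le> p x * p (y \<oplus> (-1) \<odot> y') + p (x \<oplus> (-1) \<odot> x') * p y'" .
  qed (simp_all add: cl)
qed

theorem (in star_algebra) cstar_normed_completion:
  assumes p: "cstar_seminorm A p"
  shows "cstar_normed (completion A p) (nrm (completion A p))"
proof -
  interpret pre: prenormed A p "\<lambda>x y. p (x \<oplus> (-1) \<odot> y)" by (rule prenormed_of_cstar_seminorm[OF p])
  note D = cstar_seminormD[OF p]
  have A: "star_algebra A" by unfold_locales
  note rules = star_algebra_rules[OF A] and cl = star_algebra_closed[OF A]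
  let ?C = "completion A p"
  note ops = pre.cls_add pre.cls_mult pre.cls_smult pre.cls_star pre.completion_simps(2,3)
    pre.cauchy_add pre.cauchy_mult pre.cauchy_smult pre.cauchy_star pre.cauchy_const cl pre.cls_closed
  interpret C: star_algebra ?C
    by (rule star_algebraI)
      (auto elim!: pre.completion_cases simp: ops pre.cauchy_in rules a_ac)
  have nonneg: "0 \<le> nrm ?C X" if "X \<in> carrier ?C" for X
    using that
  proof (elim pre.completion_cases)
    fix s assume s: "seqcauchy A p s" "X = cauchy_class A p s"
    show ?thesis unfolding s(2)
      by (rule LIMSEQ_le_const[OF pre.nrm_cls[OF s(1)]]) (use D(1) pre.cauchy_in[OF s(1)] in blast)
  qed
  show ?thesis
  proof
    show "cstar_seminorm ?C (nrm ?C)"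
      unfolding cstar_seminorm_def
    proof (intro conjI ballI allI)
      fix X Y c assume X: "X \<in> carrier ?C"
      show "0 \<le> nrm ?C X" by (rule nonneg[OF X])
      obtain s where s: "seqcauchy A p s" "X = cauchy_class A p s" using X by (rule pre.completion_cases)
      show "nrm ?C (c \<odot>\<^bsub>?C\<^esub> X) = cmod c * nrm ?C X"
      proof (rule LIMSEQ_unique)
        show "(\<lambda>n. p (c \<odot> s n)) \<longlonglongrightarrow> nrm ?C (c \<odot>\<^bsub>?C\<^esub> X)"
          using pre.nrm_cls[OF pre.cauchy_smult[OF s(1)]] s by (simp add: ops)
        show "(\<lambda>n. p (c \<odot> s n)) \<longlonglongrightarrow> cmod c * nrm ?C X"
          using tendsto_mult_left[OF pre.nrm_cls[OF s(1)]] s by (simp add: D pre.cauchy_in)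
      qed
      show "nrm ?C (star ?C X \<otimes>\<^bsub>?C\<^esub> X) = (nrm ?C X)\<^sup>2"
      proof (rule LIMSEQ_unique)
        show "(\<lambda>n. p (star A (s n) \<otimes> s n)) \<longlonglongrightarrow> nrm ?C (star ?C X \<otimes>\<^bsub>?C\<^esub> X)"
          using pre.nrm_cls[OF pre.cauchy_mult[OF pre.cauchy_star[OF s(1)] s(1)]] s by (simp add: ops)
        show "(\<lambda>n. p (star A (s n) \<otimes> s n)) \<longlonglongrightarrow> (nrm ?C X)\<^sup>2"
          using tendsto_power[OF pre.nrm_cls[OF s(1)], of 2] s by (simp add: D pre.cauchy_in)
      qed
      assume Y: "Y \<in> carrier ?C"
      obtain t where t: "seqcauchy A p t" "Y = cauchy_class A p t" using Y by (rule pre.completion_cases)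
      show "nrm ?C (X \<oplus>\<^bsub>?C\<^esub> Y) \<le> nrm ?C X + nrm ?C Y"
      proof (rule LIMSEQ_le)
        show "(\<lambda>n. p (s n \<oplus> t n)) \<longlonglongrightarrow> nrm ?C (X \<oplus>\<^bsub>?C\<^esub> Y)"
          using pre.nrm_cls[OF pre.cauchy_add[OF s(1) t(1)]] s t by (simp add: ops)
        show "(\<lambda>n. p (s n) + p (t n)) \<longlonglongrightarrow> nrm ?C X + nrm ?C Y"
          using tendsto_add[OF pre.nrm_cls[OF s(1)] pre.nrm_cls[OF t(1)]] s t by simp
      qed (use D(3) pre.cauchy_in s t in blast)
      show "nrm ?C (X \<otimes>\<^bsub>?C\<^esub> Y) \<le> nrm ?C X * nrm ?C Y"
      proof (rule LIMSEQ_le)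
        show "(\<lambda>n. p (s n \<otimes> t n)) \<longlonglongrightarrow> nrm ?C (X \<otimes>\<^bsub>?C\<^esub> Y)"
          using pre.nrm_cls[OF pre.cauchy_mult[OF s(1) t(1)]] s t by (simp add: ops)
        show "(\<lambda>n. p (s n) * p (t n)) \<longlonglongrightarrow> nrm ?C X * nrm ?C Y"
          using tendsto_mult[OF pre.nrm_cls[OF s(1)] pre.nrm_cls[OF t(1)]] s t by simp
      qed (use D(4) pre.cauchy_in s t in blast)
    qed
  next
    fix X assume X: "X \<in> carrier ?C" "nrm ?C X = 0"
    obtain s where s: "seqcauchy A p s" "X = cauchy_class A p s" using X(1) by (rule pre.completion_cases)
    have "(\<lambda>n. p (s n)) \<longlonglongrightarrow> 0" using pre.nrm_cls[OF s(1)] s X(2) by simp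
    then show "X = \<zero>\<^bsub>?C\<^esub>"
      using s by (simp add: ops pre.cls_eq_iff smult_zero pre.cauchy_in)
  next
    show "seqcauchy ?C (nrm ?C) X \<Longrightarrow> \<exists>x\<in>carrier ?C. seqconv ?C (nrm ?C) X x" for X
      by (rule pre.completion_complete)
  qed
qed

section \<open>Semi-inner products and operator seminorms\<close>

lemma cnj_mult_self: "cnj z * z = complex_of_real ((cmod z)\<^sup>2)"
  by (simp only: complex_norm_square mult.commute)

lemma cauchy_schwarz_scalar:
  assumes a: "0 \<le> a" and b: "0 \<le> b" and pos: "\<And>c. 0 \<le> a + 2 * Re (c * z) + (cmod c)\<^sup>2 * b"
  shows "(cmod z)\<^sup>2 \<le> a * b"
proof (cases "b = 0")
  case True
  have "z = 0"
  proof (rule ccontr)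
    assume "z \<noteq> 0"
    \<comment> \<open>With b = 0 the positivity condition at \<open>- t * cnj z\<close> reads 0
      \<le> a - 2 t |z|^2; this t makes the right side equal to -1.\<close>
    define t where "t = (a + 1) / (2 * (cmod z)\<^sup>2)"
    have z: "0 < (cmod z)\<^sup>2" using \<open>z \<noteq> 0\<close> by simp
    have "Re (- of_real t * cnj z * z) = - t * (cmod z)\<^sup>2"
      by (simp add: mult.assoc cnj_mult_self flip: of_real_power)
    then have "0 \<le> a - 2 * (t * (cmod z)\<^sup>2)" using pos[of "- of_real t * cnj z"] True by simp
    moreover have "2 * (t * (cmod z)\<^sup>2) = a + 1" using z by (simp add: t_def)
    ultimately show False by simp
  qed
  then show ?thesis using a b by simp
next
  case False
  then have b0: "0 < b" using b by simp
  \<comment> \<open>The minimiser of the quadratic expression in c.\<close>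
  define c where "c = - of_real (inverse b) * cnj z"
  have "c * z = of_real (- inverse b * (cmod z)\<^sup>2)"
    by (simp only: c_def mult_minus_left mult.assoc cnj_mult_self of_real_mult of_real_minus)
  then have "Re (c * z) = - inverse b * (cmod z)\<^sup>2" by (simp only: Re_complex_of_real)
  moreover have "(cmod c)\<^sup>2 = (inverse b)\<^sup>2 * (cmod z)\<^sup>2"
    by (simp add: c_def norm_mult power_mult_distrib norm_inverse power_inverse)
  ultimately have "0 \<le> a - 2 * (inverse b * (cmod z)\<^sup>2) + (inverse b)\<^sup>2 * (cmod z)\<^sup>2 * b"
    using pos[of c] by simp
  also have "(inverse b)\<^sup>2 * (cmod z)\<^sup>2 * b = inverse b * (cmod z)\<^sup>2"
    using b0 by (simp add: field_simps power2_eq_square)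
  finally have "inverse b * (cmod z)\<^sup>2 \<le> a" by simp
  then show ?thesis using b0 by (simp add: field_simps)
qed

section \<open>Semi-inner product spaces\<close>

locale semi_inner =
  fixes T :: "('a, 'b) star_alg_scheme" (structure) and ip :: "'a \<Rightarrow> 'a \<Rightarrow> complex"
  assumes add_cl: "x \<in> carrier T \<Longrightarrow> y \<in> carrier T \<Longrightarrow> x \<oplus> y \<in> carrier T"
    and smult_cl: "x \<in> carrier T \<Longrightarrow> c \<odot> x \<in> carrier T"
    and ip_add: "w \<in> carrier T \<Longrightarrow> x \<in> carrier T \<Longrightarrow> y \<in> carrier T \<Longrightarrow> ip w (x \<oplus> y) = ip w x + ip w y"
    and ip_smult: "w \<in> carrier T \<Longrightarrow> x \<in> carrier T \<Longrightarrow> ip w (c \<odot> x) = c * ip w x"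
    and ip_sym: "w \<in> carrier T \<Longrightarrow> x \<in> carrier T \<Longrightarrow> ip x w = cnj (ip w x)"
    and ip_pos: "x \<in> carrier T \<Longrightarrow> 0 \<le> Re (ip x x)"
begin

definition len :: "'a \<Rightarrow> real" where "len x = sqrt (Re (ip x x))"

lemma len_nonneg: "x \<in> carrier T \<Longrightarrow> 0 \<le> len x"
  by (simp add: len_def ip_pos)

lemma len_square: "x \<in> carrier T \<Longrightarrow> (len x)\<^sup>2 = Re (ip x x)"
  by (simp add: len_def ip_pos)

lemma ip_self: "x \<in> carrier T \<Longrightarrow> ip x x = of_real ((len x)\<^sup>2)"
  using ip_sym[of x x] by (simp add: len_square complex_eq_iff)

lemma ip_add_left: "w \<in> carrier T \<Longrightarrow> x \<in> carrier T \<Longrightarrow> y \<in> carrier T \<Longrightarrow> ip (x \<oplus> y) w = ip x w + ip y w"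
  using ip_sym[of w "x \<oplus> y"] ip_sym[of w x] ip_sym[of w y] by (simp add: add_cl ip_add)

lemma ip_smult_left: "w \<in> carrier T \<Longrightarrow> x \<in> carrier T \<Longrightarrow> ip (c \<odot> x) w = cnj c * ip x w"
  using ip_sym[of w "c \<odot> x"] ip_sym[of w x] by (simp add: smult_cl ip_smult)

lemma len_add_square:
  assumes "x \<in> carrier T" "y \<in> carrier T"
  shows "(len (x \<oplus> y))\<^sup>2 = (len x)\<^sup>2 + 2 * Re (ip x y) + (len y)\<^sup>2"
  using assms ip_sym[of x y] by (simp add: len_square add_cl ip_add ip_add_left)

lemma len_smult: "x \<in> carrier T \<Longrightarrow> len (c \<odot> x) = cmod c * len x"
proof -
  assume x: "x \<in> carrier T"
  have "ip (c \<odot> x) (c \<odot> x) = (c * cnj c) * ip x x"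
    using x by (simp add: smult_cl ip_smult ip_smult_left)
  then have "Re (ip (c \<odot> x) (c \<odot> x)) = (cmod c)\<^sup>2 * (len x)\<^sup>2"
    using x by (simp add: ip_self cnj_mult_self mult.commute[of c] flip: of_real_mult of_real_power)
  then show ?thesis using x by (simp add: len_def[of "c \<odot> x"] real_sqrt_mult len_nonneg)
qed

lemma cauchy_schwarz:
  assumes x: "x \<in> carrier T" and y: "y \<in> carrier T"
  shows "cmod (ip x y) \<le> len x * len y"
proof -
  have "(cmod (ip x y))\<^sup>2 \<le> (len x)\<^sup>2 * (len y)\<^sup>2"
  proof (rule cauchy_schwarz_scalar)
    fix c
    have "0 \<le> (len (x \<oplus> c \<odot> y))\<^sup>2" by simp
    also have "\<dots> = (len x)\<^sup>2 + 2 * Re (c * ip x y) + (cmod c)\<^sup>2 * (len y)\<^sup>2"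
      using x y by (simp add: len_add_square smult_cl len_smult ip_smult power_mult_distrib)
    finally show "0 \<le> (len x)\<^sup>2 + 2 * Re (c * ip x y) + (cmod c)\<^sup>2 * (len y)\<^sup>2" .
  qed simp_all
  then have "(cmod (ip x y))\<^sup>2 \<le> (len x * len y)\<^sup>2" by (simp add: power_mult_distrib)
  then show ?thesis by (rule power2_le_imp_le) (use x y in \<open>simp add: len_nonneg\<close>)
qed

lemma len_triangle:
  assumes x: "x \<in> carrier T" and y: "y \<in> carrier T"
  shows "len (x \<oplus> y) \<le> len x + len y"
proof (rule power2_le_imp_le)
  have "Re (ip x y) \<le> len x * len y"
    using cauchy_schwarz[OF x y] complex_Re_le_cmod order_trans by blast
  then show "(len (x \<oplus> y))\<^sup>2 \<le> (len x + len y)\<^sup>2"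
    using x y by (simp add: len_add_square power2_sum)
qed (use x y len_nonneg in simp)

text \<open>Vectors with the same inner products differ by a null vector. This makes it harmless
  that the laws of an algebra hold for formal tensors only inside inner products.\<close>

lemma len_cong:
  assumes "x \<in> carrier T" "y \<in> carrier T" "\<And>w. w \<in> carrier T \<Longrightarrow> ip w x = ip w y"
  shows "len x = len y"
proof -
  have "ip x x = ip x y" "ip y x = ip y y" using assms by auto
  moreover have "ip y x = cnj (ip x y)" using assms by (intro ip_sym)
  ultimately show ?thesis by (metis len_def complex_cnj(1) complex.sel(1) complex_cnj_cancel_iff cnj.simps(1))
qed

end

text \<open>A family of semi-inner products on a *-algebra for which left multiplication is a bounded
  *-representation. The algebra laws are only required up to null vectors.\<close>

locale star_rep_family =
  fixes T :: "('a, 'b) star_alg_scheme" (structure) and S :: "('a \<Rightarrow> 'a \<Rightarrow> complex) set"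
  assumes one_cl: "\<one> \<in> carrier T" and zero_cl: "\<zero> \<in> carrier T"
    and mult_cl: "x \<in> carrier T \<Longrightarrow> y \<in> carrier T \<Longrightarrow> x \<otimes> y \<in> carrier T"
    and star_cl: "x \<in> carrier T \<Longrightarrow> star T x \<in> carrier T"
    and semi_inner: "i \<in> S \<Longrightarrow> semi_inner T i"
    and unit: "\<exists>i\<in>S. \<exists>y\<in>carrier T. i y y = 1"
    and rep_add: "i \<in> S \<Longrightarrow> w \<in> carrier T \<Longrightarrow> x \<in> carrier T \<Longrightarrow> y \<in> carrier T \<Longrightarrow> v \<in> carrier T \<Longrightarrow>
      i w ((x \<oplus> y) \<otimes> v) = i w (x \<otimes> v) + i w (y \<otimes> v)"
    and rep_smult: "i \<in> S \<Longrightarrow> w \<in> carrier T \<Longrightarrow> x \<in> carrier T \<Longrightarrow> v \<in> carrier T \<Longrightarrow>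
      i w ((c \<odot> x) \<otimes> v) = c * i w (x \<otimes> v)"
    and rep_mult: "i \<in> S \<Longrightarrow> w \<in> carrier T \<Longrightarrow> x \<in> carrier T \<Longrightarrow> y \<in> carrier T \<Longrightarrow> v \<in> carrier T \<Longrightarrow>
      i w ((x \<otimes> y) \<otimes> v) = i w (x \<otimes> (y \<otimes> v))"
    and rep_star: "i \<in> S \<Longrightarrow> w \<in> carrier T \<Longrightarrow> x \<in> carrier T \<Longrightarrow> v \<in> carrier T \<Longrightarrow>
      i (x \<otimes> w) v = i w (star T x \<otimes> v)"
    and rep_bounded: "x \<in> carrier T \<Longrightarrow> \<exists>C. \<forall>i\<in>S. \<forall>v\<in>carrier T.
      Re (i (x \<otimes> v) (x \<otimes> v)) \<le> C * Re (i v v)"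
begin

text \<open>The supremum runs over unit vectors rather than quotients of lengths, which is the form
  of the spatial norm, so that \<open>min_norm\<close> becomes an instance.\<close>

definition opnorm :: "'a \<Rightarrow> real" where
  "opnorm x = Sup {sqrt (Re (i (x \<otimes> v) (x \<otimes> v))) | i v. i \<in> S \<and> v \<in> carrier T \<and> i v v = 1}"

abbreviation "nm \<equiv> semi_inner.len"

lemma
  shows add_cl: "x \<in> carrier T \<Longrightarrow> y \<in> carrier T \<Longrightarrow> x \<oplus> y \<in> carrier T"
    and smult_cl: "x \<in> carrier T \<Longrightarrow> c \<odot> x \<in> carrier T"
  using unit semi_inner semi_inner.add_cl semi_inner.smult_cl by metis+

lemma opnorm_nonempty: "{sqrt (Re (i (x \<otimes> v) (x \<otimes> v))) | i v. i \<in> S \<and> v \<in> carrier T \<and> i v v = 1} \<noteq> {}"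
  using unit by blast

lemma opnorm_bdd:
  assumes "x \<in> carrier T"
  shows "bdd_above {sqrt (Re (i (x \<otimes> v) (x \<otimes> v))) | i v. i \<in> S \<and> v \<in> carrier T \<and> i v v = 1}"
proof -
  obtain C where C: "\<forall>i\<in>S. \<forall>v\<in>carrier T. Re (i (x \<otimes> v) (x \<otimes> v)) \<le> C * Re (i v v)"
    using rep_bounded[OF assms] by blast
  show ?thesis
  proof (rule bdd_aboveI[of _ "sqrt C"])
    fix r assume "r \<in> {sqrt (Re (i (x \<otimes> v) (x \<otimes> v))) | i v. i \<in> S \<and> v \<in> carrier T \<and> i v v = 1}"
    then obtain i v where "r = sqrt (Re (i (x \<otimes> v) (x \<otimes> v)))" "i \<in> S" "v \<in> carrier T" "i v v = 1" by blast
    then show "r \<le> sqrt C" using C by (metis mult.right_neutral one_complex.simps(1) real_sqrt_le_iff)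
  qed
qed

lemma opnorm_nonneg: "x \<in> carrier T \<Longrightarrow> 0 \<le> opnorm x"
proof -
  assume x: "x \<in> carrier T"
  obtain i v where iv: "i \<in> S" "v \<in> carrier T" "i v v = 1" using unit by blast
  interpret semi_inner T i using semi_inner iv by blast
  have "0 \<le> sqrt (Re (i (x \<otimes> v) (x \<otimes> v)))" using x iv mult_cl ip_pos by simp
  also have "\<dots> \<le> opnorm x" unfolding opnorm_def by (rule cSup_upper[OF _ opnorm_bdd[OF x]]) (use iv in blast)
  finally show ?thesis .
qed

lemma nm_mult_le:
  assumes x: "x \<in> carrier T" and i: "i \<in> S" and v: "v \<in> carrier T"
  shows "nm i (x \<otimes> v) \<le> opnorm x * nm i v"
proof -
  interpret semi_inner T i using semi_inner i by blast
  show ?thesis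
  proof (cases "len v = 0")
    \<comment> \<open>Null vectors do not contribute to the supremum in \<open>opnorm\<close>. The
      bound \<open>rep_bounded\<close> shows that \<open>x\<close> maps them to null
      vectors.\<close>
    case True
    obtain C where "\<forall>i\<in>S. \<forall>v\<in>carrier T. Re (i (x \<otimes> v) (x \<otimes> v)) \<le> C * Re (i v v)"
      using rep_bounded[OF x] by blast
    then have "(len (x \<otimes> v))\<^sup>2 \<le> C * (len v)\<^sup>2" using i v x mult_cl by (simp add: len_square)
    then show ?thesis using True by simp
  next
    case False
    then have l: "0 < len v" using len_nonneg[OF v] by simp
    define u where "u = of_real (inverse (len v)) \<odot> v"
    have u: "u \<in> carrier T" using v by (simp add: u_def smult_cl)
    have "len u = 1" using v l by (simp add: u_def len_smult norm_inverse)
    then have uu: "i u u = 1" using ip_self[OF u] by simp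
    have "len (x \<otimes> u) = len (of_real (inverse (len v)) \<odot> (x \<otimes> v))"
    proof (rule len_cong)
      fix w assume w: "w \<in> carrier T"
      have adj: "i w (x \<otimes> y) = i (star T x \<otimes> w) y" if "y \<in> carrier T" for y
        using rep_star[OF i that x w] ip_sym that x w mult_cl star_cl by metis
      show "i w (x \<otimes> u) = i w (of_real (inverse (len v)) \<odot> (x \<otimes> v))"
        using w x v u by (simp add: adj mult_cl star_cl ip_smult) (simp add: u_def mult_cl star_cl ip_smult)
    qed (use x u v mult_cl smult_cl in auto)
    also have "\<dots> = inverse (len v) * len (x \<otimes> v)" using x v l by (simp add: len_smult mult_cl norm_inverse)
    finally have "inverse (len v) * len (x \<otimes> v) \<le> opnorm x"
      using cSup_upper[OF _ opnorm_bdd[OF x], of "len (x \<otimes> u)"] i u uu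
      unfolding opnorm_def len_def[of "x \<otimes> u"] by force
    then show ?thesis using l by (simp add: field_simps)
  qed
qed

lemma opnorm_le:
  assumes x: "x \<in> carrier T" and C: "0 \<le> C"
    and le: "\<And>i v. i \<in> S \<Longrightarrow> v \<in> carrier T \<Longrightarrow> nm i (x \<otimes> v) \<le> C * nm i v"
  shows "opnorm x \<le> C"
  unfolding opnorm_def
proof (rule cSup_least[OF opnorm_nonempty])
  fix r assume "r \<in> {sqrt (Re (i (x \<otimes> v) (x \<otimes> v))) | i v. i \<in> S \<and> v \<in> carrier T \<and> i v v = 1}"
  then obtain i v where iv: "r = sqrt (Re (i (x \<otimes> v) (x \<otimes> v)))" "i \<in> S" "v \<in> carrier T" "i v v = 1" by blast
  interpret semi_inner T i using semi_inner iv by blast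
  have "len v = 1" using iv by (simp add: len_def)
  then show "r \<le> C" using le[OF iv(2,3)] iv by (simp add: len_def)
qed

lemma rep_linear:
  assumes i: "i \<in> S" and w: "w \<in> carrier T" and x: "x \<in> carrier T" and y: "y \<in> carrier T"
  shows "i w (x \<otimes> y) = i (star T x \<otimes> w) y"
proof -
  interpret semi_inner T i using semi_inner i by blast
  show ?thesis using rep_star[OF i y x w] ip_sym x y w mult_cl star_cl by metis
qed

lemma rep_star_star:
  assumes i: "i \<in> S" and w: "w \<in> carrier T" and x: "x \<in> carrier T" and y: "y \<in> carrier T"
  shows "i w (star T (star T x) \<otimes> y) = i w (x \<otimes> y)"
  using assms by (subst rep_star[symmetric]) (simp_all add: star_cl rep_linear[of i w x y])

text \<open>The form in which algebraic identities are used below: agreement of all matrix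
  coefficients is enough, and no equality in the carrier is required.\<close>

lemma opnorm_cong:
  assumes x: "x \<in> carrier T" and y: "y \<in> carrier T"
    and eq: "\<And>i v w. i \<in> S \<Longrightarrow> v \<in> carrier T \<Longrightarrow> w \<in> carrier T \<Longrightarrow> i w (x \<otimes> v) = i w (y \<otimes> v)"
  shows "opnorm x = opnorm y"
proof -
  have "Re (i (x \<otimes> v) (x \<otimes> v)) = Re (i (y \<otimes> v) (y \<otimes> v))" if "i \<in> S" "v \<in> carrier T" for i v
  proof -
    interpret semi_inner T i using semi_inner that by blast
    have "len (x \<otimes> v) = len (y \<otimes> v)"
      by (rule len_cong) (use that eq x y mult_cl in auto)
    then show ?thesis using that x y mult_cl by (simp flip: len_square)
  qed
  then show ?thesis unfolding opnorm_def by (metis (no_types, lifting))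
qed

lemma opnorm_add: "x \<in> carrier T \<Longrightarrow> y \<in> carrier T \<Longrightarrow> opnorm (x \<oplus> y) \<le> opnorm x + opnorm y"
proof (rule opnorm_le)
  assume x: "x \<in> carrier T" and y: "y \<in> carrier T"
  fix i v assume i: "i \<in> S" and v: "v \<in> carrier T"
  interpret semi_inner T i using semi_inner i by blast
  have "len ((x \<oplus> y) \<otimes> v) = len (x \<otimes> v \<oplus> y \<otimes> v)"
    by (rule len_cong) (use x y v i in \<open>auto simp: rep_add ip_add mult_cl add_cl\<close>)
  also have "\<dots> \<le> len (x \<otimes> v) + len (y \<otimes> v)" using x y v by (intro len_triangle mult_cl)
  also have "\<dots> \<le> opnorm x * len v + opnorm y * len v" using x y v i by (intro add_mono nm_mult_le)
  finally show "len ((x \<oplus> y) \<otimes> v) \<le> (opnorm x + opnorm y) * len v" by (simp add: algebra_simps)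
qed (use opnorm_nonneg add_cl in auto)

lemma opnorm_smult_le: "x \<in> carrier T \<Longrightarrow> opnorm (c \<odot> x) \<le> cmod c * opnorm x"
proof (rule opnorm_le)
  assume x: "x \<in> carrier T"
  fix i v assume i: "i \<in> S" and v: "v \<in> carrier T"
  interpret semi_inner T i using semi_inner i by blast
  have "len ((c \<odot> x) \<otimes> v) = len (c \<odot> (x \<otimes> v))"
    by (rule len_cong) (use x v i in \<open>auto simp: rep_smult ip_smult mult_cl smult_cl\<close>)
  also have "\<dots> = cmod c * len (x \<otimes> v)" using x v by (intro len_smult mult_cl)
  also have "\<dots> \<le> cmod c * (opnorm x * len v)" using x v i by (intro mult_left_mono nm_mult_le) auto
  finally show "len ((c \<odot> x) \<otimes> v) \<le> cmod c * opnorm x * len v" by simp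
qed (use opnorm_nonneg smult_cl in auto)

lemma opnorm_smult: "x \<in> carrier T \<Longrightarrow> opnorm (c \<odot> x) = cmod c * opnorm x"
proof (rule antisym[OF opnorm_smult_le])
  assume x: "x \<in> carrier T"
  show "cmod c * opnorm x \<le> opnorm (c \<odot> x)"
  proof (cases "c = 0")
    case True then show ?thesis using opnorm_nonneg[OF smult_cl[OF x]] by simp
  next
    case False
    have "opnorm x = opnorm (inverse c \<odot> (c \<odot> x))"
      by (rule opnorm_cong) (use x False in \<open>auto simp: rep_smult smult_cl\<close>)
    also have "\<dots> \<le> cmod (inverse c) * opnorm (c \<odot> x)" using x by (intro opnorm_smult_le smult_cl)
    finally show ?thesis using False by (simp add: norm_inverse norm_divide field_simps)
  qed
qed

lemma opnorm_mult: "x \<in> carrier T \<Longrightarrow> y \<in> carrier T \<Longrightarrow> opnorm (x \<otimes> y) \<le> opnorm x * opnorm y"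
proof (rule opnorm_le)
  assume x: "x \<in> carrier T" and y: "y \<in> carrier T"
  fix i v assume i: "i \<in> S" and v: "v \<in> carrier T"
  interpret semi_inner T i using semi_inner i by blast
  have "len ((x \<otimes> y) \<otimes> v) = len (x \<otimes> (y \<otimes> v))"
    by (rule len_cong) (use x y v i in \<open>auto simp: rep_mult mult_cl\<close>)
  also have "\<dots> \<le> opnorm x * len (y \<otimes> v)" using x y v i by (intro nm_mult_le mult_cl)
  also have "\<dots> \<le> opnorm x * (opnorm y * len v)"
    using x y v i by (intro mult_left_mono nm_mult_le opnorm_nonneg)
  finally show "len ((x \<otimes> y) \<otimes> v) \<le> opnorm x * opnorm y * len v" by simp
qed (use opnorm_nonneg mult_cl in auto)

lemma opnorm_cstar_ge: "x \<in> carrier T \<Longrightarrow> (opnorm x)\<^sup>2 \<le> opnorm (star T x \<otimes> x)"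
proof -
  assume x: "x \<in> carrier T"
  have xx: "star T x \<otimes> x \<in> carrier T" using x by (intro mult_cl star_cl)
  have "opnorm x \<le> sqrt (opnorm (star T x \<otimes> x))"
  proof (rule opnorm_le[OF x])
    fix i v assume i: "i \<in> S" and v: "v \<in> carrier T"
    interpret semi_inner T i using semi_inner i by blast
    have "(len (x \<otimes> v))\<^sup>2 = Re (i (x \<otimes> v) (x \<otimes> v))" using x v by (simp add: len_square mult_cl)
    also have "i (x \<otimes> v) (x \<otimes> v) = i v ((star T x \<otimes> x) \<otimes> v)"
      using x v i by (simp add: rep_star rep_mult mult_cl star_cl)
    also have "Re \<dots> \<le> len v * len ((star T x \<otimes> x) \<otimes> v)"
      using cauchy_schwarz[OF v mult_cl[OF xx v]] complex_Re_le_cmod order_trans by blast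
    also have "\<dots> \<le> len v * (opnorm (star T x \<otimes> x) * len v)"
      using v i xx by (intro mult_left_mono nm_mult_le len_nonneg)
    also have "\<dots> = (sqrt (opnorm (star T x \<otimes> x)) * len v)\<^sup>2"
      using opnorm_nonneg[OF xx] by (simp add: power_mult_distrib) (simp add: power2_eq_square)
    finally show "len (x \<otimes> v) \<le> sqrt (opnorm (star T x \<otimes> x)) * len v"
      by (rule power2_le_imp_le) (use v xx in \<open>simp add: len_nonneg opnorm_nonneg\<close>)
  qed (use xx opnorm_nonneg in simp)
  then have "(opnorm x)\<^sup>2 \<le> (sqrt (opnorm (star T x \<otimes> x)))\<^sup>2" using opnorm_nonneg[OF x] by (rule power_mono)
  then show ?thesis using opnorm_nonneg[OF xx] by simp
qed

lemma opnorm_star: "x \<in> carrier T \<Longrightarrow> opnorm (star T x) = opnorm x"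
proof -
  have le: "opnorm x \<le> opnorm (star T x)" if x: "x \<in> carrier T" for x
  proof (cases "opnorm x = 0")
    case True then show ?thesis using opnorm_nonneg[OF star_cl[OF x]] by simp
  next
    case False
    have "opnorm x * opnorm x \<le> opnorm (star T x) * opnorm x"
      using opnorm_cstar_ge[OF x] opnorm_mult[OF star_cl[OF x] x] by (simp add: power2_eq_square)
    then show ?thesis using False opnorm_nonneg[OF x] by simp
  qed
  assume x: "x \<in> carrier T"
  have "opnorm (star T (star T x)) = opnorm x"
    by (rule opnorm_cong) (use x in \<open>auto simp: star_cl rep_star_star\<close>)
  then show ?thesis using le[OF x] le[OF star_cl[OF x]] by simp
qed

lemma opnorm_cstar: "x \<in> carrier T \<Longrightarrow> opnorm (star T x \<otimes> x) = (opnorm x)\<^sup>2"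
  using opnorm_cstar_ge[of x] opnorm_mult[OF star_cl, of x x] opnorm_star[of x]
  by (simp add: power2_eq_square)

lemma cstar_seminorm_opnorm: "cstar_seminorm T opnorm"
  by (simp add: cstar_seminorm_def opnorm_nonneg opnorm_smult opnorm_add opnorm_mult opnorm_cstar)

lemma rep_add_right:
  assumes "i \<in> S" "w \<in> carrier T" "x \<in> carrier T" "u \<in> carrier T" "v \<in> carrier T"
  shows "i w (x \<otimes> (u \<oplus> v)) = i w (x \<otimes> u) + i w (x \<otimes> v)"
proof -
  interpret semi_inner T i using semi_inner assms by blast
  show ?thesis using assms by (simp add: rep_linear add_cl ip_add mult_cl star_cl)
qed

lemma rep_smult_right:
  assumes "i \<in> S" "w \<in> carrier T" "x \<in> carrier T" "v \<in> carrier T"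
  shows "i w (x \<otimes> (c \<odot> v)) = c * i w (x \<otimes> v)"
proof -
  interpret semi_inner T i using semi_inner assms by blast
  show ?thesis using assms by (simp add: rep_linear smult_cl ip_smult mult_cl star_cl)
qed

lemma rep_mult_add:
  assumes "i \<in> S" "w \<in> carrier T" "x \<in> carrier T" "y \<in> carrier T" "z \<in> carrier T" "v \<in> carrier T"
  shows "i w (x \<otimes> ((y \<oplus> z) \<otimes> v)) = i w (x \<otimes> (y \<otimes> v)) + i w (x \<otimes> (z \<otimes> v))"
  using assms by (simp add: rep_linear[of i w x] rep_add add_cl mult_cl star_cl)

lemma rep_mult_smult:
  assumes "i \<in> S" "w \<in> carrier T" "x \<in> carrier T" "y \<in> carrier T" "v \<in> carrier T"
  shows "i w (x \<otimes> ((c \<odot> y) \<otimes> v)) = c * i w (x \<otimes> (y \<otimes> v))"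
  using assms by (simp add: rep_linear[of i w x] rep_smult smult_cl mult_cl star_cl)

lemma rep_star_add:
  assumes "i \<in> S" "w \<in> carrier T" "x \<in> carrier T" "y \<in> carrier T" "v \<in> carrier T"
  shows "i w (star T (x \<oplus> y) \<otimes> v) = i w (star T x \<otimes> v) + i w (star T y \<otimes> v)"
proof -
  interpret semi_inner T i using semi_inner assms by blast
  have "i ((x \<oplus> y) \<otimes> w) v = cnj (i v ((x \<oplus> y) \<otimes> w))" by (rule ip_sym) (use assms add_cl mult_cl in auto)
  also have "\<dots> = i (x \<otimes> w) v + i (y \<otimes> w) v"
    using assms ip_sym[of v "x \<otimes> w"] ip_sym[of v "y \<otimes> w"] by (simp add: rep_add mult_cl)
  finally show ?thesis using assms by (simp add: rep_star add_cl)
qed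

lemma rep_star_smult:
  assumes "i \<in> S" "w \<in> carrier T" "x \<in> carrier T" "v \<in> carrier T"
  shows "i w (star T (c \<odot> x) \<otimes> v) = cnj c * i w (star T x \<otimes> v)"
proof -
  interpret semi_inner T i using semi_inner assms by blast
  have "i ((c \<odot> x) \<otimes> w) v = cnj (i v ((c \<odot> x) \<otimes> w))" by (rule ip_sym) (use assms smult_cl mult_cl in auto)
  also have "\<dots> = cnj c * i (x \<otimes> w) v"
    using assms ip_sym[of v "x \<otimes> w"] by (simp add: rep_smult mult_cl)
  finally show ?thesis using assms by (simp add: rep_star smult_cl)
qed

text \<open>Formal tensors have no additive inverses, so each property of the distance is reduced to
  an identity between matrix coefficients by \<open>opnorm_cong\<close>, and then to the
  corresponding property of the operator seminorm.\<close>

theorem prenormed_opnorm: "prenormed T opnorm (\<lambda>x y. opnorm (x \<oplus> (-1) \<odot> y))"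
proof
  note cl = add_cl smult_cl mult_cl star_cl
  note rep = rep_add rep_smult rep_mult rep_add_right rep_smult_right rep_star_add rep_star_smult
  fix x y z x' y' c assume x: "x \<in> carrier T"
  have "opnorm (x \<oplus> (-1) \<odot> x) = opnorm (0 \<odot> x)"
    by (rule opnorm_cong) (use x in \<open>auto simp: cl rep\<close>)
  then show "opnorm (x \<oplus> (-1) \<odot> x) = 0" using x by (simp add: opnorm_smult)
  assume y: "y \<in> carrier T"
  have "opnorm (x \<oplus> (-1) \<odot> y) = opnorm ((-1) \<odot> (y \<oplus> (-1) \<odot> x))"
    by (rule opnorm_cong) (use x y in \<open>auto simp: cl rep\<close>)
  then show "opnorm (x \<oplus> (-1) \<odot> y) = opnorm (y \<oplus> (-1) \<odot> x)"
    using x y by (simp add: opnorm_smult cl)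
  have "opnorm (c \<odot> x \<oplus> (-1) \<odot> (c \<odot> y)) = opnorm (c \<odot> (x \<oplus> (-1) \<odot> y))"
    by (rule opnorm_cong) (use x y in \<open>auto simp: cl rep algebra_simps\<close>)
  then show "opnorm (c \<odot> x \<oplus> (-1) \<odot> (c \<odot> y)) \<le> cmod c * opnorm (x \<oplus> (-1) \<odot> y)"
    using x y by (simp add: opnorm_smult cl)
  have "opnorm (star T x \<oplus> (-1) \<odot> star T y) = opnorm (star T (x \<oplus> (-1) \<odot> y))"
    by (rule opnorm_cong) (use x y in \<open>auto simp: cl rep\<close>)
  then show "opnorm (star T x \<oplus> (-1) \<odot> star T y) \<le> opnorm (x \<oplus> (-1) \<odot> y)"
    using x y by (simp add: opnorm_star cl)
  have "opnorm x = opnorm (y \<oplus> (x \<oplus> (-1) \<odot> y))"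
    by (rule opnorm_cong) (use x y in \<open>auto simp: cl rep\<close>)
  then show "opnorm x \<le> opnorm y + opnorm (x \<oplus> (-1) \<odot> y)"
    using x y by (simp add: opnorm_add cl)
  assume z: "z \<in> carrier T"
  have "opnorm (x \<oplus> (-1) \<odot> z) = opnorm ((x \<oplus> (-1) \<odot> y) \<oplus> (y \<oplus> (-1) \<odot> z))"
    by (rule opnorm_cong) (use x y z in \<open>auto simp: cl rep\<close>)
  then show "opnorm (x \<oplus> (-1) \<odot> z) \<le> opnorm (x \<oplus> (-1) \<odot> y) + opnorm (y \<oplus> (-1) \<odot> z)"
    using x y z by (simp add: opnorm_add cl)
next
  note cl = add_cl smult_cl mult_cl star_cl
  note rep = rep_add rep_smult rep_mult rep_mult_add rep_mult_smult
  fix x y x' y' assume xy: "x \<in> carrier T" "y \<in> carrier T" "x' \<in> carrier T" "y' \<in> carrier T"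
  have "opnorm (x \<oplus> y \<oplus> (-1) \<odot> (x' \<oplus> y')) = opnorm ((x \<oplus> (-1) \<odot> x') \<oplus> (y \<oplus> (-1) \<odot> y'))"
    by (rule opnorm_cong) (use xy in \<open>auto simp: cl rep\<close>)
  then show "opnorm (x \<oplus> y \<oplus> (-1) \<odot> (x' \<oplus> y')) \<le> opnorm (x \<oplus> (-1) \<odot> x') + opnorm (y \<oplus> (-1) \<odot> y')"
    using xy by (simp add: opnorm_add cl)
  have "opnorm (x \<otimes> y \<oplus> (-1) \<odot> (x' \<otimes> y')) =
      opnorm (x \<otimes> (y \<oplus> (-1) \<odot> y') \<oplus> (x \<oplus> (-1) \<odot> x') \<otimes> y')"
    by (rule opnorm_cong) (use xy in \<open>auto simp: cl rep\<close>)
  also have "\<dots> \<le> opnorm (x \<otimes> (y \<oplus> (-1) \<odot> y')) + opnorm ((x \<oplus> (-1) \<odot> x') \<otimes> y')"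
    using xy by (intro opnorm_add cl)
  also have "\<dots> \<le> opnorm x * opnorm (y \<oplus> (-1) \<odot> y') + opnorm (x \<oplus> (-1) \<odot> x') * opnorm y'"
    using xy by (intro add_mono opnorm_mult cl)
  finally show "opnorm (x \<otimes> y \<oplus> (-1) \<odot> (x' \<otimes> y')) \<le>
    opnorm x * opnorm (y \<oplus> (-1) \<odot> y') + opnorm (x \<oplus> (-1) \<odot> x') * opnorm y'" .
qed (simp_all add: one_cl zero_cl add_cl mult_cl smult_cl star_cl opnorm_nonneg)

end

section \<open>Positive functionals\<close>

definition lin :: "('a, 'b) star_alg_scheme \<Rightarrow> ('a \<Rightarrow> complex) \<Rightarrow> bool" where
  "lin A \<phi> \<longleftrightarrow> (\<forall>x\<in>carrier A. \<forall>y\<in>carrier A. \<phi> (x \<oplus>\<^bsub>A\<^esub> y) = \<phi> x + \<phi> y) \<and>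
     (\<forall>c. \<forall>x\<in>carrier A. \<phi> (c \<odot>\<^bsub>A\<^esub> x) = c * \<phi> x)"

lemma lin_add: "lin A \<phi> \<Longrightarrow> x \<in> carrier A \<Longrightarrow> y \<in> carrier A \<Longrightarrow> \<phi> (x \<oplus>\<^bsub>A\<^esub> y) = \<phi> x + \<phi> y"
  by (simp add: lin_def)

lemma lin_smult: "lin A \<phi> \<Longrightarrow> x \<in> carrier A \<Longrightarrow> \<phi> (c \<odot>\<^bsub>A\<^esub> x) = c * \<phi> x"
  by (simp add: lin_def)

lemma state_lin: "state A \<phi> \<Longrightarrow> lin A \<phi>"
  by (auto simp: state_def lin_def)

lemma state_one: "state A \<phi> \<Longrightarrow> \<phi> \<one>\<^bsub>A\<^esub> = 1"
  by (simp add: state_def)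

lemma state_pos: "state A \<phi> \<Longrightarrow> x \<in> carrier A \<Longrightarrow> 0 \<le> Re (\<phi> (star A x \<otimes>\<^bsub>A\<^esub> x))"
  by (simp add: state_def)

lemma state_pos_Im: "state A \<phi> \<Longrightarrow> x \<in> carrier A \<Longrightarrow> Im (\<phi> (star A x \<otimes>\<^bsub>A\<^esub> x)) = 0"
  by (simp add: state_def)

context star_algebra
begin

lemma A_star: "star_algebra A" by unfold_locales

lemmas cl = star_algebra_closed[OF A_star]
lemmas rules = star_algebra_rules[OF A_star]

lemma lin_zero: "lin A \<phi> \<Longrightarrow> \<phi> \<zero> = 0"
  using lin_smult[of A \<phi> \<zero> 0] by (simp add: smult_zero)

text \<open>Polarisation: the value at (x + c y)* (x + c y) is real for c = 1 and for c = i, which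
  fixes the imaginary and the real part of the difference.\<close>

lemma state_sym:
  assumes \<phi>: "state A \<phi>" and x: "x \<in> carrier A" and y: "y \<in> carrier A"
  shows "\<phi> (star A y \<otimes> x) = cnj (\<phi> (star A x \<otimes> y))"
proof -
  note L = lin_add[OF state_lin[OF \<phi>]] lin_smult[OF state_lin[OF \<phi>]]
  have expand: "\<phi> (star A (x \<oplus> c \<odot> y) \<otimes> (x \<oplus> c \<odot> y)) = \<phi> (star A x \<otimes> x) + c * \<phi> (star A x \<otimes> y) +
      cnj c * \<phi> (star A y \<otimes> x) + cnj c * c * \<phi> (star A y \<otimes> y)" for c
    using x y by (simp add: rules cl L algebra_simps)
  have "Im (\<phi> (star A (x \<oplus> c \<odot> y) \<otimes> (x \<oplus> c \<odot> y))) = 0" for c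
    using x y by (intro state_pos_Im[OF \<phi>] cl)
  from this[of 1] this[of \<i>] show ?thesis
    using state_pos_Im[OF \<phi> x] state_pos_Im[OF \<phi> y] by (simp add: expand complex_eq_iff)
qed

lemma semi_inner_state:
  assumes \<phi>: "state A \<phi>"
  shows "semi_inner A (\<lambda>v w. \<phi> (star A v \<otimes> w))"
proof
  show "\<phi> (star A x \<otimes> w) = cnj (\<phi> (star A w \<otimes> x))" if "w \<in> carrier A" "x \<in> carrier A" for w x
    using that by (rule state_sym[OF \<phi>])
qed (simp_all add: rules cl lin_add[OF state_lin[OF \<phi>]] lin_smult[OF state_lin[OF \<phi>]] state_pos[OF \<phi>])

lemma state_cauchy_schwarz:
  assumes \<phi>: "state A \<phi>" and x: "x \<in> carrier A" and y: "y \<in> carrier A"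
  shows "cmod (\<phi> (star A x \<otimes> y)) \<le> sqrt (Re (\<phi> (star A x \<otimes> x))) * sqrt (Re (\<phi> (star A y \<otimes> y)))"
proof -
  interpret i: semi_inner A "\<lambda>v w. \<phi> (star A v \<otimes> w)" by (rule semi_inner_state[OF \<phi>])
  show ?thesis using i.cauchy_schwarz[OF x y] by (simp add: i.len_def)
qed

lemma state_null_left:
  assumes \<phi>: "state A \<phi>" and x: "x \<in> carrier A" and y: "y \<in> carrier A"
    and "\<phi> (star A x \<otimes> x) = 0"
  shows "\<phi> (star A x \<otimes> y) = 0"
  using state_cauchy_schwarz[OF \<phi> x y] assms(4) by simp

lemma state_norm_le:
  assumes \<phi>: "state A \<phi>" and x: "x \<in> carrier A"
  shows "cmod (\<phi> x) \<le> sqrt (Re (\<phi> (star A x \<otimes> x)))"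
  using state_cauchy_schwarz[OF \<phi> one_closed x] x by (simp add: star_one state_one[OF \<phi>])

text \<open>The GNS representation.\<close>

lemma star_rep_family_state:
  assumes \<phi>: "state A \<phi>"
    and bdd: "\<And>x. x \<in> carrier A \<Longrightarrow> \<exists>C. \<forall>v\<in>carrier A.
      Re (\<phi> (star A (x \<otimes> v) \<otimes> (x \<otimes> v))) \<le> C * Re (\<phi> (star A v \<otimes> v))"
  shows "star_rep_family A {\<lambda>v w. \<phi> (star A v \<otimes> w)}"
proof (rule star_rep_family.intro)
  show "\<exists>i\<in>{\<lambda>v w. \<phi> (star A v \<otimes> w)}. \<exists>y\<in>carrier A. i y y = 1"
    using state_one[OF \<phi>] by (auto intro!: bexI[of _ \<one>] simp: star_one)
  show "i \<in> {\<lambda>v w. \<phi> (star A v \<otimes> w)} \<Longrightarrow> semi_inner A i" for i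
    using semi_inner_state[OF \<phi>] by simp
qed (use lin_add[OF state_lin[OF \<phi>]] lin_smult[OF state_lin[OF \<phi>]] bdd in \<open>auto simp: rules cl\<close>)

text \<open>The seminorm is the operator norm of the GNS representation, tested on the cyclic vector
  \<one>. Boundedness is assumed because the algebra need not be complete.\<close>

lemma state_square_le_cstar_seminorm:
  assumes \<phi>: "state A \<phi>"
    and bdd: "\<And>x. x \<in> carrier A \<Longrightarrow> \<exists>C. \<forall>v\<in>carrier A.
      Re (\<phi> (star A (x \<otimes> v) \<otimes> (x \<otimes> v))) \<le> C * Re (\<phi> (star A v \<otimes> v))"
  obtains q where "cstar_seminorm A q" "\<And>x. x \<in> carrier A \<Longrightarrow> Re (\<phi> (star A x \<otimes> x)) \<le> (q x)\<^sup>2"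
proof -
  interpret R: star_rep_family A "{\<lambda>v w. \<phi> (star A v \<otimes> w)}" by (rule star_rep_family_state[OF assms])
  show thesis
  proof (rule that[OF R.cstar_seminorm_opnorm])
    interpret i: semi_inner A "\<lambda>v w. \<phi> (star A v \<otimes> w)" by (rule semi_inner_state[OF \<phi>])
    fix x assume x: "x \<in> carrier A"
    have "i.len \<one> = 1" using state_one[OF \<phi>] by (simp add: i.len_def star_one)
    then have "i.len x \<le> R.opnorm x"
      using R.nm_mult_le[OF x _ one_closed, of "\<lambda>v w. \<phi> (star A v \<otimes> w)"] x by simp
    then show "Re (\<phi> (star A x \<otimes> x)) \<le> (R.opnorm x)\<^sup>2"
      using i.len_square[OF x] i.len_nonneg[OF x] by (metis power_mono)
  qed
qed

end

section \<open>Formal tensors\<close>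

context star_algebra
begin

abbreviation "T \<equiv> formal_tensor A A"

section \<open>The algebra of lists of elementary tensors\<close>

lemma T_simps:
  "carrier T = lists (carrier A \<times> carrier A)" "\<one>\<^bsub>T\<^esub> = [(\<one>, \<one>)]" "\<zero>\<^bsub>T\<^esub> = []"
  "s \<oplus>\<^bsub>T\<^esub> t = s @ t"
  "c \<odot>\<^bsub>T\<^esub> [] = []" "c \<odot>\<^bsub>T\<^esub> ((a, b) # s) = (c \<odot> a, b) # c \<odot>\<^bsub>T\<^esub> s" "c \<odot>\<^bsub>T\<^esub> (s @ t) = c \<odot>\<^bsub>T\<^esub> s @ c \<odot>\<^bsub>T\<^esub> t"
  "star T [] = []" "star T ((a, b) # s) = (star A a, star A b) # star T s" "star T (s @ t) = star T s @ star T t"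
  "[] \<otimes>\<^bsub>T\<^esub> t = []" "((a, b) # s) \<otimes>\<^bsub>T\<^esub> t = map (\<lambda>(a', b'). (a \<otimes> a', b \<otimes> b')) t @ s \<otimes>\<^bsub>T\<^esub> t"
  "(s @ s') \<otimes>\<^bsub>T\<^esub> t = s \<otimes>\<^bsub>T\<^esub> t @ s' \<otimes>\<^bsub>T\<^esub> t"
  by (simp_all add: formal_tensor_def)

lemma tf_simps:
  "tensor_functional \<phi> \<psi> [] = 0"
  "tensor_functional \<phi> \<psi> ((a, b) # t) = \<phi> a * \<psi> b + tensor_functional \<phi> \<psi> t"
  "tensor_functional \<phi> \<psi> (s @ t) = tensor_functional \<phi> \<psi> s + tensor_functional \<phi> \<psi> t"
  by (simp_all add: tensor_functional_def)

lemma map_mult_in: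
  "a \<in> carrier A \<Longrightarrow> b \<in> carrier A \<Longrightarrow> t \<in> carrier T \<Longrightarrow> map (\<lambda>(a', b'). (a \<otimes> a', b \<otimes> b')) t \<in> carrier T"
  by (induction t) (auto simp: T_simps)

lemma T_closed:
  "\<one>\<^bsub>T\<^esub> \<in> carrier T" "\<zero>\<^bsub>T\<^esub> \<in> carrier T"
  "s \<in> carrier T \<Longrightarrow> t \<in> carrier T \<Longrightarrow> s \<oplus>\<^bsub>T\<^esub> t \<in> carrier T"
  "s \<in> carrier T \<Longrightarrow> t \<in> carrier T \<Longrightarrow> s \<otimes>\<^bsub>T\<^esub> t \<in> carrier T"
  "s \<in> carrier T \<Longrightarrow> c \<odot>\<^bsub>T\<^esub> s \<in> carrier T"
  "s \<in> carrier T \<Longrightarrow> star T s \<in> carrier T"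
proof -
  show "\<one>\<^bsub>T\<^esub> \<in> carrier T" "\<zero>\<^bsub>T\<^esub> \<in> carrier T" "s \<in> carrier T \<Longrightarrow> t \<in> carrier T \<Longrightarrow> s \<oplus>\<^bsub>T\<^esub> t \<in> carrier T"
    by (simp_all add: T_simps)
  show "s \<in> carrier T \<Longrightarrow> t \<in> carrier T \<Longrightarrow> s \<otimes>\<^bsub>T\<^esub> t \<in> carrier T"
  proof (induction s)
    case (Cons x s)
    then show ?case using map_mult_in[of "fst x" "snd x" t] by (cases x) (auto simp: T_simps)
  qed (simp add: T_simps)
  show "s \<in> carrier T \<Longrightarrow> c \<odot>\<^bsub>T\<^esub> s \<in> carrier T"
    by (induction s) (auto simp: T_simps cl)
  show "s \<in> carrier T \<Longrightarrow> star T s \<in> carrier T"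
    by (induction s) (auto simp: T_simps cl)
qed

lemma T_closed_simps:
  "[] \<in> carrier T" "(a, b) # t \<in> carrier T \<longleftrightarrow> a \<in> carrier A \<and> b \<in> carrier A \<and> t \<in> carrier T"
  "s @ t \<in> carrier T \<longleftrightarrow> s \<in> carrier T \<and> t \<in> carrier T"
  by (auto simp: T_simps)

lemma T_induct [consumes 1, case_names Nil Cons]:
  assumes "t \<in> carrier T" "P []"
    "\<And>a b t. a \<in> carrier A \<Longrightarrow> b \<in> carrier A \<Longrightarrow> t \<in> carrier T \<Longrightarrow> P t \<Longrightarrow> P ((a, b) # t)"
  shows "P t"
  using assms(1)
proof (induction t)
  case (Cons x t)
  then show ?case using assms(3)[of "fst x" "snd x" t] by (cases x) (auto simp: T_closed_simps)
qed (use assms(2) in simp)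

lemma tf_smult:
  assumes "lin A \<phi>" "s \<in> carrier T"
  shows "tensor_functional \<phi> \<psi> (c \<odot>\<^bsub>T\<^esub> s) = c * tensor_functional \<phi> \<psi> s"
  using assms(2) by (induction s rule: T_induct) (simp_all add: T_simps tf_simps lin_smult[OF assms(1)] algebra_simps)

lemma tf_map_mult:
  "tensor_functional \<phi> \<psi> (map (\<lambda>(a', b'). (a \<otimes> a', b \<otimes> b')) t) =
    tensor_functional (\<lambda>x. \<phi> (a \<otimes> x)) (\<lambda>y. \<psi> (b \<otimes> y)) t"
  by (induction t) (auto simp: tf_simps)

lemma tf_mult_Cons:
  "tensor_functional \<phi> \<psi> (((a, b) # s) \<otimes>\<^bsub>T\<^esub> t) =
    tensor_functional (\<lambda>x. \<phi> (a \<otimes> x)) (\<lambda>y. \<psi> (b \<otimes> y)) t + tensor_functional \<phi> \<psi> (s \<otimes>\<^bsub>T\<^esub> t)"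
  by (simp add: T_simps tf_simps tf_map_mult)

lemma tf_mult_Nil_right: "tensor_functional \<phi> \<psi> (s \<otimes>\<^bsub>T\<^esub> []) = 0"
  by (induction s) (auto simp: T_simps tf_simps)

lemma tf_mult_Cons_right:
  "tensor_functional \<phi> \<psi> (s \<otimes>\<^bsub>T\<^esub> ((c, d) # t)) =
    tensor_functional (\<lambda>x. \<phi> (x \<otimes> c)) (\<lambda>y. \<psi> (y \<otimes> d)) s + tensor_functional \<phi> \<psi> (s \<otimes>\<^bsub>T\<^esub> t)"
proof (induction s)
  case (Cons x s)
  then show ?case by (cases x) (simp add: tf_mult_Cons tf_simps)
qed (simp add: T_simps tf_simps)

lemma tf_mult_append_right:
  "tensor_functional \<phi> \<psi> (s \<otimes>\<^bsub>T\<^esub> (t @ u)) = tensor_functional \<phi> \<psi> (s \<otimes>\<^bsub>T\<^esub> t) + tensor_functional \<phi> \<psi> (s \<otimes>\<^bsub>T\<^esub> u)"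
proof (induction s)
  case (Cons x s)
  then show ?case by (cases x) (simp add: tf_mult_Cons tf_simps)
qed (simp add: T_simps tf_simps)

lemma lin_mult_left: "lin A \<phi> \<Longrightarrow> a \<in> carrier A \<Longrightarrow> lin A (\<lambda>x. \<phi> (a \<otimes> x))"
  by (simp add: lin_def rules cl)

lemma lin_mult_right: "lin A \<phi> \<Longrightarrow> a \<in> carrier A \<Longrightarrow> lin A (\<lambda>x. \<phi> (x \<otimes> a))"
  by (simp add: lin_def rules cl)

lemma lin_star: "lin A \<phi> \<Longrightarrow> lin A (\<lambda>x. cnj (\<phi> (star A x)))"
  by (simp add: lin_def rules cl)

text \<open>Equality in the algebraic tensor product, whose points are separated by products of linear
  functionals.\<close>

definition teq :: "('a \<times> 'a) list \<Rightarrow> ('a \<times> 'a) list \<Rightarrow> bool" where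
  "teq s t \<longleftrightarrow> s \<in> carrier T \<and> t \<in> carrier T \<and>
    (\<forall>\<phi> \<psi>. lin A \<phi> \<longrightarrow> lin A \<psi> \<longrightarrow> tensor_functional \<phi> \<psi> s = tensor_functional \<phi> \<psi> t)"

lemma teqD: "teq s t \<Longrightarrow> lin A \<phi> \<Longrightarrow> lin A \<psi> \<Longrightarrow> tensor_functional \<phi> \<psi> s = tensor_functional \<phi> \<psi> t"
  by (simp add: teq_def)

lemma teq_in: "teq s t \<Longrightarrow> s \<in> carrier T" "teq s t \<Longrightarrow> t \<in> carrier T"
  by (simp_all add: teq_def)

lemma teq_refl: "s \<in> carrier T \<Longrightarrow> teq s s"
  by (simp add: teq_def)

lemma teq_sym: "teq s t \<Longrightarrow> teq t s"
  by (simp add: teq_def)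

lemma teq_trans: "teq s t \<Longrightarrow> teq t u \<Longrightarrow> teq s u"
  by (simp add: teq_def)

lemma teq_append: "teq s s' \<Longrightarrow> teq t t' \<Longrightarrow> teq (s @ t) (s' @ t')"
  by (simp add: teq_def tf_simps T_closed_simps)

lemma teq_smult: "teq s s' \<Longrightarrow> teq (c \<odot>\<^bsub>T\<^esub> s) (c \<odot>\<^bsub>T\<^esub> s')"
  by (simp add: teq_def tf_smult T_closed)

lemma tf_mult_cong_right:
  assumes "s \<in> carrier T" "teq t t'" "lin A \<phi>" "lin A \<psi>"
  shows "tensor_functional \<phi> \<psi> (s \<otimes>\<^bsub>T\<^esub> t) = tensor_functional \<phi> \<psi> (s \<otimes>\<^bsub>T\<^esub> t')"
  using assms(1) by (induction s rule: T_induct)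
    (simp_all add: T_simps(11) tf_mult_Cons teqD[OF assms(2)] lin_mult_left assms)

lemma tf_mult_cong_left:
  assumes "t \<in> carrier T" "teq s s'" "lin A \<phi>" "lin A \<psi>"
  shows "tensor_functional \<phi> \<psi> (s \<otimes>\<^bsub>T\<^esub> t) = tensor_functional \<phi> \<psi> (s' \<otimes>\<^bsub>T\<^esub> t)"
  using assms(1) by (induction t rule: T_induct)
    (simp_all add: tf_mult_Nil_right tf_mult_Cons_right teqD[OF assms(2)] lin_mult_right assms)

lemma teq_mult: "teq s s' \<Longrightarrow> teq t t' \<Longrightarrow> teq (s \<otimes>\<^bsub>T\<^esub> t) (s' \<otimes>\<^bsub>T\<^esub> t')"
  using tf_mult_cong_left[of t s s'] tf_mult_cong_right[of s' t t']
  by (auto simp: teq_def T_closed)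

lemma tf_star:
  "s \<in> carrier T \<Longrightarrow> tensor_functional \<phi> \<psi> (star T s) =
    cnj (tensor_functional (\<lambda>x. cnj (\<phi> (star A x))) (\<lambda>x. cnj (\<psi> (star A x))) s)"
  by (induction s rule: T_induct) (simp_all add: T_simps tf_simps)

lemma teq_star: "teq s s' \<Longrightarrow> teq (star T s) (star T s')"
  by (auto simp: teq_def T_closed tf_star lin_star)

lemma T_mult_assoc:
  assumes "s \<in> carrier T" "t \<in> carrier T" "u \<in> carrier T"
  shows "(s \<otimes>\<^bsub>T\<^esub> t) \<otimes>\<^bsub>T\<^esub> u = s \<otimes>\<^bsub>T\<^esub> (t \<otimes>\<^bsub>T\<^esub> u)"
  using assms(1)
proof (induction s rule: T_induct)
  case (Cons a b s)
  have "map (\<lambda>(a', b'). (a \<otimes> a', b \<otimes> b')) t \<otimes>\<^bsub>T\<^esub> u = map (\<lambda>(a', b'). (a \<otimes> a', b \<otimes> b')) (t \<otimes>\<^bsub>T\<^esub> u)"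
    using assms(2)
  proof (induction t rule: T_induct)
    case (Cons c d t)
    have "map (\<lambda>(a', b'). (a \<otimes> c \<otimes> a', b \<otimes> d \<otimes> b')) u =
        map (\<lambda>(a', b'). (a \<otimes> a', b \<otimes> b')) (map (\<lambda>(a', b'). (c \<otimes> a', d \<otimes> b')) u)"
      using assms(3) \<open>a \<in> carrier A\<close> \<open>b \<in> carrier A\<close> Cons.hyps
      by (induction u rule: T_induct) (simp_all add: m_assoc)
    then show ?case using Cons by (simp add: T_simps)
  qed (simp add: T_simps)
  then show ?case using Cons by (simp add: T_simps)
qed (simp add: T_simps)

lemma T_smult_mult:
  assumes "s \<in> carrier T" "t \<in> carrier T" shows "(c \<odot>\<^bsub>T\<^esub> s) \<otimes>\<^bsub>T\<^esub> t = c \<odot>\<^bsub>T\<^esub> (s \<otimes>\<^bsub>T\<^esub> t)"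
  using assms(1)
proof (induction s rule: T_induct)
  case (Cons a b s)
  have "map (\<lambda>(a', b'). ((c \<odot> a) \<otimes> a', b \<otimes> b')) t = c \<odot>\<^bsub>T\<^esub> map (\<lambda>(a', b'). (a \<otimes> a', b \<otimes> b')) t"
    using assms(2) Cons.hyps by (induction t rule: T_induct) (simp_all add: T_simps rules)
  then show ?case using Cons by (simp add: T_simps)
qed (simp add: T_simps)

lemma T_mult_one: "s \<in> carrier T \<Longrightarrow> s \<otimes>\<^bsub>T\<^esub> [(\<one>, \<one>)] = s"
  by (induction s rule: T_induct) (simp_all add: T_simps)

lemma T_one_mult: "s \<in> carrier T \<Longrightarrow> [(\<one>, \<one>)] \<otimes>\<^bsub>T\<^esub> s = s"
  by (induction s rule: T_induct) (simp_all add: T_simps)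

text \<open>The two lists contain the same pairs in a different order, so only equality as tensors
  holds; associativity, in contrast, is an equality of lists.\<close>

lemma teq_star_mult:
  assumes "s \<in> carrier T" "t \<in> carrier T"
  shows "teq (star T (s \<otimes>\<^bsub>T\<^esub> t)) (star T t \<otimes>\<^bsub>T\<^esub> star T s)"
proof -
  have "tensor_functional \<phi> \<psi> (star T (s \<otimes>\<^bsub>T\<^esub> t)) = tensor_functional \<phi> \<psi> (star T t \<otimes>\<^bsub>T\<^esub> star T s)"
    for \<phi> \<psi>
    using assms(1)
  proof (induction s rule: T_induct)
    case Nil then show ?case by (simp add: T_simps tf_simps tf_mult_Nil_right)
  next
    case (Cons a b s)
    have "tensor_functional \<phi> \<psi> (star T (map (\<lambda>(a', b'). (a \<otimes> a', b \<otimes> b')) t)) =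
        tensor_functional (\<lambda>x. \<phi> (x \<otimes> star A a)) (\<lambda>y. \<psi> (y \<otimes> star A b)) (star T t)"
      using assms(2) Cons.hyps by (induction t rule: T_induct) (simp_all add: T_simps tf_simps rules)
    then show ?case using Cons by (simp add: T_simps tf_simps tf_mult_Cons_right)
  qed
  then show ?thesis using assms by (simp add: teq_def T_closed)
qed

section \<open>The product of two states as a semi-inner product\<close>

definition tip :: "('a \<Rightarrow> complex) \<Rightarrow> ('a \<Rightarrow> complex) \<Rightarrow> ('a \<times> 'a) list \<Rightarrow> ('a \<times> 'a) list \<Rightarrow> complex" where
  "tip \<phi> \<psi> s t = tensor_functional \<phi> \<psi> (star T s \<otimes>\<^bsub>T\<^esub> t)"

lemma tip_cong:
  assumes "teq s s'" "teq t t'" "state A \<phi>" "state A \<psi>"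
  shows "tip \<phi> \<psi> s t = tip \<phi> \<psi> s' t'"
  unfolding tip_def using teq_mult[OF teq_star[OF assms(1)] assms(2)] state_lin assms by (intro teqD) auto

lemma tip_sym:
  assumes \<phi>: "state A \<phi>" and \<psi>: "state A \<psi>" and "s \<in> carrier T" "t \<in> carrier T"
  shows "tip \<phi> \<psi> s t = cnj (tip \<phi> \<psi> t s)"
  unfolding tip_def using assms(3)
proof (induction s rule: T_induct)
  case Nil then show ?case by (simp add: T_simps tf_simps tf_mult_Nil_right)
next
  case (Cons a b s)
  have "tensor_functional (\<lambda>x. \<phi> (star A a \<otimes> x)) (\<lambda>y. \<psi> (star A b \<otimes> y)) t =
      cnj (tensor_functional (\<lambda>x. \<phi> (x \<otimes> a)) (\<lambda>y. \<psi> (y \<otimes> b)) (star T t))"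
    using assms(4)
  proof (induction t rule: T_induct)
    case Nil then show ?case by (simp add: T_simps tf_simps)
  next
    case (Cons c d t)
    then show ?case using state_sym[OF \<phi>, of c a] state_sym[OF \<psi>, of d b] \<open>a \<in> carrier A\<close> \<open>b \<in> carrier A\<close>
      by (simp add: T_simps tf_simps)
  qed
  then show ?case using Cons by (simp add: T_simps tf_simps tf_mult_Cons_right tf_mult_Cons del: T_simps(12))
qed

text \<open>Positivity of \<open>\<phi> \<otimes> \<psi>\<close> by the Gram-Schmidt process in the first leg.\<close>

lemma tip_pos:
  assumes \<phi>: "state A \<phi>" and \<psi>: "state A \<psi>" and t: "t \<in> carrier T"
  shows "0 \<le> Re (tip \<phi> \<psi> t t)"
  using t
proof (induction "length t" arbitrary: t rule: less_induct)
  case less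
  note \<phi>L = lin_add[OF state_lin[OF \<phi>]] lin_smult[OF state_lin[OF \<phi>]]
  show ?case
  proof (cases t)
    case Nil then show ?thesis by (simp add: tip_def T_simps tf_simps)
  next
    case (Cons ab t')
    obtain a b where ab: "ab = (a, b)" by (cases ab)
    have in_c: "a \<in> carrier A" "b \<in> carrier A" "t' \<in> carrier T"
      using less.prems Cons ab by (auto simp: T_closed_simps)
    define n where "n = \<phi> (star A a \<otimes> a)"
    \<comment> \<open>The coefficient of the projection of \<open>x\<close> onto \<open>a\<close>.
      If \<open>a\<close> is a null vector for \<phi>, then every \<open>x\<close> is orthogonal to
      it by the Cauchy-Schwarz inequality, so 0 is the right value.\<close>
    define l where "l x = (if n = 0 then 0 else \<phi> (star A a \<otimes> x) / n)" for x
    define t'' where "t'' = map (\<lambda>(x, y). (x \<oplus> (- l x) \<odot> a, y)) t'"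
    \<comment> \<open>The components along \<open>a\<close> are collected in the second leg of the
      first pair, so that the tensor itself does not change.\<close>
    define b' where "b' = foldr (\<lambda>(x, y) s. (l x \<odot> y) \<oplus> s) t' b"
    have t''_in: "t'' \<in> carrier T" unfolding t''_def
      using in_c(3) in_c(1) by (induction t' rule: T_induct) (auto simp: T_closed_simps cl)
    have b'_in: "b' \<in> carrier A" unfolding b'_def
      using in_c(3) in_c(2) by (induction t' rule: T_induct) (auto simp: cl)
    have teq: "teq t ((a, b') # t'')"
    proof -
      have "\<phi>' a * \<psi>' b + tensor_functional \<phi>' \<psi>' t' = \<phi>' a * \<psi>' b' + tensor_functional \<phi>' \<psi>' t''"
        if L: "lin A \<phi>'" "lin A \<psi>'" for \<phi>' \<psi>'
        unfolding t''_def b'_def using in_c(3)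
      proof (induction t' rule: T_induct)
        case (Cons x y u)
        have "foldr (\<lambda>(x, y) s. l x \<odot> y \<oplus> s) u b \<in> carrier A"
          using Cons(3) in_c(2) by (induction u rule: T_induct) (auto simp: cl)
        then show ?case using Cons in_c
          by (simp add: tf_simps lin_add[OF L(1)] lin_smult[OF L(1)] lin_add[OF L(2)] lin_smult[OF L(2)] cl algebra_simps)
      qed (simp add: tf_simps)
      then show ?thesis using in_c b'_in t''_in
        by (auto simp: teq_def T_closed_simps tf_simps Cons ab)
    qed
    have orth: "\<phi> (star A a \<otimes> (x \<oplus> (- l x) \<odot> a)) = 0" if x: "x \<in> carrier A" for x
    proof (cases "n = 0")
      case True
      then show ?thesis using state_null_left[OF \<phi> in_c(1), of "x \<oplus> (- l x) \<odot> a"] x in_c by (simp add: n_def cl)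
    next
      case False
      then show ?thesis using x in_c by (simp add: rules cl \<phi>L l_def n_def)
    qed
    have cross: "tip \<phi> \<psi> [(a, b')] t'' = 0"
      unfolding t''_def tip_def using in_c(3)
    proof (induction t' rule: T_induct)
      case Nil then show ?case by (simp add: tf_mult_Nil_right)
    next
      case (Cons x y u)
      then show ?case using orth[of x] by (simp add: tf_mult_Cons_right) (simp add: T_simps tf_simps)
    qed
    have "length t'' < length t" by (simp add: t''_def Cons)
    then have IH: "0 \<le> Re (tip \<phi> \<psi> t'' t'')" using less.hyps t''_in by blast
    have "tip \<phi> \<psi> t t = tip \<phi> \<psi> ([(a, b')] @ t'') ([(a, b')] @ t'')"
      using tip_cong[OF teq teq \<phi> \<psi>] by simp
    also have "\<dots> = tip \<phi> \<psi> [(a, b')] [(a, b')] + tip \<phi> \<psi> [(a, b')] t'' + tip \<phi> \<psi> t'' [(a, b')] + tip \<phi> \<psi> t'' t''"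
      by (simp only: tip_def T_simps(10,13) tf_simps(3) tf_mult_append_right add.assoc)
    also have "tip \<phi> \<psi> t'' [(a, b')] = 0"
      using tip_sym[OF \<phi> \<psi> t''_in, of "[(a, b')]"] cross in_c b'_in by (simp add: T_closed_simps)
    finally have "tip \<phi> \<psi> t t = tip \<phi> \<psi> [(a, b')] [(a, b')] + tip \<phi> \<psi> t'' t''" using cross by simp
    moreover have "tip \<phi> \<psi> [(a, b')] [(a, b')] = n * \<psi> (star A b' \<otimes> b')"
      by (simp add: tip_def T_simps tf_simps n_def)
    moreover have "0 \<le> Re (n * \<psi> (star A b' \<otimes> b'))"
      using state_pos[OF \<phi> in_c(1)] state_pos[OF \<psi> b'_in] state_pos_Im[OF \<phi> in_c(1)]
      by (simp add: n_def)
    ultimately show ?thesis using IH by simp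
  qed
qed

lemma semi_inner_tip:
  assumes \<phi>: "state A \<phi>" and \<psi>: "state A \<psi>"
  shows "semi_inner T (tip \<phi> \<psi>)"
proof
  fix w x y c
  assume w: "w \<in> carrier T" and x: "x \<in> carrier T"
  show "tip \<phi> \<psi> x w = cnj (tip \<phi> \<psi> w x)" by (rule tip_sym[OF \<phi> \<psi> x w])
  have "tip \<phi> \<psi> (c \<odot>\<^bsub>T\<^esub> x) w = cnj c * tip \<phi> \<psi> x w" for c
  proof -
    have "star T (c \<odot>\<^bsub>T\<^esub> x) = cnj c \<odot>\<^bsub>T\<^esub> star T x"
      using x by (induction x rule: T_induct) (simp_all add: T_simps rules)
    then show ?thesis using x w by (simp add: tip_def T_smult_mult T_closed tf_smult[OF state_lin[OF \<phi>]])
  qed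
  from this[of "cnj c"] show "tip \<phi> \<psi> w (c \<odot>\<^bsub>T\<^esub> x) = c * tip \<phi> \<psi> w x"
    using tip_sym[OF \<phi> \<psi> w T_closed(5)[OF x, of c]] tip_sym[OF \<phi> \<psi> w x]
    by (metis complex_cnj_cnj complex_cnj_mult tip_sym[OF \<phi> \<psi>] \<open>\<And>c. tip \<phi> \<psi> (c \<odot>\<^bsub>T\<^esub> x) w = cnj c * tip \<phi> \<psi> x w\<close>)
  assume y: "y \<in> carrier T"
  show "tip \<phi> \<psi> w (x \<oplus>\<^bsub>T\<^esub> y) = tip \<phi> \<psi> w x + tip \<phi> \<psi> w y"
    by (simp add: tip_def T_simps(4) tf_mult_append_right)
qed (use tip_pos[OF \<phi> \<psi>] in \<open>auto simp: T_closed\<close>)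

lemma tip_mult_left:
  assumes \<phi>: "state A \<phi>" and \<psi>: "state A \<psi>" and "x \<in> carrier T" "w \<in> carrier T" "v \<in> carrier T"
  shows "tip \<phi> \<psi> (x \<otimes>\<^bsub>T\<^esub> w) v = tip \<phi> \<psi> w (star T x \<otimes>\<^bsub>T\<^esub> v)"
proof -
  have "tip \<phi> \<psi> (x \<otimes>\<^bsub>T\<^esub> w) v = tensor_functional \<phi> \<psi> ((star T w \<otimes>\<^bsub>T\<^esub> star T x) \<otimes>\<^bsub>T\<^esub> v)"
    unfolding tip_def
    using teq_mult[OF teq_star_mult teq_refl, of x w v] assms state_lin by (intro teqD) auto
  then show ?thesis using assms by (simp add: tip_def T_mult_assoc T_closed)
qed

end


section \<open>The minimal tensor product\<close>

locale cstar_nontrivial = cstar_normed A p for A :: "('a, 'b) star_alg_scheme" (structure) and p +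
  assumes one_neq_zero: "\<one> \<noteq> \<zero>"
begin

lemma ex_state_norm:
  assumes "x \<in> carrier A"
  obtains \<psi> where "state A \<psi>" "\<psi> (star A x \<otimes> x) = of_real ((p x)\<^sup>2)"
  using ex_state[OF one_neq_zero assms] by blast

text \<open>The vector state of the normalised vector \<open>y\<close> in the GNS representation of
  \<psi>.\<close>

lemma state_conj:
  assumes \<psi>: "state A \<psi>" and y: "y \<in> carrier A" and n: "\<psi> (star A y \<otimes> y) \<noteq> 0"
  shows "state A (\<lambda>a. \<psi> (star A y \<otimes> (a \<otimes> y)) / \<psi> (star A y \<otimes> y))"
proof -
  note L = lin_add[OF state_lin[OF \<psi>]] lin_smult[OF state_lin[OF \<psi>]]
  define r where "r = Re (\<psi> (star A y \<otimes> y))"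
  have r: "\<psi> (star A y \<otimes> y) = of_real r" "0 < r"
    using state_pos[OF \<psi> y] state_pos_Im[OF \<psi> y] n by (auto simp: complex_eq_iff less_le r_def)
  have "\<psi> (star A y \<otimes> ((star A x \<otimes> x) \<otimes> y)) = \<psi> (star A (x \<otimes> y) \<otimes> (x \<otimes> y))" if "x \<in> carrier A" for x
    using that y by (simp add: rules cl)
  moreover have "Im (\<psi> (star A (x \<otimes> y) \<otimes> (x \<otimes> y))) = 0" "0 \<le> Re (\<psi> (star A (x \<otimes> y) \<otimes> (x \<otimes> y)))"
    if "x \<in> carrier A" for x
    using that y state_pos[OF \<psi>] state_pos_Im[OF \<psi>] by simp_all
  ultimately show ?thesis
    using y r by (simp add: state_def rules cl L add_divide_distrib)
qed

text \<open>Take a state \<psi> that attains the norm of \<open>x\<close> at x* x. All its vector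
  states vanish at \<open>x\<close>; applied to the vectors x + c 1 with c = 1 and c = i, this
  isolates \<psi>(x* x) = 0.\<close>

lemma eq_zero_of_states:
  assumes x: "x \<in> carrier A" and 0: "\<And>\<psi>. state A \<psi> \<Longrightarrow> \<psi> x = 0" shows "x = \<zero>"
proof -
  obtain \<psi> where \<psi>: "state A \<psi>" "\<psi> (star A x \<otimes> x) = of_real ((p x)\<^sup>2)" using ex_state_norm[OF x] .
  note L = lin_add[OF state_lin[OF \<psi>(1)]] lin_smult[OF state_lin[OF \<psi>(1)]]
  have conj: "\<psi> (star A y \<otimes> (x \<otimes> y)) = 0" if y: "y \<in> carrier A" for y
  proof (cases "\<psi> (star A y \<otimes> y) = 0")
    case True
    have "\<psi> (star A y \<otimes> (x \<otimes> y)) = 0" by (rule state_null_left[OF \<psi>(1)]) (use x y True in auto)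
    then show ?thesis .
  next
    case False
    then show ?thesis using 0[OF state_conj[OF \<psi>(1) y]] by simp
  qed
  have expand: "\<psi> (star A (x \<oplus> c \<odot> \<one>) \<otimes> (x \<otimes> (x \<oplus> c \<odot> \<one>))) = \<psi> (star A x \<otimes> (x \<otimes> x)) +
      c * \<psi> (star A x \<otimes> x) + cnj c * \<psi> (x \<otimes> x) + cnj c * c * \<psi> x" for c
    using x by (simp add: rules cl L algebra_simps)
  have 1: "c * \<psi> (star A x \<otimes> x) + cnj c * \<psi> (x \<otimes> x) = 0" for c
    using conj[of "x \<oplus> c \<odot> \<one>"] conj[OF x] 0[OF \<psi>(1)] x by (simp add: expand cl)
  have "\<psi> (star A x \<otimes> x) = 0" using 1[of 1] 1[of \<i>] by (simp add: complex_eq_iff)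
  then have "p x = 0" using \<psi>(2) by simp
  then show ?thesis by (rule p_definite[OF x])
qed

definition tips :: "(('a \<times> 'a) list \<Rightarrow> ('a \<times> 'a) list \<Rightarrow> complex) set" where
  "tips = {tip \<phi> \<psi> | \<phi> \<psi>. state A \<phi> \<and> state A \<psi>}"

text \<open>Tensoring c* c + a* a = t with 1 in the other leg writes t times the length of
  \<open>v\<close> as the sum of two nonnegative terms, one of which is the term to be
  bounded.\<close>

lemma tip_elementary_bound:
  assumes \<phi>: "state A \<phi>" and \<psi>: "state A \<psi>" and a: "a \<in> carrier A" and v: "v \<in> carrier T"
    and t: "(p a)\<^sup>2 < t"
  shows "Re (tip \<phi> \<psi> ([(a, \<one>)] \<otimes>\<^bsub>T\<^esub> v) ([(a, \<one>)] \<otimes>\<^bsub>T\<^esub> v)) \<le> t * Re (tip \<phi> \<psi> v v)" (is ?left)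
    and "Re (tip \<phi> \<psi> ([(\<one>, a)] \<otimes>\<^bsub>T\<^esub> v) ([(\<one>, a)] \<otimes>\<^bsub>T\<^esub> v)) \<le> t * Re (tip \<phi> \<psi> v v)" (is ?right)
proof -
  obtain c where c: "c \<in> carrier A" "star A c \<otimes> c \<oplus> star A a \<otimes> a = of_real t \<odot> \<one>"
    using ex_complement_square[OF one_neq_zero a t] .
  interpret semi_inner T "tip \<phi> \<psi>" by (rule semi_inner_tip[OF \<phi> \<psi>])
  have move: "tip \<phi> \<psi> ([(a, b)] \<otimes>\<^bsub>T\<^esub> v) ([(a, b)] \<otimes>\<^bsub>T\<^esub> v) = tip \<phi> \<psi> v ([(star A a \<otimes> a, star A b \<otimes> b)] \<otimes>\<^bsub>T\<^esub> v)"
    if ab: "a \<in> carrier A" "b \<in> carrier A" for a b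
  proof -
    have in_T: "[(a, b)] \<in> carrier T" "[(star A a, star A b)] \<in> carrier T"
      using ab by (simp_all add: T_closed_simps cl)
    have "tip \<phi> \<psi> ([(a, b)] \<otimes>\<^bsub>T\<^esub> v) ([(a, b)] \<otimes>\<^bsub>T\<^esub> v) =
        tip \<phi> \<psi> v ([(star A a, star A b)] \<otimes>\<^bsub>T\<^esub> ([(a, b)] \<otimes>\<^bsub>T\<^esub> v))"
      using tip_mult_left[OF \<phi> \<psi> in_T(1) v, of "[(a, b)] \<otimes>\<^bsub>T\<^esub> v"] v in_T by (simp add: T_closed T_simps(8,9))
    also have "[(star A a, star A b)] \<otimes>\<^bsub>T\<^esub> ([(a, b)] \<otimes>\<^bsub>T\<^esub> v) = [(star A a \<otimes> a, star A b \<otimes> b)] \<otimes>\<^bsub>T\<^esub> v"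
      by (subst T_mult_assoc[symmetric]) (use in_T v in \<open>simp_all add: T_simps(11,12)\<close>)
    finally show ?thesis .
  qed
  have teq_l: "teq ([(star A c \<otimes> c, \<one>)] @ [(star A a \<otimes> a, \<one>)]) (of_real t \<odot>\<^bsub>T\<^esub> [(\<one>, \<one>)])"
    using a c by (auto simp: teq_def T_closed_simps T_simps(5,6) cl tf_simps lin_smult simp flip: distrib_right
        c(2) lin_add)
  have teq_r: "teq ([(\<one>, star A c \<otimes> c)] @ [(\<one>, star A a \<otimes> a)]) (of_real t \<odot>\<^bsub>T\<^esub> [(\<one>, \<one>)])"
  proof -
    have "\<psi>' (star A c \<otimes> c) + \<psi>' (star A a \<otimes> a) = of_real t * \<psi>' \<one>" if "lin A \<psi>'" for \<psi>'
      using lin_add[OF that, of "star A c \<otimes> c" "star A a \<otimes> a"] lin_smult[OF that, of \<one> "of_real t"] a c by (simp add: cl)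
    then show ?thesis
      using a c by (auto simp: teq_def T_closed_simps T_simps(5,6) cl tf_simps lin_smult simp flip: distrib_left)
  qed
  have fin: "Re (tip \<phi> \<psi> v (s \<otimes>\<^bsub>T\<^esub> v)) \<le> t * Re (tip \<phi> \<psi> v v)"
    if "teq (s' @ s) (of_real t \<odot>\<^bsub>T\<^esub> [(\<one>, \<one>)])" "0 \<le> Re (tip \<phi> \<psi> v (s' \<otimes>\<^bsub>T\<^esub> v))" for s s'
  proof -
    have s: "s \<in> carrier T" "s' \<in> carrier T" using teq_in[OF that(1)] by (simp_all add: T_closed_simps)
    have "tip \<phi> \<psi> v (s' \<otimes>\<^bsub>T\<^esub> v) + tip \<phi> \<psi> v (s \<otimes>\<^bsub>T\<^esub> v) = tip \<phi> \<psi> v ((s' @ s) \<otimes>\<^bsub>T\<^esub> v)"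
      using ip_add[of v "s' \<otimes>\<^bsub>T\<^esub> v" "s \<otimes>\<^bsub>T\<^esub> v"] s v by (simp add: T_closed T_simps(4,13))
    also have "\<dots> = tip \<phi> \<psi> v ((of_real t \<odot>\<^bsub>T\<^esub> [(\<one>, \<one>)]) \<otimes>\<^bsub>T\<^esub> v)"
      by (intro tip_cong[OF _ _ \<phi> \<psi>] teq_mult that teq_refl v)
    also have "\<dots> = of_real t * tip \<phi> \<psi> v v"
      using v T_closed(1) by (simp add: T_smult_mult T_one_mult ip_smult T_simps(2))
    finally show ?thesis using that(2) by (simp add: complex_eq_iff)
  qed
  show ?left
    using fin[OF teq_l] move[OF c(1) one_closed] move[OF a one_closed] ip_pos[of "[(c, \<one>)] \<otimes>\<^bsub>T\<^esub> v"] c v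
    by (simp add: star_one T_closed T_closed_simps)
  show ?right
    using fin[OF teq_r] move[OF one_closed c(1)] move[OF one_closed a] ip_pos[of "[(\<one>, c)] \<otimes>\<^bsub>T\<^esub> v"] c v
    by (simp add: star_one T_closed T_closed_simps)
qed

text \<open>The bound has to be uniform over all pairs of states for the spatial norm to be a finite
  supremum. It is, since the constants come only from the norms of the legs.\<close>

lemma tips_bounded:
  assumes "x \<in> carrier T"
  shows "\<exists>C. \<forall>i\<in>tips. \<forall>v\<in>carrier T. Re (i (x \<otimes>\<^bsub>T\<^esub> v) (x \<otimes>\<^bsub>T\<^esub> v)) \<le> C * Re (i v v)"
proof -
  have "\<exists>C\<ge>0. \<forall>\<phi> \<psi>. state A \<phi> \<longrightarrow> state A \<psi> \<longrightarrow> (\<forall>v\<in>carrier T.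
    semi_inner.len (tip \<phi> \<psi>) (x \<otimes>\<^bsub>T\<^esub> v) \<le> C * semi_inner.len (tip \<phi> \<psi>) v)"
    using assms
  proof (induction x rule: T_induct)
    case Nil
    have "semi_inner.len (tip \<phi> \<psi>) [] = 0" if "state A \<phi>" "state A \<psi>" for \<phi> \<psi>
      using semi_inner_tip[OF that] by (simp add: semi_inner.len_def tip_def T_simps tf_simps)
    then show ?case by (intro exI[of _ 0]) (simp add: T_simps(11))
  next
    case (Cons a b x)
    obtain C where C: "0 \<le> C" "\<And>\<phi> \<psi> v. state A \<phi> \<Longrightarrow> state A \<psi> \<Longrightarrow> v \<in> carrier T \<Longrightarrow>
      semi_inner.len (tip \<phi> \<psi>) (x \<otimes>\<^bsub>T\<^esub> v) \<le> C * semi_inner.len (tip \<phi> \<psi>) v"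
      using Cons.IH by blast
    \<comment> \<open>The summand 1 makes the inequality strict, as the complementary square
      requires.\<close>
    define B where "B y = sqrt ((p y)\<^sup>2 + 1)" for y
    have B: "0 \<le> B y" "(p y)\<^sup>2 < (B y)\<^sup>2" for y by (simp_all add: B_def)
    have "semi_inner.len (tip \<phi> \<psi>) (((a, b) # x) \<otimes>\<^bsub>T\<^esub> v) \<le> (B a * B b + C) * semi_inner.len (tip \<phi> \<psi>) v"
      if \<phi>: "state A \<phi>" and \<psi>: "state A \<psi>" and v: "v \<in> carrier T" for \<phi> \<psi> v
    proof -
      interpret semi_inner T "tip \<phi> \<psi>" by (rule semi_inner_tip[OF \<phi> \<psi>])
      have ab: "a \<in> carrier A" "b \<in> carrier A" "x \<in> carrier T" by fact+
      have left: "len ([(a, \<one>)] \<otimes>\<^bsub>T\<^esub> u) \<le> B a * len u" and right: "len ([(\<one>, b)] \<otimes>\<^bsub>T\<^esub> u) \<le> B b * len u"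
        if u: "u \<in> carrier T" for u
      proof -
        have "(len ([(a, \<one>)] \<otimes>\<^bsub>T\<^esub> u))\<^sup>2 \<le> (B a * len u)\<^sup>2" "(len ([(\<one>, b)] \<otimes>\<^bsub>T\<^esub> u))\<^sup>2 \<le> (B b * len u)\<^sup>2"
          using tip_elementary_bound(1)[OF \<phi> \<psi> ab(1) u B(2)] tip_elementary_bound(2)[OF \<phi> \<psi> ab(2) u B(2)] u ab
          by (simp_all add: len_square T_closed T_closed_simps power_mult_distrib)
        then show "len ([(a, \<one>)] \<otimes>\<^bsub>T\<^esub> u) \<le> B a * len u" "len ([(\<one>, b)] \<otimes>\<^bsub>T\<^esub> u) \<le> B b * len u"
          using B len_nonneg[OF u] by (auto intro: power2_le_imp_le)
      qed
      have in_T: "[(a, \<one>)] \<in> carrier T" "[(\<one>, b)] \<in> carrier T" "[(a, b)] \<in> carrier T"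
        using ab by (simp_all add: T_closed_simps)
      have "[(a, b)] \<otimes>\<^bsub>T\<^esub> v = [(a, \<one>)] \<otimes>\<^bsub>T\<^esub> ([(\<one>, b)] \<otimes>\<^bsub>T\<^esub> v)"
        by (subst T_mult_assoc[symmetric]) (use in_T v ab in \<open>simp_all add: T_simps(11,12)\<close>)
      then have "len ([(a, b)] \<otimes>\<^bsub>T\<^esub> v) \<le> B a * (B b * len v)"
        using left[of "[(\<one>, b)] \<otimes>\<^bsub>T\<^esub> v"] mult_left_mono[OF right[OF v] B(1)[of a]] in_T v
        by (simp add: T_closed)
      moreover have "((a, b) # x) \<otimes>\<^bsub>T\<^esub> v = [(a, b)] \<otimes>\<^bsub>T\<^esub> v \<oplus>\<^bsub>T\<^esub> x \<otimes>\<^bsub>T\<^esub> v"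
        by (simp add: T_simps)
      moreover have "len ([(a, b)] \<otimes>\<^bsub>T\<^esub> v \<oplus>\<^bsub>T\<^esub> x \<otimes>\<^bsub>T\<^esub> v) \<le> len ([(a, b)] \<otimes>\<^bsub>T\<^esub> v) + len (x \<otimes>\<^bsub>T\<^esub> v)"
        using in_T v ab by (intro len_triangle T_closed) auto
      ultimately show ?thesis using C(2)[OF \<phi> \<psi> v] by (simp add: algebra_simps)
    qed
    then show ?case using B C by (intro exI[of _ "B a * B b + C"]) auto
  qed
  then obtain C where C: "0 \<le> C" "\<And>\<phi> \<psi> v. state A \<phi> \<Longrightarrow> state A \<psi> \<Longrightarrow> v \<in> carrier T \<Longrightarrow>
    semi_inner.len (tip \<phi> \<psi>) (x \<otimes>\<^bsub>T\<^esub> v) \<le> C * semi_inner.len (tip \<phi> \<psi>) v" by blast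
  have "Re (tip \<phi> \<psi> (x \<otimes>\<^bsub>T\<^esub> v) (x \<otimes>\<^bsub>T\<^esub> v)) \<le> C\<^sup>2 * Re (tip \<phi> \<psi> v v)"
    if "state A \<phi>" "state A \<psi>" "v \<in> carrier T" for \<phi> \<psi> v
  proof -
    interpret semi_inner T "tip \<phi> \<psi>" by (rule semi_inner_tip[OF that(1,2)])
    have xv: "x \<otimes>\<^bsub>T\<^esub> v \<in> carrier T" using assms that by (intro T_closed)
    have "(len (x \<otimes>\<^bsub>T\<^esub> v))\<^sup>2 \<le> (C * len v)\<^sup>2"
      using C(2)[OF that] len_nonneg[OF xv] by (rule power_mono)
    then show ?thesis using that xv by (simp add: len_square power_mult_distrib)
  qed
  then show ?thesis by (intro exI[of _ "C\<^sup>2"]) (auto simp: tips_def)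
qed

lemma star_rep_family_tips: "star_rep_family T tips"
proof (rule star_rep_family.intro)
  show "i \<in> tips \<Longrightarrow> semi_inner T i" for i by (auto simp: tips_def intro: semi_inner_tip)
  obtain \<phi> where \<phi>: "state A \<phi>" using ex_state_norm[OF one_closed] .
  have "tip \<phi> \<phi> [(\<one>, \<one>)] [(\<one>, \<one>)] = 1"
    by (simp add: tip_def T_simps tf_simps star_one state_one[OF \<phi>])
  then show "\<exists>i\<in>tips. \<exists>y\<in>carrier T. i y y = 1"
    using \<phi> by (intro bexI[of _ "tip \<phi> \<phi>"] bexI[of _ "[(\<one>, \<one>)]"]) (auto simp: tips_def T_closed_simps)
  fix i w x y v c
  assume "i \<in> tips"
  then obtain \<phi> \<psi> where i: "i = tip \<phi> \<psi>" and \<phi>: "state A \<phi>" and \<psi>: "state A \<psi>" by (auto simp: tips_def)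
  interpret semi_inner T i unfolding i by (rule semi_inner_tip[OF \<phi> \<psi>])
  assume in_T: "w \<in> carrier T" "x \<in> carrier T" "v \<in> carrier T"
  show "i w (c \<odot>\<^bsub>T\<^esub> x \<otimes>\<^bsub>T\<^esub> v) = c * i w (x \<otimes>\<^bsub>T\<^esub> v)"
    using in_T by (simp add: T_smult_mult ip_smult T_closed)
  show "i (x \<otimes>\<^bsub>T\<^esub> w) v = i w (star T x \<otimes>\<^bsub>T\<^esub> v)"
    unfolding i using in_T by (intro tip_mult_left \<phi> \<psi>)
  assume y: "y \<in> carrier T"
  show "i w ((x \<oplus>\<^bsub>T\<^esub> y) \<otimes>\<^bsub>T\<^esub> v) = i w (x \<otimes>\<^bsub>T\<^esub> v) + i w (y \<otimes>\<^bsub>T\<^esub> v)"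
    using ip_add[of w "x \<otimes>\<^bsub>T\<^esub> v" "y \<otimes>\<^bsub>T\<^esub> v"] in_T y by (simp add: T_closed T_simps(4,13))
  show "i w (x \<otimes>\<^bsub>T\<^esub> y \<otimes>\<^bsub>T\<^esub> v) = i w (x \<otimes>\<^bsub>T\<^esub> (y \<otimes>\<^bsub>T\<^esub> v))"
    using in_T y by (simp add: T_mult_assoc)
qed (auto simp: T_closed intro: tips_bounded)

sublocale M: star_rep_family T tips
  by (rule star_rep_family_tips)

lemma min_norm_eq_opnorm: "min_norm A A = M.opnorm"
proof
  fix t
  have "{sqrt (Re (tensor_functional \<phi> \<psi> (star T (t \<otimes>\<^bsub>T\<^esub> y) \<otimes>\<^bsub>T\<^esub> (t \<otimes>\<^bsub>T\<^esub> y)))) | \<phi> \<psi> y.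
      state A \<phi> \<and> state A \<psi> \<and> y \<in> carrier T \<and> tensor_functional \<phi> \<psi> (star T y \<otimes>\<^bsub>T\<^esub> y) = 1} =
    {sqrt (Re (i (t \<otimes>\<^bsub>T\<^esub> v) (t \<otimes>\<^bsub>T\<^esub> v))) | i v. i \<in> tips \<and> v \<in> carrier T \<and> i v v = 1}"
    unfolding tips_def tip_def[symmetric] by blast
  then show "min_norm A A t = M.opnorm t" by (simp add: min_norm_def M.opnorm_def Let_def)
qed

lemma cstar_seminorm_min_norm: "cstar_seminorm T (min_norm A A)"
  unfolding min_norm_eq_opnorm by (rule M.cstar_seminorm_opnorm)

lemma prenormed_min_norm: "prenormed T (min_norm A A) (\<lambda>x y. min_norm A A (x \<oplus>\<^bsub>T\<^esub> (-1) \<odot>\<^bsub>T\<^esub> y))"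
  unfolding min_norm_eq_opnorm by (rule M.prenormed_opnorm)

lemma min_norm_cong:
  assumes "teq s t" shows "min_norm A A s = min_norm A A t"
  unfolding min_norm_eq_opnorm
proof (rule M.opnorm_cong)
  show "s \<in> carrier T" "t \<in> carrier T" using assms by (rule teq_in)+
  show "i w (s \<otimes>\<^bsub>T\<^esub> v) = i w (t \<otimes>\<^bsub>T\<^esub> v)" if "i \<in> tips" "v \<in> carrier T" "w \<in> carrier T" for i v w
    using that assms by (auto simp: tips_def intro!: tip_cong teq_mult teq_refl)
qed

lemma tf_le_min_norm:
  assumes \<phi>: "state A \<phi>" and \<psi>: "state A \<psi>" and s: "s \<in> carrier T" and t: "t \<in> carrier T"
  shows "cmod (tip \<phi> \<psi> s t) \<le> sqrt (Re (tip \<phi> \<psi> s s)) * min_norm A A t"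
proof -
  interpret semi_inner T "tip \<phi> \<psi>" by (rule semi_inner_tip[OF \<phi> \<psi>])
  have "len [(\<one>, \<one>)] = 1"
    by (simp add: len_def tip_def T_simps tf_simps star_one state_one[OF \<phi>] state_one[OF \<psi>])
  then have "len t \<le> M.opnorm t"
    using M.nm_mult_le[OF t, of "tip \<phi> \<psi>" "[(\<one>, \<one>)]"] \<phi> \<psi> t
    by (auto simp: tips_def T_closed_simps T_mult_one)
  then have "len s * len t \<le> len s * min_norm A A t"
    using len_nonneg[OF s] by (simp add: min_norm_eq_opnorm mult_left_mono)
  then show ?thesis using cauchy_schwarz[OF s t] by (simp add: len_def)
qed

end

section \<open>Slice maps on formal tensors\<close>

context star_algebra
begin

definition slL :: "('a \<Rightarrow> complex) \<Rightarrow> ('a \<times> 'a) list \<Rightarrow> 'a" where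
  "slL h t = foldr (\<lambda>(a, b) s. (h a \<odot> b) \<oplus> s) t \<zero>"

definition slR :: "('a \<Rightarrow> complex) \<Rightarrow> ('a \<times> 'a) list \<Rightarrow> 'a" where
  "slR h t = foldr (\<lambda>(a, b) s. (h b \<odot> a) \<oplus> s) t \<zero>"

lemma sl_simps:
  "slL h [] = \<zero>" "slL h ((a, b) # t) = (h a \<odot> b) \<oplus> slL h t"
  "slR h [] = \<zero>" "slR h ((a, b) # t) = (h b \<odot> a) \<oplus> slR h t"
  by (simp_all add: slL_def slR_def)

lemma sl_closed: "t \<in> carrier T \<Longrightarrow> slL h t \<in> carrier A" "t \<in> carrier T \<Longrightarrow> slR h t \<in> carrier A"
  by (induction t rule: T_induct) (simp_all add: sl_simps cl)

lemma sl_append: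
  assumes "s \<in> carrier T" "t \<in> carrier T"
  shows "slL h (s @ t) = slL h s \<oplus> slL h t" "slR h (s @ t) = slR h s \<oplus> slR h t"
  using assms by (induction s rule: T_induct) (simp_all add: sl_simps sl_closed cl rules a_lcomm)

lemma sl_smult:
  assumes "lin A h" "t \<in> carrier T"
  shows "slL h (c \<odot>\<^bsub>T\<^esub> t) = c \<odot> slL h t" "slR h (c \<odot>\<^bsub>T\<^esub> t) = c \<odot> slR h t"
  using assms(2) by (induction t rule: T_induct)
    (simp_all add: sl_simps T_simps sl_closed cl rules lin_smult[OF assms(1)] mult.commute)

lemma lin_sl:
  assumes "lin A \<psi>" "t \<in> carrier T"
  shows "\<psi> (slL h t) = tensor_functional h \<psi> t" "\<psi> (slR h t) = tensor_functional \<psi> h t"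
  using assms(2) by (induction t rule: T_induct)
    (simp_all add: sl_simps tf_simps lin_zero assms sl_closed cl lin_add[OF assms(1)] lin_smult[OF assms(1)])

end

context cstar_nontrivial
begin

lemma tf_one_left: "t \<in> carrier T \<Longrightarrow> tensor_functional (\<lambda>x. h (\<one> \<otimes> x)) \<psi> t = tensor_functional h \<psi> t"
  by (induction t rule: T_induct) (simp_all add: tf_simps)

lemma tf_one_right: "t \<in> carrier T \<Longrightarrow> tensor_functional h (\<lambda>x. \<psi> (\<one> \<otimes> x)) t = tensor_functional h \<psi> t"
  by (induction t rule: T_induct) (simp_all add: tf_simps)

text \<open>Choose a state \<psi> attaining the norm of the slice s at s* s. The value \<psi>(s* s)
  is the inner product of 1 \<otimes> s with \<open>t\<close>, and 1 \<otimes> s has length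
  \<open>p s\<close>; so Cauchy-Schwarz gives the bound after division by
  \<open>p s\<close>.\<close>

lemma sl_le_min_norm:
  assumes h: "state A h" and t: "t \<in> carrier T"
  shows "p (slL h t) \<le> min_norm A A t" "p (slR h t) \<le> min_norm A A t"
proof -
  note L = lin_add[OF state_lin] lin_smult[OF state_lin]
  have nonneg: "0 \<le> min_norm A A t" using cstar_seminormD(1)[OF cstar_seminorm_min_norm t] .
  have fin: "p s \<le> min_norm A A t" if "s \<in> carrier A" "(p s)\<^sup>2 \<le> p s * min_norm A A t" for s
    using that cstar_seminormD(1)[OF p_seminorm that(1)] nonneg
    by (cases "p s = 0") (auto simp: power2_eq_square)
  show "p (slL h t) \<le> min_norm A A t"
  proof (rule fin)
    define s where "s = slL h t"
    have s: "s \<in> carrier A" using t by (simp add: s_def sl_closed)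
    then show "slL h t \<in> carrier A" by (simp add: s_def)
    obtain \<psi> where \<psi>: "state A \<psi>" "\<psi> (star A s \<otimes> s) = of_real ((p s)\<^sup>2)" using ex_state_norm[OF s] .
    have "tip h \<psi> [(\<one>, s)] t = \<psi> (star A s \<otimes> slL h t)"
      using t lin_sl(1)[OF lin_mult_left[OF state_lin[OF \<psi>(1)], of "star A s"] t, of h] s
      unfolding tip_def T_simps(8,9) tf_mult_Cons
      by (simp add: T_simps(11) tf_simps star_one cl tf_one_left[OF t] tf_one_right[OF t])
    moreover have "Re (tip h \<psi> [(\<one>, s)] [(\<one>, s)]) = (p s)\<^sup>2"
      by (simp add: tip_def T_simps tf_simps star_one state_one[OF h] \<psi>)
    ultimately show "(p (slL h t))\<^sup>2 \<le> p (slL h t) * min_norm A A t"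
      using tf_le_min_norm[OF h \<psi>(1) _ t, of "[(\<one>, s)]"] s \<psi>(2) cstar_seminormD(1)[OF p_seminorm s]
      by (simp add: T_closed_simps s_def norm_power)
  qed
  show "p (slR h t) \<le> min_norm A A t"
  proof (rule fin)
    define s where "s = slR h t"
    have s: "s \<in> carrier A" using t by (simp add: s_def sl_closed)
    then show "slR h t \<in> carrier A" by (simp add: s_def)
    obtain \<psi> where \<psi>: "state A \<psi>" "\<psi> (star A s \<otimes> s) = of_real ((p s)\<^sup>2)" using ex_state_norm[OF s] .
    have "tip \<psi> h [(s, \<one>)] t = \<psi> (star A s \<otimes> slR h t)"
      using t lin_sl(2)[OF lin_mult_left[OF state_lin[OF \<psi>(1)], of "star A s"] t, of h] s
      unfolding tip_def T_simps(8,9) tf_mult_Cons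
      by (simp add: T_simps(11) tf_simps star_one cl tf_one_left[OF t] tf_one_right[OF t])
    moreover have "Re (tip \<psi> h [(s, \<one>)] [(s, \<one>)]) = (p s)\<^sup>2"
      by (simp add: tip_def T_simps tf_simps star_one state_one[OF h] \<psi>)
    ultimately show "(p (slR h t))\<^sup>2 \<le> p (slR h t) * min_norm A A t"
      using tf_le_min_norm[OF \<psi>(1) h _ t, of "[(s, \<one>)]"] s \<psi>(2) cstar_seminormD(1)[OF p_seminorm s]
      by (simp add: T_closed_simps s_def norm_power)
  qed
qed

lemma eq_of_states:
  assumes "x \<in> carrier A" "y \<in> carrier A" "\<And>\<psi>. state A \<psi> \<Longrightarrow> \<psi> x = \<psi> y" shows "x = y"
proof (rule eq_of_diff_zero[OF assms(1,2)])
  show "x \<oplus> (-1) \<odot> y = \<zero>"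
    by (rule eq_zero_of_states) (use assms in \<open>auto simp: cl lin_add[OF state_lin] lin_smult[OF state_lin]\<close>)
qed

text \<open>The minimal norm involves only states, whereas \<open>teq\<close> refers to all linear
  functionals. One leg is treated at a time: slices by states agree, hence states cannot distinguish
  the slices by an arbitrary functional in the other leg, and these agree as well.\<close>

lemma teq_of_min_norm:
  assumes s: "s \<in> carrier T" and t: "t \<in> carrier T" and 0: "min_norm A A (s @ (-1) \<odot>\<^bsub>T\<^esub> t) = 0"
  shows "teq s t"
proof -
  have st: "s @ (-1) \<odot>\<^bsub>T\<^esub> t \<in> carrier T" using s t by (simp add: T_closed_simps T_closed)
  have slice: "slL \<phi> s = slL \<phi> t" if \<phi>: "state A \<phi>" for \<phi>
  proof (rule eq_of_diff_zero)
    have "p (slL \<phi> (s @ (-1) \<odot>\<^bsub>T\<^esub> t)) = 0"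
      using sl_le_min_norm(1)[OF \<phi> st] 0 cstar_seminormD(1)[OF p_seminorm sl_closed(1)[OF st, of \<phi>]] by linarith
    then show "slL \<phi> s \<oplus> (-1) \<odot> slL \<phi> t = \<zero>"
      using p_definite[OF sl_closed(1)[OF st, of \<phi>]] s t state_lin[OF \<phi>] by (simp add: sl_append sl_smult T_closed)
  qed (use s t sl_closed in auto)
  have "slR \<psi> s = slR \<psi> t" if \<psi>: "lin A \<psi>" for \<psi>
  proof (rule eq_of_states)
    fix \<phi> assume \<phi>: "state A \<phi>"
    show "\<phi> (slR \<psi> s) = \<phi> (slR \<psi> t)"
      using lin_sl[OF state_lin[OF \<phi>]] lin_sl[OF \<psi>] s t slice[OF \<phi>] by metis
  qed (use s t sl_closed in auto)
  then have "tensor_functional \<phi> \<psi> s = tensor_functional \<phi> \<psi> t" if "lin A \<phi>" "lin A \<psi>" for \<phi> \<psi>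
    using lin_sl(2)[OF that(1) s, of \<psi>] lin_sl(2)[OF that(1) t, of \<psi>] that(2) by simp
  then show ?thesis using s t by (simp add: teq_def)
qed

text \<open>The identity c* c + x* x = t bounds \<phi>(x* x) by t for every t above the squared
  norm.\<close>

lemma state_square_le:
  assumes \<phi>: "state A \<phi>" and x: "x \<in> carrier A"
  shows "Re (\<phi> (star A x \<otimes> x)) \<le> (p x)\<^sup>2"
proof (rule field_le_epsilon)
  fix e :: real assume "0 < e"
  then have "(p x)\<^sup>2 < (p x)\<^sup>2 + e" by simp
  then obtain c where c: "c \<in> carrier A" "star A c \<otimes> c \<oplus> star A x \<otimes> x = of_real ((p x)\<^sup>2 + e) \<odot> \<one>"
    using ex_complement_square[OF one_neq_zero x] by blast
  have "\<phi> (star A c \<otimes> c) + \<phi> (star A x \<otimes> x) = of_real ((p x)\<^sup>2 + e) * \<phi> \<one>"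
    using lin_add[OF state_lin[OF \<phi>], of "star A c \<otimes> c" "star A x \<otimes> x"]
      lin_smult[OF state_lin[OF \<phi>], of \<one> "of_real ((p x)\<^sup>2 + e)"] c x by (simp add: cl)
  then have "Re (\<phi> (star A c \<otimes> c)) + Re (\<phi> (star A x \<otimes> x)) = (p x)\<^sup>2 + e"
    by (simp add: state_one[OF \<phi>] complex_eq_iff)
  then show "Re (\<phi> (star A x \<otimes> x)) \<le> (p x)\<^sup>2 + e" using state_pos[OF \<phi> c(1)] by simp
qed

lemma state_le:
  assumes \<phi>: "state A \<phi>" and x: "x \<in> carrier A"
  shows "cmod (\<phi> x) \<le> p x"
proof -
  have "sqrt (Re (\<phi> (star A x \<otimes> x))) \<le> sqrt ((p x)\<^sup>2)"
    using state_square_le[OF assms] by (rule real_sqrt_le_mono)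
  then show ?thesis using state_norm_le[OF assms] cstar_seminormD(1)[OF p_seminorm x] by simp
qed

end

section \<open>Comultiplication on the polynomial algebra\<close>

text \<open>\<open>cop A g x t\<close> states that the formal tensor \<open>t\<close> represents \<open>\<Delta> x\<close>, where the pairs in \<open>g\<close> prescribe
  \<open>\<Delta>\<close> on generators.\<close>

inductive cop :: "('a, 'b) star_alg_scheme \<Rightarrow> ('a \<times> ('a \<times> 'a) list) set \<Rightarrow> 'a \<Rightarrow> ('a \<times> 'a) list \<Rightarrow> bool"
  for A g where
  base: "(x, t) \<in> g \<Longrightarrow> cop A g x t"
| one: "cop A g \<one>\<^bsub>A\<^esub> \<one>\<^bsub>formal_tensor A A\<^esub>"
| add: "cop A g x s \<Longrightarrow> cop A g y t \<Longrightarrow> cop A g (x \<oplus>\<^bsub>A\<^esub> y) (s \<oplus>\<^bsub>formal_tensor A A\<^esub> t)"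
| mult: "cop A g x s \<Longrightarrow> cop A g y t \<Longrightarrow> cop A g (x \<otimes>\<^bsub>A\<^esub> y) (s \<otimes>\<^bsub>formal_tensor A A\<^esub> t)"
| smult: "cop A g x s \<Longrightarrow> cop A g (c \<odot>\<^bsub>A\<^esub> x) (c \<odot>\<^bsub>formal_tensor A A\<^esub> s)"
| star: "cop A g x s \<Longrightarrow> cop A g (star A x) (star (formal_tensor A A) s)"

definition gens :: "nat \<Rightarrow> 'a mat \<Rightarrow> ('a \<times> ('a \<times> 'a) list) set" where
  "gens n u = {(u i j, [(u i k, u k j). k \<leftarrow> [0..<n]]) | i j. i < n \<and> j < n}"

lemma gensI: "i < n \<Longrightarrow> j < n \<Longrightarrow> (u i j, [(u i k, u k j). k \<leftarrow> [0..<n]]) \<in> gens n u"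
  by (auto simp: gens_def)

lemma gensE:
  assumes "(x, t) \<in> gens n u"
  obtains i j where "i < n" "j < n" "x = u i j" "t = [(u i k, u k j). k \<leftarrow> [0..<n]]"
  using assms unfolding gens_def by blast

lemma (in star_algebra) gens_closed:
  assumes "\<And>i j. i < n \<Longrightarrow> j < n \<Longrightarrow> u i j \<in> carrier A" "(x, t) \<in> gens n u"
  shows "x \<in> carrier A" "t \<in> carrier T"
  using assms by (auto simp: gens_def T_simps(1))

lemma (in star_algebra) cop_closed:
  assumes g: "\<And>x t. (x, t) \<in> g \<Longrightarrow> x \<in> carrier A \<and> t \<in> carrier T" and "cop A g x t"
  shows "x \<in> carrier A" "t \<in> carrier T"
proof -
  have "x \<in> carrier A \<and> t \<in> carrier T"
    using assms(2) by induction (use g cl T_closed in auto)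
  then show "x \<in> carrier A" "t \<in> carrier T" by auto
qed

abbreviation tmap :: "('a \<Rightarrow> 'b) \<Rightarrow> ('a \<times> 'a) list \<Rightarrow> ('b \<times> 'b) list" where
  "tmap f \<equiv> map (map_prod f f)"

section \<open>Transport of tensors and comultiplications along homomorphisms\<close>

locale star_morphism = A: star_algebra A + B: star_algebra B
  for A :: "('a, 'c) star_alg_scheme" (structure) and B :: "('b, 'd) star_alg_scheme" +
  fixes f :: "'a \<Rightarrow> 'b"
  assumes hom: "star_hom A B f"
begin

lemma f_simps:
  "x \<in> carrier A \<Longrightarrow> f x \<in> carrier B"
  "x \<in> carrier A \<Longrightarrow> y \<in> carrier A \<Longrightarrow> f (x \<oplus> y) = f x \<oplus>\<^bsub>B\<^esub> f y"
  "x \<in> carrier A \<Longrightarrow> y \<in> carrier A \<Longrightarrow> f (x \<otimes> y) = f x \<otimes>\<^bsub>B\<^esub> f y"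
  "x \<in> carrier A \<Longrightarrow> f (c \<odot> x) = c \<odot>\<^bsub>B\<^esub> f x"
  "x \<in> carrier A \<Longrightarrow> f (star A x) = star B (f x)"
  "f \<one> = \<one>\<^bsub>B\<^esub>"
  using hom by (auto simp: star_hom_def ring_hom_def)

lemma f_zero: "f \<zero> = \<zero>\<^bsub>B\<^esub>"
  using f_simps(4)[of \<zero> 0] f_simps(1)[of \<zero>] by (simp add: A.smult_zero B.rules)

lemma tmap_simps:
  "tmap f \<one>\<^bsub>A.T\<^esub> = \<one>\<^bsub>B.T\<^esub>" "tmap f (s \<oplus>\<^bsub>A.T\<^esub> t) = tmap f s \<oplus>\<^bsub>B.T\<^esub> tmap f t"
  "s \<in> carrier A.T \<Longrightarrow> tmap f s \<in> carrier B.T"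
  "s \<in> carrier A.T \<Longrightarrow> tmap f (c \<odot>\<^bsub>A.T\<^esub> s) = c \<odot>\<^bsub>B.T\<^esub> tmap f s"
  "s \<in> carrier A.T \<Longrightarrow> tmap f (star A.T s) = star B.T (tmap f s)"
proof -
  show "tmap f \<one>\<^bsub>A.T\<^esub> = \<one>\<^bsub>B.T\<^esub>" "tmap f (s \<oplus>\<^bsub>A.T\<^esub> t) = tmap f s \<oplus>\<^bsub>B.T\<^esub> tmap f t"
    by (simp_all add: A.T_simps B.T_simps f_simps)
  show "s \<in> carrier A.T \<Longrightarrow> tmap f s \<in> carrier B.T"
    by (induction s rule: A.T_induct) (simp_all add: B.T_closed_simps f_simps)
  show "s \<in> carrier A.T \<Longrightarrow> tmap f (c \<odot>\<^bsub>A.T\<^esub> s) = c \<odot>\<^bsub>B.T\<^esub> tmap f s"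
    by (induction s rule: A.T_induct) (simp_all add: A.T_simps B.T_simps f_simps)
  show "s \<in> carrier A.T \<Longrightarrow> tmap f (star A.T s) = star B.T (tmap f s)"
    by (induction s rule: A.T_induct) (simp_all add: A.T_simps B.T_simps f_simps)
qed

lemma tmap_mult:
  assumes "s \<in> carrier A.T" "t \<in> carrier A.T"
  shows "tmap f (s \<otimes>\<^bsub>A.T\<^esub> t) = tmap f s \<otimes>\<^bsub>B.T\<^esub> tmap f t"
  using assms(1)
proof (induction s rule: A.T_induct)
  case (Cons a b s)
  have "tmap f (map (\<lambda>(a', b'). (a \<otimes> a', b \<otimes> b')) t) = map (\<lambda>(a', b'). (f a \<otimes>\<^bsub>B\<^esub> a', f b \<otimes>\<^bsub>B\<^esub> b')) (tmap f t)"
    using assms(2) Cons.hyps by (induction t rule: A.T_induct) (simp_all add: f_simps)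
  then show ?case using Cons by (simp add: A.T_simps B.T_simps)
qed (simp add: A.T_simps B.T_simps)

lemma cop_map:
  assumes g: "\<And>x t. (x, t) \<in> g \<Longrightarrow> x \<in> carrier A \<and> t \<in> carrier A.T"
    and g': "\<And>x t. (x, t) \<in> g \<Longrightarrow> (f x, tmap f t) \<in> g'" and "cop A g x t"
  shows "cop B g' (f x) (tmap f t)"
  using assms(3)
proof induction
  case (add x s y t)
  then show ?case using A.cop_closed[OF g] cop.add[OF add.IH]
    by (simp add: f_simps tmap_simps)
next
  case (mult x s y t)
  then show ?case using A.cop_closed[OF g] cop.mult[OF mult.IH]
    by (simp add: f_simps tmap_mult)
next
  case (smult x s c)
  then show ?case using A.cop_closed[OF g] cop.smult[OF smult.IH, of c]
    by (simp add: f_simps tmap_simps)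
next
  case (star x s)
  then show ?case using A.cop_closed[OF g] cop.star[OF star.IH]
    by (simp add: f_simps tmap_simps)
next
  case one
  then show ?case using cop.one[of B g'] by (simp only: f_simps(6) tmap_simps(1))
qed (use g' in \<open>auto intro: cop.base\<close>)

lemma cop_map_gens:
  assumes u: "\<And>i j. i < n \<Longrightarrow> j < n \<Longrightarrow> u i j \<in> carrier A" and "cop A (gens n u) x t"
  shows "cop B (gens n (\<lambda>i j. f (u i j))) (f x) (tmap f t)"
proof (rule cop_map[OF _ _ assms(2)])
  show "x \<in> carrier A \<and> t \<in> carrier A.T" if "(x, t) \<in> gens n u" for x t
    using A.gens_closed[OF u that] by simp
  show "(f x, tmap f t) \<in> gens n (\<lambda>i j. f (u i j))" if "(x, t) \<in> gens n u" for x t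
  proof -
    from that obtain i j where "i < n" "j < n" "x = u i j" "t = [(u i k, u k j). k \<leftarrow> [0..<n]]"
      by (rule gensE)
    then show ?thesis using gensI[of i n j "\<lambda>i j. f (u i j)"] by (simp add: o_def)
  qed
qed

lemma lin_comp: "lin B \<phi> \<Longrightarrow> lin A (\<lambda>x. \<phi> (f x))"
  by (simp add: lin_def f_simps)

lemma state_comp: "state B \<phi> \<Longrightarrow> state A (\<lambda>x. \<phi> (f x))"
  by (simp add: state_def f_simps flip: f_simps(3,5))
     (simp add: f_simps A.cl)

lemma tf_tmap: "tensor_functional \<phi> \<psi> (tmap f t) = tensor_functional (\<lambda>x. \<phi> (f x)) (\<lambda>x. \<psi> (f x)) t"
  by (induction t) (auto simp: A.tf_simps B.tf_simps)

lemma teq_tmap: "A.teq s t \<Longrightarrow> B.teq (tmap f s) (tmap f t)"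
  by (simp add: A.teq_def B.teq_def tmap_simps tf_tmap lin_comp)

lemma sl_tmap:
  assumes "t \<in> carrier A.T"
  shows "B.slL h (tmap f t) = f (A.slL (\<lambda>x. h (f x)) t)" "B.slR h (tmap f t) = f (A.slR (\<lambda>x. h (f x)) t)"
  using assms by (induction t rule: A.T_induct)
    (simp_all add: A.sl_simps B.sl_simps f_zero f_simps A.sl_closed A.cl)

end

lemma seqlimI:
  assumes "cstar_normed A (nrm A)" "x \<in> carrier A" "seqconv A (nrm A) s x" "\<And>n. s n \<in> carrier A"
  shows "seqlim A s = x"
  unfolding seqlim_def
proof (rule the_equality)
  interpret cstar_normed A "nrm A" by fact
  interpret pre: prenormed A "nrm A" "\<lambda>x y. nrm A (x \<oplus>\<^bsub>A\<^esub> (-1) \<odot>\<^bsub>A\<^esub> y)"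
    by (rule prenormed_of_cstar_seminorm[OF p_seminorm])
  show "x \<in> carrier A \<and> seqconv A (nrm A) s x" using assms by simp
  fix y assume y: "y \<in> carrier A \<and> seqconv A (nrm A) s y"
  have "(\<lambda>n. nrm A (y \<oplus>\<^bsub>A\<^esub> (-1) \<odot>\<^bsub>A\<^esub> x)) \<longlonglongrightarrow> 0"
  proof (rule pre.dst_null_trans)
    show "(\<lambda>n. nrm A (s n \<oplus>\<^bsub>A\<^esub> (-1) \<odot>\<^bsub>A\<^esub> x)) \<longlonglongrightarrow> 0" using assms(3) by (simp add: seqconv_def)
    show "(\<lambda>n. nrm A (y \<oplus>\<^bsub>A\<^esub> (-1) \<odot>\<^bsub>A\<^esub> s n)) \<longlonglongrightarrow> 0"
      by (rule pre.dst_null_commute) (use y assms(4) in \<open>auto simp: seqconv_def\<close>)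
  qed (use assms y in auto)
  then have "nrm A (y \<oplus>\<^bsub>A\<^esub> (-1) \<odot>\<^bsub>A\<^esub> x) = 0" by (simp add: LIMSEQ_const_iff)
  then have "y \<oplus>\<^bsub>A\<^esub> (-1) \<odot>\<^bsub>A\<^esub> x = \<zero>\<^bsub>A\<^esub>" using y assms(2) by (intro p_definite) (simp_all add: cl)
  then show "y = x" using y assms(2) eq_of_diff_zero by blast
qed

section \<open>Slices and uniqueness of the comultiplication in a C*-algebra\<close>

context cstar_algebra
begin

sublocale cstar_nontrivial A "nrm A"
proof -
  interpret cstar_normed A "nrm A" by (rule cstar_normed)
  show "cstar_nontrivial A (nrm A)" by unfold_locales (rule nontrivial)
qed

sublocale mt: prenormed T "min_norm A A" "\<lambda>x y. min_norm A A (x \<oplus>\<^bsub>T\<^esub> (-1) \<odot>\<^bsub>T\<^esub> y)"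
  by (rule prenormed_min_norm)

text \<open>The slice of a class is defined through the chosen representative \<open>rep\<close>. As
  slices are contractive for the minimal norm, any Cauchy sequence of the class may be used
  instead.\<close>

lemma slice_limit:
  assumes h: "state A h" and s: "seqcauchy T (min_norm A A) s" and y: "y \<in> carrier A"
  shows "seqconv A (nrm A) (\<lambda>n. slL h (s n)) y \<Longrightarrow> slice_left A h (cauchy_class T (min_norm A A) s) = y"
    and "seqconv A (nrm A) (\<lambda>n. slR h (s n)) y \<Longrightarrow> slice_right A h (cauchy_class T (min_norm A A) s) = y"
proof -
  interpret pre: prenormed A "nrm A" "\<lambda>x y. nrm A (x \<oplus> (-1) \<odot> y)"
    by (rule prenormed_of_cstar_seminorm[OF p_seminorm])
  let ?X = "cauchy_class T (min_norm A A) s"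
  note r = mt.rep_cls[OF s]
  have r_in: "rep ?X n \<in> carrier T" and s_in: "s n \<in> carrier T" for n
    using r s mt.cauchy_in by auto
  have diff: "s n \<oplus>\<^bsub>T\<^esub> (-1) \<odot>\<^bsub>T\<^esub> rep ?X n \<in> carrier T" for n using r_in s_in by (intro T_closed)
  note lh = state_lin[OF h]
  show "slice_left A h ?X = y" if "seqconv A (nrm A) (\<lambda>n. slL h (s n)) y"
    unfolding slice_left_def slL_def[symmetric]
  proof (rule seqlimI[OF cstar_normed y])
    have "(\<lambda>n. nrm A (slL h (s n) \<oplus> (-1) \<odot> slL h (rep ?X n))) \<longlonglongrightarrow> 0"
    proof (rule pre.tendsto_0_le)
      show "nrm A (slL h (s n) \<oplus> (-1) \<odot> slL h (rep ?X n)) \<le> min_norm A A (s n \<oplus>\<^bsub>T\<^esub> (-1) \<odot>\<^bsub>T\<^esub> rep ?X n)" for n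
        using sl_le_min_norm(1)[OF h diff[of n]] r_in s_in
        by (simp add: T_simps(4) sl_append sl_smult[OF lh] T_closed)
    qed (use r r_in s_in sl_closed pre.dst_nonneg in auto)
    then have "(\<lambda>n. nrm A (slL h (rep ?X n) \<oplus> (-1) \<odot> slL h (s n))) \<longlonglongrightarrow> 0"
      by (rule pre.dst_null_commute) (use r_in s_in sl_closed in auto)
    then show "seqconv A (nrm A) (\<lambda>n. slL h (rep ?X n)) y"
      unfolding seqconv_def
      by (rule pre.dst_null_trans) (use that r_in s_in y sl_closed in \<open>auto simp: seqconv_def\<close>)
  qed (use r_in sl_closed in auto)
  show "slice_right A h ?X = y" if "seqconv A (nrm A) (\<lambda>n. slR h (s n)) y"
    unfolding slice_right_def slR_def[symmetric]
  proof (rule seqlimI[OF cstar_normed y])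
    have "(\<lambda>n. nrm A (slR h (s n) \<oplus> (-1) \<odot> slR h (rep ?X n))) \<longlonglongrightarrow> 0"
    proof (rule pre.tendsto_0_le)
      show "nrm A (slR h (s n) \<oplus> (-1) \<odot> slR h (rep ?X n)) \<le> min_norm A A (s n \<oplus>\<^bsub>T\<^esub> (-1) \<odot>\<^bsub>T\<^esub> rep ?X n)" for n
        using sl_le_min_norm(2)[OF h diff[of n]] r_in s_in
        by (simp add: T_simps(4) sl_append sl_smult[OF lh] T_closed)
    qed (use r r_in s_in sl_closed pre.dst_nonneg in auto)
    then have "(\<lambda>n. nrm A (slR h (rep ?X n) \<oplus> (-1) \<odot> slR h (s n))) \<longlonglongrightarrow> 0"
      by (rule pre.dst_null_commute) (use r_in s_in sl_closed in auto)
    then show "seqconv A (nrm A) (\<lambda>n. slR h (rep ?X n)) y"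
      unfolding seqconv_def
      by (rule pre.dst_null_trans) (use that r_in s_in y sl_closed in \<open>auto simp: seqconv_def\<close>)
  qed (use r_in sl_closed in auto)
qed

lemma slice_emb:
  assumes h: "state A h" and t: "t \<in> carrier T"
  shows "slice_left A h (mt.emb t) = slL h t" "slice_right A h (mt.emb t) = slR h t"
  unfolding to_completion_def using t sl_closed
  by (auto intro!: slice_limit[OF h] mt.cauchy_const simp: seqconv_def rules seminorm_zero[OF p_seminorm] sl_closed)

context
  fixes \<Delta> n and u :: "'a mat"
  assumes \<Delta>: "star_hom A (min_tensor A A) \<Delta>"
    and u: "\<And>i j. i < n \<Longrightarrow> j < n \<Longrightarrow> u i j \<in> carrier A"
    and \<Delta>u: "\<And>i j. i < n \<Longrightarrow> j < n \<Longrightarrow>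
      \<Delta> (u i j) = to_min_tensor A A [(u i k, u k j). k \<leftarrow> [0..<n]]"
begin

lemma cop_comultiplication:
  assumes "cop A (gens n u) x t"
  shows "\<Delta> x = mt.emb t"
  using assms
proof induction
  case (base x t)
  then show ?case using \<Delta>u by (auto simp: gens_def to_min_tensor_def)
next
  case one
  then show ?case using \<Delta> by (simp add: star_hom_def ring_hom_def mt.emb_simps min_tensor_def)
next
  case (add x s y t)
  then show ?case using \<Delta> cop_closed[OF conjI[OF gens_closed[OF u]]]
    by (simp add: star_hom_def ring_hom_def mt.emb_simps min_tensor_def)
next
  case (mult x s y t)
  then show ?case using \<Delta> cop_closed[OF conjI[OF gens_closed[OF u]]]
    by (simp add: star_hom_def ring_hom_def mt.emb_simps min_tensor_def)
next
  case (smult x s c)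
  then show ?case using \<Delta> cop_closed[OF conjI[OF gens_closed[OF u]]]
    by (simp add: star_hom_def ring_hom_def mt.emb_simps min_tensor_def)
next
  case (star x s)
  then show ?case using \<Delta> cop_closed[OF conjI[OF gens_closed[OF u]]]
    by (simp add: star_hom_def ring_hom_def mt.emb_simps min_tensor_def)
qed

text \<open>Both tensors have the same image in the minimal tensor product, namely
  \<open>\<Delta> x\<close>, and the minimal norm separates algebraic tensors.\<close>

lemma cop_unique:
  assumes "cop A (gens n u) x s" "cop A (gens n u) x t"
  shows "teq s t"
proof (rule teq_of_min_norm)
  show s: "s \<in> carrier T" and t: "t \<in> carrier T"
    using cop_closed(2)[OF conjI[OF gens_closed[OF u]]] assms by auto
  have "mt.emb s = mt.emb t" using cop_comultiplication assms by metis
  then show "min_norm A A (s @ (-1) \<odot>\<^bsub>T\<^esub> t) = 0" using s t by (simp add: mt.emb_eq_iff T_simps(4))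
qed

lemma cop_slices:
  assumes h: "state A h" and "cop A (gens n u) x t"
    and "slice_left A h (\<Delta> x) = h x \<odot> \<one>" "slice_right A h (\<Delta> x) = h x \<odot> \<one>"
  shows "slL h t = h x \<odot> \<one>" "slR h t = h x \<odot> \<one>"
  using assms cop_comultiplication[OF assms(2)] slice_emb[OF h] cop_closed(2)[OF conjI[OF gens_closed[OF u]] assms(2)]
  by simp_all

end

end

text \<open>Well-definedness of the comultiplication descends along injective *-homomorphisms.\<close>

lemma (in star_morphism) teq_of_teq_tmap:
  assumes B: "cstar_nontrivial B q" and inj: "inj_on f (carrier A)"
    and s: "s \<in> carrier A.T" and t: "t \<in> carrier A.T" and eq: "B.teq (tmap f s) (tmap f t)"
  shows "A.teq s t"
proof -
  interpret B: cstar_nontrivial B q by fact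
  have inj': "x = y" if "x \<in> carrier A" "y \<in> carrier A" "\<And>\<phi>. state B \<phi> \<Longrightarrow> \<phi> (f x) = \<phi> (f y)" for x y
    using B.eq_of_states[of "f x" "f y"] that f_simps(1) inj by (simp add: inj_on_def)
  have slice: "A.slL (\<lambda>x. \<phi> (f x)) s = A.slL (\<lambda>x. \<phi> (f x)) t" if \<phi>: "state B \<phi>" for \<phi>
  proof (rule inj')
    fix \<psi> assume \<psi>: "state B \<psi>"
    show "\<psi> (f (A.slL (\<lambda>x. \<phi> (f x)) s)) = \<psi> (f (A.slL (\<lambda>x. \<phi> (f x)) t))"
      using A.lin_sl(1)[OF lin_comp[OF state_lin[OF \<psi>]] s] A.lin_sl(1)[OF lin_comp[OF state_lin[OF \<psi>]] t]
        B.teqD[OF eq state_lin[OF \<phi>] state_lin[OF \<psi>]] by (simp add: tf_tmap)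
  qed (use s t A.sl_closed in auto)
  have "A.slR \<psi> s = A.slR \<psi> t" if \<psi>: "lin A \<psi>" for \<psi>
  proof (rule inj')
    fix \<phi> assume \<phi>: "state B \<phi>"
    show "\<phi> (f (A.slR \<psi> s)) = \<phi> (f (A.slR \<psi> t))"
      using A.lin_sl(2)[OF lin_comp[OF state_lin[OF \<phi>]] s, of \<psi>] A.lin_sl(2)[OF lin_comp[OF state_lin[OF \<phi>]] t, of \<psi>]
        A.lin_sl(1)[OF \<psi> s, of "\<lambda>x. \<phi> (f x)"] A.lin_sl(1)[OF \<psi> t, of "\<lambda>x. \<phi> (f x)"] slice[OF \<phi>] by simp
  qed (use s t A.sl_closed in auto)
  then have "tensor_functional \<phi> \<psi> s = tensor_functional \<phi> \<psi> t" if "lin A \<phi>" "lin A \<psi>" for \<phi> \<psi>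
    using A.lin_sl(2)[OF that(1) s, of \<psi>] A.lin_sl(2)[OF that(1) t, of \<psi>] that(2) by simp
  then show ?thesis using s t by (simp add: A.teq_def)
qed

section \<open>Coamenability in terms of the polynomial algebra\<close>

locale quantum_algebra = star_algebra A for A :: "('a, 'b) star_alg_scheme" (structure) +
  fixes p :: "'a \<Rightarrow> real" and n :: nat and u :: "'a mat"
  assumes p_cstar: "cstar_seminorm A p"
    and p_def: "\<lbrakk>x \<in> carrier A; p x = 0\<rbrakk> \<Longrightarrow> x = \<zero>"
    and p_max: "\<lbrakk>cstar_seminorm A q; x \<in> carrier A\<rbrakk> \<Longrightarrow> q x \<le> p x"
    and nontriv: "\<one> \<noteq> \<zero>"
    and u_in: "\<lbrakk>i < n; j < n\<rbrakk> \<Longrightarrow> u i j \<in> carrier A"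
    and cop_total: "x \<in> carrier A \<Longrightarrow> \<exists>t. cop A (gens n u) x t"
begin

sublocale pre: prenormed A p "\<lambda>x y. p (x \<oplus> (-1) \<odot> y)"
  by (rule prenormed_of_cstar_seminorm[OF p_cstar])

abbreviation "K \<equiv> completion A p"

abbreviation "cp \<equiv> cop A (gens n u)"

definition M :: "(nat \<Rightarrow> 'a) set cmqg" where
  "M = \<lparr>alg = K, msize = n, fund = (\<lambda>i j. pre.emb (u i j))\<rparr>"

text \<open>The faithful Haar state of the completion, expressed without the completion. The bound
  by \<open>p\<close> is the continuity needed for extending \<open>h\<close>, and invariance is
  demanded for every formal tensor that represents the comultiplication of x.\<close>

definition haar_on :: "('a \<Rightarrow> complex) \<Rightarrow> bool" where
  "haar_on h \<longleftrightarrow> state A h \<and> (\<forall>x\<in>carrier A. cmod (h x) \<le> p x) \<and>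
     (\<forall>x t. cp x t \<longrightarrow> slL h t = h x \<odot> \<one> \<and> slR h t = h x \<odot> \<one>) \<and>
     (\<forall>s. seqcauchy A p s \<longrightarrow> (\<lambda>n. h (star A (s n) \<otimes> s n)) \<longlonglongrightarrow> 0 \<longrightarrow> (\<lambda>n. p (s n)) \<longlonglongrightarrow> 0)"

sublocale K: cstar_algebra K
proof -
  interpret C: cstar_normed K "nrm K" by (rule cstar_normed_completion[OF p_cstar])
  show "cstar_algebra K"
  proof
    show "\<one>\<^bsub>K\<^esub> \<noteq> \<zero>\<^bsub>K\<^esub>"
      using pre.emb_eq_iff[of \<one> \<zero>] p_def[OF one_closed] nontriv
      by (auto simp: pre.emb_simps smult_zero)
  qed (use C.p_seminorm C.p_definite C.p_complete in auto)
qed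

sublocale emb: star_morphism A K pre.emb
  by unfold_locales (rule pre.emb_hom)

lemma emb_inj: "inj_on pre.emb (carrier A)"
proof (rule inj_onI)
  fix x y assume xy: "x \<in> carrier A" "y \<in> carrier A" "pre.emb x = pre.emb y"
  then have "x \<oplus> (-1) \<odot> y = \<zero>" by (intro p_def) (simp_all add: pre.emb_eq_iff cl)
  then show "x = y" using xy eq_of_diff_zero by blast
qed

lemma cp_closed: "cp x t \<Longrightarrow> x \<in> carrier A" "cp x t \<Longrightarrow> t \<in> carrier T"
  using cop_closed[OF conjI[OF gens_closed[OF u_in]]] by auto

lemma fund_M: "fund M = (\<lambda>i j. pre.emb (u i j))" "msize M = n" "alg M = K"
  by (simp_all add: M_def)

lemma cls_star_mult:
  assumes "seqcauchy A p s"
  shows "star K (pre.cls s) \<otimes>\<^bsub>K\<^esub> pre.cls s = pre.cls (\<lambda>n. star A (s n) \<otimes> s n)"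
  using assms by (simp add: pre.cls_star pre.cls_mult pre.cauchy_star)

theorem haar_on_of_haar_state:
  assumes H: "haar_state M H" and faithful: "faithful (alg M) H"
  shows "haar_on (\<lambda>x. H (pre.emb x))"
proof -
  obtain \<Delta> where H': "state K H" and \<Delta>: "comultiplication M \<Delta>" and inv:
    "\<And>X. X \<in> carrier K \<Longrightarrow> slice_left K H (\<Delta> X) = H X \<odot>\<^bsub>K\<^esub> \<one>\<^bsub>K\<^esub>"
    "\<And>X. X \<in> carrier K \<Longrightarrow> slice_right K H (\<Delta> X) = H X \<odot>\<^bsub>K\<^esub> \<one>\<^bsub>K\<^esub>"
    using H by (auto simp: haar_state_def fund_M)
  have \<Delta>': "star_hom K (min_tensor K K) \<Delta>" "\<And>i j. i < n \<Longrightarrow> j < n \<Longrightarrow>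
      \<Delta> (pre.emb (u i j)) = to_min_tensor K K [(pre.emb (u i k), pre.emb (u k j)). k \<leftarrow> [0..<n]]"
    using \<Delta> by (auto simp: comultiplication_def fund_M)
  have emb_in: "pre.emb (u i j) \<in> carrier K" if "i < n" "j < n" for i j
    using u_in[OF that] by (simp add: pre.emb_simps)
  show ?thesis
    unfolding haar_on_def
  proof (intro conjI ballI allI impI)
    show "state A (\<lambda>x. H (pre.emb x))" by (rule emb.state_comp[OF H'])
    show "cmod (H (pre.emb x)) \<le> p x" if "x \<in> carrier A" for x
      using K.state_le[OF H', of "pre.emb x"] that by (simp add: pre.emb_simps)
  next
    fix x t assume xt: "cp x t"
    note in_c = cp_closed[OF xt]
    have c: "cop K (gens n (\<lambda>i j. pre.emb (u i j))) (pre.emb x) (tmap pre.emb t)"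
      by (rule emb.cop_map_gens[OF u_in xt])
    note sl = K.cop_slices[OF \<Delta>'(1) emb_in \<Delta>'(2) H' c inv(1) inv(2)]
    have e: "H (pre.emb x) \<odot>\<^bsub>K\<^esub> \<one>\<^bsub>K\<^esub> = pre.emb (H (pre.emb x) \<odot> \<one>)"
      by (simp add: pre.emb_simps)
    show "slL (\<lambda>x. H (pre.emb x)) t = H (pre.emb x) \<odot> \<one>"
      using sl(1) in_c by (intro inj_onD[OF emb_inj]) (auto simp: e emb.sl_tmap pre.emb_simps(1) sl_closed cl)
    show "slR (\<lambda>x. H (pre.emb x)) t = H (pre.emb x) \<odot> \<one>"
      using sl(2) in_c by (intro inj_onD[OF emb_inj]) (auto simp: e emb.sl_tmap pre.emb_simps(1) sl_closed cl)
  next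
    fix s assume s: "seqcauchy A p s" and lim: "(\<lambda>n. H (pre.emb (star A (s n) \<otimes> s n))) \<longlonglongrightarrow> 0"
    let ?X = "pre.cls s"
    have X: "?X \<in> carrier K" by (rule pre.cls_closed[OF s])
    define t where "t n = star A (s n) \<otimes> s n" for n
    have t: "seqcauchy A p t" unfolding t_def using s by (intro pre.cauchy_mult pre.cauchy_star)
    have XX: "star K ?X \<otimes>\<^bsub>K\<^esub> ?X = pre.cls t" using cls_star_mult[OF s] by (simp add: t_def[abs_def])
    \<comment> \<open>States are contractive, so H on the class is the limit of its values on the
      terms. By \<open>lim\<close> this limit is 0, and faithfulness makes the class zero.\<close>
    have "(\<lambda>n. H (pre.emb (t n)) - H (pre.cls t)) \<longlonglongrightarrow> 0"
    proof (rule tendsto_norm_zero_cancel, rule pre.tendsto_0_le[OF pre.cauchy_tendsto_emb[OF t]])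
      fix n
      have in_K: "pre.emb (t n) \<in> carrier K" "pre.cls t \<in> carrier K"
        using pre.cauchy_in[OF t] t by (simp_all add: pre.emb_simps pre.cls_closed)
      have "H (pre.emb (t n)) - H (pre.cls t) = H (pre.emb (t n) \<oplus>\<^bsub>K\<^esub> (-1) \<odot>\<^bsub>K\<^esub> pre.cls t)"
        using in_K by (simp add: lin_add[OF state_lin[OF H']] lin_smult[OF state_lin[OF H']] K.cl)
      then show "norm (H (pre.emb (t n)) - H (pre.cls t)) \<le> nrm K (pre.emb (t n) \<oplus>\<^bsub>K\<^esub> (-1) \<odot>\<^bsub>K\<^esub> pre.cls t)"
        using K.state_le[OF H'] in_K by (simp add: K.cl)
    qed simp
    from tendsto_diff[OF lim[folded t_def] this] have "(\<lambda>n. H (pre.cls t)) \<longlonglongrightarrow> 0" by simp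
    then have "H (star K ?X \<otimes>\<^bsub>K\<^esub> ?X) = 0" by (simp add: XX LIMSEQ_const_iff)
    then have "?X = \<zero>\<^bsub>K\<^esub>" using faithful X by (simp add: faithful_def fund_M)
    then show "(\<lambda>n. p (s n)) \<longlonglongrightarrow> 0"
      using pre.nrm_cls[OF s] by (simp add: K.seminorm_zero[OF K.p_seminorm])
  qed
qed

section \<open>Extension of the comultiplication and of the Haar state to the completion\<close>

context
  assumes cp_unique: "\<And>x s t. cp x s \<Longrightarrow> cp x t \<Longrightarrow> teq s t"
begin

definition rep_cop :: "'a \<Rightarrow> ('a \<times> 'a) list" where
  "rep_cop x = (SOME t. cp x t)"

lemma rep_cop: "x \<in> carrier A \<Longrightarrow> cp x (rep_cop x)"
  unfolding rep_cop_def using cop_total by (rule someI_ex)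

text \<open>The norm of the comultiplication of \<open>x\<close>. It is a C*-seminorm, hence at most
  \<open>p\<close> by maximality; this is how the comultiplication becomes contractive and extends
  to the completion.\<close>

definition q :: "'a \<Rightarrow> real" where
  "q x = min_norm K K (tmap pre.emb (rep_cop x))"

lemma q_eq: "cp x t \<Longrightarrow> q x = min_norm K K (tmap pre.emb t)"
  unfolding q_def using rep_cop[OF cp_closed(1)] cp_unique emb.teq_tmap K.min_norm_cong by blast

lemma q_cstar: "cstar_seminorm A q"
  unfolding cstar_seminorm_def
proof (intro conjI ballI allI)
  note D = cstar_seminormD[OF K.cstar_seminorm_min_norm]
  fix x y c assume x: "x \<in> carrier A"
  note cx = rep_cop[OF x] and tx = cp_closed(2)[OF rep_cop[OF x]]
  show "0 \<le> q x" unfolding q_def by (rule D) (rule emb.tmap_simps(3)[OF tx])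
  show "q (c \<odot> x) = cmod c * q x"
    using q_eq[OF cop.smult[OF cx]] q_eq[OF cx] tx by (simp add: emb.tmap_simps D)
  show "q (star A x \<otimes> x) = (q x)\<^sup>2"
    using q_eq[OF cop.mult[OF cop.star[OF cx] cx]] q_eq[OF cx] tx
    by (simp add: emb.tmap_simps emb.tmap_mult D T_closed)
  assume y: "y \<in> carrier A"
  note cy = rep_cop[OF y] and ty = cp_closed(2)[OF rep_cop[OF y]]
  show "q (x \<oplus> y) \<le> q x + q y"
    unfolding q_eq[OF cop.add[OF cx cy]] q_eq[OF cx] q_eq[OF cy] emb.tmap_simps(2)
    by (rule D) (use tx ty emb.tmap_simps(3) in auto)
  show "q (x \<otimes> y) \<le> q x * q y"
    unfolding q_eq[OF cop.mult[OF cx cy]] q_eq[OF cx] q_eq[OF cy] emb.tmap_mult[OF tx ty]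
    by (rule D) (use tx ty emb.tmap_simps(3) in auto)
qed

lemma q_le: "x \<in> carrier A \<Longrightarrow> q x \<le> p x"
  by (rule p_max[OF q_cstar])

abbreviation "mdst s t \<equiv> min_norm K K (s \<oplus>\<^bsub>K.T\<^esub> (-1) \<odot>\<^bsub>K.T\<^esub> t)"

lemma mdst_cop:
  assumes "cp x s" "cp y t"
  shows "mdst (tmap pre.emb s) (tmap pre.emb t) = q (x \<oplus> (-1) \<odot> y)"
  using q_eq[OF cop.add[OF assms(1) cop.smult[OF assms(2), of "-1"]]] cp_closed assms
  by (simp add: emb.tmap_simps)

definition lift_cop :: "'a \<Rightarrow> ((nat \<Rightarrow> 'a) set \<times> (nat \<Rightarrow> 'a) set) list" where
  "lift_cop x = tmap pre.emb (rep_cop x)"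

lemma lift_cop_in: "x \<in> carrier A \<Longrightarrow> lift_cop x \<in> carrier K.T"
  unfolding lift_cop_def by (rule emb.tmap_simps(3)[OF cp_closed(2)[OF rep_cop]])

lemma mdst_lift: "x \<in> carrier A \<Longrightarrow> y \<in> carrier A \<Longrightarrow> mdst (lift_cop x) (lift_cop y) \<le> p (x \<oplus> (-1) \<odot> y)"
  unfolding lift_cop_def using mdst_cop[OF rep_cop rep_cop, of x y] q_le[of "x \<oplus> (-1) \<odot> y"] by (simp add: cl)

lemma mdst_lift_cop: "cp x t \<Longrightarrow> mdst (lift_cop x) (tmap pre.emb t) = 0"
proof -
  assume c: "cp x t"
  have "mdst (lift_cop x) (tmap pre.emb t) = q (x \<oplus> (-1) \<odot> x)"
    unfolding lift_cop_def by (rule mdst_cop[OF rep_cop[OF cp_closed(1)[OF c]] c])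
  then show ?thesis using cp_closed(1)[OF c] by (simp add: rules seminorm_zero[OF q_cstar])
qed

lemma cauchy_lift:
  assumes "seqcauchy A p s" shows "seqcauchy K.T (min_norm K K) (\<lambda>n. lift_cop (s n))"
  unfolding seqcauchy_def
proof (intro conjI allI impI)
  note s_in = pre.cauchy_in[OF assms]
  show "lift_cop (s n) \<in> carrier K.T" for n by (rule lift_cop_in[OF s_in])
  fix e :: real assume "0 < e"
  then obtain N where "\<forall>m\<ge>N. \<forall>n\<ge>N. p (s m \<oplus> (-1) \<odot> s n) < e"
    using assms unfolding pre.cauchy_iff by meson
  then show "\<exists>M. \<forall>m\<ge>M. \<forall>n\<ge>M. mdst (lift_cop (s m)) (lift_cop (s n)) < e"
    using mdst_lift[OF s_in s_in] by (meson le_less_trans)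
qed

definition \<Delta>K :: "(nat \<Rightarrow> 'a) set \<Rightarrow> (nat \<Rightarrow> ((nat \<Rightarrow> 'a) set \<times> (nat \<Rightarrow> 'a) set) list) set" where
  "\<Delta>K X = cauchy_class K.T (min_norm K K) (\<lambda>n. lift_cop (rep X n))"

text \<open>Both choices in the definition, of a representative and of tensors for its terms, are
  immaterial: other choices change the sequence of tensors by a null sequence.\<close>

lemma \<Delta>K_cls:
  assumes s: "seqcauchy A p s" and t: "\<And>n. cp (s n) (t n)"
  shows "\<Delta>K (pre.cls s) = cauchy_class K.T (min_norm K K) (\<lambda>n. tmap pre.emb (t n))"
    and "seqcauchy K.T (min_norm K K) (\<lambda>n. tmap pre.emb (t n))"
proof -
  note r = pre.rep_cls[OF s]
  note in_c = pre.cauchy_in[OF s] pre.cauchy_in[OF conjunct1[OF r]]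
  have null: "(\<lambda>n. mdst (lift_cop (s n)) (tmap pre.emb (t n))) \<longlonglongrightarrow> 0"
    by (simp add: mdst_lift_cop[OF t])
  have t_in: "tmap pre.emb (t n) \<in> carrier K.T" for n
    using cp_closed(2)[OF t] emb.tmap_simps(3) by blast
  show cau: "seqcauchy K.T (min_norm K K) (\<lambda>n. tmap pre.emb (t n))"
    by (rule K.mt.cauchy_of_null[OF cauchy_lift[OF s] null t_in])
  have "(\<lambda>n. mdst (lift_cop (s n)) (lift_cop (rep (pre.cls s) n))) \<longlonglongrightarrow> 0"
    by (rule pre.tendsto_0_le[OF conjunct2[OF r]])
      (use in_c mdst_lift K.mt.dst_nonneg lift_cop_in in auto)
  then have "(\<lambda>n. mdst (lift_cop (rep (pre.cls s) n)) (lift_cop (s n))) \<longlonglongrightarrow> 0"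
    by (rule K.mt.dst_null_commute) (use lift_cop_in in_c in auto)
  then have "(\<lambda>n. mdst (lift_cop (rep (pre.cls s) n)) (tmap pre.emb (t n))) \<longlonglongrightarrow> 0"
    by (rule K.mt.dst_null_trans[OF _ null]) (use lift_cop_in in_c t_in in auto)
  then show "\<Delta>K (pre.cls s) = cauchy_class K.T (min_norm K K) (\<lambda>n. tmap pre.emb (t n))"
    unfolding \<Delta>K_def using cauchy_lift[OF conjunct1[OF r]] cau by (subst K.mt.cls_eq_iff) auto
qed

lemma \<Delta>K_hom: "star_hom K (min_tensor K K) \<Delta>K"
proof -
  have cases: "\<exists>s t. seqcauchy A p s \<and> X = pre.cls s \<and> (\<forall>n. cp (s n) (t n))" if "X \<in> carrier K" for X
  proof -
    obtain s where s: "seqcauchy A p s" "X = pre.cls s" using \<open>X \<in> carrier K\<close> by (rule pre.completion_cases)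
    then show ?thesis using rep_cop[OF pre.cauchy_in[OF s(1)]]
      by (intro exI[of _ s] exI[of _ "\<lambda>n. rep_cop (s n)"]) auto
  qed
  show ?thesis
    unfolding star_hom_def
  proof (intro conjI ballI allI ring_hom_memI)
    have "cp \<one> [(\<one>, \<one>)]" using cop.one[of A "gens n u"] by (simp add: T_simps)
    then have "\<Delta>K (pre.cls (\<lambda>_. \<one>)) = K.mt.cls (\<lambda>_. tmap pre.emb [(\<one>, \<one>)])"
      by (intro \<Delta>K_cls(1) pre.cauchy_const) auto
    then show "\<Delta>K \<one>\<^bsub>K\<^esub> = \<one>\<^bsub>min_tensor K K\<^esub>"
      by (simp add: pre.completion_simps K.mt.completion_simps min_tensor_def K.T_simps pre.emb_simps
          flip: pre.completion_simps(2))
    fix X Y c assume X: "X \<in> carrier K"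
    obtain s t where s: "seqcauchy A p s" "X = pre.cls s" "\<And>n. cp (s n) (t n)" using cases[OF X] by blast
    note X1 = \<Delta>K_cls[OF s(1,3)]
    have t_in: "t n \<in> carrier T" for n using cp_closed(2)[OF s(3)] .
    show "\<Delta>K X \<in> carrier (min_tensor K K)"
      using X1 s(2) by (simp add: min_tensor_def K.mt.cls_closed)
    show "\<Delta>K (c \<odot>\<^bsub>K\<^esub> X) = c \<odot>\<^bsub>min_tensor K K\<^esub> \<Delta>K X"
      using \<Delta>K_cls(1)[OF pre.cauchy_smult[OF s(1)] cop.smult[OF s(3)], of c] X1 s(1,2) t_in
      by (simp add: min_tensor_def pre.cls_smult K.mt.cls_smult emb.tmap_simps)
    show "\<Delta>K (star K X) = star (min_tensor K K) (\<Delta>K X)"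
      using \<Delta>K_cls(1)[OF pre.cauchy_star[OF s(1)] cop.star[OF s(3)]] X1 s(1,2) t_in
      by (simp add: min_tensor_def pre.cls_star K.mt.cls_star emb.tmap_simps)
    assume Y: "Y \<in> carrier K"
    obtain s' t' where s': "seqcauchy A p s'" "Y = pre.cls s'" "\<And>n. cp (s' n) (t' n)" using cases[OF Y] by blast
    note Y1 = \<Delta>K_cls[OF s'(1,3)]
    have t'_in: "t' n \<in> carrier T" for n using cp_closed(2)[OF s'(3)] .
    show "\<Delta>K (X \<oplus>\<^bsub>K\<^esub> Y) = \<Delta>K X \<oplus>\<^bsub>min_tensor K K\<^esub> \<Delta>K Y"
      using \<Delta>K_cls(1)[OF pre.cauchy_add[OF s(1) s'(1)] cop.add[OF s(3) s'(3)]] X1 Y1 s(1,2) s'(1,2) t_in t'_in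
      by (simp add: min_tensor_def pre.cls_add K.mt.cls_add emb.tmap_simps)
    show "\<Delta>K (X \<otimes>\<^bsub>K\<^esub> Y) = \<Delta>K X \<otimes>\<^bsub>min_tensor K K\<^esub> \<Delta>K Y"
      using \<Delta>K_cls(1)[OF pre.cauchy_mult[OF s(1) s'(1)] cop.mult[OF s(3) s'(3)]] X1 Y1 s(1,2) s'(1,2) t_in t'_in
      by (simp add: min_tensor_def pre.cls_mult K.mt.cls_mult emb.tmap_mult)
  qed
qed

lemma comultiplication_\<Delta>K: "comultiplication M \<Delta>K"
  unfolding comultiplication_def fund_M
proof (intro conjI allI impI \<Delta>K_hom)
  fix i j assume ij: "i < n" "j < n"
  have "cp (u i j) [(u i k, u k j). k \<leftarrow> [0..<n]]" using ij by (intro cop.base gensI)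
  then have "\<Delta>K (pre.cls (\<lambda>_. u i j)) = K.mt.cls (\<lambda>_. tmap pre.emb [(u i k, u k j). k \<leftarrow> [0..<n]])"
    using ij u_in by (intro \<Delta>K_cls(1) pre.cauchy_const) auto
  then show "\<Delta>K (pre.emb (u i j)) = to_min_tensor K K [(pre.emb (u i k), pre.emb (u k j)). k \<leftarrow> [0..<n]]"
    by (simp add: to_completion_def to_min_tensor_def o_def)
qed

text \<open>\<open>h\<close> extends along Cauchy sequences by its bound. Invariance holds on each
  term of a sequence and passes to the limit because slices are continuous; faithfulness is the last
  clause of \<open>haar_on\<close>.\<close>

theorem haar_state_of_haar_on:
  assumes h: "haar_on h"
  shows "\<exists>H. haar_state M H \<and> faithful (alg M) H"
proof -
  have hs: "state A h" and h_le: "\<And>x. x \<in> carrier A \<Longrightarrow> cmod (h x) \<le> p x"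
    and sl: "\<And>x t. cp x t \<Longrightarrow> slL h t = h x \<odot> \<one>" "\<And>x t. cp x t \<Longrightarrow> slR h t = h x \<odot> \<one>"
    and faith: "\<And>s. seqcauchy A p s \<Longrightarrow> (\<lambda>n. h (star A (s n) \<otimes> s n)) \<longlonglongrightarrow> 0 \<Longrightarrow> (\<lambda>n. p (s n)) \<longlonglongrightarrow> 0"
    using h unfolding haar_on_def by blast+
  note hl = lin_add[OF state_lin[OF hs]] lin_smult[OF state_lin[OF hs]]
  define H where "H X = lim (\<lambda>n. h (rep X n))" for X
  have diff: "cmod (h x - h y) \<le> p (x \<oplus> (-1) \<odot> y)" if "x \<in> carrier A" "y \<in> carrier A" for x y
    using h_le[of "x \<oplus> (-1) \<odot> y"] that by (simp add: hl cl)
  have conv: "convergent (\<lambda>n. h (s n))" if s: "seqcauchy A p s" for s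
  proof -
    have "Cauchy (\<lambda>n. h (s n))"
    proof (rule metric_CauchyI)
      fix e :: real assume "0 < e"
      then obtain N where "\<forall>m\<ge>N. \<forall>n\<ge>N. p (s m \<oplus> (-1) \<odot> s n) < e"
        using s unfolding pre.cauchy_iff by meson
      then show "\<exists>M. \<forall>m\<ge>M. \<forall>n\<ge>M. dist (h (s m)) (h (s n)) < e"
        using diff[OF pre.cauchy_in[OF s] pre.cauchy_in[OF s]] unfolding dist_norm by (meson le_less_trans)
    qed
    then show ?thesis by (simp add: Cauchy_convergent)
  qed
  have H_cls: "(\<lambda>n. h (s n)) \<longlonglongrightarrow> H (pre.cls s)" if s: "seqcauchy A p s" for s
  proof -
    note r = pre.rep_cls[OF s]
    obtain l where l: "(\<lambda>n. h (s n)) \<longlonglongrightarrow> l" using conv[OF s] by (auto simp: convergent_def)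
    have "(\<lambda>n. h (s n) - h (rep (pre.cls s) n)) \<longlonglongrightarrow> 0"
      by (rule tendsto_norm_zero_cancel, rule pre.tendsto_0_le[OF conjunct2[OF r]])
        (use diff pre.cauchy_in r s in auto)
    from tendsto_diff[OF l this] have "(\<lambda>n. h (rep (pre.cls s) n)) \<longlonglongrightarrow> l" by simp
    then show ?thesis using l by (simp add: H_def limI)
  qed
  have H_emb: "H (pre.emb x) = h x" if "x \<in> carrier A" for x
    using LIMSEQ_unique[OF H_cls[OF pre.cauchy_const[OF that]] tendsto_const]
    by (simp add: to_completion_def)
  have Hs: "state K H"
    unfolding state_def
  proof (intro conjI ballI allI)
    fix X Y c assume X: "X \<in> carrier K"
    obtain s where s: "seqcauchy A p s" "X = pre.cls s" using X by (rule pre.completion_cases)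
    note s_in = pre.cauchy_in[OF s(1)]
    show "H (c \<odot>\<^bsub>K\<^esub> X) = c * H X"
      using LIMSEQ_unique[OF H_cls[OF pre.cauchy_smult[OF s(1), of c]], of "c * H X"]
        tendsto_mult_left[OF H_cls[OF s(1)], of c] s s_in by (simp add: pre.cls_smult hl)
    have lim: "(\<lambda>n. h (star A (s n) \<otimes> s n)) \<longlonglongrightarrow> H (star K X \<otimes>\<^bsub>K\<^esub> X)"
      using H_cls[OF pre.cauchy_mult[OF pre.cauchy_star[OF s(1)] s(1)]] cls_star_mult[OF s(1)] s(2) by simp
    have "(\<lambda>n. 0) \<longlonglongrightarrow> Im (H (star K X \<otimes>\<^bsub>K\<^esub> X))"
      using tendsto_Im[OF lim] state_pos_Im[OF hs s_in] by simp
    then show "Im (H (star K X \<otimes>\<^bsub>K\<^esub> X)) = 0" by (simp add: LIMSEQ_const_iff)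
    show "0 \<le> Re (H (star K X \<otimes>\<^bsub>K\<^esub> X))"
      by (rule LIMSEQ_le_const[OF tendsto_Re[OF lim]]) (use state_pos[OF hs s_in] in blast)
    assume Y: "Y \<in> carrier K"
    obtain t where t: "seqcauchy A p t" "Y = pre.cls t" using Y by (rule pre.completion_cases)
    show "H (X \<oplus>\<^bsub>K\<^esub> Y) = H X + H Y"
      using LIMSEQ_unique[OF H_cls[OF pre.cauchy_add[OF s(1) t(1)]], of "H X + H Y"]
        tendsto_add[OF H_cls[OF s(1)] H_cls[OF t(1)]] s t s_in pre.cauchy_in[OF t(1)] by (simp add: pre.cls_add hl)
  next
    show "H \<one>\<^bsub>K\<^esub> = 1" using H_emb[OF one_closed] state_one[OF hs] by (simp add: pre.emb_simps)
  qed
  have slices: "slice_left K H (\<Delta>K X) = H X \<odot>\<^bsub>K\<^esub> \<one>\<^bsub>K\<^esub> \<and> slice_right K H (\<Delta>K X) = H X \<odot>\<^bsub>K\<^esub> \<one>\<^bsub>K\<^esub>"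
    if X: "X \<in> carrier K" for X
  proof -
    obtain s where s: "seqcauchy A p s" "X = pre.cls s" using X by (rule pre.completion_cases)
    note s_in = pre.cauchy_in[OF s(1)]
    define t where "t n = rep_cop (s n)" for n
    have t: "cp (s n) (t n)" for n unfolding t_def by (rule rep_cop[OF s_in])
    note \<Delta>X = \<Delta>K_cls[OF s(1) t]
    have HX: "H X \<odot>\<^bsub>K\<^esub> \<one>\<^bsub>K\<^esub> \<in> carrier K" by (simp add: K.cl)
    have cong: "slL (\<lambda>x. H (pre.emb x)) t = slL h t" "slR (\<lambda>x. H (pre.emb x)) t = slR h t"
      if "t \<in> carrier T" for t
      using that by (induction t rule: T_induct) (simp_all add: sl_simps H_emb)
    have sl_t: "K.slL H (tmap pre.emb (t n)) = h (s n) \<odot>\<^bsub>K\<^esub> \<one>\<^bsub>K\<^esub>"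
      "K.slR H (tmap pre.emb (t n)) = h (s n) \<odot>\<^bsub>K\<^esub> \<one>\<^bsub>K\<^esub>" for n
      using cp_closed(2)[OF t[of n]] sl[OF t[of n]] by (simp_all add: emb.sl_tmap cong pre.emb_simps)
    have "seqconv K (nrm K) (\<lambda>n. h (s n) \<odot>\<^bsub>K\<^esub> \<one>\<^bsub>K\<^esub>) (H X \<odot>\<^bsub>K\<^esub> \<one>\<^bsub>K\<^esub>)"
    proof -
      have "h (s n) \<odot>\<^bsub>K\<^esub> \<one>\<^bsub>K\<^esub> \<oplus>\<^bsub>K\<^esub> (-1) \<odot>\<^bsub>K\<^esub> (H X \<odot>\<^bsub>K\<^esub> \<one>\<^bsub>K\<^esub>) = (h (s n) - H X) \<odot>\<^bsub>K\<^esub> \<one>\<^bsub>K\<^esub>" for n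
        using K.smult_add_left[of "\<one>\<^bsub>K\<^esub>" "h (s n)" "- H X"] by (simp add: K.rules(14))
      then have "nrm K (h (s n) \<odot>\<^bsub>K\<^esub> \<one>\<^bsub>K\<^esub> \<oplus>\<^bsub>K\<^esub> (-1) \<odot>\<^bsub>K\<^esub> (H X \<odot>\<^bsub>K\<^esub> \<one>\<^bsub>K\<^esub>)) = cmod (h (s n) - H X) * nrm K \<one>\<^bsub>K\<^esub>" for n
        by (simp add: cstar_seminormD(2)[OF K.p_seminorm])
      moreover have "(\<lambda>n. cmod (h (s n) - H X) * nrm K \<one>\<^bsub>K\<^esub>) \<longlonglongrightarrow> 0"
        using H_cls[OF s(1)] s(2) by (intro tendsto_mult_left_zero tendsto_norm_zero) (simp add: LIM_zero)
      ultimately show ?thesis by (simp add: seqconv_def)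
    qed
    then show ?thesis
      using K.slice_limit[OF Hs \<Delta>X(2) HX] \<Delta>X(1) s(2) by (simp add: sl_t)
  qed
  have "faithful K H"
    unfolding faithful_def
  proof (intro ballI impI)
    fix X assume X: "X \<in> carrier K" and 0: "H (star K X \<otimes>\<^bsub>K\<^esub> X) = 0"
    obtain s where s: "seqcauchy A p s" "X = pre.cls s" using X by (rule pre.completion_cases)
    have "(\<lambda>n. h (star A (s n) \<otimes> s n)) \<longlonglongrightarrow> 0"
      using H_cls[OF pre.cauchy_mult[OF pre.cauchy_star[OF s(1)] s(1)]] cls_star_mult[OF s(1)] s(2) 0 by simp
    then have "(\<lambda>n. p (s n)) \<longlonglongrightarrow> 0" by (rule faith[OF s(1)])
    then have "nrm K X = 0" using pre.nrm_cls[OF s(1)] s(2) LIMSEQ_unique by blast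
    then show "X = \<zero>\<^bsub>K\<^esub>" by (rule K.p_definite[OF X])
  qed
  moreover have "haar_state M H"
    unfolding haar_state_def fund_M using Hs slices comultiplication_\<Delta>K by blast
  ultimately show ?thesis by (auto simp: fund_M)
qed

end

end

section \<open>Universal C*-seminorms\<close>

lemma (in star_algebra) lin_finsum:
  assumes "lin A \<phi>" "finite S" "\<And>k. k \<in> S \<Longrightarrow> g k \<in> carrier A"
  shows "\<phi> (\<Oplus>k\<in>S. g k) = (\<Sum>k\<in>S. \<phi> (g k))"
  using assms(2,3)
proof (induction S rule: finite_induct)
  case (insert k S)
  then show ?case by (simp add: lin_add[OF assms(1)] finsum_closed Pi_def)
qed (simp add: lin_zero[OF assms(1)])

lemma (in star_morphism) f_finsum:
  assumes "finite S" "\<And>k. k \<in> S \<Longrightarrow> g k \<in> carrier A"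
  shows "f (\<Oplus>k\<in>S. g k) = (\<Oplus>\<^bsub>B\<^esub>k\<in>S. f (g k))"
  using assms
proof (induction S rule: finite_induct)
  case (insert k S)
  then show ?case by (simp add: f_simps Pi_def)
qed (simp add: f_zero)

text \<open>States exist on C*-algebras, so one is taken on the separated completion and pulled
  back. It is nontrivial because \<open>p\<close> does not vanish at the unit.\<close>

lemma (in star_algebra) ex_state_seminorm:
  assumes p: "cstar_seminorm A p" and "p \<one> \<noteq> 0" and x: "x \<in> carrier A"
  obtains \<phi> where "state A \<phi>" "Re (\<phi> (star A x \<otimes> x)) = (p x)\<^sup>2" "\<And>y. y \<in> carrier A \<Longrightarrow> cmod (\<phi> y) \<le> p y"
proof -
  let ?C = "completion A p"
  interpret pre: prenormed A p "\<lambda>x y. p (x \<oplus> (-1) \<odot> y)" by (rule prenormed_of_cstar_seminorm[OF p])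
  interpret C: cstar_normed ?C "nrm ?C" by (rule cstar_normed_completion[OF p])
  interpret emb: star_morphism A ?C pre.emb by unfold_locales (rule pre.emb_hom)
  have "\<one>\<^bsub>?C\<^esub> \<noteq> \<zero>\<^bsub>?C\<^esub>"
    using pre.emb_eq_iff[of \<one> \<zero>] assms(2) by (auto simp: pre.emb_simps smult_zero)
  then interpret C: cstar_nontrivial ?C "nrm ?C" by unfold_locales
  obtain \<psi> where \<psi>: "state ?C \<psi>"
    "\<psi> (star ?C (pre.emb x) \<otimes>\<^bsub>?C\<^esub> pre.emb x) = of_real ((nrm ?C (pre.emb x))\<^sup>2)"
    using C.ex_state_norm[OF pre.emb_simps(1)[OF x]] .
  show thesis
  proof (rule that[of "\<lambda>y. \<psi> (pre.emb y)"])
    show "state A (\<lambda>y. \<psi> (pre.emb y))" by (rule emb.state_comp[OF \<psi>(1)])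
    show "Re (\<psi> (pre.emb (star A x \<otimes> x))) = (p x)\<^sup>2" using \<psi>(2) x by (simp add: pre.emb_simps cl)
    show "cmod (\<psi> (pre.emb y)) \<le> p y" if "y \<in> carrier A" for y
      using C.state_le[OF \<psi>(1), of "pre.emb y"] that by (simp add: pre.emb_simps)
  qed
qed

text \<open>In a state attaining the seminorm of one \<open>z k\<close>, the nonnegative values at
  all z* z sum to 1, so each is at most 1. This bounds the entries of a matrix whose columns are
  normalised.\<close>

lemma (in star_algebra) seminorm_le_one:
  assumes p: "cstar_seminorm A p" and "finite S" "k \<in> S" "\<And>k. k \<in> S \<Longrightarrow> z k \<in> carrier A"
    and 0: "p ((\<Oplus>k\<in>S. star A (z k) \<otimes> z k) \<oplus> (-1) \<odot> \<one>) = 0"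
  shows "p (z k) \<le> 1"
proof (cases "p \<one> = 0")
  case True
  then show ?thesis using seminorm_trivial[OF p True] assms by simp
next
  case False
  obtain \<phi> where \<phi>: "state A \<phi>" "Re (\<phi> (star A (z k) \<otimes> z k)) = (p (z k))\<^sup>2" "\<And>y. y \<in> carrier A \<Longrightarrow> cmod (\<phi> y) \<le> p y"
    using ex_state_seminorm[OF p False, of "z k"] assms by blast
  note L = lin_add[OF state_lin[OF \<phi>(1)]] lin_smult[OF state_lin[OF \<phi>(1)]]
  have sum_in: "(\<Oplus>k\<in>S. star A (z k) \<otimes> z k) \<in> carrier A" using assms by (simp add: finsum_closed Pi_def cl)
  have "\<phi> ((\<Oplus>k\<in>S. star A (z k) \<otimes> z k) \<oplus> (-1) \<odot> \<one>) = 0"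
    using \<phi>(3)[of "(\<Oplus>k\<in>S. star A (z k) \<otimes> z k) \<oplus> (-1) \<odot> \<one>"] 0 sum_in by (simp add: cl)
  then have "(\<Sum>k\<in>S. \<phi> (star A (z k) \<otimes> z k)) = 1"
    using sum_in assms lin_finsum[OF state_lin[OF \<phi>(1)] assms(2), of "\<lambda>k. star A (z k) \<otimes> z k"]
    by (simp add: L cl state_one[OF \<phi>(1)])
  then have "(\<Sum>k\<in>S. Re (\<phi> (star A (z k) \<otimes> z k))) = 1" by (simp flip: Re_sum)
  moreover have "Re (\<phi> (star A (z k) \<otimes> z k)) \<le> (\<Sum>k\<in>S. Re (\<phi> (star A (z k) \<otimes> z k)))"
    using assms state_pos[OF \<phi>(1)] by (intro member_le_sum) auto
  ultimately have "(p (z k))\<^sup>2 \<le> 1" using \<phi>(2) by simp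
  then show ?thesis using power2_le_imp_le[of "p (z k)" 1] by simp
qed

text \<open>Automatic continuity: a state that attains \<open>q\<close> at x* x is also a state of
  the complete algebra, where its value there is at most the square of the norm.\<close>

lemma (in cstar_normed) seminorm_contractive:
  assumes q: "cstar_seminorm A q" and x: "x \<in> carrier A"
  shows "q x \<le> p x"
proof (cases "q \<one> = 0")
  case True
  then show ?thesis using seminorm_trivial[OF q True x] cstar_seminormD(1)[OF p_seminorm x] by simp
next
  case False
  then have "\<one> \<noteq> \<zero>" using seminorm_zero[OF q] by auto
  then interpret cstar_nontrivial A p by unfold_locales
  obtain \<phi> where \<phi>: "state A \<phi>" "Re (\<phi> (star A x \<otimes> x)) = (q x)\<^sup>2"
    using ex_state_seminorm[OF q False x] by blast
  have "(q x)\<^sup>2 \<le> (p x)\<^sup>2" using state_square_le[OF \<phi>(1) x] \<phi>(2) by simp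
  then show ?thesis using cstar_seminormD(1)[OF p_seminorm x] by (rule power2_le_imp_le)
qed

section \<open>Generated subalgebras and finiteness of universal seminorms\<close>

lemma star_subalgebra_Inter:
  assumes "\<And>B. B \<in> \<B> \<Longrightarrow> star_subalgebra A B" "\<B> \<noteq> {}" shows "star_subalgebra A (\<Inter>\<B>)"
  using assms unfolding star_subalgebra_def by blast

context star_algebra
begin

lemma star_subalgebra_carrier: "star_subalgebra A (carrier A)"
  by (simp add: star_subalgebra_def cl)

lemma star_subalgebra_gen:
  assumes "S \<subseteq> carrier A"
  shows "star_subalgebra A (gen_star_subalgebra A S)"
  unfolding gen_star_subalgebra_def
  by (rule star_subalgebra_Inter) (use assms star_subalgebra_carrier in auto)

lemma gen_superset: "S \<subseteq> gen_star_subalgebra A S"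
  unfolding gen_star_subalgebra_def by blast

lemma gen_least: "star_subalgebra A B \<Longrightarrow> S \<subseteq> B \<Longrightarrow> gen_star_subalgebra A S \<subseteq> B"
  unfolding gen_star_subalgebra_def by blast

lemma star_algebra_sub:
  assumes B: "star_subalgebra A B" shows "star_algebra (A\<lparr>carrier := B\<rparr>)"
proof -
  have B': "x \<in> B \<Longrightarrow> x \<in> carrier A" "\<one> \<in> B" "x \<in> B \<Longrightarrow> c \<odot> x \<in> B" "x \<in> B \<Longrightarrow> star A x \<in> B"
    "x \<in> B \<Longrightarrow> y \<in> B \<Longrightarrow> x \<oplus> y \<in> B" "x \<in> B \<Longrightarrow> y \<in> B \<Longrightarrow> x \<otimes> y \<in> B" for x y c
    using B by (auto simp: star_subalgebra_def)
  have "\<zero> \<in> B" using B'(3)[OF B'(2), of 0] by (simp add: rules)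
  then show ?thesis by (intro star_algebraI) (simp_all add: B' rules a_lcomm)
qed

definition compatible :: "('a \<times> 'a) set \<Rightarrow> ('a \<Rightarrow> real) set" where
  "compatible R = {p. cstar_seminorm A p \<and> (\<forall>(a, b)\<in>R. p (a \<oplus> (-1) \<odot> b) = 0)}"

lemma universal_seminorm_def': "universal_seminorm A R x = (SUP p\<in>compatible R. p x)"
  by (simp add: universal_seminorm_def compatible_def)

lemma zero_compatible: "(\<lambda>_. 0) \<in> compatible R"
  by (auto simp: compatible_def cstar_seminorm_def)

text \<open>The real supremum in \<open>universal_seminorm\<close> is meaningful only for families
  that are bounded at each element. Since the bounded elements form a subalgebra, only generators
  have to be checked.\<close>

lemma star_subalgebra_bounded:
  "star_subalgebra A {x \<in> carrier A. \<exists>C. \<forall>p\<in>compatible R. p x \<le> C}"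
  unfolding star_subalgebra_def
proof (intro conjI ballI allI)
  note D = cstar_seminormD
  have comp: "cstar_seminorm A p" if "p \<in> compatible R" for p using that by (simp add: compatible_def)
  have "p \<one> \<le> 1" if "p \<in> compatible R" for p using seminorm_one_cases[OF comp[OF that]] by auto
  then show "\<one> \<in> {x \<in> carrier A. \<exists>C. \<forall>p\<in>compatible R. p x \<le> C}" by auto
  fix x y c assume x: "x \<in> {x \<in> carrier A. \<exists>C. \<forall>p\<in>compatible R. p x \<le> C}"
  then obtain C where C: "x \<in> carrier A" "\<And>p. p \<in> compatible R \<Longrightarrow> p x \<le> C" by blast
  have "p (c \<odot> x) \<le> cmod c * C" if "p \<in> compatible R" for p
    using C that comp D(2)[OF comp[OF that]] by (simp add: mult_left_mono)
  then show "c \<odot> x \<in> {x \<in> carrier A. \<exists>C. \<forall>p\<in>compatible R. p x \<le> C}" using C by (auto simp: cl)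
  show "star A x \<in> {x \<in> carrier A. \<exists>C. \<forall>p\<in>compatible R. p x \<le> C}"
    using C by (auto simp: cl seminorm_star[OF comp])
  assume "y \<in> {x \<in> carrier A. \<exists>C. \<forall>p\<in>compatible R. p x \<le> C}"
  then obtain C' where C': "y \<in> carrier A" "\<And>p. p \<in> compatible R \<Longrightarrow> p y \<le> C'" by blast
  have "p (x \<oplus> y) \<le> C + C'" if "p \<in> compatible R" for p
    using D(3)[OF comp[OF that] C(1) C'(1)] C(2)[OF that] C'(2)[OF that] by simp
  then show "x \<oplus> y \<in> {x \<in> carrier A. \<exists>C. \<forall>p\<in>compatible R. p x \<le> C}" using C C' by (auto simp: cl)
  have "p (x \<otimes> y) \<le> max 0 C * max 0 C'" if "p \<in> compatible R" for p
  proof -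
    have "p x * p y \<le> max 0 C * max 0 C'"
      using C(2)[OF that] C'(2)[OF that] D(1)[OF comp[OF that] C(1)] D(1)[OF comp[OF that] C'(1)]
      by (intro mult_mono) auto
    then show ?thesis using D(4)[OF comp[OF that] C(1) C'(1)] by simp
  qed
  then show "x \<otimes> y \<in> {x \<in> carrier A. \<exists>C. \<forall>p\<in>compatible R. p x \<le> C}" using C C' by (auto simp: cl)
qed auto

lemma bounded_of_generators:
  assumes "carrier A \<subseteq> gen_star_subalgebra A S" "S \<subseteq> carrier A"
    and "\<And>s. s \<in> S \<Longrightarrow> \<exists>C. \<forall>p\<in>compatible R. p s \<le> C" and "x \<in> carrier A"
  shows "\<exists>C. \<forall>p\<in>compatible R. p x \<le> C"
  using gen_least[OF star_subalgebra_bounded[of R], of S] assms by blast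

context
  fixes R
  assumes bdd: "\<And>x. x \<in> carrier A \<Longrightarrow> \<exists>C. \<forall>p\<in>compatible R. p x \<le> C"
begin

lemma le_universal:
  assumes "p \<in> compatible R" "x \<in> carrier A" shows "p x \<le> universal_seminorm A R x"
  unfolding universal_seminorm_def' using bdd[OF assms(2)] assms(1)
  by (intro cSUP_upper) (auto intro: bdd_aboveI2)

lemma universal_le:
  assumes "\<And>p. p \<in> compatible R \<Longrightarrow> p x \<le> C" shows "universal_seminorm A R x \<le> C"
  unfolding universal_seminorm_def' using zero_compatible assms by (intro cSUP_least) auto

lemma cstar_seminorm_universal: "cstar_seminorm A (universal_seminorm A R)"
  unfolding cstar_seminorm_def
proof (intro conjI ballI allI)
  note D = cstar_seminormD
  have comp: "cstar_seminorm A p" if "p \<in> compatible R" for p using that by (simp add: compatible_def)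
  let ?U = "universal_seminorm A R"
  have nonneg: "0 \<le> ?U x" if "x \<in> carrier A" for x using le_universal[OF zero_compatible that] .
  fix x y c assume x: "x \<in> carrier A"
  show "0 \<le> ?U x" by (rule nonneg[OF x])
  have smult_le: "?U (c \<odot> x) \<le> cmod c * ?U x" if x: "x \<in> carrier A" for c x
  proof (rule universal_le)
    fix p assume p: "p \<in> compatible R"
    show "p (c \<odot> x) \<le> cmod c * ?U x"
      using D(2)[OF comp[OF p] x, of c] mult_left_mono[OF le_universal[OF p x], of "cmod c"] by simp
  qed
  show "?U (c \<odot> x) = cmod c * ?U x"
  proof (rule antisym[OF smult_le[OF x]])
    show "cmod c * ?U x \<le> ?U (c \<odot> x)"
    proof (cases "c = 0")
      case True then show ?thesis using nonneg x by (simp add: cl)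
    next
      case False
      have "?U (inverse c \<odot> (c \<odot> x)) \<le> cmod (inverse c) * ?U (c \<odot> x)" using x by (intro smult_le cl)
      then show ?thesis using False x by (simp add: rules norm_inverse norm_divide field_simps)
    qed
  qed
  show "?U (star A x \<otimes> x) = (?U x)\<^sup>2"
  proof (rule antisym)
    show "?U (star A x \<otimes> x) \<le> (?U x)\<^sup>2"
    proof (rule universal_le)
      fix p assume p: "p \<in> compatible R"
      show "p (star A x \<otimes> x) \<le> (?U x)\<^sup>2"
        using D(5)[OF comp[OF p] x] power_mono[OF le_universal[OF p x] D(1)[OF comp[OF p] x], of 2] by simp
    qed
    have "?U x \<le> sqrt (?U (star A x \<otimes> x))"
    proof (rule universal_le)
      fix p assume p: "p \<in> compatible R"
      have "(p x)\<^sup>2 \<le> ?U (star A x \<otimes> x)" using le_universal[OF p, of "star A x \<otimes> x"] D(5)[OF comp[OF p] x] x by (simp add: cl)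
      then show "p x \<le> sqrt (?U (star A x \<otimes> x))" by (rule real_le_rsqrt)
    qed
    then have "(?U x)\<^sup>2 \<le> (sqrt (?U (star A x \<otimes> x)))\<^sup>2" using nonneg[OF x] by (rule power_mono)
    then show "(?U x)\<^sup>2 \<le> ?U (star A x \<otimes> x)" using nonneg[of "star A x \<otimes> x"] x by (simp add: cl)
  qed
  assume y: "y \<in> carrier A"
  show "?U (x \<oplus> y) \<le> ?U x + ?U y"
  proof (rule universal_le)
    fix p assume p: "p \<in> compatible R"
    show "p (x \<oplus> y) \<le> ?U x + ?U y"
      using D(3)[OF comp[OF p] x y] le_universal[OF p x] le_universal[OF p y] by simp
  qed
  show "?U (x \<otimes> y) \<le> ?U x * ?U y"
  proof (rule universal_le)
    fix p assume p: "p \<in> compatible R"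
    have "p x * p y \<le> ?U x * ?U y"
      using le_universal[OF p x] le_universal[OF p y] D(1)[OF comp[OF p]] x y nonneg by (intro mult_mono) auto
    then show "p (x \<otimes> y) \<le> ?U x * ?U y" using D(4)[OF comp[OF p] x y] by simp
  qed
qed

lemma universal_relation:
  assumes "(a, b) \<in> R" shows "universal_seminorm A R (a \<oplus> (-1) \<odot> b) = 0"
proof -
  have "p (a \<oplus> (-1) \<odot> b) = 0" if "p \<in> compatible R" for p using that assms by (auto simp: compatible_def)
  then have "(SUP p\<in>compatible R. p (a \<oplus> (-1) \<odot> b)) = (SUP p\<in>compatible R. 0)"
    by (intro SUP_cong) auto
  also have "\<dots> = 0" by (rule cSUP_const) (use zero_compatible in blast)
  finally show ?thesis by (simp add: universal_seminorm_def')
qed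

lemma to_universal_eq:
  assumes "(a, b) \<in> R" "a \<in> carrier A" "b \<in> carrier A"
  shows "to_universal A R a = to_universal A R b"
proof -
  interpret pre: prenormed A "universal_seminorm A R" "\<lambda>x y. universal_seminorm A R (x \<oplus> (-1) \<odot> y)"
    by (rule prenormed_of_cstar_seminorm[OF cstar_seminorm_universal])
  show ?thesis using assms universal_relation by (simp add: to_universal_def pre.emb_eq_iff)
qed

lemma to_universal_hom: "star_hom A (universal_cstar A R) (to_universal A R)"
proof -
  interpret pre: prenormed A "universal_seminorm A R" "\<lambda>x y. universal_seminorm A R (x \<oplus> (-1) \<odot> y)"
    by (rule prenormed_of_cstar_seminorm[OF cstar_seminorm_universal])
  show ?thesis using pre.emb_hom by (simp add: to_universal_def universal_cstar_def)
qed

lemma cstar_normed_universal: "cstar_normed (universal_cstar A R) (nrm (universal_cstar A R))"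
  unfolding universal_cstar_def by (rule cstar_normed_completion[OF cstar_seminorm_universal])

end

end

lemma (in star_algebra) hom_relations_hom:
  assumes F: "star_algebra F" and i: "\<And>x. x \<in> carrier A \<Longrightarrow> i x \<in> carrier F"
    and sub: "hom_relations A F i \<subseteq> R"
    and bdd: "\<And>x. x \<in> carrier F \<Longrightarrow> \<exists>C. \<forall>p\<in>star_algebra.compatible F R. p x \<le> C"
  shows "star_hom A (universal_cstar F R) (\<lambda>x. to_universal F R (i x))"
proof -
  interpret F: star_algebra F by fact
  have hom: "star_hom F (universal_cstar F R) (to_universal F R)" by (rule F.to_universal_hom) (rule bdd)
  have h: "x \<in> carrier F \<Longrightarrow> y \<in> carrier F \<Longrightarrow> to_universal F R (x \<oplus>\<^bsub>F\<^esub> y) = to_universal F R x \<oplus>\<^bsub>universal_cstar F R\<^esub> to_universal F R y"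
    "x \<in> carrier F \<Longrightarrow> y \<in> carrier F \<Longrightarrow> to_universal F R (x \<otimes>\<^bsub>F\<^esub> y) = to_universal F R x \<otimes>\<^bsub>universal_cstar F R\<^esub> to_universal F R y"
    "x \<in> carrier F \<Longrightarrow> to_universal F R (c \<odot>\<^bsub>F\<^esub> x) = c \<odot>\<^bsub>universal_cstar F R\<^esub> to_universal F R x"
    "x \<in> carrier F \<Longrightarrow> to_universal F R (star F x) = star (universal_cstar F R) (to_universal F R x)"
    "to_universal F R \<one>\<^bsub>F\<^esub> = \<one>\<^bsub>universal_cstar F R\<^esub>" "x \<in> carrier F \<Longrightarrow> to_universal F R x \<in> carrier (universal_cstar F R)"
    for x y c using hom by (auto simp: star_hom_def ring_hom_def)
  have eq: "to_universal F R a = to_universal F R b" if "(a, b) \<in> R" "a \<in> carrier F" "b \<in> carrier F" for a b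
    by (rule F.to_universal_eq[OF _ that]) (rule bdd)
  have e: "x \<in> carrier A \<Longrightarrow> y \<in> carrier A \<Longrightarrow> to_universal F R (i (x \<oplus> y)) = to_universal F R (i x \<oplus>\<^bsub>F\<^esub> i y)"
    "x \<in> carrier A \<Longrightarrow> y \<in> carrier A \<Longrightarrow> to_universal F R (i (x \<otimes> y)) = to_universal F R (i x \<otimes>\<^bsub>F\<^esub> i y)"
    "x \<in> carrier A \<Longrightarrow> to_universal F R (i (c \<odot> x)) = to_universal F R (c \<odot>\<^bsub>F\<^esub> i x)"
    "x \<in> carrier A \<Longrightarrow> to_universal F R (i (star A x)) = to_universal F R (star F (i x))"
    "to_universal F R (i \<one>) = to_universal F R \<one>\<^bsub>F\<^esub>" for x y c
    by (rule eq[OF subsetD[OF sub]]; (unfold hom_relations_def, blast)?; simp add: i cl F.cl)+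
  show ?thesis
    by (simp add: star_hom_def ring_hom_def Pi_def e h i F.cl)
qed

text \<open>A C*-seminorm compatible with the relations of a free product restricts to a C*-seminorm on each
  factor, hence is dominated by the norm there.\<close>

lemma (in cstar_normed) hom_relations_bound:
  assumes F: "star_algebra F" and i: "\<And>x. x \<in> carrier A \<Longrightarrow> i x \<in> carrier F"
    and sub: "hom_relations A F i \<subseteq> R" and q: "q \<in> star_algebra.compatible F R" and x: "x \<in> carrier A"
  shows "q (i x) \<le> p x"
proof -
  interpret F: star_algebra F by fact
  have qs: "cstar_seminorm F q" and q0: "\<And>a b. (a, b) \<in> R \<Longrightarrow> q (a \<oplus>\<^bsub>F\<^esub> (-1) \<odot>\<^bsub>F\<^esub> b) = 0"
    using q by (auto simp: F.compatible_def)
  interpret pre: prenormed F q "\<lambda>x y. q (x \<oplus>\<^bsub>F\<^esub> (-1) \<odot>\<^bsub>F\<^esub> y)" by (rule F.prenormed_of_cstar_seminorm[OF qs])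
  have eq: "q a = q b" if "(a, b) \<in> R" "a \<in> carrier F" "b \<in> carrier F" for a b
    using pre.p_lipschitz[OF that(2,3)] pre.p_lipschitz[OF that(3,2)] pre.dst_commute[OF that(3,2)] q0[OF that(1)] by simp
  have e: "x \<in> carrier A \<Longrightarrow> y \<in> carrier A \<Longrightarrow> q (i (x \<oplus> y)) = q (i x \<oplus>\<^bsub>F\<^esub> i y)"
    "x \<in> carrier A \<Longrightarrow> y \<in> carrier A \<Longrightarrow> q (i (x \<otimes> y)) = q (i x \<otimes>\<^bsub>F\<^esub> i y)"
    "x \<in> carrier A \<Longrightarrow> q (i (c \<odot> x)) = q (c \<odot>\<^bsub>F\<^esub> i x)" for x y c
    by (rule eq[OF subsetD[OF sub]]; (unfold hom_relations_def, blast)?; simp add: i cl F.cl)+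
  have st: "q (i (star A x) \<otimes>\<^bsub>F\<^esub> i x) = q (star F (i x) \<otimes>\<^bsub>F\<^esub> i x)" if x: "x \<in> carrier A" for x
  proof -
    have "(i (star A x), star F (i x)) \<in> R" using sub x unfolding hom_relations_def by blast
    then have 0: "q (i (star A x) \<oplus>\<^bsub>F\<^esub> (-1) \<odot>\<^bsub>F\<^esub> star F (i x)) = 0" by (rule q0)
    have ix: "i (star A x) \<in> carrier F" "i x \<in> carrier F" "star F (i x) \<in> carrier F" using x i cl F.cl by auto
    have "q (i (star A x) \<otimes>\<^bsub>F\<^esub> i x \<oplus>\<^bsub>F\<^esub> (-1) \<odot>\<^bsub>F\<^esub> (star F (i x) \<otimes>\<^bsub>F\<^esub> i x)) \<le> 0"
      using pre.dst_mult[OF ix(1,2) ix(3,2)] pre.dst_refl[OF ix(2)] 0 by simp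
    then show ?thesis
      using pre.p_lipschitz[of "i (star A x) \<otimes>\<^bsub>F\<^esub> i x" "star F (i x) \<otimes>\<^bsub>F\<^esub> i x"]
        pre.p_lipschitz[of "star F (i x) \<otimes>\<^bsub>F\<^esub> i x" "i (star A x) \<otimes>\<^bsub>F\<^esub> i x"]
        pre.dst_commute[of "star F (i x) \<otimes>\<^bsub>F\<^esub> i x" "i (star A x) \<otimes>\<^bsub>F\<^esub> i x"] ix by (simp add: F.cl)
  qed
  note D = cstar_seminormD[OF qs]
  have "cstar_seminorm A (\<lambda>x. q (i x))"
    by (simp add: cstar_seminorm_def e st i cl D)
  then show ?thesis using seminorm_contractive x by blast
qed

section \<open>The free star algebra and the group algebra of the group of order two\<close>

definition word :: "('g \<times> bool) list \<Rightarrow> ('g \<times> bool) list \<Rightarrow> complex" where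
  "word w = (\<lambda>v. if v = w then 1 else 0)"

definition flip :: "('g \<times> bool) list \<Rightarrow> ('g \<times> bool) list" where
  "flip w = rev (map (\<lambda>(x, b). (x, \<not> b)) w)"

lemma flip_flip: "flip (flip w) = w"
  by (simp add: flip_def rev_map o_def case_prod_beta)

lemma length_flip: "length (flip w) = length w"
  by (simp add: flip_def)

lemma flip_in_lists: "flip w \<in> lists (X \<times> UNIV) \<longleftrightarrow> w \<in> lists (X \<times> UNIV)"
  by (auto simp: flip_def)

lemma flip_take_drop: "k \<le> length w \<Longrightarrow> flip (take k w) = drop (length w - k) (flip w)"
  "k \<le> length w \<Longrightarrow> flip (drop k w) = take (length w - k) (flip w)"
  by (simp_all add: flip_def rev_take rev_drop flip: take_map drop_map)

abbreviation "supp f \<equiv> {w. f w \<noteq> 0}"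

lemma free_star_alg_simps:
  "f \<in> carrier (free_star_alg X) \<longleftrightarrow> finite (supp f) \<and> supp f \<subseteq> lists (X \<times> UNIV)"
  "f \<otimes>\<^bsub>free_star_alg X\<^esub> g = (\<lambda>w. \<Sum>k\<le>length w. f (take k w) * g (drop k w))"
  "\<one>\<^bsub>free_star_alg X\<^esub> = word []" "\<zero>\<^bsub>free_star_alg X\<^esub> = (\<lambda>_. 0)"
  "f \<oplus>\<^bsub>free_star_alg X\<^esub> g = (\<lambda>w. f w + g w)" "c \<odot>\<^bsub>free_star_alg X\<^esub> f = (\<lambda>w. c * f w)"
  "star (free_star_alg X) f = (\<lambda>w. cnj (f (flip w)))"
  by (simp_all add: free_star_alg_def word_def flip_def)

lemma star_algebra_free: "star_algebra (free_star_alg X)"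
proof (rule star_algebraI)
  let ?F = "free_star_alg X"
  note s = free_star_alg_simps
  have supp_mult: "supp (f \<otimes>\<^bsub>?F\<^esub> g) \<subseteq> (\<lambda>(u, v). u @ v) ` (supp f \<times> supp g)" for f g
  proof
    fix w assume "w \<in> supp (f \<otimes>\<^bsub>?F\<^esub> g)"
    then obtain k where "f (take k w) * g (drop k w) \<noteq> 0"
      unfolding s by (metis (mono_tags, lifting) mem_Collect_eq sum.neutral)
    then show "w \<in> (\<lambda>(u, v). u @ v) ` (supp f \<times> supp g)"
      by (intro image_eqI[of _ _ "(take k w, drop k w)"]) auto
  qed
  show "f \<otimes>\<^bsub>?F\<^esub> g \<in> carrier ?F" if "f \<in> carrier ?F" "g \<in> carrier ?F" for f g
  proof -
    have "finite ((\<lambda>(u, v). u @ v) ` (supp f \<times> supp g))" using that by (simp add: s(1))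
    moreover have "(\<lambda>(u, v). u @ v) ` (supp f \<times> supp g) \<subseteq> lists (X \<times> UNIV)"
    proof
      fix w assume "w \<in> (\<lambda>(u, v). u @ v) ` (supp f \<times> supp g)"
      then obtain u v where w: "w = u @ v" and "f u \<noteq> 0" "g v \<noteq> 0" by auto
      then have "u \<in> lists (X \<times> UNIV)" "v \<in> lists (X \<times> UNIV)" using that unfolding s(1) by blast+
      then show "w \<in> lists (X \<times> UNIV)" by (simp add: w)
    qed
    ultimately show ?thesis using supp_mult[of f g] unfolding s(1) by (meson finite_subset subset_trans)
  qed
  show "f \<oplus>\<^bsub>?F\<^esub> g \<in> carrier ?F" if "f \<in> carrier ?F" "g \<in> carrier ?F" for f g
  proof -
    have "supp (f \<oplus>\<^bsub>?F\<^esub> g) \<subseteq> supp f \<union> supp g" by (auto simp: s)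
    then show ?thesis using that unfolding s(1) by (meson finite_UnI finite_subset le_sup_iff subset_trans)
  qed
  show "c \<odot>\<^bsub>?F\<^esub> f \<in> carrier ?F" if "f \<in> carrier ?F" for c f
  proof -
    have "supp (c \<odot>\<^bsub>?F\<^esub> f) \<subseteq> supp f" by (auto simp: s)
    then show ?thesis using that unfolding s(1) by (meson finite_subset subset_trans)
  qed
  show "star ?F f \<in> carrier ?F" if "f \<in> carrier ?F" for f
  proof -
    have "supp (star ?F f) = flip ` supp f"
    proof (intro subset_antisym subsetI)
      fix w assume "w \<in> supp (star ?F f)"
      then have "f (flip w) \<noteq> 0" by (simp add: s)
      then show "w \<in> flip ` supp f" by (intro image_eqI[of _ _ "flip w"]) (simp_all add: flip_flip)
    qed (auto simp: s flip_flip)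
    moreover have "flip ` supp f \<subseteq> lists (X \<times> UNIV)"
    proof (rule image_subsetI)
      fix v assume "v \<in> supp f"
      then show "flip v \<in> lists (X \<times> UNIV)" unfolding flip_in_lists using that s(1) by blast
    qed
    ultimately show ?thesis using that unfolding s(1) by simp
  qed
  show "(f \<otimes>\<^bsub>?F\<^esub> g) \<otimes>\<^bsub>?F\<^esub> h = f \<otimes>\<^bsub>?F\<^esub> (g \<otimes>\<^bsub>?F\<^esub> h)" for f g h
  proof
    fix w :: "('a \<times> bool) list"
    let ?n = "length w"
    \<comment> \<open>Both sides sum over the ways to cut the word twice, after j and after j + i
      letters; only the order of summation differs.\<close>
    define a where "a j i = f (take j w) * g (take i (drop j w)) * h (drop (j + i) w)" for j i
    have "((f \<otimes>\<^bsub>?F\<^esub> g) \<otimes>\<^bsub>?F\<^esub> h) w = (\<Sum>k\<le>?n. \<Sum>j\<le>k. a j (k - j))"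
      unfolding s by (intro sum.cong refl) (auto simp: a_def sum_distrib_right min_absorb2 drop_take intro!: sum.cong)
    also have "\<dots> = (\<Sum>(j, i)\<in>{(j, i). j + i \<le> ?n}. a j i)" by (rule sum.triangle_reindex_eq[symmetric])
    also have "{(j, i). j + i \<le> ?n} = Sigma {..?n} (\<lambda>j. {..?n - j})" by auto
    also have "(\<Sum>(j, i)\<in>Sigma {..?n} (\<lambda>j. {..?n - j}). a j i) = (\<Sum>j\<le>?n. \<Sum>i\<le>?n - j. a j i)"
      by (rule sum.Sigma[symmetric]) auto
    also have "\<dots> = (f \<otimes>\<^bsub>?F\<^esub> (g \<otimes>\<^bsub>?F\<^esub> h)) w"
      unfolding s by (intro sum.cong refl) (auto simp: a_def sum_distrib_left add.commute mult.assoc intro!: sum.cong)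
    finally show "((f \<otimes>\<^bsub>?F\<^esub> g) \<otimes>\<^bsub>?F\<^esub> h) w = (f \<otimes>\<^bsub>?F\<^esub> (g \<otimes>\<^bsub>?F\<^esub> h)) w" .
  qed
  show "\<one>\<^bsub>?F\<^esub> \<otimes>\<^bsub>?F\<^esub> f = f" for f
  proof
    fix w :: "('a \<times> bool) list"
    have "(\<one>\<^bsub>?F\<^esub> \<otimes>\<^bsub>?F\<^esub> f) w = (\<Sum>k\<le>length w. if k = 0 then f w else 0)"
      unfolding s by (intro sum.cong) (auto simp: word_def)
    then show "(\<one>\<^bsub>?F\<^esub> \<otimes>\<^bsub>?F\<^esub> f) w = f w" by simp
  qed
  show "f \<otimes>\<^bsub>?F\<^esub> \<one>\<^bsub>?F\<^esub> = f" for f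
  proof
    fix w :: "('a \<times> bool) list"
    have "(f \<otimes>\<^bsub>?F\<^esub> \<one>\<^bsub>?F\<^esub>) w = (\<Sum>k\<le>length w. if k = length w then f w else 0)"
      unfolding s by (intro sum.cong) (auto simp: word_def)
    then show "(f \<otimes>\<^bsub>?F\<^esub> \<one>\<^bsub>?F\<^esub>) w = f w" by simp
  qed
  show "star ?F (f \<otimes>\<^bsub>?F\<^esub> g) = star ?F g \<otimes>\<^bsub>?F\<^esub> star ?F f" for f g
  proof
    fix w :: "('a \<times> bool) list"
    have "star ?F (f \<otimes>\<^bsub>?F\<^esub> g) w = (\<Sum>k\<le>length w. cnj (f (take k (flip w))) * cnj (g (drop k (flip w))))"
      by (simp add: s length_flip)
    also have "\<dots> = (\<Sum>k\<le>length w. cnj (g (flip (take k w))) * cnj (f (flip (drop k w))))"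
      by (rule sum.reindex_bij_witness[of _ "\<lambda>k. length w - k" "\<lambda>k. length w - k"]) (auto simp: flip_take_drop)
    also have "\<dots> = (star ?F g \<otimes>\<^bsub>?F\<^esub> star ?F f) w" by (simp add: s)
    finally show "star ?F (f \<otimes>\<^bsub>?F\<^esub> g) w = (star ?F g \<otimes>\<^bsub>?F\<^esub> star ?F f) w" .
  qed
qed (auto simp: free_star_alg_simps fun_eq_iff algebra_simps sum_distrib_left sum.distrib flip_flip word_def)

lemma word_mult: "word u \<otimes>\<^bsub>free_star_alg X\<^esub> word v = word (u @ v)"
proof
  fix w :: "('a \<times> bool) list"
  have "(word u \<otimes>\<^bsub>free_star_alg X\<^esub> word v) w = (\<Sum>k\<le>length w. if k = length u then (if w = u @ v then 1 else 0) else 0)"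
    unfolding free_star_alg_simps(2)
  proof (intro sum.cong refl)
    fix k assume k: "k \<in> {..length w}"
    have *: "take k w = u \<and> drop k w = v \<longleftrightarrow> k = length u \<and> w = u @ v"
      using k by (metis append_eq_conv_conj append_take_drop_id atMost_iff length_take min.absorb2)
    show "word u (take k w) * word v (drop k w) = (if k = length u then (if w = u @ v then 1 else 0) else 0)"
    proof (cases "k = length u \<and> w = u @ v")
      case True then show ?thesis by (simp add: word_def)
    next
      case False
      then have "take k w \<noteq> u \<or> drop k w \<noteq> v" using * by blast
      then have "word u (take k w) * word v (drop k w) = 0" by (auto simp: word_def)
      then show ?thesis using False by auto
    qed
  qed
  also have "\<dots> = word (u @ v) w" by (auto simp: word_def)
  finally show "(word u \<otimes>\<^bsub>free_star_alg X\<^esub> word v) w = word (u @ v) w" .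
qed

lemma gen_word: "gen x = word [(x, False)]"
  by (simp add: gen_def word_def)

lemma gen_in: "x \<in> X \<Longrightarrow> gen x \<in> carrier (free_star_alg X)"
  by (auto simp: free_star_alg_simps(1) gen_def)

lemma free_generated: "carrier (free_star_alg X) \<subseteq> gen_star_subalgebra (free_star_alg X) (gen ` X)"
proof (rule subsetI)
  let ?F = "free_star_alg X" and ?G = "gen_star_subalgebra (free_star_alg X) (gen ` X)"
  interpret star_algebra ?F by (rule star_algebra_free)
  have "star_subalgebra ?F ?G" by (rule star_subalgebra_gen) (auto intro: gen_in)
  then have G: "\<one>\<^bsub>?F\<^esub> \<in> ?G" "\<And>c x. x \<in> ?G \<Longrightarrow> c \<odot>\<^bsub>?F\<^esub> x \<in> ?G" "\<And>x. x \<in> ?G \<Longrightarrow> star ?F x \<in> ?G"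
    "\<And>x y. x \<in> ?G \<Longrightarrow> y \<in> ?G \<Longrightarrow> x \<oplus>\<^bsub>?F\<^esub> y \<in> ?G" "\<And>x y. x \<in> ?G \<Longrightarrow> y \<in> ?G \<Longrightarrow> x \<otimes>\<^bsub>?F\<^esub> y \<in> ?G"
    by (auto simp: star_subalgebra_def)
  have letter: "word [(x, b)] \<in> ?G" if "x \<in> X" for x b
  proof -
    have g: "gen x \<in> ?G" using that by (intro subsetD[OF gen_superset] imageI)
    have "flip [(x, True)] = [(x, False)]" "flip [(x, False)] = [(x, True)]" by (simp_all add: flip_def)
    then have "flip w = [(x, False)] \<longleftrightarrow> w = [(x, True)]" for w using flip_flip[of w] by metis
    then have "star ?F (gen x) = word [(x, True)]" by (simp add: free_star_alg_simps gen_word word_def fun_eq_iff)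
    then show ?thesis using g G(3)[OF g] by (cases b) (simp_all add: gen_word)
  qed
  have words: "word w \<in> ?G" if "w \<in> lists (X \<times> UNIV)" for w
    using that
  proof (induction w)
    case Nil then show ?case using G(1) by (simp add: free_star_alg_simps)
  next
    case (Cons l w)
    obtain x b where l: "l = (x, b)" by (cases l)
    have "word [l] \<otimes>\<^bsub>?F\<^esub> word w \<in> ?G" using Cons letter[of x b] l by (intro G) auto
    then show ?case by (simp add: word_mult)
  qed
  fix f assume "f \<in> carrier ?F"
  then have "finite (supp f)" "supp f \<subseteq> lists (X \<times> UNIV)" by (auto simp: free_star_alg_simps)
  then show "f \<in> ?G"
  proof (induction "card (supp f)" arbitrary: f)
    case 0
    then have "supp f = {}" by simp
    then have "f w = 0" for w by blast
    then have "f = 0 \<odot>\<^bsub>?F\<^esub> \<one>\<^bsub>?F\<^esub>" by (simp add: free_star_alg_simps fun_eq_iff)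
    then show ?case using G(2)[OF G(1), of 0] by (simp only:)
  next
    case (Suc n)
    then have "supp f \<noteq> {}" by (metis card.empty nat.distinct(1))
    then obtain w where w: "f w \<noteq> 0" by blast
    have supp: "supp (f(w := 0)) = supp f - {w}" by auto
    have "f(w := 0) \<in> ?G"
    proof (rule Suc.hyps(1))
      show "n = card (supp (f(w := 0)))" unfolding supp using Suc.hyps(2) w Suc.prems(1) by simp
      show "finite (supp (f(w := 0)))" "supp (f(w := 0)) \<subseteq> lists (X \<times> UNIV)"
        unfolding supp using Suc.prems by auto
    qed
    moreover have "word w \<in> ?G" using Suc.prems(2) w by (intro words) auto
    ultimately have "f w \<odot>\<^bsub>?F\<^esub> word w \<oplus>\<^bsub>?F\<^esub> f(w := 0) \<in> ?G" by (intro G)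
    moreover have "f w \<odot>\<^bsub>?F\<^esub> word w \<oplus>\<^bsub>?F\<^esub> f(w := 0) = f" by (auto simp: free_star_alg_simps word_def fun_eq_iff)
    ultimately show ?case by (simp only:)
  qed
qed

section \<open>The group algebra of the group of order two\<close>

abbreviation "Z2_alg \<equiv> group_star_alg (integer_mod_group 2)"

lemma carrier_Z2: "carrier (integer_mod_group 2) = {0, 1}"
  by (auto simp: carrier_integer_mod_group)

lemma Z2_alg_simps:
  "f \<in> carrier Z2_alg \<longleftrightarrow> (\<forall>x. x \<noteq> 0 \<longrightarrow> x \<noteq> 1 \<longrightarrow> f x = 0)"
  "f \<otimes>\<^bsub>Z2_alg\<^esub> g = (\<lambda>x. if x = 0 then f 0 * g 0 + f 1 * g 1 else if x = 1 then f 0 * g 1 + f 1 * g 0 else 0)"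
  "\<one>\<^bsub>Z2_alg\<^esub> = (\<lambda>x. if x = 0 then 1 else 0)" "\<zero>\<^bsub>Z2_alg\<^esub> = (\<lambda>_. 0)"
  "f \<oplus>\<^bsub>Z2_alg\<^esub> g = (\<lambda>x. f x + g x)" "c \<odot>\<^bsub>Z2_alg\<^esub> f = (\<lambda>x. c * f x)"
  "star Z2_alg f = (\<lambda>x. if x = 0 \<or> x = 1 then cnj (f x) else 0)"
proof -
  have inv: "inv\<^bsub>integer_mod_group 2\<^esub> 0 = 0" "inv\<^bsub>integer_mod_group 2\<^esub> 1 = 1"
    by (auto simp: inv_integer_mod_group carrier_Z2)
  have *: "f \<in> carrier Z2_alg \<longleftrightarrow> finite (supp f) \<and> supp f \<subseteq> {0, 1}" for f
    by (simp add: group_star_alg_def carrier_Z2)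
  show "f \<in> carrier Z2_alg \<longleftrightarrow> (\<forall>x. x \<noteq> 0 \<longrightarrow> x \<noteq> 1 \<longrightarrow> f x = 0)"
    unfolding * by (auto intro: finite_subset[of _ "{0, 1}"])
  have sum: "(\<Sum>y | y \<in> carrier (integer_mod_group 2) \<and> f y \<noteq> 0. f y * h y) = f 0 * h 0 + f 1 * h 1" for h
  proof -
    have "(\<Sum>y | y \<in> carrier (integer_mod_group 2) \<and> f y \<noteq> 0. f y * h y) = (\<Sum>y\<in>{0, 1}. f y * h y)"
      by (rule sum.mono_neutral_left) (auto simp: carrier_Z2)
    then show ?thesis by simp
  qed
  show "f \<otimes>\<^bsub>Z2_alg\<^esub> g = (\<lambda>x. if x = 0 then f 0 * g 0 + f 1 * g 1 else if x = 1 then f 0 * g 1 + f 1 * g 0 else 0)"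
  proof -
    have "f \<otimes>\<^bsub>Z2_alg\<^esub> g = (\<lambda>x. if x \<in> carrier (integer_mod_group 2)
        then \<Sum>y | y \<in> carrier (integer_mod_group 2) \<and> f y \<noteq> 0. f y * g (inv\<^bsub>integer_mod_group 2\<^esub> y \<otimes>\<^bsub>integer_mod_group 2\<^esub> x) else 0)"
      by (simp add: group_star_alg_def)
    then show ?thesis unfolding sum by (auto simp: fun_eq_iff carrier_Z2 inv mult_integer_mod_group)
  qed
  show "\<one>\<^bsub>Z2_alg\<^esub> = (\<lambda>x. if x = 0 then 1 else 0)" "\<zero>\<^bsub>Z2_alg\<^esub> = (\<lambda>_. 0)"
    "f \<oplus>\<^bsub>Z2_alg\<^esub> g = (\<lambda>x. f x + g x)" "c \<odot>\<^bsub>Z2_alg\<^esub> f = (\<lambda>x. c * f x)"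
    by (simp_all add: group_star_alg_def)
  show "star Z2_alg f = (\<lambda>x. if x = 0 \<or> x = 1 then cnj (f x) else 0)"
    by (auto simp: group_star_alg_def carrier_Z2 inv fun_eq_iff)
qed

lemma star_algebra_Z2: "star_algebra Z2_alg"
  by (rule star_algebraI) (auto simp: Z2_alg_simps fun_eq_iff algebra_simps)

section \<open>Relations in quantum subgroups of the free product\<close>

text \<open>With self-adjoint entries the adjoint matrix is the transpose, so the sums express v* v
  = 1. They run along columns, which is the shape in which they bound single entries.\<close>

definition orthogonal :: "('a, 'b) star_alg_scheme \<Rightarrow> nat \<Rightarrow> 'a mat \<Rightarrow> bool" where
  "orthogonal A N v \<longleftrightarrow> (\<forall>i<N. \<forall>j<N. v i j \<in> carrier A \<and> star A (v i j) = v i j \<and>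
     (\<Oplus>\<^bsub>A\<^esub>k\<in>{..<N}. v k i \<otimes>\<^bsub>A\<^esub> v k j) = mat_one A i j)"

definition reflection :: "('a, 'b) star_alg_scheme \<Rightarrow> 'a \<Rightarrow> bool" where
  "reflection A r \<longleftrightarrow> r \<in> carrier A \<and> star A r = r \<and> r \<otimes>\<^bsub>A\<^esub> r = \<one>\<^bsub>A\<^esub>"

lemma (in star_morphism) orthogonal_map:
  assumes v: "orthogonal A N v" shows "orthogonal B N (\<lambda>i j. f (v i j))"
  unfolding orthogonal_def
proof (intro allI impI conjI)
  fix i j assume ij: "i < N" "j < N"
  have v': "v i j \<in> carrier A" "star A (v i j) = v i j" "(\<Oplus>k\<in>{..<N}. v k i \<otimes> v k j) = mat_one A i j"
    if "i < N" "j < N" for i j using v that by (auto simp: orthogonal_def)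
  show "f (v i j) \<in> carrier B" "star B (f (v i j)) = f (v i j)"
    using v'[OF ij] by (simp_all add: f_simps flip: f_simps(5))
  have "(\<Oplus>\<^bsub>B\<^esub>k\<in>{..<N}. f (v k i) \<otimes>\<^bsub>B\<^esub> f (v k j)) = (\<Oplus>\<^bsub>B\<^esub>k\<in>{..<N}. f (v k i \<otimes> v k j))"
    by (rule B.finsum_cong') (use v' ij in \<open>auto simp: f_simps B.cl\<close>)
  also have "\<dots> = f (\<Oplus>k\<in>{..<N}. v k i \<otimes> v k j)"
    by (rule f_finsum[symmetric]) (use v' ij in \<open>auto simp: A.cl\<close>)
  also have "\<dots> = f (mat_one A i j)" using v'(3)[OF ij] by simp
  also have "\<dots> = mat_one B i j" by (simp add: mat_one_def f_simps f_zero)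
  finally show "(\<Oplus>\<^bsub>B\<^esub>k\<in>{..<N}. f (v k i) \<otimes>\<^bsub>B\<^esub> f (v k j)) = mat_one B i j" .
qed

lemma (in star_morphism) reflection_map: "reflection A r \<Longrightarrow> reflection B (f r)"
  by (auto simp: reflection_def f_simps simp flip: f_simps(3,5))

lemma (in star_algebra) inclusion_morphism:
  assumes B: "star_subalgebra A B" shows "star_morphism (A\<lparr>carrier := B\<rparr>) A (\<lambda>x. x)"
proof -
  interpret B: star_algebra "A\<lparr>carrier := B\<rparr>" by (rule star_algebra_sub[OF B])
  show ?thesis
    by unfold_locales (use B in \<open>auto simp: star_hom_def ring_hom_def star_subalgebra_def\<close>)
qed

lemma (in star_algebra) orthogonal_sub:
  assumes B: "star_subalgebra A B" and v: "orthogonal A N v" and "\<And>i j. i < N \<Longrightarrow> j < N \<Longrightarrow> v i j \<in> B"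
  shows "orthogonal (A\<lparr>carrier := B\<rparr>) N v"
proof -
  interpret m: star_morphism "A\<lparr>carrier := B\<rparr>" A "\<lambda>x. x" by (rule inclusion_morphism[OF B])
  have "(\<Oplus>\<^bsub>A\<lparr>carrier := B\<rparr>\<^esub>k\<in>{..<N}. v k i \<otimes> v k j) = (\<Oplus>k\<in>{..<N}. v k i \<otimes> v k j)" if "i < N" "j < N" for i j
    using m.f_finsum[of "{..<N}" "\<lambda>k. v k i \<otimes> v k j"] that assms(3) B by (simp add: star_subalgebra_def)
  then show ?thesis using v assms(3) by (simp add: orthogonal_def mat_one_def)
qed

lemma star_morphism_universal:
  assumes "star_algebra A" "\<And>x. x \<in> carrier A \<Longrightarrow> \<exists>C. \<forall>p\<in>star_algebra.compatible A R. p x \<le> C"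
  shows "star_morphism A (universal_cstar A R) (to_universal A R)"
proof -
  interpret star_algebra A by fact
  interpret U: cstar_normed "universal_cstar A R" "nrm (universal_cstar A R)"
    by (rule cstar_normed_universal) (rule assms(2))
  show ?thesis by unfold_locales (rule to_universal_hom, rule assms(2))
qed

section \<open>The free orthogonal quantum group, the dual of the group of order two, and their free
  product\<close>

lemma O_plus_bounded:
  assumes "x \<in> carrier (O_plus_free N)"
  shows "\<exists>C. \<forall>p\<in>star_algebra.compatible (O_plus_free N) (O_plus_relations N). p x \<le> C"
proof -
  let ?F = "O_plus_free N" and ?R = "O_plus_relations N"
  interpret star_algebra ?F by (rule star_algebra_free)
  show ?thesis
  proof (rule bounded_of_generators[OF free_generated _ _ assms])
    show "gen ` ({..<N} \<times> {..<N}) \<subseteq> carrier ?F" by (auto intro: gen_in)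
    fix s :: "((nat \<times> nat) \<times> bool) list \<Rightarrow> complex" assume "s \<in> gen ` ({..<N} \<times> {..<N})"
    then obtain i j where s: "s = gen (i, j)" and ij: "i < N" "j < N" by auto
    have "p s \<le> 1" if p: "p \<in> compatible ?R" for p
    proof -
      \<comment> \<open>The j-th diagonal entry of u* u = 1: the j-th column is normalised, which
        bounds each of its entries by 1.\<close>
      have "(mat_mul ?F N (\<lambda>i j. star ?F (gen (j, i))) (\<lambda>i j. gen (i, j)) j j, mat_one ?F j j) \<in> ?R"
        unfolding O_plus_relations_def Let_def using ij by blast
      then have "p (mat_mul ?F N (\<lambda>i j. star ?F (gen (j, i))) (\<lambda>i j. gen (i, j)) j j \<oplus>\<^bsub>?F\<^esub> (-1) \<odot>\<^bsub>?F\<^esub> mat_one ?F j j) = 0"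
        using p by (auto simp: compatible_def)
      then show ?thesis unfolding s
        using p ij by (intro seminorm_le_one[of p "{..<N}" i "\<lambda>k. gen (k, j)"])
          (auto simp: compatible_def mat_mul_def mat_one_def gen_in)
    qed
    then show "\<exists>C. \<forall>p\<in>compatible ?R. p s \<le> C" by blast
  qed
qed

lemma O_plus_orthogonal:
  "cstar_normed (alg (O_plus N)) (nrm (alg (O_plus N)))" "orthogonal (alg (O_plus N)) N (fund (O_plus N))"
proof -
  let ?F = "O_plus_free N" and ?R = "O_plus_relations N"
  interpret F: star_algebra ?F by (rule star_algebra_free)
  interpret m: star_morphism ?F "universal_cstar ?F ?R" "to_universal ?F ?R"
    by (rule star_morphism_universal[OF star_algebra_free O_plus_bounded])
  have alg: "alg (O_plus N) = universal_cstar ?F ?R" "fund (O_plus N) = (\<lambda>i j. to_universal ?F ?R (gen (i, j)))"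
    by (simp_all add: O_plus_def)
  show "cstar_normed (alg (O_plus N)) (nrm (alg (O_plus N)))"
    unfolding alg by (rule F.cstar_normed_universal) (rule O_plus_bounded)
  have eq: "to_universal ?F ?R a = to_universal ?F ?R b" if "(a, b) \<in> ?R" "a \<in> carrier ?F" "b \<in> carrier ?F" for a b
    by (rule F.to_universal_eq[OF _ that]) (rule O_plus_bounded)
  show "orthogonal (alg (O_plus N)) N (fund (O_plus N))"
    unfolding orthogonal_def alg
  proof (intro allI impI conjI)
    fix i j assume ij: "i < N" "j < N"
    have g: "gen (k, l) \<in> carrier ?F" if "k < N" "l < N" for k l using that by (intro gen_in) auto
    show "to_universal ?F ?R (gen (i, j)) \<in> carrier (universal_cstar ?F ?R)"
      using g ij by (simp add: m.f_simps)
    have st: "star (universal_cstar ?F ?R) (to_universal ?F ?R (gen (i, j))) = to_universal ?F ?R (gen (i, j))"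
      if "i < N" "j < N" for i j
    proof -
      have "(star ?F (gen (i, j)), gen (i, j)) \<in> ?R" unfolding O_plus_relations_def Let_def using that by blast
      then show ?thesis using g that by (simp add: F.cl eq flip: m.f_simps(5))
    qed
    then show "star (universal_cstar ?F ?R) (to_universal ?F ?R (gen (i, j))) = to_universal ?F ?R (gen (i, j))"
      using ij by blast
    have "(mat_mul ?F N (\<lambda>i j. star ?F (gen (j, i))) (\<lambda>i j. gen (i, j)) i j, mat_one ?F i j) \<in> ?R"
      unfolding O_plus_relations_def Let_def using ij by blast
    then have "to_universal ?F ?R (\<Oplus>\<^bsub>?F\<^esub>k\<in>{..<N}. star ?F (gen (k, i)) \<otimes>\<^bsub>?F\<^esub> gen (k, j)) = to_universal ?F ?R (mat_one ?F i j)"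
      using g ij by (intro eq) (auto simp: mat_mul_def mat_one_def F.cl intro!: F.finsum_closed)
    moreover have "to_universal ?F ?R (mat_one ?F i j) = mat_one (universal_cstar ?F ?R) i j"
      by (simp add: mat_one_def m.f_simps m.f_zero)
    moreover have "to_universal ?F ?R (\<Oplus>\<^bsub>?F\<^esub>k\<in>{..<N}. star ?F (gen (k, i)) \<otimes>\<^bsub>?F\<^esub> gen (k, j)) =
        (\<Oplus>\<^bsub>universal_cstar ?F ?R\<^esub>k\<in>{..<N}. to_universal ?F ?R (star ?F (gen (k, i)) \<otimes>\<^bsub>?F\<^esub> gen (k, j)))"
      using g ij by (intro m.f_finsum) (auto simp: F.cl)
    moreover have "\<dots> = (\<Oplus>\<^bsub>universal_cstar ?F ?R\<^esub>k\<in>{..<N}. to_universal ?F ?R (gen (k, i)) \<otimes>\<^bsub>universal_cstar ?F ?R\<^esub> to_universal ?F ?R (gen (k, j)))"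
      by (rule m.B.finsum_cong') (use g ij st in \<open>auto simp: m.f_simps F.cl m.B.cl\<close>)
    ultimately show "(\<Oplus>\<^bsub>universal_cstar ?F ?R\<^esub>k\<in>{..<N}. to_universal ?F ?R (gen (k, i)) \<otimes>\<^bsub>universal_cstar ?F ?R\<^esub> to_universal ?F ?R (gen (k, j))) =
      mat_one (universal_cstar ?F ?R) i j" by simp
  qed
qed

lemma Z2_reflection:
  "cstar_normed (alg Z2_dual) (nrm (alg Z2_dual))" "reflection (alg Z2_dual) (fund Z2_dual 0 0)"
proof -
  interpret F: star_algebra Z2_alg by (rule star_algebra_Z2)
  define r :: "int \<Rightarrow> complex" where "r = (\<lambda>x. if x = 1 then 1 else 0)"
  have r: "reflection Z2_alg r" by (auto simp: reflection_def r_def Z2_alg_simps fun_eq_iff)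
  then have r_in: "r \<in> carrier Z2_alg" by (simp add: reflection_def)
  have gen: "carrier Z2_alg \<subseteq> gen_star_subalgebra Z2_alg {r}"
  proof
    fix f assume f: "f \<in> carrier Z2_alg"
    have "star_subalgebra Z2_alg (gen_star_subalgebra Z2_alg {r})" "r \<in> gen_star_subalgebra Z2_alg {r}"
      using F.star_subalgebra_gen[of "{r}"] F.gen_superset[of "{r}"] r_in by auto
    then have "f 0 \<odot>\<^bsub>Z2_alg\<^esub> \<one>\<^bsub>Z2_alg\<^esub> \<oplus>\<^bsub>Z2_alg\<^esub> f 1 \<odot>\<^bsub>Z2_alg\<^esub> r \<in> gen_star_subalgebra Z2_alg {r}"
      by (simp add: star_subalgebra_def)
    moreover have "f 0 \<odot>\<^bsub>Z2_alg\<^esub> \<one>\<^bsub>Z2_alg\<^esub> \<oplus>\<^bsub>Z2_alg\<^esub> f 1 \<odot>\<^bsub>Z2_alg\<^esub> r = f"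
      using f by (auto simp: Z2_alg_simps r_def fun_eq_iff)
    ultimately show "f \<in> gen_star_subalgebra Z2_alg {r}" by simp
  qed
  have bdd: "\<exists>C. \<forall>p\<in>F.compatible {}. p x \<le> C" if "x \<in> carrier Z2_alg" for x
  proof (rule F.bounded_of_generators[OF gen _ _ that])
    have "p r \<le> 1" if "p \<in> F.compatible {}" for p
    proof -
      have p: "cstar_seminorm Z2_alg p" using that by (simp add: F.compatible_def)
      have "(p r)\<^sup>2 = p \<one>\<^bsub>Z2_alg\<^esub>" using cstar_seminormD(5)[OF p r_in] r by (simp add: reflection_def)
      then have "(p r)\<^sup>2 \<le> 1" using F.seminorm_one_cases[OF p] by auto
      then show ?thesis using power2_le_imp_le[of "p r" 1] by simp
    qed
    then show "\<exists>C. \<forall>p\<in>F.compatible {}. p s \<le> C" if "s \<in> {r}" for s using that by blast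
  qed (use r_in in simp)
  interpret m: star_morphism Z2_alg "enveloping_cstar Z2_alg" "to_enveloping Z2_alg"
    by (rule star_morphism_universal[OF star_algebra_Z2 bdd])
  show "cstar_normed (alg Z2_dual) (nrm (alg Z2_dual))"
    using F.cstar_normed_universal[OF bdd] by (simp add: Z2_dual_def Let_def)
  show "reflection (alg Z2_dual) (fund Z2_dual 0 0)"
    using m.reflection_map[OF r] by (simp add: Z2_dual_def Let_def r_def)
qed

lemma free_product_morphisms:
  assumes A: "cstar_normed A (nrm A)" and B: "cstar_normed B (nrm B)"
  shows "star_morphism A (cstar_free_product A B) (free_prod_inl A B)"
    "star_morphism B (cstar_free_product A B) (free_prod_inr A B)"
proof -
  interpret A: cstar_normed A "nrm A" by fact
  interpret B: cstar_normed B "nrm B" by fact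
  let ?F = "free_prod_alg A B" and ?R = "free_prod_relations A B"
  have F: "star_algebra ?F" unfolding free_prod_alg_def by (rule star_algebra_free)
  interpret F: star_algebra ?F by (rule F)
  have i: "x \<in> carrier A \<Longrightarrow> gen (Inl x) \<in> carrier ?F" and j: "y \<in> carrier B \<Longrightarrow> gen (Inr y) \<in> carrier ?F" for x y
    unfolding free_prod_alg_def by (auto intro: gen_in)
  have sub: "hom_relations A ?F (\<lambda>a. gen (Inl a)) \<subseteq> ?R" "hom_relations B ?F (\<lambda>b. gen (Inr b)) \<subseteq> ?R"
    by (simp_all add: free_prod_relations_def)
  have bdd: "\<exists>C. \<forall>p\<in>F.compatible ?R. p x \<le> C" if "x \<in> carrier ?F" for x
  proof (rule F.bounded_of_generators[OF _ _ _ that])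
    show "carrier ?F \<subseteq> gen_star_subalgebra ?F (gen ` (carrier A <+> carrier B))"
      unfolding free_prod_alg_def by (rule free_generated)
    show "gen ` (carrier A <+> carrier B) \<subseteq> carrier ?F" using i j by auto
    fix s :: "(('a + 'b) \<times> bool) list \<Rightarrow> complex" assume "s \<in> gen ` (carrier A <+> carrier B)"
    then consider a where "a \<in> carrier A" "s = gen (Inl a)" | b where "b \<in> carrier B" "s = gen (Inr b)" by auto
    then show "\<exists>C. \<forall>p\<in>F.compatible ?R. p s \<le> C"
      using A.hom_relations_bound[OF F i sub(1)] B.hom_relations_bound[OF F j sub(2)] by cases blast+
  qed
  interpret U: cstar_normed "cstar_free_product A B" "nrm (cstar_free_product A B)"
    unfolding cstar_free_product_def by (rule F.cstar_normed_universal) (rule bdd)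
  show "star_morphism A (cstar_free_product A B) (free_prod_inl A B)"
    by unfold_locales (use A.hom_relations_hom[OF F i sub(1) bdd] in \<open>simp add: cstar_free_product_def free_prod_inl_def[abs_def]\<close>)
  show "star_morphism B (cstar_free_product A B) (free_prod_inr A B)"
    by unfold_locales (use B.hom_relations_hom[OF F j sub(2) bdd] in \<open>simp add: cstar_free_product_def free_prod_inr_def[abs_def]\<close>)
qed

definition block_relations :: "('a, 'b) star_alg_scheme \<Rightarrow> nat \<Rightarrow> 'a mat \<Rightarrow> bool" where
  "block_relations A N u \<longleftrightarrow> orthogonal A N u \<and> reflection A (u N N) \<and>
     (\<forall>i<N. u i N = \<zero>\<^bsub>A\<^esub> \<and> u N i = \<zero>\<^bsub>A\<^esub>)"

lemma (in star_algebra) orthogonal_cong: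
  assumes v: "orthogonal A N v" and eq: "\<And>i j. i < N \<Longrightarrow> j < N \<Longrightarrow> u i j = v i j"
  shows "orthogonal A N u"
proof -
  have "(\<Oplus>k\<in>{..<N}. u k i \<otimes> u k j) = (\<Oplus>k\<in>{..<N}. v k i \<otimes> v k j)" if "i < N" "j < N" for i j
    using v that by (intro finsum_cong') (auto simp: eq orthogonal_def intro!: cl)
  then show ?thesis using v by (simp add: orthogonal_def eq)
qed

lemma free_product_block_relations:
  fixes N defines "H \<equiv> cmqg_free_product (O_plus N) Z2_dual"
  shows "star_algebra (alg H)" "block_relations (alg H) N (fund H)" "msize H = Suc N"
proof -
  have alg: "alg H = cstar_free_product (alg (O_plus N)) (alg Z2_dual)" and m: "msize (O_plus N) = N"
    by (simp_all add: H_def cmqg_free_product_def Let_def O_plus_def)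
  interpret l: star_morphism "alg (O_plus N)" "alg H" "free_prod_inl (alg (O_plus N)) (alg Z2_dual)"
    unfolding alg by (rule free_product_morphisms[OF O_plus_orthogonal(1) Z2_reflection(1)])
  interpret r: star_morphism "alg Z2_dual" "alg H" "free_prod_inr (alg (O_plus N)) (alg Z2_dual)"
    unfolding alg by (rule free_product_morphisms[OF O_plus_orthogonal(1) Z2_reflection(1)])
  show "star_algebra (alg H)" by (rule l.B.A_star)
  show "msize H = Suc N" by (simp add: H_def cmqg_free_product_def Let_def O_plus_def Z2_dual_def)
  have f: "fund H = (\<lambda>i j. if i < N \<and> j < N then free_prod_inl (alg (O_plus N)) (alg Z2_dual) (fund (O_plus N) i j)
      else if N \<le> i \<and> N \<le> j then free_prod_inr (alg (O_plus N)) (alg Z2_dual) (fund Z2_dual (i - N) (j - N))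
      else \<zero>\<^bsub>alg H\<^esub>)"
    unfolding alg by (simp add: H_def cmqg_free_product_def Let_def m)
  have "orthogonal (alg H) N (fund H)"
    by (rule l.B.orthogonal_cong[OF l.orthogonal_map[OF O_plus_orthogonal(2)]]) (simp add: f)
  moreover have "reflection (alg H) (fund H N N)"
    using r.reflection_map[OF Z2_reflection(2)] by (simp add: f)
  ultimately show "block_relations (alg H) N (fund H)" by (simp add: block_relations_def f)
qed

lemma (in star_morphism) block_relations_map:
  assumes "block_relations A N u"
  shows "block_relations B N (\<lambda>i j. f (u i j))"
  using assms orthogonal_map reflection_map by (simp add: block_relations_def f_zero)

text \<open>A quantum subgroup is given by a homomorphism of polynomial algebras. So the relations
  of the free product are first restricted to its polynomial algebra and then mapped to that of
  \<open>G\<close>.\<close>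

lemma quantum_subgroup_block_relations:
  assumes G: "star_algebra (pol G)" and sub: "quantum_subgroup G (cmqg_free_product (O_plus N) Z2_dual)"
  shows "msize G = Suc N" "block_relations (pol G) N (fund G)"
proof -
  define H where "H = cmqg_free_product (O_plus N) Z2_dual"
  note H = free_product_block_relations[of N, folded H_def]
  interpret A: star_algebra "alg H" by (rule H(1))
  have in_c: "fund H i j \<in> carrier (alg H)" if "i < Suc N" "j < Suc N" for i j
    using H(2) that by (auto simp: block_relations_def orthogonal_def reflection_def less_Suc_eq A.cl)
  then have entries: "entries H \<subseteq> carrier (alg H)" by (auto simp: entries_def H(3))
  let ?B = "gen_star_subalgebra (alg H) (entries H)"
  have B: "star_subalgebra (alg H) ?B" by (rule A.star_subalgebra_gen[OF entries])
  have in_B: "fund H i j \<in> ?B" if "i < Suc N" "j < Suc N" for i j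
    using A.gen_superset[of "entries H"] that by (auto simp: entries_def H(3))
  interpret P: star_algebra "pol H" unfolding pol_def by (rule A.star_algebra_sub[OF B])
  have "orthogonal (pol H) N (fund H)"
    unfolding pol_def using H(2) in_B by (intro A.orthogonal_sub[OF B]) (auto simp: block_relations_def)
  then have rel: "block_relations (pol H) N (fund H)"
    using H(2) in_B by (simp add: block_relations_def reflection_def pol_def)
  interpret G: star_algebra "pol G" by (rule G)
  obtain f where f: "star_hom (pol H) (pol G) f" "\<And>i j. i < Suc N \<Longrightarrow> j < Suc N \<Longrightarrow> f (fund H i j) = fund G i j"
    and m: "msize G = Suc N"
    using sub H(3) unfolding quantum_subgroup_def H_def[symmetric] by auto
  interpret f: star_morphism "pol H" "pol G" f by unfold_locales (rule f)
  show "msize G = Suc N" by (rule m)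
  have "block_relations (pol G) N (\<lambda>i j. f (fund H i j))" by (rule f.block_relations_map[OF rel])
  then have rel': "block_relations (pol G) N (\<lambda>i j. f (fund H i j))" .
  have "orthogonal (pol G) N (fund G)"
    by (rule G.orthogonal_cong[OF conjunct1[OF rel'[unfolded block_relations_def]]]) (simp add: f(2))
  then show "block_relations (pol G) N (fund G)"
    using rel' by (simp add: block_relations_def f(2))
qed

lemma star_subalgebra_sub:
  assumes "star_subalgebra A B" "star_subalgebra (A\<lparr>carrier := B\<rparr>) C" shows "star_subalgebra A C"
  using assms by (auto simp: star_subalgebra_def subset_iff)

lemma (in star_algebra) gen_sub:
  assumes B: "star_subalgebra A B" and S: "S \<subseteq> B"
  shows "gen_star_subalgebra (A\<lparr>carrier := B\<rparr>) S = gen_star_subalgebra A S"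
proof
  interpret B: star_algebra "A\<lparr>carrier := B\<rparr>" by (rule star_algebra_sub[OF B])
  have S': "S \<subseteq> carrier A" using S B by (auto simp: star_subalgebra_def)
  have "star_subalgebra (A\<lparr>carrier := B\<rparr>) (gen_star_subalgebra (A\<lparr>carrier := B\<rparr>) S)"
    by (rule B.star_subalgebra_gen) (use S in simp)
  from gen_least[OF star_subalgebra_sub[OF B this] B.gen_superset]
  show "gen_star_subalgebra A S \<subseteq> gen_star_subalgebra (A\<lparr>carrier := B\<rparr>) S" .
  have "star_subalgebra (A\<lparr>carrier := B\<rparr>) (gen_star_subalgebra A S)"
    using star_subalgebra_gen[OF S'] gen_least[OF B S] by (simp add: star_subalgebra_def)
  then show "gen_star_subalgebra (A\<lparr>carrier := B\<rparr>) S \<subseteq> gen_star_subalgebra A S"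
    by (rule B.gen_least) (rule gen_superset)
qed

lemma (in star_algebra) block_entry_le_one:
  assumes rel: "block_relations A N u" and p: "cstar_seminorm A p" and ij: "i < Suc N" "j < Suc N"
  shows "u i j \<in> carrier A" "p (u i j) \<le> 1"
proof -
  have v: "\<And>i j. i < N \<Longrightarrow> j < N \<Longrightarrow> u i j \<in> carrier A" "\<And>i j. i < N \<Longrightarrow> j < N \<Longrightarrow> star A (u i j) = u i j"
    "\<And>i j. i < N \<Longrightarrow> j < N \<Longrightarrow> (\<Oplus>k\<in>{..<N}. u k i \<otimes> u k j) = mat_one A i j"
    and r: "u N N \<in> carrier A" "star A (u N N) = u N N" "u N N \<otimes> u N N = \<one>"
    and z: "\<And>i. i < N \<Longrightarrow> u i N = \<zero>" "\<And>i. i < N \<Longrightarrow> u N i = \<zero>"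
    using rel by (auto simp: block_relations_def orthogonal_def reflection_def)
  consider "i < N" "j < N" | "i = N" "j = N" | "u i j = \<zero>" using z ij by (auto simp: less_Suc_eq)
  then have "u i j \<in> carrier A \<and> p (u i j) \<le> 1"
  proof cases
    case 1
    have "(\<Oplus>k\<in>{..<N}. star A (u k j) \<otimes> u k j) = (\<Oplus>k\<in>{..<N}. u k j \<otimes> u k j)"
      by (rule finsum_cong') (use v 1 in auto)
    then show ?thesis using v 1 seminorm_zero[OF p]
      by (auto intro!: seminorm_le_one[OF p, of "{..<N}" i "\<lambda>k. u k j"] simp: mat_one_def rules)
  next
    case 2
    have "(p (u N N))\<^sup>2 = p \<one>" using cstar_seminormD(5)[OF p r(1)] by (simp add: r)
    then have "(p (u N N))\<^sup>2 \<le> 1" using seminorm_one_cases[OF p] by auto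
    then show ?thesis using power2_le_imp_le[of "p (u N N)" 1] r 2 by simp
  next
    case 3
    then show ?thesis using seminorm_zero[OF p] by (simp add: cl)
  qed
  then show "u i j \<in> carrier A" "p (u i j) \<le> 1" by auto
qed

section \<open>Gluing\<close>

lemma tensor_ops_sub:
  "mult (formal_tensor (A\<lparr>carrier := B\<rparr>) (A\<lparr>carrier := B\<rparr>)) = mult (formal_tensor A A)"
  "add (formal_tensor (A\<lparr>carrier := B\<rparr>) (A\<lparr>carrier := B\<rparr>)) = add (formal_tensor A A)"
  "smult (formal_tensor (A\<lparr>carrier := B\<rparr>) (A\<lparr>carrier := B\<rparr>)) = smult (formal_tensor A A)"
  "star (formal_tensor (A\<lparr>carrier := B\<rparr>) (A\<lparr>carrier := B\<rparr>)) = star (formal_tensor A A)"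
  "one (formal_tensor (A\<lparr>carrier := B\<rparr>) (A\<lparr>carrier := B\<rparr>)) = one (formal_tensor A A)"
  by (simp_all add: formal_tensor_def)

lemma (in star_algebra) cop_total_of_generated:
  assumes u: "\<And>i j. i < n \<Longrightarrow> j < n \<Longrightarrow> u i j \<in> carrier A"
    and gen: "carrier A \<subseteq> gen_star_subalgebra A {u i j | i j. i < n \<and> j < n}" and x: "x \<in> carrier A"
  shows "\<exists>t. cop A (gens n u) x t"
proof -
  have "star_subalgebra A {x. \<exists>t. cop A (gens n u) x t}"
    unfolding star_subalgebra_def
  proof (intro conjI ballI allI)
    show "{x. \<exists>t. cop A (gens n u) x t} \<subseteq> carrier A"
    proof
      fix x assume "x \<in> {x. \<exists>t. cop A (gens n u) x t}"
      then obtain t where "cop A (gens n u) x t" by blast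
      then show "x \<in> carrier A" using cop_closed(1)[OF conjI[OF gens_closed[OF u]]] by auto
    qed
    show "\<one> \<in> {x. \<exists>t. cop A (gens n u) x t}" using cop.one by blast
    fix x y c assume "x \<in> {x. \<exists>t. cop A (gens n u) x t}"
    then obtain s where s: "cop A (gens n u) x s" by blast
    show "c \<odot> x \<in> {x. \<exists>t. cop A (gens n u) x t}" using cop.smult[OF s] by blast
    show "star A x \<in> {x. \<exists>t. cop A (gens n u) x t}" using cop.star[OF s] by blast
    assume "y \<in> {x. \<exists>t. cop A (gens n u) x t}"
    then obtain t where t: "cop A (gens n u) y t" by blast
    show "x \<oplus> y \<in> {x. \<exists>t. cop A (gens n u) x t}" using cop.add[OF s t] by blast
    show "x \<otimes> y \<in> {x. \<exists>t. cop A (gens n u) x t}" using cop.mult[OF s t] by blast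
  qed
  moreover have "{u i j | i j. i < n \<and> j < n} \<subseteq> {x. \<exists>t. cop A (gens n u) x t}"
  proof
    fix x assume "x \<in> {u i j | i j. i < n \<and> j < n}"
    then obtain i j where ij: "i < n" "j < n" "x = u i j" by blast
    show "x \<in> {x. \<exists>t. cop A (gens n u) x t}"
      using cop.base[OF gensI[of i n j u, OF ij(1,2)], of A] unfolding ij(3) by blast
  qed
  ultimately have "gen_star_subalgebra A {u i j | i j. i < n \<and> j < n} \<subseteq> {x. \<exists>t. cop A (gens n u) x t}"
    by (rule gen_least)
  then show ?thesis using gen x by blast
qed

text \<open>The elements acting boundedly in the GNS space, together with their adjoints, form a
  subalgebra; so boundedness need only be checked on self-adjoint generators.\<close>

lemma (in star_algebra) state_bounded_of_generated:
  assumes f: "state A f" and gen: "carrier A \<subseteq> gen_star_subalgebra A S" and S: "S \<subseteq> carrier A"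
    and sa: "\<And>s. s \<in> S \<Longrightarrow> star A s = s"
    and bdd: "\<And>s. s \<in> S \<Longrightarrow> \<exists>C. \<forall>y\<in>carrier A. Re (f (star A (s \<otimes> y) \<otimes> (s \<otimes> y))) \<le> C * Re (f (star A y \<otimes> y))"
    and x: "x \<in> carrier A"
  shows "\<exists>C. \<forall>y\<in>carrier A. Re (f (star A (x \<otimes> y) \<otimes> (x \<otimes> y))) \<le> C * Re (f (star A y \<otimes> y))"
proof -
  interpret i: semi_inner A "\<lambda>v w. f (star A v \<otimes> w)" by (rule semi_inner_state[OF f])
  define bd where "bd x \<longleftrightarrow> (\<exists>C\<ge>0. \<forall>y\<in>carrier A. i.len (x \<otimes> y) \<le> C * i.len y)" for x
  have bd_of: "bd s" if s: "s \<in> carrier A" and C: "\<forall>y\<in>carrier A. Re (f (star A (s \<otimes> y) \<otimes> (s \<otimes> y))) \<le> C * Re (f (star A y \<otimes> y))" for s C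
    unfolding bd_def
  proof (intro exI conjI ballI)
    show "0 \<le> sqrt \<bar>C\<bar>" by simp
    fix y assume y: "y \<in> carrier A"
    have "(i.len (s \<otimes> y))\<^sup>2 \<le> C * (i.len y)\<^sup>2" using C y s by (simp add: i.len_square cl)
    also have "\<dots> \<le> \<bar>C\<bar> * (i.len y)\<^sup>2" by (intro mult_right_mono) auto
    also have "\<dots> = (sqrt \<bar>C\<bar> * i.len y)\<^sup>2" by (simp add: power_mult_distrib)
    finally show "i.len (s \<otimes> y) \<le> sqrt \<bar>C\<bar> * i.len y"
      by (rule power2_le_imp_le) (use i.len_nonneg[OF y] in simp)
  qed
  have bd_add: "bd (x \<oplus> y)" if "x \<in> carrier A" "y \<in> carrier A" "bd x" "bd y" for x y
  proof -
    obtain C C' where C: "0 \<le> C" "0 \<le> C'" "\<forall>z\<in>carrier A. i.len (x \<otimes> z) \<le> C * i.len z" "\<forall>z\<in>carrier A. i.len (y \<otimes> z) \<le> C' * i.len z"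
      using \<open>bd x\<close> \<open>bd y\<close> unfolding bd_def by blast
    have "i.len ((x \<oplus> y) \<otimes> z) \<le> (C + C') * i.len z" if z: "z \<in> carrier A" for z
      using i.len_triangle[of "x \<otimes> z" "y \<otimes> z"] C(3,4) z that \<open>x \<in> carrier A\<close> \<open>y \<in> carrier A\<close>
      by (fastforce simp: rules cl distrib_right)
    then show ?thesis unfolding bd_def using C by (intro exI[of _ "C + C'"]) auto
  qed
  have bd_mult: "bd (x \<otimes> y)" if xy: "x \<in> carrier A" "y \<in> carrier A" "bd x" "bd y" for x y
  proof -
    obtain C C' where C: "0 \<le> C" "0 \<le> C'" "\<forall>z\<in>carrier A. i.len (x \<otimes> z) \<le> C * i.len z" "\<forall>z\<in>carrier A. i.len (y \<otimes> z) \<le> C' * i.len z"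
      using \<open>bd x\<close> \<open>bd y\<close> unfolding bd_def by blast
    have "i.len ((x \<otimes> y) \<otimes> z) \<le> (C * C') * i.len z" if z: "z \<in> carrier A" for z
    proof -
      have "i.len ((x \<otimes> y) \<otimes> z) \<le> C * i.len (y \<otimes> z)" using C(3) xy z by (simp add: rules cl)
      also have "\<dots> \<le> C * (C' * i.len z)" using C z by (intro mult_left_mono) auto
      finally show ?thesis by (simp add: mult.assoc)
    qed
    then show ?thesis unfolding bd_def using C by (intro exI[of _ "C * C'"]) auto
  qed
  have bd_smult: "bd (c \<odot> x)" if x: "x \<in> carrier A" "bd x" for c x
  proof -
    obtain C where C: "0 \<le> C" "\<forall>z\<in>carrier A. i.len (x \<otimes> z) \<le> C * i.len z"
      using \<open>bd x\<close> unfolding bd_def by blast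
    have "i.len ((c \<odot> x) \<otimes> z) \<le> (cmod c * C) * i.len z" if z: "z \<in> carrier A" for z
      using C x z i.len_smult[of "x \<otimes> z" c] by (simp add: rules cl mult.assoc mult_left_mono)
    then show ?thesis unfolding bd_def using C by (intro exI[of _ "cmod c * C"]) auto
  qed
  have bd_one: "bd \<one>" unfolding bd_def by (intro exI[of _ 1]) (auto simp: rules)
  have "star_subalgebra A {x \<in> carrier A. bd x \<and> bd (star A x)}"
    unfolding star_subalgebra_def
    by (auto simp: cl rules bd_one intro!: bd_add bd_mult bd_smult)
  moreover have "S \<subseteq> {x \<in> carrier A. bd x \<and> bd (star A x)}"
  proof
    fix s assume s: "s \<in> S"
    then have "s \<in> carrier A" using S by blast
    moreover have "bd s" using bdd[OF s] bd_of[OF \<open>s \<in> carrier A\<close>] by blast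
    ultimately show "s \<in> {x \<in> carrier A. bd x \<and> bd (star A x)}" using sa[OF s] by simp
  qed
  ultimately have "gen_star_subalgebra A S \<subseteq> {x \<in> carrier A. bd x \<and> bd (star A x)}" by (rule gen_least)
  then have "bd x" using gen x by blast
  then obtain C where C: "0 \<le> C" "\<forall>y\<in>carrier A. i.len (x \<otimes> y) \<le> C * i.len y" unfolding bd_def by blast
  have "Re (f (star A (x \<otimes> y) \<otimes> (x \<otimes> y))) \<le> C\<^sup>2 * Re (f (star A y \<otimes> y))" if y: "y \<in> carrier A" for y
  proof -
    have "(i.len (x \<otimes> y))\<^sup>2 \<le> (C * i.len y)\<^sup>2" using C x y i.len_nonneg[of "x \<otimes> y"] by (intro power_mono) (auto simp: cl)
    then show ?thesis using x y by (simp add: power_mult_distrib i.len_square cl)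
  qed
  then show ?thesis by blast
qed

context star_algebra
begin

text \<open>Slicing with a character is multiplicative, as \<chi> \<otimes> id is a homomorphism.
  Hence \<gamma> is a homomorphism.\<close>

lemma slL_mult:
  assumes h: "lin A h" "\<And>x y. x \<in> carrier A \<Longrightarrow> y \<in> carrier A \<Longrightarrow> h (x \<otimes> y) = h x * h y"
    and s: "s \<in> carrier T" and t: "t \<in> carrier T"
  shows "slL h (s \<otimes>\<^bsub>T\<^esub> t) = slL h s \<otimes> slL h t"
  using s
proof (induction s rule: T_induct)
  case Nil then show ?case using t by (simp add: T_simps sl_simps sl_closed)
next
  case (Cons a b s)
  have "slL h (map (\<lambda>(a', b'). (a \<otimes> a', b \<otimes> b')) t) = h a \<odot> (b \<otimes> slL h t)"
    using t Cons.hyps by (induction t rule: T_induct)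
      (simp_all add: sl_simps rules cl h sl_closed mult.commute)
  moreover have "map (\<lambda>(a', b'). (a \<otimes> a', b \<otimes> b')) t \<in> carrier T" using Cons.hyps t by (intro map_mult_in)
  ultimately show ?case using Cons t
    by (simp add: T_simps(12) sl_append T_closed sl_simps sl_closed rules cl)
qed

lemma slL_star:
  assumes h: "lin A h" "\<And>x. x \<in> carrier A \<Longrightarrow> h (star A x) = cnj (h x)" and s: "s \<in> carrier T"
  shows "slL h (star T s) = star A (slL h s)"
  using s by (induction s rule: T_induct) (simp_all add: T_simps sl_simps rules cl h sl_closed)

end

context quantum_algebra
begin

lemma eq_of_lin:
  assumes "x \<in> carrier A" "y \<in> carrier A" "\<And>\<psi>. lin A \<psi> \<Longrightarrow> \<psi> x = \<psi> y" shows "x = y"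
proof (rule inj_onD[OF emb_inj])
  show "pre.emb x = pre.emb y"
    by (rule K.eq_of_states) (use assms emb.lin_comp[OF state_lin] pre.emb_simps(1) in auto)
qed (use assms in auto)

lemma sl_cong:
  assumes h: "lin A h" and st: "teq s t"
  shows "slL h s = slL h t" "slR h s = slR h t"
proof -
  note in_c = teq_in[OF st]
  show "slL h s = slL h t"
    by (rule eq_of_lin) (use in_c sl_closed lin_sl(1) teqD[OF st h] in auto)
  show "slR h s = slR h t"
    by (rule eq_of_lin) (use in_c sl_closed lin_sl(2) teqD[OF st _ h] in auto)
qed

end

text \<open>The character \<open>\<chi>\<close> sends the fundamental representation \<open>u = v \<oplus> r\<close> to minus the identity matrix;
  it exists because the degree of reflection is two.\<close>

locale graded_quantum_algebra = quantum_algebra A p "Suc N" u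
  for A :: "('a, 'b) star_alg_scheme" (structure) and p N u +
  fixes \<chi> :: "'a \<Rightarrow> complex"
  assumes cp_unique: "cp x s \<Longrightarrow> cp x t \<Longrightarrow> teq s t"
    and rel: "block_relations A N u"
    and generated: "carrier A \<subseteq> gen_star_subalgebra A {u i j | i j. i < Suc N \<and> j < Suc N}"
    and \<chi>_lin: "lin A \<chi>"
    and \<chi>_mult: "\<lbrakk>x \<in> carrier A; y \<in> carrier A\<rbrakk> \<Longrightarrow> \<chi> (x \<otimes> y) = \<chi> x * \<chi> y"
    and \<chi>_star: "x \<in> carrier A \<Longrightarrow> \<chi> (star A x) = cnj (\<chi> x)"
    and \<chi>_one: "\<chi> \<one> = 1"
    and \<chi>_u: "\<lbrakk>i < Suc N; j < Suc N\<rbrakk> \<Longrightarrow> \<chi> (u i j) = (if i = j then -1 else 0)"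
begin

abbreviation "r \<equiv> u N N"

definition w :: "'a mat" where "w i j = u i j \<otimes> r"

lemma r: "r \<in> carrier A" "star A r = r" "r \<otimes> r = \<one>"
  using rel by (auto simp: block_relations_def reflection_def)

lemma rr: "x \<in> carrier A \<Longrightarrow> r \<otimes> (r \<otimes> x) = x"
  using m_assoc[OF r(1) r(1), of x] by (simp add: r)

lemma v: "i < N \<Longrightarrow> j < N \<Longrightarrow> u i j \<in> carrier A" "i < N \<Longrightarrow> j < N \<Longrightarrow> star A (u i j) = u i j"
  "i < N \<Longrightarrow> j < N \<Longrightarrow> (\<Oplus>k\<in>{..<N}. u k i \<otimes> u k j) = mat_one A i j"
  using rel by (auto simp: block_relations_def orthogonal_def)

lemma off_diagonal: "i < N \<Longrightarrow> u i N = \<zero>" "i < N \<Longrightarrow> u N i = \<zero>"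
  using rel by (auto simp: block_relations_def)

lemma u_selfadj: "i < Suc N \<Longrightarrow> j < Suc N \<Longrightarrow> star A (u i j) = u i j"
  using v(2)[of i j] r(2) by (auto simp: less_Suc_eq off_diagonal star_zero)

lemma generated_induct:
  assumes "star_subalgebra A B" "\<And>i j. i < Suc N \<Longrightarrow> j < Suc N \<Longrightarrow> u i j \<in> B" "x \<in> carrier A"
  shows "x \<in> B"
  using gen_least[OF assms(1), of "{u i j | i j. i < Suc N \<and> j < Suc N}"] generated assms(2,3) by blast

definition \<gamma> :: "'a \<Rightarrow> 'a" where "\<gamma> x = slL \<chi> (SOME t. cp x t)"

lemma \<gamma>_eq: "cp x t \<Longrightarrow> \<gamma> x = slL \<chi> t"
  unfolding \<gamma>_def by (rule sl_cong(1)[OF \<chi>_lin cp_unique]) (rule someI)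

lemma \<gamma>_simps:
  assumes x: "x \<in> carrier A"
  shows "\<gamma> x \<in> carrier A" "\<gamma> (c \<odot> x) = c \<odot> \<gamma> x" "\<gamma> (star A x) = star A (\<gamma> x)"
    "y \<in> carrier A \<Longrightarrow> \<gamma> (x \<oplus> y) = \<gamma> x \<oplus> \<gamma> y" "y \<in> carrier A \<Longrightarrow> \<gamma> (x \<otimes> y) = \<gamma> x \<otimes> \<gamma> y"
proof -
  obtain s where s: "cp x s" using cop_total[OF x] by blast
  note s_in = cp_closed(2)[OF s]
  show "\<gamma> x \<in> carrier A" using \<gamma>_eq[OF s] sl_closed(1)[OF s_in] by simp
  show "\<gamma> (c \<odot> x) = c \<odot> \<gamma> x" using \<gamma>_eq[OF cop.smult[OF s]] \<gamma>_eq[OF s] sl_smult(1)[OF \<chi>_lin s_in] by simp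
  show "\<gamma> (star A x) = star A (\<gamma> x)"
    using \<gamma>_eq[OF cop.star[OF s]] \<gamma>_eq[OF s] slL_star[OF \<chi>_lin \<chi>_star s_in] by simp
  assume y: "y \<in> carrier A"
  obtain t where t: "cp y t" using cop_total[OF y] by blast
  note t_in = cp_closed(2)[OF t]
  show "\<gamma> (x \<oplus> y) = \<gamma> x \<oplus> \<gamma> y"
    using \<gamma>_eq[OF cop.add[OF s t]] \<gamma>_eq[OF s] \<gamma>_eq[OF t] sl_append(1)[OF s_in t_in] by (simp add: T_simps(4))
  show "\<gamma> (x \<otimes> y) = \<gamma> x \<otimes> \<gamma> y"
    using \<gamma>_eq[OF cop.mult[OF s t]] \<gamma>_eq[OF s] \<gamma>_eq[OF t] slL_mult[OF \<chi>_lin \<chi>_mult s_in t_in] by simp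
qed

lemma \<gamma>_one: "\<gamma> \<one> = \<one>"
  using \<gamma>_eq[OF cop.one] by (simp add: T_simps sl_simps \<chi>_one rules)

lemma \<gamma>_u: assumes ij: "i < Suc N" "j < Suc N" shows "\<gamma> (u i j) = (-1) \<odot> u i j"
proof -
  \<comment> \<open>Since \<chi> is -1 on the diagonal and 0 elsewhere, only the summand k = i
    survives. The induction runs over lists of distinct indices so that this summand occurs at most
    once.\<close>
  have "slL \<chi> (map (\<lambda>k. (u i k, u k j)) ks) = (if i \<in> set ks then (-1) \<odot> u i j else \<zero>)"
    if "distinct ks" "set ks \<subseteq> {..<Suc N}" for ks
    using that
  proof (induction ks)
    case (Cons k ks)
    then have k: "k < Suc N" by simp
    show ?case using Cons u_in[OF ij] u_in[OF k ij(2)] \<chi>_u[OF ij(1) k] by (auto simp: sl_simps rules cl)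
  qed (simp add: sl_simps)
  from this[of "[0..<Suc N]"] have "slL \<chi> [(u i k, u k j). k \<leftarrow> [0..<Suc N]] = (-1) \<odot> u i j"
    using ij by (simp del: upt_Suc add: atLeast0LessThan)
  then show ?thesis using \<gamma>_eq[OF cop.base[OF gensI[of i "Suc N" j u, OF ij]]] by simp
qed

text \<open>Composition of \<open>p\<close> with a homomorphism is again a C*-seminorm, and
  \<open>p\<close> is the largest one.\<close>

lemma p_\<gamma>: "x \<in> carrier A \<Longrightarrow> p (\<gamma> x) \<le> p x"
proof (rule p_max)
  note D = cstar_seminormD[OF p_cstar]
  have "p (star A (\<gamma> x) \<otimes> \<gamma> x) = (p (\<gamma> x))\<^sup>2" if "x \<in> carrier A" for x using that by (simp add: D \<gamma>_simps)
  then show "cstar_seminorm A (\<lambda>x. p (\<gamma> x))"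
    by (simp add: cstar_seminorm_def \<gamma>_simps D cl)
qed

section \<open>The even part and the decomposition into even and odd elements\<close>

definition even :: "'a set" where
  "even = gen_star_subalgebra A {w i j | i j. i < N \<and> j < N}"

abbreviation "E \<equiv> A\<lparr>carrier := even\<rparr>"

lemma w_in: "i < N \<Longrightarrow> j < N \<Longrightarrow> w i j \<in> carrier A"
  by (simp add: w_def v r)

lemma even_sub: "star_subalgebra A even"
  unfolding even_def by (rule star_subalgebra_gen) (auto simp: w_in)

sublocale E: star_algebra E
  by (rule star_algebra_sub[OF even_sub])

lemma even_closed:
  "x \<in> even \<Longrightarrow> x \<in> carrier A" "\<one> \<in> even" "x \<in> even \<Longrightarrow> c \<odot> x \<in> even" "x \<in> even \<Longrightarrow> star A x \<in> even"
  "x \<in> even \<Longrightarrow> y \<in> even \<Longrightarrow> x \<oplus> y \<in> even" "x \<in> even \<Longrightarrow> y \<in> even \<Longrightarrow> x \<otimes> y \<in> even"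
  using even_sub by (auto simp: star_subalgebra_def)

lemma zero_even: "\<zero> \<in> even"
  using even_closed(3)[OF even_closed(2), of 0] by (simp add: rules)

lemma w_even: "i < N \<Longrightarrow> j < N \<Longrightarrow> w i j \<in> even"
  using gen_superset[of "{w i j | i j. i < N \<and> j < N}"] unfolding even_def by auto

lemma even_induct:
  assumes "star_subalgebra A B" "\<And>i j. i < N \<Longrightarrow> j < N \<Longrightarrow> w i j \<in> B" "x \<in> even"
  shows "x \<in> B"
  using gen_least[OF assms(1), of "{w i j | i j. i < N \<and> j < N}"] assms(2,3) unfolding even_def by blast

lemma \<gamma>_even: "x \<in> even \<Longrightarrow> \<gamma> x = x"
proof -
  assume x: "x \<in> even"
  have "x \<in> {x \<in> carrier A. \<gamma> x = x}"
  proof (rule even_induct[OF _ _ x])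
    show "star_subalgebra A {x \<in> carrier A. \<gamma> x = x}"
      by (auto simp: star_subalgebra_def cl \<gamma>_simps \<gamma>_one)
    show "w i j \<in> {x \<in> carrier A. \<gamma> x = x}" if "i < N" "j < N" for i j
      using that w_in[OF that] v(1)[OF that] r by (simp add: w_def \<gamma>_simps \<gamma>_u rules cl)
  qed
  then show ?thesis by simp
qed

text \<open>On generators r (v r) r = r v is the adjoint of v r, because \<open>v\<close> and
  \<open>r\<close> are self-adjoint; conjugation by \<open>r\<close> is a homomorphism, so the rest
  follows.\<close>

lemma conj_even: "x \<in> even \<Longrightarrow> r \<otimes> (x \<otimes> r) \<in> even"
proof -
  assume x: "x \<in> even"
  have "x \<in> {x \<in> carrier A. r \<otimes> (x \<otimes> r) \<in> even}"
  proof (rule even_induct[OF _ _ x])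
    have mult: "r \<otimes> ((x \<otimes> y) \<otimes> r) = (r \<otimes> (x \<otimes> r)) \<otimes> (r \<otimes> (y \<otimes> r))" if "x \<in> carrier A" "y \<in> carrier A" for x y
      using that by (simp add: m_assoc r rr)
    have star: "r \<otimes> (star A x \<otimes> r) = star A (r \<otimes> (x \<otimes> r))" if "x \<in> carrier A" for x
      using that by (simp add: rules cl r)
    show "star_subalgebra A {x \<in> carrier A. r \<otimes> (x \<otimes> r) \<in> even}"
      unfolding star_subalgebra_def
    proof (intro conjI ballI allI)
      show "\<one> \<in> {x \<in> carrier A. r \<otimes> (x \<otimes> r) \<in> even}" using r even_closed(2) by simp
      fix x y c assume "x \<in> {x \<in> carrier A. r \<otimes> (x \<otimes> r) \<in> even}"
      then have x: "x \<in> carrier A" "r \<otimes> (x \<otimes> r) \<in> even" by auto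
      show "c \<odot> x \<in> {x \<in> carrier A. r \<otimes> (x \<otimes> r) \<in> even}"
        using even_closed(3)[OF x(2), of c] x(1) r by (simp add: rules cl)
      show "star A x \<in> {x \<in> carrier A. r \<otimes> (x \<otimes> r) \<in> even}"
        using even_closed(4)[OF x(2)] x(1) by (simp add: cl star)
      assume "y \<in> {x \<in> carrier A. r \<otimes> (x \<otimes> r) \<in> even}"
      then have y: "y \<in> carrier A" "r \<otimes> (y \<otimes> r) \<in> even" by auto
      show "x \<oplus> y \<in> {x \<in> carrier A. r \<otimes> (x \<otimes> r) \<in> even}"
        using even_closed(5)[OF x(2) y(2)] x(1) y(1) r by (simp add: rules cl)
      show "x \<otimes> y \<in> {x \<in> carrier A. r \<otimes> (x \<otimes> r) \<in> even}"
        using even_closed(6)[OF x(2) y(2)] x(1) y(1) by (simp add: cl mult)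
    qed auto
    show "w i j \<in> {x \<in> carrier A. r \<otimes> (x \<otimes> r) \<in> even}" if "i < N" "j < N" for i j
    proof -
      have "r \<otimes> (w i j \<otimes> r) = star A (w i j)" using v[OF that] r by (simp add: w_def rules cl)
      then show ?thesis using w_in[OF that] even_closed(4)[OF w_even[OF that]] by simp
    qed
  qed
  then show ?thesis by simp
qed

text \<open>The sums a + b r form a subalgebra: conjugation by \<open>r\<close> preserves the even
  part and moves \<open>r\<close> past even factors, and two factors \<open>r\<close> cancel. It
  contains v = (v r) r and \<open>r\<close> itself.\<close>

lemma decomposition:
  assumes x: "x \<in> carrier A"
  obtains a b where "a \<in> even" "b \<in> even" "x = a \<oplus> b \<otimes> r"
proof -
  let ?D = "{a \<oplus> b \<otimes> r | a b. a \<in> even \<and> b \<in> even}"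
  have D: "a \<in> even \<Longrightarrow> b \<in> even \<Longrightarrow> z = a \<oplus> b \<otimes> r \<Longrightarrow> z \<in> ?D" for a b z by blast
  note c = even_closed zero_even
  have "x \<in> ?D"
  proof (rule generated_induct[OF _ _ x])
    show "star_subalgebra A ?D"
      unfolding star_subalgebra_def
    proof (intro conjI ballI allI)
      show "?D \<subseteq> carrier A" using c r by (auto simp: cl)
      show "\<one> \<in> ?D" by (rule D[of \<one> \<zero>]) (use c r in \<open>simp_all add: rules cl\<close>)
      fix x y k assume "x \<in> ?D"
      then obtain a b where ab: "a \<in> even" "b \<in> even" and x: "x = a \<oplus> b \<otimes> r" by blast
      note ab' = ab[THEN even_closed(1)]
      show "k \<odot> x \<in> ?D"
        by (rule D[of "k \<odot> a" "k \<odot> b"]) (use ab ab' c r in \<open>simp_all add: x rules cl\<close>)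
      show "star A x \<in> ?D"
        by (rule D[of "star A a" "r \<otimes> (star A b \<otimes> r)"])
          (use ab ab' c r in \<open>simp_all add: x rules cl conj_even\<close>)
      assume "y \<in> ?D"
      then obtain a' b' where ab2: "a' \<in> even" "b' \<in> even" and y: "y = a' \<oplus> b' \<otimes> r" by blast
      note ab2' = ab2[THEN even_closed(1)]
      show "x \<oplus> y \<in> ?D"
        by (rule D[of "a \<oplus> a'" "b \<oplus> b'"]) (use ab ab' ab2 ab2' c r in \<open>simp_all add: x y rules cl a_lcomm\<close>)
      show "x \<otimes> y \<in> ?D"
        by (rule D[of "a \<otimes> a' \<oplus> b \<otimes> (r \<otimes> (b' \<otimes> r))" "a \<otimes> b' \<oplus> b \<otimes> (r \<otimes> (a' \<otimes> r))"])
          (use ab ab' ab2 ab2' c r conj_even in \<open>simp_all add: x y rules cl a_lcomm\<close>)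
    qed
    fix i j assume "i < Suc N" "j < Suc N"
    then consider "i < N" "j < N" | "i = N" "j = N" | "u i j = \<zero>" using off_diagonal by (auto simp: less_Suc_eq)
    then show "u i j \<in> ?D"
    proof cases
      case 1
      show ?thesis by (rule D[of \<zero> "w i j"]) (use 1 w_even v c r in \<open>simp_all add: w_def rules cl\<close>)
    next
      case 2
      show ?thesis by (rule D[of \<zero> \<one>]) (use 2 c r in \<open>simp_all add: rules cl\<close>)
    next
      case 3
      show ?thesis by (rule D[of \<zero> \<zero>]) (use 3 c r in \<open>simp_all add: rules cl\<close>)
    qed
  qed
  then show thesis using that by blast
qed

definition ev :: "'a \<Rightarrow> 'a" where "ev x = (1/2) \<odot> (x \<oplus> \<gamma> x)"

lemma half_add: "x \<in> carrier A \<Longrightarrow> (1/2) \<odot> x \<oplus> (1/2) \<odot> x = x"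
  using smult_add_left[of x "1/2" "1/2"] by (simp add: rules)

lemma ev_simps:
  assumes x: "x \<in> carrier A"
  shows "ev x \<in> carrier A" "ev (c \<odot> x) = c \<odot> ev x" "y \<in> carrier A \<Longrightarrow> ev (x \<oplus> y) = ev x \<oplus> ev y"
    "x \<in> even \<Longrightarrow> ev x = x"
  using x by (simp_all add: ev_def \<gamma>_simps cl rules \<gamma>_even a_lcomm mult.commute half_add)

lemma odd_r: "b \<in> even \<Longrightarrow> \<gamma> (b \<otimes> r) = (-1) \<odot> (b \<otimes> r)"
  using r even_closed(1) by (simp add: \<gamma>_simps \<gamma>_even \<gamma>_u rules)

lemma ev_odd: "x \<in> carrier A \<Longrightarrow> \<gamma> x = (-1) \<odot> x \<Longrightarrow> ev x = \<zero>"
  by (simp add: ev_def rules cl)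

lemma ev_decomposition: "a \<in> even \<Longrightarrow> b \<in> even \<Longrightarrow> ev (a \<oplus> b \<otimes> r) = a"
  using even_closed(1) r by (simp add: ev_simps cl ev_odd odd_r rules)

lemma ev_even: "x \<in> carrier A \<Longrightarrow> ev x \<in> even"
  using decomposition ev_decomposition by metis

text \<open>Here \<open>r\<close> is split off on the left, since (r c)* (r c) = c* c by unitarity
  of \<open>r\<close>. With \<open>r\<close> on the right, the square would be conjugated by
  \<open>r\<close>.\<close>

definition od :: "'a \<Rightarrow> 'a" where "od x = r \<otimes> (x \<oplus> (-1) \<odot> ev x)"

lemma od_decomposition: "a \<in> even \<Longrightarrow> b \<in> even \<Longrightarrow> od (a \<oplus> b \<otimes> r) = r \<otimes> (b \<otimes> r)"
proof -
  assume ab: "a \<in> even" "b \<in> even"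
  then have in_A: "a \<in> carrier A" "b \<otimes> r \<in> carrier A" using even_closed(1) r by auto
  have "(a \<oplus> b \<otimes> r) \<oplus> (-1) \<odot> a = (a \<oplus> (-1) \<odot> a) \<oplus> b \<otimes> r" using in_A by (simp add: cl a_ac)
  then show ?thesis using ab in_A by (simp add: od_def ev_decomposition rules)
qed

lemma od_even: "x \<in> carrier A \<Longrightarrow> od x \<in> even"
  using decomposition od_decomposition conj_even by metis

lemma recompose: "x \<in> carrier A \<Longrightarrow> x = ev x \<oplus> r \<otimes> od x"
proof -
  assume x: "x \<in> carrier A"
  obtain a b where ab: "a \<in> even" "b \<in> even" "x = a \<oplus> b \<otimes> r" using decomposition[OF x] .
  then have "b \<in> carrier A" "a \<in> carrier A" using even_closed(1) by auto
  then show ?thesis using ab r by (simp add: ev_decomposition od_decomposition rr)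
qed

text \<open>The mixed terms of x* x contain one factor \<open>r\<close> and are odd, so
  \<open>ev\<close> removes them; in the square of the odd part \<open>r\<close> cancels.\<close>

lemma ev_square:
  assumes x: "x \<in> carrier A"
  shows "ev (star A x \<otimes> x) = star A (ev x) \<otimes> ev x \<oplus> star A (od x) \<otimes> od x"
proof -
  obtain a b where ab: "a \<in> even" "b \<in> even" "x = a \<oplus> b \<otimes> r" using decomposition[OF x] .
  then have in_A: "b \<in> carrier A" "a \<in> carrier A" using even_closed(1) by auto
  let ?e = "star A a \<otimes> a \<oplus> r \<otimes> (star A b \<otimes> (b \<otimes> r))" and ?o = "star A a \<otimes> b \<oplus> r \<otimes> (star A b \<otimes> a \<otimes> r)"
  have even: "?e \<in> even" "?o \<in> even"
    using ab even_closed conj_even[of "star A b \<otimes> b"] conj_even[of "star A b \<otimes> a"] in_A r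
    by (simp_all add: m_assoc cl)
  have "star A x \<otimes> x = ?e \<oplus> ?o \<otimes> r"
    using in_A r by (simp add: ab(3) rules cl a_lcomm)
  then have "ev (star A x \<otimes> x) = ?e" using ev_decomposition[OF even] by simp
  also have "?e = star A (ev x) \<otimes> ev x \<oplus> star A (od x) \<otimes> od x"
    using in_A r by (simp add: ab(3) ev_decomposition[OF ab(1,2)] od_decomposition[OF ab(1,2)] rules cl rr)
  finally show ?thesis .
qed

lemma p_ev: "x \<in> carrier A \<Longrightarrow> p (ev x) \<le> p x"
  using cstar_seminormD(2)[OF p_cstar, of "x \<oplus> \<gamma> x" "1/2"] cstar_seminormD(3)[OF p_cstar, of x "\<gamma> x"] p_\<gamma>[of x]
  by (simp add: ev_def cl \<gamma>_simps norm_divide)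

lemma p_r: "p r \<le> 1"
  by (rule block_entry_le_one(2)[OF rel p_cstar]) simp_all

lemma p_r_mult: "x \<in> carrier A \<Longrightarrow> p (r \<otimes> x) \<le> p x"
  using cstar_seminormD(4)[OF p_cstar r(1), of x] mult_right_mono[OF p_r cstar_seminormD(1)[OF p_cstar, of x]]
  by simp

section \<open>Extension of states from the even part\<close>

lemma lin_ev: "lin E \<phi> \<Longrightarrow> lin A (\<lambda>x. \<phi> (ev x))"
  by (simp add: lin_def ev_simps ev_even)

lemma state_ev:
  assumes \<phi>: "state E \<phi>" shows "state A (\<lambda>x. \<phi> (ev x))"
proof -
  have "\<phi> (ev (star A x \<otimes> x)) = \<phi> (star E (ev x) \<otimes>\<^bsub>E\<^esub> ev x) + \<phi> (star E (od x) \<otimes>\<^bsub>E\<^esub> od x)"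
    if x: "x \<in> carrier A" for x
    using lin_add[OF state_lin[OF \<phi>], of "star A (ev x) \<otimes> ev x" "star A (od x) \<otimes> od x"] ev_even[OF x] od_even[OF x]
    by (simp add: ev_square[OF x] even_closed)
  then show ?thesis
    using lin_ev[OF state_lin[OF \<phi>]] state_pos[OF \<phi>] state_pos_Im[OF \<phi>] state_one[OF \<phi>] ev_even od_even
    by (simp add: state_def lin_def ev_simps even_closed(2))
qed

text \<open>Normalised columns give y* y as the sum of (z y)* (z y) over the entries z of a column.
  In any state each summand is at most the total, so every entry acts as a contraction.\<close>

lemma state_bounded:
  assumes f: "state A f" and x: "x \<in> carrier A"
  shows "\<exists>C. \<forall>y\<in>carrier A. Re (f (star A (x \<otimes> y) \<otimes> (x \<otimes> y))) \<le> C * Re (f (star A y \<otimes> y))"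
proof (rule state_bounded_of_generated[OF f generated _ _ _ x])
  show "{u i j | i j. i < Suc N \<and> j < Suc N} \<subseteq> carrier A" using u_in by blast
  fix s assume "s \<in> {u i j | i j. i < Suc N \<and> j < Suc N}"
  then obtain i j where ij: "i < Suc N" "j < Suc N" "s = u i j" by blast
  show "star A s = s" using ij u_selfadj by simp
  note L = lin_add[OF state_lin[OF f]] lin_smult[OF state_lin[OF f]]
  have col: "Re (f (star A (z k \<otimes> y) \<otimes> (z k \<otimes> y))) \<le> Re (f (star A y \<otimes> y))"
    if S: "finite S" "k \<in> S" and z: "\<And>k. k \<in> S \<Longrightarrow> z k \<in> carrier A" "(\<Oplus>k\<in>S. star A (z k) \<otimes> z k) = \<one>"
      and y: "y \<in> carrier A" for S k z y
  proof -
    have "f (star A y \<otimes> (\<one> \<otimes> y)) = (\<Sum>k\<in>S. f (star A y \<otimes> ((star A (z k) \<otimes> z k) \<otimes> y)))"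
    proof -
      have "lin A (\<lambda>x. f (star A y \<otimes> (x \<otimes> y)))" using y by (simp add: lin_def rules cl L)
      from lin_finsum[OF this S(1), of "\<lambda>k. star A (z k) \<otimes> z k"] show ?thesis using z by (simp add: cl)
    qed
    also have "\<dots> = (\<Sum>k\<in>S. f (star A (z k \<otimes> y) \<otimes> (z k \<otimes> y)))"
      using z y by (intro sum.cong refl) (simp add: rules cl)
    finally have "Re (f (star A y \<otimes> y)) = (\<Sum>k\<in>S. Re (f (star A (z k \<otimes> y) \<otimes> (z k \<otimes> y))))"
      using y by (simp flip: Re_sum)
    moreover have "Re (f (star A (z k \<otimes> y) \<otimes> (z k \<otimes> y))) \<le> (\<Sum>k\<in>S. Re (f (star A (z k \<otimes> y) \<otimes> (z k \<otimes> y))))"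
      using S z y state_pos[OF f] by (intro member_le_sum) (auto simp: cl)
    ultimately show ?thesis by simp
  qed
  from ij consider "i < N" "j < N" | "i = N" "j = N" | "u i j = \<zero>" using off_diagonal by (auto simp: less_Suc_eq)
  then have "\<forall>y\<in>carrier A. Re (f (star A (s \<otimes> y) \<otimes> (s \<otimes> y))) \<le> Re (f (star A y \<otimes> y))"
  proof cases
    case 1
    have "(\<Oplus>k\<in>{..<N}. star A (u k j) \<otimes> u k j) = (\<Oplus>k\<in>{..<N}. u k j \<otimes> u k j)"
      by (rule finsum_cong') (use v 1 in auto)
    then show ?thesis using col[of "{..<N}" i "\<lambda>k. u k j"] v 1 ij by (auto simp: mat_one_def)
  next
    case 2
    then show ?thesis using col[of "{N}" N "\<lambda>_. r"] r ij by (auto simp: cl)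
  next
    case 3
    then show ?thesis using state_pos[OF f] ij lin_zero[OF state_lin[OF f]] by (auto simp: rules cl)
  qed
  then show "\<exists>C. \<forall>y\<in>carrier A. Re (f (star A (s \<otimes> y) \<otimes> (s \<otimes> y))) \<le> C * Re (f (star A y \<otimes> y))"
    by (intro exI[of _ 1]) simp
qed

text \<open>A C*-seminorm on the even part is attained on states, which extend by zero on the odd part.\<close>

lemma even_seminorm_le:
  fixes s assumes s: "cstar_seminorm E s" and x: "x \<in> even"
  shows "s x \<le> p x"
proof (cases "s \<one> = 0")
  case True
  then show ?thesis using E.seminorm_trivial[OF s] x cstar_seminormD(1)[OF p_cstar even_closed(1)[OF x]] by simp
next
  case False
  have xA: "x \<in> carrier A" by (rule even_closed(1)[OF x])
  obtain \<phi> where \<phi>: "state E \<phi>" "Re (\<phi> (star A x \<otimes> x)) = (s x)\<^sup>2"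
    using E.ex_state_seminorm[OF s, of x] False x by auto
  note f = state_ev[OF \<phi>(1)]
  \<comment> \<open>The extended state has a bounded GNS representation, and its operator norm is a
    C*-seminorm on the whole algebra, hence at most \<open>p\<close>.\<close>
  obtain q' where q': "cstar_seminorm A q'" "\<And>y. y \<in> carrier A \<Longrightarrow> Re (\<phi> (ev (star A y \<otimes> y))) \<le> (q' y)\<^sup>2"
    using state_square_le_cstar_seminorm[OF f state_bounded[OF f]] by blast
  have "ev (star A x \<otimes> x) = star A x \<otimes> x" using x even_closed by (simp add: ev_simps xA cl)
  then have "(s x)\<^sup>2 \<le> (q' x)\<^sup>2" using q'(2)[OF xA] \<phi>(2) by simp
  also have "\<dots> \<le> (p x)\<^sup>2"
    using p_max[OF q'(1) xA] cstar_seminormD(1)[OF q'(1) xA] by (intro power_mono)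
  finally show ?thesis using cstar_seminormD(1)[OF p_cstar xA] by (rule power2_le_imp_le)
qed

definition pE :: "'a \<Rightarrow> real" where "pE = universal_seminorm E {}"

lemma bdd_even: "x \<in> carrier E \<Longrightarrow> \<exists>C. \<forall>q\<in>E.compatible {}. q x \<le> C"
  using even_seminorm_le by (auto simp: E.compatible_def)

lemma p_seminorm_E: "cstar_seminorm E p"
  using p_cstar even_closed by (simp add: cstar_seminorm_def)

lemma pE_eq: "x \<in> even \<Longrightarrow> pE x = p x"
proof (rule antisym)
  assume x: "x \<in> even"
  show "pE x \<le> p x" unfolding pE_def
    by (rule E.universal_le[OF bdd_even]) (use even_seminorm_le x in \<open>auto simp: E.compatible_def\<close>)
  show "p x \<le> pE x" unfolding pE_def
    by (rule E.le_universal[OF bdd_even]) (use p_seminorm_E x in \<open>auto simp: E.compatible_def\<close>)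
qed

lemma even_generated: "carrier E \<subseteq> gen_star_subalgebra E {w i j | i j. i < N \<and> j < N}"
  using gen_sub[OF even_sub, of "{w i j | i j. i < N \<and> j < N}"] w_even by (auto simp: even_def)

text \<open>The polynomial algebra of the glued version becomes a second instance of the locale, so
  that the criterion \<open>haar_on\<close> is available on both sides.\<close>

sublocale EQ: quantum_algebra E pE N w
proof
  show "cstar_seminorm E pE" unfolding pE_def by (rule E.cstar_seminorm_universal[OF bdd_even])
  show "x \<in> carrier E \<Longrightarrow> pE x = 0 \<Longrightarrow> x = \<zero>\<^bsub>E\<^esub>" for x using pE_eq p_def even_closed(1) by simp
  show "cstar_seminorm E q \<Longrightarrow> x \<in> carrier E \<Longrightarrow> q x \<le> pE x" for q x
    using even_seminorm_le pE_eq by simp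
  show "\<one>\<^bsub>E\<^esub> \<noteq> \<zero>\<^bsub>E\<^esub>" using nontriv by simp
  show "i < N \<Longrightarrow> j < N \<Longrightarrow> w i j \<in> carrier E" for i j using w_even by simp
  show "x \<in> carrier E \<Longrightarrow> \<exists>t. cop E (gens N w) x t" for x
    by (rule E.cop_total_of_generated[OF _ even_generated]) (use w_even in auto)
qed

section \<open>Comultiplication of the even part\<close>

lemma tensor_even: "t \<in> carrier E.T \<Longrightarrow> t \<in> carrier T"
  using even_closed(1) by (auto simp: T_simps(1) E.T_simps(1))

text \<open>The entry \<open>r\<close> is group-like: all other summands of its comultiplication
  contain off-diagonal entries, which vanish. They remain as pairs in the list, hence equality holds
  only as tensors.\<close>

lemma comul_r: "cp r [(u N k, u k N). k \<leftarrow> [0..<Suc N]]" "teq [(u N k, u k N). k \<leftarrow> [0..<Suc N]] [(r, r)]"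
proof -
  show c: "cp r [(u N k, u k N). k \<leftarrow> [0..<Suc N]]" by (intro cop.base gensI) auto
  have "tensor_functional \<phi> \<psi> (map (\<lambda>k. (u N k, u k N)) ks) = 0" if "lin A \<phi>" "set ks \<subseteq> {..<N}" for \<phi> \<psi> ks
    using that(2) lin_zero[OF that(1)] by (induction ks) (simp_all add: tf_simps off_diagonal)
  from this[of _ "[0..<N]"] have "tensor_functional \<phi> \<psi> (map (\<lambda>k. (u N k, u k N)) [0..<N]) = 0" if "lin A \<phi>" for \<phi> \<psi>
    using that by (simp add: atLeast0LessThan)
  then show "teq [(u N k, u k N). k \<leftarrow> [0..<Suc N]] [(r, r)]"
    using cp_closed(2)[OF c] r by (auto simp: teq_def T_closed_simps tf_simps)
qed

lemma comul_v:
  assumes ij: "i < N" "j < N"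
  shows "cp (u i j) [(u i k, u k j). k \<leftarrow> [0..<Suc N]]"
    "teq [(u i k, u k j). k \<leftarrow> [0..<Suc N]] [(u i k, u k j). k \<leftarrow> [0..<N]]"
proof -
  show c: "cp (u i j) [(u i k, u k j). k \<leftarrow> [0..<Suc N]]" by (intro cop.base gensI) (use ij in auto)
  then show "teq [(u i k, u k j). k \<leftarrow> [0..<Suc N]] [(u i k, u k j). k \<leftarrow> [0..<N]]"
    using cp_closed(2)[OF c] lin_zero by (auto simp: teq_def T_closed_simps tf_simps off_diagonal ij)
qed

text \<open>The comultiplication of the even part is the restriction of the given one. On generators
  this is the product of the comultiplications of v and of the group-like \<open>r\<close>, which
  multiplies both legs by \<open>r\<close>.\<close>

lemma comul_even:
  assumes "EQ.cp x t"
  shows "\<exists>t'. cp x t' \<and> teq t' t"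
  using assms
proof induction
  case (base x t)
  then obtain i j where ij: "i < N" "j < N" "x = w i j" "t = [(w i k, w k j). k \<leftarrow> [0..<N]]" by (rule gensE)
  have "[(u i k, u k j). k \<leftarrow> ks] \<otimes>\<^bsub>T\<^esub> [(r, r)] = [(w i k, w k j). k \<leftarrow> ks]" for ks
    by (induction ks) (simp_all add: T_simps w_def)
  then show ?case
    using cop.mult[OF comul_v(1)[OF ij(1,2)] comul_r(1)] teq_mult[OF comul_v(2)[OF ij(1,2)] comul_r(2)]
    by (auto simp: ij w_def)
next
  case one
  have "cp \<one> \<one>\<^bsub>T\<^esub>" "teq \<one>\<^bsub>T\<^esub> \<one>\<^bsub>T\<^esub>" by (auto intro: cop.one teq_refl T_closed)
  then show ?case by (auto simp: tensor_ops_sub)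
next
  case (add x s y t)
  then obtain s' t' where "cp x s'" "teq s' s" "cp y t'" "teq t' t" by blast
  then show ?case using cop.add[of A _ x s' y t'] teq_append[of s' s t' t] by (auto simp: tensor_ops_sub T_simps(4))
next
  case (mult x s y t)
  then obtain s' t' where "cp x s'" "teq s' s" "cp y t'" "teq t' t" by blast
  then show ?case using cop.mult[of A _ x s' y t'] teq_mult[of s' s t' t] by (auto simp: tensor_ops_sub)
next
  case (smult x s c)
  then obtain s' where "cp x s'" "teq s' s" by blast
  then show ?case using cop.smult[of A _ x s'] teq_smult[of s' s] by (auto simp: tensor_ops_sub)
next
  case (star x s)
  then obtain s' where "cp x s'" "teq s' s" by blast
  then show ?case using cop.star[of A _ x s'] teq_star[of s' s] by (auto simp: tensor_ops_sub)
qed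

lemma tf_ev: "t \<in> carrier E.T \<Longrightarrow> tensor_functional (\<lambda>x. \<phi> (ev x)) (\<lambda>x. \<psi> (ev x)) t = tensor_functional \<phi> \<psi> t"
  by (induction t rule: E.T_induct) (simp_all add: tf_simps ev_simps even_closed(1))

text \<open>Linear functionals on the even part extend to the whole algebra by composition with
  \<open>ev\<close>, so tensors over the even part that agree over the whole algebra already
  agree.\<close>

lemma EQ_unique:
  assumes s: "EQ.cp x s" and t: "EQ.cp x t"
  shows "E.teq s t"
proof -
  obtain s' t' where s': "cp x s'" "teq s' s" and t': "cp x t'" "teq t' t"
    using comul_even[OF s] comul_even[OF t] by blast
  have st: "teq s t" using teq_trans[OF teq_trans[OF teq_sym[OF s'(2)] cp_unique[OF s'(1) t'(1)]] t'(2)] .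
  note in_E = EQ.cp_closed(2)[OF s] EQ.cp_closed(2)[OF t]
  show ?thesis
    unfolding E.teq_def using in_E teqD[OF st lin_ev lin_ev] tf_ev by metis
qed

lemma sl_even: "E.slL h t = slL h t" "E.slR h t = slR h t"
  by (simp_all add: E.slL_def slL_def E.slR_def slR_def)

lemma sl_ev:
  "t \<in> carrier E.T \<Longrightarrow> slL (\<lambda>x. h (ev x)) t = slL h t" "t \<in> carrier E.T \<Longrightarrow> slR (\<lambda>x. h (ev x)) t = slR h t"
  by (induction t rule: E.T_induct) (simp_all add: sl_simps ev_simps even_closed(1))

text \<open>Multiplication by r \<otimes> r makes both legs odd, and \<open>ev\<close> annihilates
  odd elements. This is the invariance of the extended functional on the odd part.\<close>

lemma sl_odd:
  assumes h: "lin E h" and t: "t \<in> carrier E.T"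
  shows "slL (\<lambda>x. h (ev x)) (t \<otimes>\<^bsub>T\<^esub> [(r, r)]) = \<zero>" "slR (\<lambda>x. h (ev x)) (t \<otimes>\<^bsub>T\<^esub> [(r, r)]) = \<zero>"
  using t
proof (induction t rule: E.T_induct)
  case (Cons a b t)
  { case 1
    have "ev (a \<otimes> r) = \<zero>" using Cons even_closed(1) r by (simp add: ev_odd odd_r)
    then show ?case using Cons even_closed(1) r E.lin_zero[OF h] by (simp add: T_simps sl_simps rules) }
  { case 2
    have "ev (b \<otimes> r) = \<zero>" using Cons even_closed(1) r by (simp add: ev_odd odd_r)
    then show ?case using Cons even_closed(1) r E.lin_zero[OF h] by (simp add: T_simps sl_simps rules) }
qed (simp_all add: T_simps sl_simps)

section \<open>Transfer of the Haar state in both directions\<close>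

lemma EQ_cauchy: "seqcauchy E pE s \<longleftrightarrow> (\<forall>n. s n \<in> even) \<and> seqcauchy A p s"
proof -
  have "s m \<oplus> (-1) \<odot> s n \<in> even" if "\<forall>n. s n \<in> even" for m n using that even_closed by simp
  then show ?thesis by (auto simp: seqcauchy_def pE_eq even_closed(1))
qed

theorem haar_on_even:
  assumes h: "haar_on h" shows "EQ.haar_on h"
proof -
  have hs: "state A h" and h_le: "\<And>x. x \<in> carrier A \<Longrightarrow> cmod (h x) \<le> p x"
    and sl: "\<And>x t. cp x t \<Longrightarrow> slL h t = h x \<odot> \<one> \<and> slR h t = h x \<odot> \<one>"
    and faith: "\<And>s. seqcauchy A p s \<Longrightarrow> (\<lambda>n. h (star A (s n) \<otimes> s n)) \<longlonglongrightarrow> 0 \<Longrightarrow> (\<lambda>n. p (s n)) \<longlonglongrightarrow> 0"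
    using h unfolding haar_on_def by blast+
  interpret m: star_morphism E A "\<lambda>x. x" by (rule inclusion_morphism[OF even_sub])
  show ?thesis
    unfolding EQ.haar_on_def
  proof (intro conjI ballI allI impI)
    show "state E h" by (rule m.state_comp[OF hs])
    show "cmod (h x) \<le> pE x" if "x \<in> carrier E" for x using that h_le pE_eq even_closed(1) by simp
    fix x t assume "EQ.cp x t"
    then obtain t' where t': "cp x t'" "teq t' t" using comul_even by blast
    show "E.slL h t = h x \<odot>\<^bsub>E\<^esub> \<one>\<^bsub>E\<^esub>" "E.slR h t = h x \<odot>\<^bsub>E\<^esub> \<one>\<^bsub>E\<^esub>"
      using sl[OF t'(1)] sl_cong[OF state_lin[OF hs] t'(2)] by (simp_all add: sl_even)
  next
    fix s assume s: "seqcauchy E pE s" "(\<lambda>n. h (star E (s n) \<otimes>\<^bsub>E\<^esub> s n)) \<longlonglongrightarrow> 0"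
    then show "(\<lambda>n. pE (s n)) \<longlonglongrightarrow> 0" using faith[of s] by (simp add: EQ_cauchy pE_eq)
  qed
qed

theorem haar_on_of_even:
  assumes h: "EQ.haar_on h" shows "haar_on (\<lambda>x. h (ev x))"
proof -
  have hs: "state E h" and h_le: "\<And>x. x \<in> even \<Longrightarrow> cmod (h x) \<le> p x"
    and sl: "\<And>x t. EQ.cp x t \<Longrightarrow> slL h t = h x \<odot> \<one> \<and> slR h t = h x \<odot> \<one>"
    and faith: "\<And>s. (\<And>n. s n \<in> even) \<Longrightarrow> seqcauchy A p s \<Longrightarrow> (\<lambda>n. h (star A (s n) \<otimes> s n)) \<longlonglongrightarrow> 0 \<Longrightarrow> (\<lambda>n. p (s n)) \<longlonglongrightarrow> 0"
    using h unfolding EQ.haar_on_def by (auto simp: EQ_cauchy pE_eq sl_even)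
  note hE = lin_ev[OF state_lin[OF hs]]
  show ?thesis
    unfolding haar_on_def
  proof (intro conjI ballI allI impI)
    show "state A (\<lambda>x. h (ev x))" by (rule state_ev[OF hs])
    show "cmod (h (ev x)) \<le> p x" if "x \<in> carrier A" for x
      using h_le[OF ev_even[OF that]] p_ev[OF that] by simp
  next
    fix x t assume xt: "cp x t"
    obtain a b where ab: "a \<in> even" "b \<in> even" "x = a \<oplus> b \<otimes> r" using decomposition[OF cp_closed(1)[OF xt]] .
    obtain ta tb where ta: "EQ.cp a ta" and tb: "EQ.cp b tb" using EQ.cop_total ab(1,2) by fastforce
    obtain ta' tb' where ta': "cp a ta'" "teq ta' ta" and tb': "cp b tb'" "teq tb' tb"
      using comul_even[OF ta] comul_even[OF tb] by blast
    \<comment> \<open>The comultiplication of a + b r is that of \<open>a\<close> plus that of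
      \<open>b\<close> times r \<otimes> r, so slices split into an even contribution and one that
      vanishes.\<close>
    have "teq t (ta @ tb \<otimes>\<^bsub>T\<^esub> [(r, r)])"
    proof (rule teq_trans)
      show "teq t (ta' @ tb' \<otimes>\<^bsub>T\<^esub> [(u N k, u k N). k \<leftarrow> [0..<Suc N]])"
        using cp_unique[OF xt] cop.add[OF ta'(1) cop.mult[OF tb'(1) comul_r(1)]] by (simp add: ab(3) T_simps(4))
      show "teq (ta' @ tb' \<otimes>\<^bsub>T\<^esub> [(u N k, u k N). k \<leftarrow> [0..<Suc N]]) (ta @ tb \<otimes>\<^bsub>T\<^esub> [(r, r)])"
        by (intro teq_append teq_mult ta' tb' comul_r)
    qed
    note t = sl_cong[OF hE this]
    note in_E = EQ.cp_closed(2)[OF ta] EQ.cp_closed(2)[OF tb]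
    have in_T: "ta \<in> carrier T" "tb \<otimes>\<^bsub>T\<^esub> [(r, r)] \<in> carrier T"
      using in_E[THEN tensor_even] r by (auto intro!: T_closed simp: T_closed_simps)
    have x_ev: "h (ev x) = h a" using ab by (simp add: ev_decomposition)
    show "slL (\<lambda>x. h (ev x)) t = h (ev x) \<odot> \<one>" "slR (\<lambda>x. h (ev x)) t = h (ev x) \<odot> \<one>"
      using t in_T in_E sl[OF ta] by (simp_all add: sl_append sl_odd[OF state_lin[OF hs]] sl_ev x_ev cl rules)
  next
    fix s assume s: "seqcauchy A p s" and lim: "(\<lambda>n. h (ev (star A (s n) \<otimes> s n))) \<longlonglongrightarrow> 0"
    note s_in = pre.cauchy_in[OF s]
    have split: "h (ev (star A (s n) \<otimes> s n)) = h (star A (ev (s n)) \<otimes> ev (s n)) + h (star A (od (s n)) \<otimes> od (s n))" for n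
      using lin_add[OF state_lin[OF hs], of "star A (ev (s n)) \<otimes> ev (s n)" "star A (od (s n)) \<otimes> od (s n)"]
        ev_even[OF s_in] od_even[OF s_in] by (simp add: ev_square[OF s_in] even_closed)
    have pos: "0 \<le> Re (h (star A y \<otimes> y))" "Im (h (star A y \<otimes> y)) = 0" if "y \<in> even" for y
      using state_pos[OF hs, of y] state_pos_Im[OF hs, of y] that by simp_all
    \<comment> \<open>Both summands in \<open>split\<close> are nonnegative, so each of them tends
      to 0 with the sum.\<close>
    have lim_part: "(\<lambda>n. h (star A (y n) \<otimes> y n)) \<longlonglongrightarrow> 0"
      if y: "\<And>n. y n \<in> even" "\<And>n. Re (h (star A (y n) \<otimes> y n)) \<le> Re (h (ev (star A (s n) \<otimes> s n)))" for y
    proof (rule tendsto_norm_zero_cancel, rule pre.tendsto_0_le)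
      show "(\<lambda>n. Re (h (ev (star A (s n) \<otimes> s n)))) \<longlonglongrightarrow> 0" using tendsto_Re[OF lim] by simp
      show "cmod (h (star A (y n) \<otimes> y n)) \<le> Re (h (ev (star A (s n) \<otimes> s n)))" for n
        using pos[OF y(1)[of n]] y(2)[of n] by (simp add: cmod_eq_Re)
    qed simp
    have diff: "ev x \<oplus> (-1) \<odot> ev y = ev (x \<oplus> (-1) \<odot> y)" "od x \<oplus> (-1) \<odot> od y = od (x \<oplus> (-1) \<odot> y)"
      if "x \<in> carrier A" "y \<in> carrier A" for x y
      using that r by (simp_all add: ev_simps od_def cl rules a_lcomm)
    \<comment> \<open>The constant 2 comes from subtracting \<open>ev x\<close>, whose seminorm is
      at most that of \<open>x\<close>.\<close>
    have p_od: "p (od x) \<le> 2 * p x" if x: "x \<in> carrier A" for x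
    proof -
      have "p (od x) \<le> p (x \<oplus> (-1) \<odot> ev x)" unfolding od_def using x by (intro p_r_mult) (simp add: cl ev_simps)
      also have "\<dots> \<le> p x + p ((-1) \<odot> ev x)" using x by (intro cstar_seminormD[OF p_cstar]) (simp_all add: cl ev_simps)
      also have "p ((-1) \<odot> ev x) = p (ev x)" using x cstar_seminormD(2)[OF p_cstar, of "ev x" "-1"] by (simp add: ev_simps)
      finally show ?thesis using p_ev[OF x] by simp
    qed
    have cauchy: "seqcauchy A p (\<lambda>n. f (s n))"
      if f: "\<And>x. x \<in> carrier A \<Longrightarrow> f x \<in> even" "\<And>x y. x \<in> carrier A \<Longrightarrow> y \<in> carrier A \<Longrightarrow> f x \<oplus> (-1) \<odot> f y = f (x \<oplus> (-1) \<odot> y)"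
        "\<And>x. x \<in> carrier A \<Longrightarrow> p (f x) \<le> 2 * p x" for f
      unfolding seqcauchy_def
    proof (intro conjI allI impI)
      show "f (s n) \<in> carrier A" for n by (intro even_closed(1) f s_in)
      fix e :: real assume "0 < e"
      then have "0 < e/2" by simp
      then obtain M where M: "\<forall>m\<ge>M. \<forall>n\<ge>M. p (s m \<oplus> (-1) \<odot> s n) < e/2"
        using s unfolding seqcauchy_def by meson
      show "\<exists>M. \<forall>m\<ge>M. \<forall>n\<ge>M. p (f (s m) \<oplus> (-1) \<odot> f (s n)) < e"
      proof (intro exI allI impI)
        fix m n assume "M \<le> m" "M \<le> n"
        then have "p (s m \<oplus> (-1) \<odot> s n) < e/2" using M by blast
        moreover have "p (f (s m \<oplus> (-1) \<odot> s n)) \<le> 2 * p (s m \<oplus> (-1) \<odot> s n)" by (rule f(3)) (simp add: s_in cl)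
        ultimately show "p (f (s m) \<oplus> (-1) \<odot> f (s n)) < e" using f(2)[OF s_in s_in, of m n] by simp
      qed
    qed
    have le2: "p (ev x) \<le> 2 * p x" if "x \<in> carrier A" for x
      using p_ev[OF that] cstar_seminormD(1)[OF p_cstar that] by simp
    have "(\<lambda>n. p (ev (s n))) \<longlonglongrightarrow> 0"
      using pos[OF od_even[OF s_in]] by (intro faith cauchy lim_part ev_even diff le2 s_in) (simp_all add: split)
    moreover have "(\<lambda>n. p (od (s n))) \<longlonglongrightarrow> 0"
      using pos[OF ev_even[OF s_in]] by (intro faith cauchy lim_part od_even diff p_od s_in) (simp_all add: split)
    ultimately have sum0: "(\<lambda>n. p (ev (s n)) + p (od (s n))) \<longlonglongrightarrow> 0" using tendsto_add by fastforce
    show "(\<lambda>n. p (s n)) \<longlonglongrightarrow> 0"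
    proof (rule pre.tendsto_0_le[OF sum0])
      fix n
      show "0 \<le> p (s n)" by (rule cstar_seminormD(1)[OF p_cstar s_in])
      have od_in: "od (s n) \<in> carrier A" by (rule even_closed(1)[OF od_even[OF s_in]])
      have "p (s n) \<le> p (ev (s n)) + p (r \<otimes> od (s n))"
        using cstar_seminormD(3)[OF p_cstar, of "ev (s n)" "r \<otimes> od (s n)"] recompose[OF s_in[of n]] od_in r s_in
        by (simp add: ev_simps)
      then show "p (s n) \<le> p (ev (s n)) + p (od (s n))" using p_r_mult[OF od_in] by simp
    qed
  qed
qed

end

section \<open>Coamenability of a quantum group and its glued version\<close>

context star_algebra
begin

text \<open>The block relations bound all entries by 1 in every C*-seminorm, so the universal
  seminorm is finite. It dominates the given definite seminorm and is therefore definite.\<close>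

lemma quantum_algebra_of_block_relations:
  assumes rel: "block_relations A N u"
    and gen: "carrier A \<subseteq> gen_star_subalgebra A {u i j | i j. i < Suc N \<and> j < Suc N}"
    and p: "cstar_seminorm A p" and p_def: "\<And>x. x \<in> carrier A \<Longrightarrow> p x = 0 \<Longrightarrow> x = \<zero>" and "\<one> \<noteq> \<zero>"
  shows "quantum_algebra A (universal_seminorm A {}) (Suc N) u"
proof -
  have u: "u i j \<in> carrier A" if "i < Suc N" "j < Suc N" for i j
    by (rule block_entry_le_one(1)[OF rel p that])
  have comp: "s \<in> compatible {} \<longleftrightarrow> cstar_seminorm A s" for s by (simp add: compatible_def)
  have bdd: "\<exists>C. \<forall>s\<in>compatible {}. s x \<le> C" if "x \<in> carrier A" for x
  proof (rule bounded_of_generators[OF gen _ _ that])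
    fix s assume "s \<in> {u i j | i j. i < Suc N \<and> j < Suc N}"
    then obtain i j where "i < Suc N" "j < Suc N" "s = u i j" by blast
    then show "\<exists>C. \<forall>q\<in>compatible {}. q s \<le> C"
      using block_entry_le_one(2)[OF rel] by (intro exI[of _ 1]) (simp add: comp)
  qed (use u in blast)
  have max: "s x \<le> universal_seminorm A {} x" if "cstar_seminorm A s" "x \<in> carrier A" for s x
    by (rule le_universal[OF bdd]) (use that comp in auto)
  show ?thesis
  proof
    show "cstar_seminorm A (universal_seminorm A {})" by (rule cstar_seminorm_universal[OF bdd])
    show "x = \<zero>" if "x \<in> carrier A" "universal_seminorm A {} x = 0" for x
      using p_def[OF that(1)] max[OF p that(1)] cstar_seminormD(1)[OF p that(1)] that(2) by simp
    show "\<exists>t. cop A (gens (Suc N) u) x t" if "x \<in> carrier A" for x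
      by (rule cop_total_of_generated[OF u gen that])
  qed (use max u \<open>\<one> \<noteq> \<zero>\<close> in auto)
qed

text \<open>If \<open>e\<close> is an eigenvector modulo an ideal for the left multiplication by all generators, then the
  eigenvalues define a character.\<close>

lemma ex_character:
  assumes I: "ideal I A" and e: "e \<in> carrier A" "e \<notin> I" and S: "S \<subseteq> carrier A"
    and eig: "\<And>s. s \<in> S \<Longrightarrow> star A s = s \<and> (\<exists>a. \<exists>k\<in>I. s \<otimes> e = complex_of_real a \<odot> e \<oplus> k)"
  obtains \<chi> where "lin (A\<lparr>carrier := gen_star_subalgebra A S\<rparr>) \<chi>"
    "\<And>x y. x \<in> gen_star_subalgebra A S \<Longrightarrow> y \<in> gen_star_subalgebra A S \<Longrightarrow> \<chi> (x \<otimes> y) = \<chi> x * \<chi> y"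
    "\<And>x. x \<in> gen_star_subalgebra A S \<Longrightarrow> \<chi> (star A x) = cnj (\<chi> x)"
    "\<chi> \<one> = 1" "\<And>x a k. k \<in> I \<Longrightarrow> x \<otimes> e = a \<odot> e \<oplus> k \<Longrightarrow> \<chi> x = a"
proof -
  interpret I: ideal I A by (rule I)
  have I_in: "k \<in> carrier A" if "k \<in> I" for k using that by (rule I.Icarr)
  have I_zero: "\<zero> \<in> I" by (rule I.zero_closed)
  have I_add: "k \<oplus> l \<in> I" if "k \<in> I" "l \<in> I" for k l using that by (rule I.a_closed)
  have I_mult: "x \<otimes> k \<in> I" if "x \<in> carrier A" "k \<in> I" for x k using I.I_l_closed[OF that(2,1)] .
  have I_smult: "a \<odot> k \<in> I" if "k \<in> I" for a k
    using I_mult[of "a \<odot> \<one>" k] that I_in[OF that] by (simp add: cl rules)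
  define eigen where "eigen x a \<longleftrightarrow> (\<exists>k\<in>I. x \<otimes> e = a \<odot> e \<oplus> k)" for x a
  have eigen_add: "eigen (x \<oplus> y) (a + b)" if "x \<in> carrier A" "y \<in> carrier A" "eigen x a" "eigen y b" for x y a b
  proof -
    obtain k l where kl: "k \<in> I" "l \<in> I" "x \<otimes> e = a \<odot> e \<oplus> k" "y \<otimes> e = b \<odot> e \<oplus> l" using \<open>eigen x a\<close> \<open>eigen y b\<close> unfolding eigen_def by blast
    have "(x \<oplus> y) \<otimes> e = (a + b) \<odot> e \<oplus> (k \<oplus> l)"
      using \<open>x \<in> carrier A\<close> \<open>y \<in> carrier A\<close> e kl I_in[OF kl(1)] I_in[OF kl(2)] by (simp add: l_distr smult_add_left a_ac cl)
    then show ?thesis using I_add[OF kl(1,2)] unfolding eigen_def by blast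
  qed
  have eigen_smult: "eigen (b \<odot> x) (b * a)" if "x \<in> carrier A" "eigen x a" for x a b
  proof -
    obtain k where k: "k \<in> I" "x \<otimes> e = a \<odot> e \<oplus> k" using \<open>eigen x a\<close> unfolding eigen_def by blast
    have "(b \<odot> x) \<otimes> e = (b * a) \<odot> e \<oplus> b \<odot> k"
      using that(1) e k(2) I_in[OF k(1)] by (simp add: rules cl)
    then show ?thesis using I_smult[OF k(1)] unfolding eigen_def by blast
  qed
  have eigen_mult: "eigen (x \<otimes> y) (a * b)" if "x \<in> carrier A" "y \<in> carrier A" "eigen x a" "eigen y b" for x y a b
  proof -
    obtain k l where kl: "k \<in> I" "l \<in> I" "x \<otimes> e = a \<odot> e \<oplus> k" "y \<otimes> e = b \<odot> e \<oplus> l" using \<open>eigen x a\<close> \<open>eigen y b\<close> unfolding eigen_def by blast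
    have "(x \<otimes> y) \<otimes> e = x \<otimes> (b \<odot> e \<oplus> l)" using that e kl(4) by (simp add: m_assoc)
    also have "\<dots> = b \<odot> (x \<otimes> e) \<oplus> x \<otimes> l" using that e I_in[OF kl(2)] by (simp add: rules cl)
    also have "\<dots> = (a * b) \<odot> e \<oplus> (b \<odot> k \<oplus> x \<otimes> l)"
      using that(1) e I_in[OF kl(1)] I_in[OF kl(2)] by (simp add: kl(3) rules cl a_lcomm mult.commute)
    finally have "(x \<otimes> y) \<otimes> e = (a * b) \<odot> e \<oplus> (b \<odot> k \<oplus> x \<otimes> l)" .
    then show ?thesis using I_add[OF I_smult[OF kl(1)] I_mult[OF that(1) kl(2)]] unfolding eigen_def by blast
  qed
  have eigen_one: "eigen \<one> 1" unfolding eigen_def using e I_zero by (intro bexI[of _ \<zero>]) (simp_all add: rules)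
  \<comment> \<open>Two different eigenvalues would put a nonzero multiple of \<open>e\<close>, and
    hence \<open>e\<close> itself, into the ideal.\<close>
  have eigen_unique: "a = b" if xa: "eigen x a" and xb: "eigen x b" for x a b
  proof (rule ccontr)
    assume ab: "a \<noteq> b"
    obtain k l where kl: "k \<in> I" "l \<in> I" "x \<otimes> e = a \<odot> e \<oplus> k" "x \<otimes> e = b \<odot> e \<oplus> l"
      using xa xb unfolding eigen_def by (elim bexE)
    note kl_in = I_in[OF kl(1)] I_in[OF kl(2)]
    have "(a - b) \<odot> e = a \<odot> e \<oplus> (-b) \<odot> e" using smult_add_left[OF e(1), of a "-b"] by simp
    also have "\<dots> = (a \<odot> e \<oplus> k) \<oplus> ((-b) \<odot> e \<oplus> (-1) \<odot> k)"
    proof -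
      have "(a \<odot> e \<oplus> k) \<oplus> ((-b) \<odot> e \<oplus> (-1) \<odot> k) = (a \<odot> e \<oplus> (-b) \<odot> e) \<oplus> (k \<oplus> (-1) \<odot> k)"
        using e kl_in by (simp add: a_ac cl)
      then show ?thesis using e kl_in by (simp add: add_smult_minus cl rules)
    qed
    also have "\<dots> = (b \<odot> e \<oplus> l) \<oplus> ((-b) \<odot> e \<oplus> (-1) \<odot> k)" using kl(3,4) by simp
    also have "\<dots> = (b \<odot> e \<oplus> (-b) \<odot> e) \<oplus> (l \<oplus> (-1) \<odot> k)" using e kl_in by (simp add: a_ac cl)
    also have "\<dots> = l \<oplus> (-1) \<odot> k"
      using e kl_in smult_add_left[OF e(1), of b "-b", symmetric] by (simp add: cl rules)
    finally have "(a - b) \<odot> e \<in> I" using I_add[OF kl(2) I_smult[OF kl(1)]] by simp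
    then have "(1 / (a - b)) \<odot> ((a - b) \<odot> e) \<in> I" by (rule I_smult)
    then show False using e ab by (simp add: smult_smult smult_1)
  qed
  \<comment> \<open>An eigenvalue equation for x gives none for its adjoint, so both are carried
    along. A self-adjoint generator with a real eigenvalue satisfies both.\<close>
  have "star_subalgebra A {x \<in> carrier A. \<exists>a. eigen x a \<and> eigen (star A x) (cnj a)}"
    unfolding star_subalgebra_def
  proof (intro conjI ballI allI)
    show "\<one> \<in> {x \<in> carrier A. \<exists>a. eigen x a \<and> eigen (star A x) (cnj a)}"
      using eigen_one by (auto simp: rules intro!: exI[of _ 1])
    fix x y b assume "x \<in> {x \<in> carrier A. \<exists>a. eigen x a \<and> eigen (star A x) (cnj a)}"
    then obtain a where x: "x \<in> carrier A" "eigen x a" "eigen (star A x) (cnj a)" by blast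
    show "b \<odot> x \<in> {x \<in> carrier A. \<exists>a. eigen x a \<and> eigen (star A x) (cnj a)}"
      using eigen_smult[OF x(1,2), of b] eigen_smult[OF _ x(3), of "cnj b"] x(1)
      by (auto simp: cl rules intro!: exI[of _ "b * a"])
    show "star A x \<in> {x \<in> carrier A. \<exists>a. eigen x a \<and> eigen (star A x) (cnj a)}"
      using x by (auto simp: cl rules intro!: exI[of _ "cnj a"])
    assume "y \<in> {x \<in> carrier A. \<exists>a. eigen x a \<and> eigen (star A x) (cnj a)}"
    then obtain d where y: "y \<in> carrier A" "eigen y d" "eigen (star A y) (cnj d)" by blast
    show "x \<oplus> y \<in> {x \<in> carrier A. \<exists>a. eigen x a \<and> eigen (star A x) (cnj a)}"
      using eigen_add[OF x(1) y(1) x(2) y(2)] eigen_add[OF _ _ x(3) y(3)] x(1) y(1)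
      by (auto simp: cl rules intro!: exI[of _ "a + d"])
    show "x \<otimes> y \<in> {x \<in> carrier A. \<exists>a. eigen x a \<and> eigen (star A x) (cnj a)}"
      using eigen_mult[OF x(1) y(1) x(2) y(2)] eigen_mult[OF _ _ y(3) x(3)] x(1) y(1)
      by (auto simp: cl rules mult.commute intro!: exI[of _ "a * d"])
  qed auto
  moreover have "S \<subseteq> {x \<in> carrier A. \<exists>a. eigen x a \<and> eigen (star A x) (cnj a)}"
  proof
    fix s assume s: "s \<in> S"
    then obtain a where "eigen s (complex_of_real a)" using eig unfolding eigen_def by blast
    then show "s \<in> {x \<in> carrier A. \<exists>a. eigen x a \<and> eigen (star A x) (cnj a)}"
      using s S eig[OF s] by (auto intro!: exI[of _ "complex_of_real a"])
  qed
  ultimately have sub: "gen_star_subalgebra A S \<subseteq> {x \<in> carrier A. \<exists>a. eigen x a \<and> eigen (star A x) (cnj a)}"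
    by (rule gen_least)
  define \<chi> where "\<chi> x = (THE a. eigen x a)" for x
  have \<chi>: "\<chi> x = a" if "eigen x a" for x a
    unfolding \<chi>_def using that eigen_unique by blast
  have ex: "x \<in> carrier A" "eigen x (\<chi> x)" "eigen (star A x) (cnj (\<chi> x))" if x: "x \<in> gen_star_subalgebra A S" for x
  proof -
    obtain a where a: "x \<in> carrier A" "eigen x a" "eigen (star A x) (cnj a)" using sub x by blast
    then show "x \<in> carrier A" "eigen x (\<chi> x)" "eigen (star A x) (cnj (\<chi> x))" using \<chi>[OF a(2)] by auto
  qed
  show thesis
  proof (rule that)
    show "lin (A\<lparr>carrier := gen_star_subalgebra A S\<rparr>) \<chi>"
      using \<chi>[OF eigen_add] \<chi>[OF eigen_smult] ex by (simp add: lin_def)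
    show "\<chi> (x \<otimes> y) = \<chi> x * \<chi> y" if "x \<in> gen_star_subalgebra A S" "y \<in> gen_star_subalgebra A S" for x y
      using ex[OF that(1)] ex[OF that(2)] by (intro \<chi> eigen_mult)
    show "\<chi> (star A x) = cnj (\<chi> x)" if "x \<in> gen_star_subalgebra A S" for x
      using ex[OF that] by (intro \<chi>)
    show "\<chi> \<one> = 1" using eigen_one by (rule \<chi>)
    show "\<chi> x = a" if "k \<in> I" "x \<otimes> e = a \<odot> e \<oplus> k" for x a k
      by (rule \<chi>) (use that in \<open>auto simp: eigen_def\<close>)
  qed
qed

end

section \<open>The reflection ideal and the polynomial algebras of both quantum groups\<close>

lemma reflection_ideal:
  assumes A: "star_algebra (alg G)" and "entries G \<subseteq> carrier (alg G)"
  shows "ideal (reflection_ideal G) (alg G)"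
    "\<lbrakk>i < msize G; j < msize G; i \<noteq> j\<rbrakk> \<Longrightarrow> fund G i j \<in> reflection_ideal G"
    "\<lbrakk>i < msize G; j < msize G\<rbrakk> \<Longrightarrow> fund G i i \<ominus>\<^bsub>alg G\<^esub> fund G j j \<in> reflection_ideal G"
proof -
  interpret star_algebra "alg G" by (rule A)
  let ?S = "{fund G i j | i j. i < msize G \<and> j < msize G \<and> i \<noteq> j} \<union>
      {fund G i i \<ominus>\<^bsub>alg G\<^esub> fund G j j | i j. i < msize G \<and> j < msize G}"
  let ?F = "{I. ideal I (alg G) \<and> norm_closed (alg G) I \<and> (\<forall>x\<in>I. star (alg G) x \<in> I) \<and> ?S \<subseteq> I}"
  have u: "fund G i j \<in> carrier (alg G)" if "i < msize G" "j < msize G" for i j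
    using assms(2) that by (auto simp: entries_def)
  have "carrier (alg G) \<in> ?F" using u oneideal by (auto simp: norm_closed_def cl)
  then show "ideal (reflection_ideal G) (alg G)"
    unfolding reflection_ideal_def gen_closed_ideal_def by (intro i_Intersect) auto
  show "\<lbrakk>i < msize G; j < msize G; i \<noteq> j\<rbrakk> \<Longrightarrow> fund G i j \<in> reflection_ideal G"
    "\<lbrakk>i < msize G; j < msize G\<rbrakk> \<Longrightarrow> fund G i i \<ominus>\<^bsub>alg G\<^esub> fund G j j \<in> reflection_ideal G"
    unfolding reflection_ideal_def gen_closed_ideal_def by blast+
qed

text \<open>If the generator of \<Gamma> is the unit of the quotient, \<Gamma> is trivial; this
  covers a zero quotient too. It serves to show that \<open>1 - r\<close> avoids the ideal when the
  degree is two.\<close>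

lemma degree_of_reflection_eq_1:
  assumes A: "star_algebra (alg G)" and I: "ideal (reflection_ideal G) (alg G)"
    and u: "fund G 0 0 \<in> carrier (alg G)" "fund G 0 0 \<ominus>\<^bsub>alg G\<^esub> \<one>\<^bsub>alg G\<^esub> \<in> reflection_ideal G"
  shows "degree_of_reflection G = 1"
proof -
  interpret star_algebra "alg G" by (rule A)
  interpret I: ideal "reflection_ideal G" "alg G" by (rule I)
  let ?Q = "alg G Quot reflection_ideal G"
  interpret Q: ring ?Q by (rule I.quotient_is_ring)
  interpret U: group "units_of ?Q" by (rule Q.units_group)
  have "reflection_ideal G +>\<^bsub>alg G\<^esub> fund G 0 0 = reflection_ideal G +>\<^bsub>alg G\<^esub> \<one>\<^bsub>alg G\<^esub>"
    by (rule I.a_repr_independence'[OF I.a_rcos_module_rev[OF one_closed u(1) u(2)[unfolded a_minus_def]] one_closed, symmetric])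
  then have "reflection_group G = subgroup_generated (units_of ?Q) {\<one>\<^bsub>units_of ?Q\<^esub>}"
    by (simp add: reflection_group_def units_of_def FactRing_def)
  then show ?thesis
    by (simp add: degree_of_reflection_def order_def subgroup_generated_def U.generate_one)
qed

text \<open>A comultiplication is given on C(G), where representing tensors are unique. Since O(G)
  embeds into C(G), uniqueness descends to tensors over O(G).\<close>

lemma cmqg_cop_unique:
  assumes G: "cmqg G" and s: "cop (pol G) (gens (msize G) (fund G)) x s" and t: "cop (pol G) (gens (msize G) (fund G)) x t"
  shows "star_algebra.teq (pol G) s t"
proof -
  interpret A: cstar_algebra "alg G" using G by (simp add: cmqg_def)
  have S: "entries G \<subseteq> carrier (alg G)" using G by (simp add: cmqg_def)
  obtain \<Delta> where \<Delta>: "comultiplication G \<Delta>" using G by (auto simp: cmqg_def)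
  interpret m: star_morphism "pol G" "alg G" "\<lambda>x. x"
    unfolding pol_def by (rule A.inclusion_morphism[OF A.star_subalgebra_gen[OF S]])
  have u: "fund G i j \<in> carrier (pol G)" if "i < msize G" "j < msize G" for i j
    using A.gen_superset[of "entries G"] that by (auto simp: pol_def entries_def)
  have closed: "s \<in> carrier m.A.T" if "cop (pol G) (gens (msize G) (fund G)) x s" for s
    using m.A.cop_closed(2)[OF conjI[OF m.A.gens_closed[OF u]]] that by auto
  show ?thesis
  proof (rule m.teq_of_teq_tmap[OF A.cstar_nontrivial_axioms _ closed[OF s] closed[OF t]])
    show "A.teq (tmap (\<lambda>x. x) s) (tmap (\<lambda>x. x) t)"
      by (rule A.cop_unique[OF _ _ _ m.cop_map_gens[OF u s] m.cop_map_gens[OF u t], where \<Delta> = \<Delta>])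
        (use \<Delta> m.f_simps(1)[OF u] in \<open>auto simp: comultiplication_def\<close>)
  qed simp
qed

lemma coamenable_iff:
  assumes "quantum_algebra (pol G) (universal_seminorm (pol G) {}) (msize G) (fund G)"
    and cp_unique: "\<And>x s t. cop (pol G) (gens (msize G) (fund G)) x s \<Longrightarrow>
      cop (pol G) (gens (msize G) (fund G)) x t \<Longrightarrow> star_algebra.teq (pol G) s t"
  shows "coamenable G \<longleftrightarrow>
    (\<exists>h. quantum_algebra.haar_on (pol G) (universal_seminorm (pol G) {}) (msize G) (fund G) h)"
proof -
  interpret quantum_algebra "pol G" "universal_seminorm (pol G) {}" "msize G" "fund G" by fact
  have M: "max_version G = M"
    by (simp add: max_version_def M_def universal_cstar_def to_universal_def)
  show ?thesis
    unfolding coamenable_def M using haar_on_of_haar_state haar_state_of_haar_on cp_unique by blast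
qed

text \<open>The generated subalgebra is the same whether formed in C(G), in the closed subalgebra of
  the glued version or in O(G). So both polynomial algebras can be compared inside O(G).\<close>

lemma pol_glued_version:
  assumes A: "star_algebra (alg G)" and r: "fund G N N \<in> carrier (pol G)" and S: "entries G \<subseteq> carrier (alg G)"
    and v: "\<And>i j. i < N \<Longrightarrow> j < N \<Longrightarrow> fund G i j \<in> carrier (pol G)"
  defines "W \<equiv> {fund G i j \<otimes>\<^bsub>alg G\<^esub> fund G N N | i j. i < N \<and> j < N}"
  shows "pol (glued_version N G) = pol G\<lparr>carrier := gen_star_subalgebra (pol G) W\<rparr>"
proof -
  interpret star_algebra "alg G" by (rule A)
  have B: "star_subalgebra (alg G) (carrier (pol G))" by (simp add: pol_def star_subalgebra_gen[OF S])
  have WB: "W \<subseteq> carrier (pol G)" using B r v by (auto simp: W_def star_subalgebra_def)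
  let ?C = "gen_cstar_subalgebra (alg G) W"
  have "star_subalgebra (alg G) ?C"
    unfolding gen_cstar_subalgebra_def
  proof (rule star_subalgebra_Inter)
    have "carrier (alg G) \<in> {B. star_subalgebra (alg G) B \<and> norm_closed (alg G) B \<and> W \<subseteq> B}"
      using WB B star_subalgebra_carrier by (auto simp: norm_closed_def star_subalgebra_def)
    then show "{B. star_subalgebra (alg G) B \<and> norm_closed (alg G) B \<and> W \<subseteq> B} \<noteq> {}" by blast
  qed auto
  moreover have "W \<subseteq> ?C" unfolding gen_cstar_subalgebra_def by blast
  ultimately have "gen_star_subalgebra (alg G\<lparr>carrier := ?C\<rparr>) W = gen_star_subalgebra (alg G) W"
    by (rule gen_sub)
  moreover have "gen_star_subalgebra (pol G) W = gen_star_subalgebra (alg G) W"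
    using gen_sub[OF B WB] by (simp add: pol_def)
  moreover have "entries (glued_version N G) = W" by (simp add: entries_def glued_version_def Let_def W_def)
  ultimately show ?thesis by (simp add: pol_def glued_version_def Let_def W_def)
qed

theorem proposition4p17:
  fixes N :: nat and G :: "'a cmqg"
  assumes "N \<ge> 1"
    and "cmqg G"
    and "in_max_version G"
    and "quantum_subgroup G (cmqg_free_product (O_plus N) Z2_dual)"
    and "degree_of_reflection G = 2"
  shows "coamenable G \<longleftrightarrow> coamenable (glued_version N G)"
proof -
  interpret A: cstar_algebra "alg G" using assms(2) by (simp add: cmqg_def)
  have S: "entries G \<subseteq> carrier (alg G)" using assms(2) by (simp add: cmqg_def)
  define B where "B = gen_star_subalgebra (alg G) (entries G)"
  have B: "star_subalgebra (alg G) B" unfolding B_def by (rule A.star_subalgebra_gen[OF S])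
  have pol: "pol G = alg G\<lparr>carrier := B\<rparr>" by (simp add: pol_def B_def)
  interpret P: star_algebra "pol G" unfolding pol by (rule A.star_algebra_sub[OF B])
  note size = quantum_subgroup_block_relations(1)[OF P.A_star assms(4)]
    and rel = quantum_subgroup_block_relations(2)[OF P.A_star assms(4)]
  let ?u = "fund G" and ?p = "universal_seminorm (pol G) {}" and ?r = "fund G N N"
  have entries: "entries G = {?u i j | i j. i < Suc N \<and> j < Suc N}" by (simp add: entries_def size)
  have SB: "entries G \<subseteq> B" unfolding B_def by (rule A.gen_superset)
  have u_B: "?u i j \<in> B" if "i < Suc N" "j < Suc N" for i j using SB that by (auto simp: entries)
  have u_in: "?u i j \<in> carrier (alg G)" if "i < Suc N" "j < Suc N" for i j using S that by (auto simp: entries)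
  have gen: "carrier (pol G) \<subseteq> gen_star_subalgebra (pol G) {?u i j | i j. i < Suc N \<and> j < Suc N}"
    using A.gen_sub[OF B SB] by (simp add: pol B_def flip: entries)
  have u_star: "star (alg G) (?u i j) = ?u i j" if "i < Suc N" "j < Suc N" for i j
    using rel that by (auto simp: block_relations_def orthogonal_def reflection_def pol less_Suc_eq A.star_zero)
  have r: "?r \<in> carrier (alg G)" "?r \<otimes>\<^bsub>alg G\<^esub> ?r = \<one>\<^bsub>alg G\<^esub>"
    using rel u_in[of N N] by (auto simp: block_relations_def reflection_def pol)
  interpret P: quantum_algebra "pol G" ?p "Suc N" ?u
  proof (rule P.quantum_algebra_of_block_relations[OF rel gen])
    have B_in: "x \<in> B \<Longrightarrow> x \<in> carrier (alg G)" for x using B by (auto simp: star_subalgebra_def)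
    show "cstar_seminorm (pol G) (nrm (alg G))"
      using A.nrm_seminorm B_in by (simp add: cstar_seminorm_def pol)
    show "x = \<zero>\<^bsub>pol G\<^esub>" if "x \<in> carrier (pol G)" "nrm (alg G) x = 0" for x
      using that B_in A.nrm_eq_zero by (simp add: pol)
    show "\<one>\<^bsub>pol G\<^esub> \<noteq> \<zero>\<^bsub>pol G\<^esub>" using A.nontrivial by (simp add: pol)
  qed
  \<comment> \<open>Twice the projection onto the eigenvalue -1 of \<open>r\<close>, so that
    \<open>r\<close> acts on \<open>?e\<close> as -1.\<close>
  let ?I = "reflection_ideal G" and ?e = "\<one>\<^bsub>alg G\<^esub> \<oplus>\<^bsub>alg G\<^esub> (-1) \<odot>\<^bsub>alg G\<^esub> ?r"
  note I = reflection_ideal[OF A.A_star S, unfolded size]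
  interpret I: ideal ?I "alg G" by (rule I(1))
  have e_in: "?e \<in> carrier (alg G)" using r by (simp add: A.cl)
  \<comment> \<open>Otherwise \<open>?u 0 0\<close>, which equals \<open>r\<close> modulo the ideal,
    would also equal 1 modulo the ideal, and the degree of reflection would be one.\<close>
  have e: "?e \<notin> ?I"
  proof
    assume "?e \<in> ?I"
    then have "?u 0 0 \<ominus>\<^bsub>alg G\<^esub> ?r \<oplus>\<^bsub>alg G\<^esub> \<ominus>\<^bsub>alg G\<^esub> ?e \<in> ?I"
      using I(3)[of 0 N] by (intro I.a_closed[OF _ I.a_inv_closed]) auto
    moreover have "?u 0 0 \<ominus>\<^bsub>alg G\<^esub> ?r \<oplus>\<^bsub>alg G\<^esub> \<ominus>\<^bsub>alg G\<^esub> ?e = ?u 0 0 \<ominus>\<^bsub>alg G\<^esub> \<one>\<^bsub>alg G\<^esub>"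
    proof -
      have "?e = \<one>\<^bsub>alg G\<^esub> \<ominus>\<^bsub>alg G\<^esub> ?r" using r by (simp add: a_minus_def A.minus_eq_smult)
      moreover have "\<ominus>\<^bsub>alg G\<^esub> ?r \<oplus>\<^bsub>alg G\<^esub> (\<ominus>\<^bsub>alg G\<^esub> \<one>\<^bsub>alg G\<^esub> \<oplus>\<^bsub>alg G\<^esub> ?r) = \<ominus>\<^bsub>alg G\<^esub> \<one>\<^bsub>alg G\<^esub>"
        using A.a_lcomm[of "\<ominus>\<^bsub>alg G\<^esub> ?r" "\<ominus>\<^bsub>alg G\<^esub> \<one>\<^bsub>alg G\<^esub>" ?r] r by (simp add: A.l_neg)
      ultimately show ?thesis using r u_in[of 0 0]
        by (simp add: a_minus_def A.minus_add A.minus_minus A.a_assoc)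
    qed
    ultimately have "degree_of_reflection G = 1"
      using degree_of_reflection_eq_1[OF A.A_star I(1) u_in[of 0 0]] by simp
    then show False using assms(5) by simp
  qed
  \<comment> \<open>Modulo the ideal, \<open>?u i j\<close> is \<open>r\<close> on the diagonal and
    0 elsewhere; multiplying by \<open>?e\<close> turns \<open>r\<close> into -1.\<close>
  have eig: "\<exists>k\<in>?I. ?u i j \<otimes>\<^bsub>alg G\<^esub> ?e = complex_of_real (if i = j then -1 else 0) \<odot>\<^bsub>alg G\<^esub> ?e \<oplus>\<^bsub>alg G\<^esub> k"
    if ij: "i < Suc N" "j < Suc N" for i j
  proof (cases "i = j")
    case True
    let ?k = "?u i j \<ominus>\<^bsub>alg G\<^esub> ?r"
    have k: "?k \<in> ?I" using I(3)[OF ij(1), of N] True by simp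
    note k_in = I.Icarr[OF k]
    have re: "?r \<otimes>\<^bsub>alg G\<^esub> ?e = (-1) \<odot>\<^bsub>alg G\<^esub> ?e" using r by (simp add: A.rules A.cl A.a_comm)
    have "?u i j \<otimes>\<^bsub>alg G\<^esub> ?e = (?r \<oplus>\<^bsub>alg G\<^esub> ?k) \<otimes>\<^bsub>alg G\<^esub> ?e"
      using r u_in[OF ij] A.a_lcomm[of ?r "?u i j" "\<ominus>\<^bsub>alg G\<^esub> ?r"] by (simp add: a_minus_def A.r_neg)
    also have "\<dots> = (-1) \<odot>\<^bsub>alg G\<^esub> ?e \<oplus>\<^bsub>alg G\<^esub> ?k \<otimes>\<^bsub>alg G\<^esub> ?e"
      using A.l_distr[OF r(1) k_in e_in] re by simp
    finally show ?thesis using I.I_r_closed[OF k e_in] True by auto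
  next
    case False
    then have "?u i j \<otimes>\<^bsub>alg G\<^esub> ?e \<in> ?I" using I(2)[OF ij] by (intro I.I_r_closed e_in) simp
    then show ?thesis using False u_in[OF ij] e_in
      by (intro bexI[of _ "?u i j \<otimes>\<^bsub>alg G\<^esub> ?e"]) (simp_all add: A.rules A.cl)
  qed
  have eig': "star (alg G) s = s \<and> (\<exists>a. \<exists>k\<in>?I. s \<otimes>\<^bsub>alg G\<^esub> ?e = complex_of_real a \<odot>\<^bsub>alg G\<^esub> ?e \<oplus>\<^bsub>alg G\<^esub> k)"
    if "s \<in> entries G" for s
    using that u_star eig unfolding entries by blast
  obtain \<chi> where \<chi>: "lin (pol G) \<chi>"
    "\<And>x y. x \<in> B \<Longrightarrow> y \<in> B \<Longrightarrow> \<chi> (x \<otimes>\<^bsub>alg G\<^esub> y) = \<chi> x * \<chi> y"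
    "\<And>x. x \<in> B \<Longrightarrow> \<chi> (star (alg G) x) = cnj (\<chi> x)" "\<chi> \<one>\<^bsub>alg G\<^esub> = 1"
    "\<And>x a k. k \<in> ?I \<Longrightarrow> x \<otimes>\<^bsub>alg G\<^esub> ?e = a \<odot>\<^bsub>alg G\<^esub> ?e \<oplus>\<^bsub>alg G\<^esub> k \<Longrightarrow> \<chi> x = a"
    by (rule A.ex_character[OF I(1) e_in e S eig', folded B_def, folded pol]) blast+
  have cp_unique: "P.teq s t" if "P.cp x s" "P.cp x t" for x s t
    using cmqg_cop_unique[OF assms(2)] that by (simp add: size)
  have \<chi>_u: "\<chi> (?u i j) = (if i = j then -1 else 0)" if ij: "i < Suc N" "j < Suc N" for i j
    using eig[OF ij] \<chi>(5) by fastforce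
  interpret P: graded_quantum_algebra "pol G" ?p N ?u \<chi>
    by unfold_locales (use cp_unique rel gen \<chi> \<chi>_u in \<open>auto simp: pol\<close>)
  have mult: "mult (pol G) = mult (alg G)" by (simp add: pol)
  have w: "fund (glued_version N G) = P.w"
    by (simp add: glued_version_def Let_def P.w_def[abs_def] mult)
  have "pol (glued_version N G) =
      pol G\<lparr>carrier := gen_star_subalgebra (pol G) {?u i j \<otimes>\<^bsub>alg G\<^esub> ?r | i j. i < N \<and> j < N}\<rparr>"
    by (rule pol_glued_version[OF A.A_star _ S]) (use u_B in \<open>simp_all add: pol\<close>)
  then have glued: "pol (glued_version N G) = P.E" by (simp only: P.even_def P.w_def mult)
  have size': "msize (glued_version N G) = N" by (simp add: glued_version_def Let_def)
  have "coamenable G \<longleftrightarrow> (\<exists>h. P.haar_on h)"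
    using coamenable_iff[of G, unfolded size, OF P.quantum_algebra_axioms cp_unique] .
  moreover have "coamenable (glued_version N G) \<longleftrightarrow> (\<exists>h. P.EQ.haar_on h)"
    using coamenable_iff[of "glued_version N G", unfolded size' glued w, folded P.pE_def,
      OF P.EQ.quantum_algebra_axioms P.EQ_unique] .
  ultimately show ?thesis using P.haar_on_even P.haar_on_of_even by blast
qed

end
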